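(* Let $\tau:[0,\infty)^2\to\mathbb{C}$ be a bounded function with $\tau(x,y)=\overline{\tau(y,x)}$ for all $x,y\ge0$, satisfying the following three conditions, where $\tau_N(j,k)=\tau(j/N,k/N)$ for $j,k\in\mathbb{Z}_+$, $N\ge 1$: (A) $\sup_{N\ge 1}\|\tau_N\|_{\mathfrak{M}}<\infty$; (B) $\tau(0,0)=1$ and for some $\varepsilon>0$ and some $\beta>1/2$ there exists $C_\beta>0$ such that $|\tau(x,y)-1|\le C_\beta|\log(x+y)|^{-\beta}$ for all $0\le x,y\le\varepsilon$; (C) for some $\alpha>1/2$ there exists $C_\alpha$ such that $|\tau(x,y)|\le C_\alpha(\log(x+y+2))^{-\alpha}$ for all $x,y\ge 0$. Let $\omega\in PC(\mathbb{T})$ satisfy $\omega(v)=\overline{\omega(\overline v)}$ for $v\in\mathbb{T}$, let $\Omega$ be the set of its jump discontinuities and $\Omega^+=\{z\in\Omega:\operatorname{Im}z>0\}$. Then for every $t>0$ and each choice of sign $\pm$ the limit $$\mathsf{LogDens}^{\pm}_\tau(t;\Gamma(\widehat\omega)):=\lim_{N\to\infty}\frac{\mathsf{n}_\pm(t;\tau_N\star\Gamma(\widehat\omega))}{\log N}$$ exists and $$\mathsf{LogDens}^{\pm}_\tau(t;\Gamma(\widehat\omega))=\sum_{z\in\Omega^+}\mathsf{c}\left(t|\varkappa_z(\omega)|^{-1}\right)+\mathsf{c}\left(t|\varkappa_1(\omega)|^{-1}\right)\mathbf{1}_\pm(-i\varkappa_1(\omega))+\mathsf{c}\left(t|\varkappa_{-1}(\omega)|^{-1}\right)\mathbf{1}_\pm(-i\varkappa_{-1}(\omega)),$$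 where $\mathbf{1}_+$ and $\mathbf{1}_-$ are the characteristic functions of $(0,\infty)$ and $(-\infty,0)$ respectively (a term with $\varkappa_{\pm1}(\omega)=0$ is read as $0$).
   Context: $\mathbb{Z}_+=\{0,1,2,\dots\}$, $\mathbb{T}$ is the unit circle in $\mathbb{C}$. $PC(\mathbb{T})$ is the class of functions $\omega:\mathbb{T}\to\mathbb{C}$ for which the limits $\omega(z\pm)=\lim_{\epsilon\to0+}\omega(ze^{\pm i\epsilon})$ exist and are finite for all $z\in\mathbb{T}$. Put $\varkappa_z(\omega)=\frac{\omega(z+)-\omega(z-)}{2}$; the jump discontinuities of $\omega$ are the points $z$ with $\varkappa_z(\omega)\ne0$. If $\omega(v)=\overline{\omega(\overline v)}$, then $\varkappa_{\overline z}(\omega)=-\overline{\varkappa_z(\omega)}$, so $\varkappa_{\pm1}(\omega)$ are purely imaginary. For a bounded measurable $\omega$ on $\mathbb{T}$, $\widehat\omega(j)=\int_0^{2\pi}\omega(e^{i\theta})e^{-ij\theta}\frac{d\theta}{2\pi}$, and $\Gamma(\widehat\omega)$ is the bounded operator on $\ell^2(\mathbb{Z}_+)$ with matrix entries $\widehat\omega(j+k)$, $j,k\ge0$ (self-adjoint under the symmetry condition on $\omega$). Schur–Hadamard multiplication: for a bounded double sequence $\sigma=(\sigma(j,k))_{j,k\ge0}$ and a bounded operator $A$ on $\ell^2(\mathbb{Z}_+)$, $\sigma\star A$ is the operator with entries $((\sigma\star A)e_j,e_k)=\sigma(j,k)(Ae_j,e_k)$, where $(e_j)$ is the standard basis; $\|\sigma\|_{\mathfrak{M}}=\sup_{\|A\|=1}\|\sigma\star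 A\|$ (operator norm, supremum over bounded operators $A$). For a compact self-adjoint operator $K$ and $t>0$, $\mathsf{n}_\pm(t;K)$ is the number of eigenvalues of $\pm K$ (counted with multiplicity) that are greater than $t$. $\mathsf{c}(t)=\frac{1}{\pi^2}\log\left(\frac{1+\sqrt{1-t^2}}{t}\right)$ for $t\in(0,1]$ and $\mathsf{c}(t)=0$ for $t\notin(0,1)$. *)

theory Defs
  imports "HOL-Analysis.Analysis"
begin

section \<open>The Hilbert space of square-summable sequences\<close>

typedef ell2 = "{x :: nat \<Rightarrow> complex. summable (\<lambda>n. (cmod (x n))\<^sup>2)}"
  morphisms ell2_nth Abs_ell2
  by (rule exI[of _ "\<lambda>_. 0"]) simp

setup_lifting type_definition_ell2

lemma summable_ell2: "summable (\<lambda>n. (cmod (ell2_nth x n))\<^sup>2)"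
  using ell2_nth[of x] by simp

lemma ell2_eqI: "(\<And>n. ell2_nth x n = ell2_nth y n) \<Longrightarrow> x = y"
  by (simp add: ell2_nth_inject[symmetric] fun_eq_iff)

lemma cmod_add_power2_le: "(cmod (a + b))\<^sup>2 \<le> 2 * (cmod a)\<^sup>2 + 2 * (cmod b)\<^sup>2"
proof -
  have "(cmod (a + b))\<^sup>2 \<le> (cmod a + cmod b)\<^sup>2"
    by (simp add: norm_triangle_ineq power_mono)
  also have "\<dots> \<le> 2 * (cmod a)\<^sup>2 + 2 * (cmod b)\<^sup>2"
    using sum_squares_bound[of "cmod a" "cmod b"] by (simp add: power2_sum)
  finally show ?thesis .
qed

lemma summable_ell2_add:
  assumes "summable (\<lambda>n. (cmod (x n))\<^sup>2)" "summable (\<lambda>n. (cmod (y n))\<^sup>2)"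
  shows "summable (\<lambda>n. (cmod (x n + y n))\<^sup>2)"
  by (rule summable_comparison_test'[of "\<lambda>n. 2 * (cmod (x n))\<^sup>2 + 2 * (cmod (y n))\<^sup>2" 0])
     (auto intro!: summable_add summable_mult assms cmod_add_power2_le)

lemma summable_ell2_scale:
  assumes "summable (\<lambda>n. (cmod (x n))\<^sup>2)"
  shows "summable (\<lambda>n. (cmod (c * x n))\<^sup>2)"
  using summable_mult[OF assms, of "(cmod c)\<^sup>2"] by (simp add: norm_mult power_mult_distrib)

lemma summable_ell2_prod:
  "summable (\<lambda>n. ell2_nth x n * cnj (ell2_nth y n))"
proof (rule summable_comparison_test'[of "\<lambda>n. (cmod (ell2_nth x n))\<^sup>2 + (cmod (ell2_nth y n))\<^sup>2" 0])
  show "summable (\<lambda>n. (cmod (ell2_nth x n))\<^sup>2 + (cmod (ell2_nth y n))\<^sup>2)"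
    by (intro summable_add summable_ell2)
  show "norm (ell2_nth x n * cnj (ell2_nth y n)) \<le> (cmod (ell2_nth x n))\<^sup>2 + (cmod (ell2_nth y n))\<^sup>2" for n
  proof -
    have "0 \<le> cmod (ell2_nth x n) * cmod (ell2_nth y n)" by simp
    then have "cmod (ell2_nth x n) * cmod (ell2_nth y n) \<le> (cmod (ell2_nth x n))\<^sup>2 + (cmod (ell2_nth y n))\<^sup>2"
      using sum_squares_bound[of "cmod (ell2_nth x n)" "cmod (ell2_nth y n)"] by linarith
    then show ?thesis by (simp add: norm_mult)
  qed
qed

definition cinner :: "ell2 \<Rightarrow> ell2 \<Rightarrow> complex" where
  "cinner x y = (\<Sum>n. ell2_nth x n * cnj (ell2_nth y n))"

lift_definition scaleC :: "complex \<Rightarrow> ell2 \<Rightarrow> ell2" is "\<lambda>c x n. c * x n"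
  using summable_ell2_scale by blast

text \<open>The library's classes of normed spaces are real; the real structure below is the one
  underlying the complex Hilbert space, with the same norm.\<close>

instantiation ell2 :: real_inner
begin

lift_definition zero_ell2 :: ell2 is "\<lambda>_. 0" by simp
lift_definition plus_ell2 :: "ell2 \<Rightarrow> ell2 \<Rightarrow> ell2" is "\<lambda>x y n. x n + y n"
  using summable_ell2_add by blast
lift_definition uminus_ell2 :: "ell2 \<Rightarrow> ell2" is "\<lambda>x n. - x n" by simp
definition minus_ell2 :: "ell2 \<Rightarrow> ell2 \<Rightarrow> ell2" where "minus_ell2 x y = x + - y"
definition scaleR_ell2 :: "real \<Rightarrow> ell2 \<Rightarrow> ell2" where "scaleR_ell2 r = scaleC (complex_of_real r)"
definition inner_ell2 :: "ell2 \<Rightarrow> ell2 \<Rightarrow> real" where "inner_ell2 x y = Re (cinner x y)"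
definition norm_ell2 :: "ell2 \<Rightarrow> real" where "norm_ell2 x = sqrt (\<Sum>n. (cmod (ell2_nth x n))\<^sup>2)"
definition sgn_ell2 :: "ell2 \<Rightarrow> ell2" where "sgn_ell2 x = inverse (norm x) *\<^sub>R x"
definition dist_ell2 :: "ell2 \<Rightarrow> ell2 \<Rightarrow> real" where "dist_ell2 x y = norm (x - y)"
definition uniformity_ell2 :: "(ell2 \<times> ell2) filter" where
  "uniformity_ell2 = (INF e\<in>{0<..}. principal {(x, y). dist x y < e})"
definition open_ell2 :: "ell2 set \<Rightarrow> bool" where
  "open_ell2 U = (\<forall>x\<in>U. eventually (\<lambda>(x', y). x' = x \<longrightarrow> y \<in> U) uniformity)"

lemma nth_add: "ell2_nth (x + y) n = ell2_nth x n + ell2_nth y n"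
  by transfer simp
lemma nth_zero: "ell2_nth 0 n = 0"
  by transfer simp
lemma nth_uminus: "ell2_nth (- x) n = - ell2_nth x n"
  by transfer simp
lemma nth_minus: "ell2_nth (x - y) n = ell2_nth x n - ell2_nth y n"
  by (simp add: minus_ell2_def nth_add nth_uminus)
lemma nth_scaleC: "ell2_nth (scaleC c x) n = c * ell2_nth x n"
  by transfer simp
lemma nth_scaleR: "ell2_nth (r *\<^sub>R x) n = complex_of_real r * ell2_nth x n"
  by (simp add: scaleR_ell2_def nth_scaleC)

lemmas ell2_nth_simps = nth_add nth_zero nth_uminus nth_minus nth_scaleC nth_scaleR

lemma inner_ell2_series:
  "inner x y = (\<Sum>n. Re (ell2_nth x n * cnj (ell2_nth y n)))"
  "summable (\<lambda>n. Re (ell2_nth x n * cnj (ell2_nth y n)))"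
  using Re_suminf[OF summable_ell2_prod[of x y]] summable_Re[OF summable_ell2_prod[of x y]]
  by (auto simp: inner_ell2_def cinner_def)

lemma Re_of_real_mult_ell2: "Re (complex_of_real r * z) = r * Re z"
  by simp

lemma inner_self_ell2: "inner x x = (\<Sum>n. (cmod (ell2_nth x n))\<^sup>2)" for x :: ell2
  by (simp only: inner_ell2_series complex_norm_square[symmetric] Re_complex_of_real)

instance
proof
  fix x y z :: ell2 and r s :: real
  show "x + y + z = x + (y + z)" "x + y = y + x" "0 + x = x" "- x + x = 0" "x - y = x + - y"
       "r *\<^sub>R (x + y) = r *\<^sub>R x + r *\<^sub>R y" "(r + s) *\<^sub>R x = r *\<^sub>R x + s *\<^sub>R x"
       "r *\<^sub>R s *\<^sub>R x = (r * s) *\<^sub>R x" "1 *\<^sub>R x = x"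
    by (rule ell2_eqI; simp add: ell2_nth_simps algebra_simps)+
  show "dist x y = norm (x - y)" "sgn x = inverse (norm x) *\<^sub>R x"
    by (simp_all add: dist_ell2_def sgn_ell2_def)
  show "uniformity = (INF e\<in>{0<..}. principal {(x :: ell2, y). dist x y < e})"
    by (rule uniformity_ell2_def)
  show "open U = (\<forall>x\<in>U. \<forall>\<^sub>F (x', y) in uniformity. x' = x \<longrightarrow> y \<in> U)" for U :: "ell2 set"
    by (rule open_ell2_def)
  show "inner x y = inner y x"
    by (simp add: inner_ell2_series mult.commute)
  show "inner (x + y) z = inner x z + inner y z"
    unfolding inner_ell2_series(1) nth_add distrib_right plus_complex.sel
    by (rule suminf_add[symmetric]) (rule inner_ell2_series)+
  show "inner (r *\<^sub>R x) y = r * inner x y"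
    unfolding inner_ell2_series(1) nth_scaleR mult.assoc Re_of_real_mult_ell2
    by (rule suminf_mult) (rule inner_ell2_series)
  show "0 \<le> inner x x"
    unfolding inner_self_ell2 by (intro suminf_nonneg summable_ell2) simp
  show "inner x x = 0 \<longleftrightarrow> x = 0"
    unfolding inner_self_ell2 using suminf_eq_zero_iff[OF summable_ell2[of x]]
    by (auto simp: nth_zero intro: ell2_eqI)
  show "norm x = sqrt (inner x x)"
    by (simp add: inner_self_ell2 norm_ell2_def)
qed

end

global_interpretation ell2: vector_space scaleC
  by unfold_locales (rule ell2_eqI; simp add: ell2_nth_simps algebra_simps)+

lift_definition basis_vec :: "nat \<Rightarrow> ell2" is "\<lambda>j n. if n = j then 1 else 0"
  by (rule summable_finite[of "{j}" for j]) auto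

section \<open>Bounded operators and Schur--Hadamard multiplication\<close>

text \<open>A bounded operator on the complex Hilbert space is an element of
  \<^typ>\<open>ell2 \<Rightarrow>\<^sub>L ell2\<close> (which carries the operator norm) that is linear over the
  complex numbers.\<close>

definition clinear_op :: "(ell2 \<Rightarrow>\<^sub>L ell2) \<Rightarrow> bool" where
  "clinear_op A \<longleftrightarrow> Vector_Spaces.linear scaleC scaleC (blinfun_apply A)"

definition entry :: "(ell2 \<Rightarrow>\<^sub>L ell2) \<Rightarrow> nat \<Rightarrow> nat \<Rightarrow> complex" where
  "entry A j k = cinner (blinfun_apply A (basis_vec j)) (basis_vec k)"

definition has_entries :: "(ell2 \<Rightarrow>\<^sub>L ell2) \<Rightarrow> (nat \<Rightarrow> nat \<Rightarrow> complex) \<Rightarrow> bool" where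
  "has_entries A M \<longleftrightarrow> clinear_op A \<and> (\<forall>j k. entry A j k = M j k)"

definition op_of_entries :: "(nat \<Rightarrow> nat \<Rightarrow> complex) \<Rightarrow> (ell2 \<Rightarrow>\<^sub>L ell2)" where
  "op_of_entries M = (THE A. has_entries A M)"

text \<open>There is at most one bounded operator with given entries (lemma \<open>has_entries_unique\<close>
  below), so the infimum is its norm if it exists, and the infimum \<open>\<infinity>\<close> of the empty set
  otherwise.\<close>

definition entries_norm :: "(nat \<Rightarrow> nat \<Rightarrow> complex) \<Rightarrow> ennreal" where
  "entries_norm M = (INF A\<in>{A. has_entries A M}. ennreal (norm A))"

definition schur_mult :: "(nat \<Rightarrow> nat \<Rightarrow> complex) \<Rightarrow> (ell2 \<Rightarrow>\<^sub>L ell2) \<Rightarrow> (ell2 \<Rightarrow>\<^sub>L ell2)"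
    (infixr "\<star>" 75) where
  "\<sigma> \<star> A = op_of_entries (\<lambda>j k. \<sigma> j k * entry A j k)"

definition multiplier_norm :: "(nat \<Rightarrow> nat \<Rightarrow> complex) \<Rightarrow> ennreal" where
  "multiplier_norm \<sigma> =
     (SUP A\<in>{A. clinear_op A \<and> norm A = 1}. entries_norm (\<lambda>j k. \<sigma> j k * entry A j k))"

lemma nth_basis_vec: "ell2_nth (basis_vec j) n = (if n = j then 1 else 0)"
  by transfer simp

lemma cinner_basis_vec: "cinner x (basis_vec k) = ell2_nth x k"
proof -
  have "(\<lambda>n. ell2_nth x n * cnj (ell2_nth (basis_vec k) n)) sums
        (\<Sum>n\<in>{k}. ell2_nth x n * cnj (ell2_nth (basis_vec k) n))"
    by (rule sums_finite) (auto simp: nth_basis_vec)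
  then show ?thesis
    by (simp add: cinner_def nth_basis_vec sums_iff)
qed

lemma nth_sum: "ell2_nth (sum f S) n = (\<Sum>i\<in>S. ell2_nth (f i) n)"
  by (induction S rule: infinite_finite_induct) (auto simp: ell2_nth_simps)

lemma basis_expansion:
  "(\<lambda>n. \<Sum>i<n. scaleC (ell2_nth x i) (basis_vec i)) \<longlonglongrightarrow> x"
proof -
  let ?f = "\<lambda>m. (cmod (ell2_nth x m))\<^sup>2"
  have nth: "ell2_nth (x - (\<Sum>i<n. scaleC (ell2_nth x i) (basis_vec i))) m =
             (if m < n then 0 else ell2_nth x m)" for n m
    by (simp add: ell2_nth_simps nth_sum nth_basis_vec if_distrib[of "\<lambda>c. _ * c"] sum.delta
             cong: if_cong)
  have "norm (x - (\<Sum>i<n. scaleC (ell2_nth x i) (basis_vec i))) = sqrt (suminf ?f - sum ?f {..<n})" for n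
  proof -
    let ?g = "\<lambda>m. (cmod (if m < n then 0 else ell2_nth x m))\<^sup>2"
    have g: "summable ?g"
      using summable_ell2[of "x - (\<Sum>i<n. scaleC (ell2_nth x i) (basis_vec i))"] by (simp only: nth)
    have "suminf ?g = (\<Sum>m. ?g (m + n)) + sum ?g {..<n}"
      by (rule suminf_split_initial_segment[OF g])
    also have "\<dots> = (\<Sum>m. ?f (m + n))" by simp
    also have "\<dots> = suminf ?f - sum ?f {..<n}"
      using suminf_split_initial_segment[OF summable_ell2[of x], of n] by simp
    finally show ?thesis by (simp only: norm_ell2_def nth)
  qed
  moreover have "(\<lambda>n. sqrt (suminf ?f - sum ?f {..<n})) \<longlonglongrightarrow> sqrt (suminf ?f - suminf ?f)"
    by (intro tendsto_intros summable_LIMSEQ summable_ell2)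
  ultimately have "(\<lambda>n. norm (x - (\<Sum>i<n. scaleC (ell2_nth x i) (basis_vec i)))) \<longlonglongrightarrow> 0"
    by simp
  then show ?thesis
    by (subst (asm) norm_minus_commute) (simp add: tendsto_norm_zero_iff LIM_zero_iff)
qed

lemma has_entries_unique:
  assumes A: "has_entries A M" and B: "has_entries B M"
  shows "A = B"
proof (rule blinfun_eqI)
  fix x
  have "Vector_Spaces.linear scaleC scaleC (blinfun_apply A)"
       "Vector_Spaces.linear scaleC scaleC (blinfun_apply B)"
    using A B by (auto simp: has_entries_def clinear_op_def)
  then have lin: "blinfun_apply A (scaleC c y) = scaleC c (blinfun_apply A y)"
                 "blinfun_apply B (scaleC c y) = scaleC c (blinfun_apply B y)" for c y
    by (auto simp: Vector_Spaces.linear_def module_hom.scale)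
  have basis: "blinfun_apply A (basis_vec j) = blinfun_apply B (basis_vec j)" for j
  proof (rule ell2_eqI)
    show "ell2_nth (blinfun_apply A (basis_vec j)) k = ell2_nth (blinfun_apply B (basis_vec j)) k" for k
      using A B by (simp add: has_entries_def entry_def cinner_basis_vec)
  qed
  let ?s = "\<lambda>n. \<Sum>i<n. scaleC (ell2_nth x i) (basis_vec i)"
  have "blinfun_apply A (?s n) = blinfun_apply B (?s n)" for n
    by (simp add: blinfun.sum_right lin basis)
  moreover have "(\<lambda>n. blinfun_apply A (?s n)) \<longlonglongrightarrow> blinfun_apply A x"
                "(\<lambda>n. blinfun_apply B (?s n)) \<longlonglongrightarrow> blinfun_apply B x"
    by (intro blinfun.tendsto tendsto_const basis_expansion)+
  ultimately show "blinfun_apply A x = blinfun_apply B x"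
    using LIMSEQ_unique by simp
qed

section \<open>Symbols and Hankel operators\<close>

definition PC :: "(complex \<Rightarrow> complex) set" where
  "PC = {\<omega>. \<forall>z\<in>sphere 0 1.
     (\<exists>l. ((\<lambda>\<epsilon>. \<omega> (z * cis \<epsilon>)) \<longlongrightarrow> l) (at_right 0)) \<and>
     (\<exists>l. ((\<lambda>\<epsilon>. \<omega> (z * cis (- \<epsilon>))) \<longlongrightarrow> l) (at_right 0))}"

definition lim_plus :: "(complex \<Rightarrow> complex) \<Rightarrow> complex \<Rightarrow> complex" where
  "lim_plus \<omega> z = Lim (at_right 0) (\<lambda>\<epsilon>::real. \<omega> (z * cis \<epsilon>))"

definition lim_minus :: "(complex \<Rightarrow> complex) \<Rightarrow> complex \<Rightarrow> complex" where
  "lim_minus \<omega> z = Lim (at_right 0) (\<lambda>\<epsilon>::real. \<omega> (z * cis (- \<epsilon>)))"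

definition half_jump :: "(complex \<Rightarrow> complex) \<Rightarrow> complex \<Rightarrow> complex" where
  "half_jump \<omega> z = (lim_plus \<omega> z - lim_minus \<omega> z) / 2"

definition jumps :: "(complex \<Rightarrow> complex) \<Rightarrow> complex set" where
  "jumps \<omega> = {z \<in> sphere 0 1. half_jump \<omega> z \<noteq> 0}"

definition jumps_upper :: "(complex \<Rightarrow> complex) \<Rightarrow> complex set" where
  "jumps_upper \<omega> = {z \<in> jumps \<omega>. 0 < Im z}"

definition fourier_coeff :: "(complex \<Rightarrow> complex) \<Rightarrow> int \<Rightarrow> complex" where
  "fourier_coeff \<omega> j =
     (LINT \<theta>:{0..2 * pi}|lebesgue. \<omega> (cis \<theta>) * cis (- (real_of_int j * \<theta>))) / complex_of_real (2 * pi)"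

definition hankel :: "(int \<Rightarrow> complex) \<Rightarrow> (ell2 \<Rightarrow>\<^sub>L ell2)" where
  "hankel a = op_of_entries (\<lambda>j k. a (int (j + k)))"

section \<open>Eigenvalue counting and logarithmic spectral density\<close>

definition eigenspace :: "(ell2 \<Rightarrow>\<^sub>L ell2) \<Rightarrow> real \<Rightarrow> ell2 set" where
  "eigenspace K \<mu> = {x. blinfun_apply K x = scaleC (complex_of_real \<mu>) x}"

text \<open>\<^const>\<open>ell2.dim\<close> is the dimension over the complex numbers. For compact self-adjoint
  \<open>K\<close> and \<open>t > 0\<close> the sum is finite and so are the dimensions, and this is the number of
  eigenvalues above \<open>t\<close> counted with multiplicity.\<close>

definition eigenvalue_count :: "real \<Rightarrow> (ell2 \<Rightarrow>\<^sub>L ell2) \<Rightarrow> nat" where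
  "eigenvalue_count t K =
     (\<Sum>\<mu> | t < \<mu> \<and> eigenspace K \<mu> \<noteq> {0}. ell2.dim (eigenspace K \<mu>))"

datatype pm = Plus | Minus

fun n_pm :: "pm \<Rightarrow> real \<Rightarrow> (ell2 \<Rightarrow>\<^sub>L ell2) \<Rightarrow> nat" where
  "n_pm Plus t K = eigenvalue_count t K"
| "n_pm Minus t K = eigenvalue_count t (- K)"

fun ind_pm :: "pm \<Rightarrow> real \<Rightarrow> real" where
  "ind_pm Plus = indicator {0<..}"
| "ind_pm Minus = indicator {..<0}"

definition c_fun :: "real \<Rightarrow> real" where
  "c_fun t = (if 0 < t \<and> t \<le> 1 then 1 / pi\<^sup>2 * ln ((1 + sqrt (1 - t\<^sup>2)) / t) else 0)"

definition tau_N :: "(real \<Rightarrow> real \<Rightarrow> complex) \<Rightarrow> nat \<Rightarrow> nat \<Rightarrow> nat \<Rightarrow> complex" where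
  "tau_N \<tau> N j k = \<tau> (real j / real N) (real k / real N)"

definition log_dens_seq ::
    "(real \<Rightarrow> real \<Rightarrow> complex) \<Rightarrow> pm \<Rightarrow> real \<Rightarrow> (ell2 \<Rightarrow>\<^sub>L ell2) \<Rightarrow> nat \<Rightarrow> real" where
  "log_dens_seq \<tau> s t A N = real (n_pm s t (tau_N \<tau> N \<star> A)) / ln (real N)"

definition LogDens ::
    "(real \<Rightarrow> real \<Rightarrow> complex) \<Rightarrow> pm \<Rightarrow> real \<Rightarrow> (ell2 \<Rightarrow>\<^sub>L ell2) \<Rightarrow> real" where
  "LogDens \<tau> s t A = lim (log_dens_seq \<tau> s t A)"

section \<open>The conditions on the multiplier\<close>

definition cond_A :: "(real \<Rightarrow> real \<Rightarrow> complex) \<Rightarrow> bool" where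
  "cond_A \<tau> \<longleftrightarrow> (SUP N\<in>{1..}. multiplier_norm (tau_N \<tau> N)) < \<infinity>"

text \<open>The right-hand side of the estimate in \<open>cond_B\<close> is read as \<open>0\<close> for \<open>x + y = 0\<close> and as
  \<open>\<infinity>\<close> for \<open>x + y = 1\<close>. The library conventions \<open>ln 0 = 0\<close> and \<open>0 powr a = 0\<close> give the former;
  the latter case is excluded explicitly.\<close>

definition cond_B :: "(real \<Rightarrow> real \<Rightarrow> complex) \<Rightarrow> bool" where
  "cond_B \<tau> \<longleftrightarrow> \<tau> 0 0 = 1 \<and>
     (\<exists>\<epsilon>>0. \<exists>\<beta>>1/2. \<exists>C>0. \<forall>x y. 0 \<le> x \<and> x \<le> \<epsilon> \<and> 0 \<le> y \<and> y \<le> \<epsilon> \<and> x + y \<noteq> 1 \<longrightarrow>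
        cmod (\<tau> x y - 1) \<le> C * \<bar>ln (x + y)\<bar> powr (- \<beta>))"

definition cond_C :: "(real \<Rightarrow> real \<Rightarrow> complex) \<Rightarrow> bool" where
  "cond_C \<tau> \<longleftrightarrow>
     (\<exists>\<alpha>>1/2. \<exists>C. \<forall>x\<ge>0. \<forall>y\<ge>0. cmod (\<tau> x y) \<le> C * ln (x + y + 2) powr (- \<alpha>))"

end

theory Submission
  imports Defs "HOL-Real_Asymp.Real_Asymp"
begin

text \<open>A step function approximates \<open>\<omega>\<close> uniformly, so up to a Hankel operator of small norm, which
  stays small under Schur multiplication by condition (A), the matrix is
  \<open>\<tau>\<^sub>N(j,k) S(j+k) / (j+k)\<close> with \<open>S(j+k) = \<Sum>\<^sub>a \<gamma>\<^sub>a \<zeta>\<^sub>a(j) \<zeta>\<^sub>a(k)\<close> for finitely many trigonometric modes \<open>\<zeta>\<^sub>a\<close>.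
  By (B) and (C), replacing \<open>\<tau>\<^sub>N\<close> by the cutoff \<open>j + k < N\<close> costs a Hilbert--Schmidt error that is
  bounded in \<open>N\<close>. On blocks of indices of equal logarithmic length \<open>h\<close> the cut-off Carleman matrix
  \<open>1/(j+k)\<close> is, again up to a Hilbert--Schmidt error, a Toeplitz matrix with entries
  \<open>(e\<^sup>h - 1) / (2 cosh (h(i-l)/2))\<close>; cutting it into long pieces and closing each up to a circulant
  diagonalises it explicitly, with eigenvalues close to the values \<open>\<pi> / cosh (\<pi>\<xi>)\<close> of the Mehler symbol.
  The modes are nearly orthogonal on every block, so their spectra simply add up. The squared
  Hilbert--Schmidt errors are a small multiple of \<open>log N\<close>, hence outside a space of dimension
  \<open>o(log N)\<close> they are small in norm and do not affect the logarithmic density.\<close>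

section \<open>The sequence space and its quadratic forms\<close>

text \<open>The exponents above 1/2 in (B) and (C) keep the cutoff error bounded: the antidiagonal j
  + k = m has m + 1 entries of squared size m^(-2) times a logarithm to the power -2 beta, so the
  error behaves like the integral of dx / (x log^(2 beta) x), finite for 2 beta > 1. The squared
  error of the block model is about h^2 log N from replacing entries inside cycles, plus a constant
  for each of the log N / (h (2 L + 1)) cycles. It is a small multiple of log N only for small h and
  large h L, so the constants depend on each other in the order step function, h, L, starting cycle,
  N. Cycles have explicit eigenvectors, which spares a limit theorem of Szego type for Toeplitz
  matrices; the wrap-around corners cost a constant per cycle. Every error also moves the threshold
  t a little, so the counts are only trapped between densities at nearby thresholds; the limit
  exists because the density is continuous in threshold and jumps, also where it vanishes. There may
  be infinitely many jumps, but those below t/2 are invisible at threshold t, and only finitely many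
  remain.\<close>

lemma mult_cnj_norm: "c * cnj c = (complex_of_real (cmod c))\<^sup>2" "cnj c * c = (complex_of_real (cmod c))\<^sup>2"
  using complex_norm_square[of c] by (simp_all add: mult.commute)

lemma cinner_sums: "(\<lambda>n. ell2_nth x n * cnj (ell2_nth y n)) sums cinner x y"
  unfolding cinner_def by (rule summable_sums[OF summable_ell2_prod])

lemma cinner_add_left: "cinner (x + y) z = cinner x z + cinner y z"
  unfolding cinner_def by (subst suminf_add[OF summable_ell2_prod summable_ell2_prod])
    (simp add: nth_add distrib_right)

lemma cinner_scaleC_left: "cinner (scaleC c x) z = c * cinner x z"
  unfolding cinner_def by (subst suminf_mult[OF summable_ell2_prod, symmetric])
    (simp add: nth_scaleC mult.assoc)

lemma cinner_commute: "cinner x y = cnj (cinner y x)"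
proof -
  have "(\<lambda>n. cnj (ell2_nth y n * cnj (ell2_nth x n))) sums cnj (cinner y x)"
    by (subst sums_cnj) (rule cinner_sums)
  then show ?thesis using cinner_sums[of x y] by (simp add: mult.commute sums_iff)
qed

lemma cinner_add_right: "cinner z (x + y) = cinner z x + cinner z y"
  by (subst (1 2 3) cinner_commute) (simp add: cinner_add_left)

lemma cinner_scaleC_right: "cinner z (scaleC c x) = cnj c * cinner z x"
  by (subst (1 2) cinner_commute) (simp add: cinner_scaleC_left)

lemma scaleR_conv_scaleC: "r *\<^sub>R x = scaleC (complex_of_real r) x"
  by (simp add: scaleR_ell2_def)

lemma cinner_minus_left: "cinner (- x) z = - cinner x z"
  using cinner_scaleC_left[of "-1" x z] by simp

lemma cinner_minus_right: "cinner z (- x) = - cinner z x"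
  using cinner_scaleC_right[of z "-1" x] by simp

lemma cinner_diff_left: "cinner (x - y) z = cinner x z - cinner y z"
  using cinner_add_left[of x "- y" z] by (simp add: cinner_minus_left)

lemma cinner_diff_right: "cinner z (x - y) = cinner z x - cinner z y"
  using cinner_add_right[of z x "- y"] by (simp add: cinner_minus_right)

lemma cinner_zero_left [simp]: "cinner 0 z = 0"
  using cinner_scaleC_left[of 0 0 z] by simp

lemma cinner_zero_right [simp]: "cinner z 0 = 0"
  by (subst cinner_commute) simp

lemma cinner_sum_left: "cinner (sum f S) z = (\<Sum>i\<in>S. cinner (f i) z)"
  by (induction S rule: infinite_finite_induct) (auto simp: cinner_add_left)

lemma cinner_sum_right: "cinner z (sum f S) = (\<Sum>i\<in>S. cinner z (f i))"
  by (induction S rule: infinite_finite_induct) (auto simp: cinner_add_right)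

lemmas cinner_simps = cinner_add_left cinner_add_right cinner_diff_left cinner_diff_right
  cinner_scaleC_left cinner_scaleC_right cinner_minus_left cinner_minus_right

lemma cinner_self: "cinner x x = of_real ((norm x)\<^sup>2)"
proof -
  have "(\<lambda>n. of_real ((cmod (ell2_nth x n))\<^sup>2)) sums complex_of_real (\<Sum>n. (cmod (ell2_nth x n))\<^sup>2)"
    by (subst sums_of_real_iff) (rule summable_sums[OF summable_ell2])
  moreover have "(norm x)\<^sup>2 = (\<Sum>n. (cmod (ell2_nth x n))\<^sup>2)"
    by (simp add: norm_ell2_def suminf_nonneg summable_ell2)
  ultimately show ?thesis using cinner_sums[of x x]
    by (simp add: complex_norm_square[symmetric] sums_iff)
qed

lemma norm_scaleC: "norm (scaleC c x) = cmod c * norm x"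
proof -
  have "complex_of_real ((norm (scaleC c x))\<^sup>2) = complex_of_real ((cmod c * norm x)\<^sup>2)"
    unfolding cinner_self[symmetric] power_mult_distrib of_real_mult
    by (simp add: cinner_simps mult_cnj_norm mult.assoc[symmetric])
  then have "(norm (scaleC c x))\<^sup>2 = (cmod c * norm x)\<^sup>2" by (simp only: of_real_eq_iff)
  then show ?thesis by (simp add: power2_eq_iff_nonneg)
qed

text \<open>The inner product of the type class is only the real part of \<open>cinner\<close>.
  Multiplying \<open>x\<close> by the phase \<open>u\<close> makes the complex product real and
  nonnegative, and the real Cauchy-Schwarz inequality applies.\<close>

lemma cmod_cinner_le: "cmod (cinner x y) \<le> norm x * norm y"
proof (cases "cinner x y = 0")
  case False
  define u where "u = cnj (cinner x y) / cmod (cinner x y)"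
  have u: "cmod u = 1" using False by (simp add: u_def norm_divide)
  have "cinner (scaleC u x) y = of_real (cmod (cinner x y))"
    using False mult_cnj_norm(2)[of "cinner x y"] by (simp add: cinner_simps u_def power2_eq_square)
  then have "cmod (cinner x y) = inner (scaleC u x) y" by (simp add: inner_ell2_def)
  also have "\<dots> \<le> norm (scaleC u x) * norm y" by (rule norm_cauchy_schwarz)
  finally show ?thesis by (simp add: norm_scaleC u)
qed simp

text \<open>Completeness: limits are taken entry by entry.\<close>

lemma ell2_nth_le_norm: "cmod (ell2_nth x n) \<le> norm x"
proof -
  have "cmod (cinner x (basis_vec n)) \<le> norm x * norm (basis_vec n)" by (rule cmod_cinner_le)
  moreover have "norm (basis_vec n) = 1"
  proof -
    have "cinner (basis_vec n) (basis_vec n) = 1" by (simp add: cinner_basis_vec nth_basis_vec)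
    then have "complex_of_real ((norm (basis_vec n))\<^sup>2) = of_real 1" unfolding cinner_self by simp
    then have "(norm (basis_vec n))\<^sup>2 = 1" by (simp only: of_real_eq_iff)
    then show ?thesis by (simp add: power2_eq_1_iff) (metis norm_ge_zero not_one_le_zero neg_0_le_iff_le
        zero_le_one)
  qed
  ultimately show ?thesis by (simp add: cinner_basis_vec)
qed

lemma norm_power2_sums: "(\<lambda>n. (cmod (ell2_nth x n))\<^sup>2) sums (norm x)\<^sup>2"
  using summable_sums[OF summable_ell2[of x]] by (simp add: norm_ell2_def suminf_nonneg summable_ell2)

lemma partial_norm_le: "(\<Sum>n<m. (cmod (ell2_nth x n))\<^sup>2) \<le> (norm x)\<^sup>2"
  using norm_power2_sums[of x] by (metis sums_iff sum_le_suminf finite_lessThan zero_le_power2)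

text \<open>\<open>Abs_ell2 f\<close> is meaningful only for square summable \<open>f\<close>. For
  vectors given by a formula, bounded partial sums justify the coordinates and bound the norm at
  once.\<close>

lemma ell2_bounded_sumsI:
  assumes "\<And>m. (\<Sum>n<m. (cmod (f n))\<^sup>2) \<le> B"
  shows "ell2_nth (Abs_ell2 f) = f" "(norm (Abs_ell2 f))\<^sup>2 \<le> B"
proof -
  have s: "summable (\<lambda>n. (cmod (f n))\<^sup>2)"
    by (rule bounded_imp_summable[of _ B]) (use assms[of "Suc _"] in \<open>auto simp: lessThan_Suc_atMost\<close>)
  then show f: "ell2_nth (Abs_ell2 f) = f" by (simp add: Abs_ell2_inverse)
  show "(norm (Abs_ell2 f))\<^sup>2 \<le> B"
    using norm_power2_sums[of "Abs_ell2 f"] assms unfolding f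
    by (metis sums_iff suminf_le_const)
qed

instance ell2 :: complete_space
proof
  fix X :: "nat \<Rightarrow> ell2" assume X: "Cauchy X"
  have "\<exists>l. (\<lambda>k. ell2_nth (X k) n) \<longlonglongrightarrow> l" for n
  proof -
    have "Cauchy (\<lambda>k. ell2_nth (X k) n)"
    proof (rule CauchyI)
      fix e :: real assume "e > 0"
      then obtain M where "\<forall>m\<ge>M. \<forall>k\<ge>M. norm (X m - X k) < e" using X CauchyD by blast
      then show "\<exists>M. \<forall>m\<ge>M. \<forall>k\<ge>M. norm (ell2_nth (X m) n - ell2_nth (X k) n) < e"
        using ell2_nth_le_norm unfolding nth_minus[symmetric] by (meson le_less_trans)
    qed
    then show ?thesis by (simp add: Cauchy_convergent_iff convergent_def)
  qed
  then obtain l where l: "\<And>n. (\<lambda>k. ell2_nth (X k) n) \<longlonglongrightarrow> l n" by metis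
  have tail: "(\<Sum>n<m. (cmod (l n - ell2_nth (X k) n))\<^sup>2) \<le> e\<^sup>2"
    if M: "\<And>i j. i \<ge> M \<Longrightarrow> j \<ge> M \<Longrightarrow> norm (X i - X j) < e" and k: "k \<ge> M" for e M k m
  proof (rule tendsto_upperbound)
    show "(\<lambda>i. \<Sum>n<m. (cmod (ell2_nth (X i) n - ell2_nth (X k) n))\<^sup>2) \<longlonglongrightarrow> (\<Sum>n<m. (cmod (l n - ell2_nth (X k)
        n))\<^sup>2)"
      by (intro tendsto_intros l)
    show "\<forall>\<^sub>F i in sequentially. (\<Sum>n<m. (cmod (ell2_nth (X i) n - ell2_nth (X k) n))\<^sup>2) \<le> e\<^sup>2"
    proof (rule eventually_sequentiallyI)
      fix i assume "i \<ge> M"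
      have "(\<Sum>n<m. (cmod (ell2_nth (X i) n - ell2_nth (X k) n))\<^sup>2) \<le> (norm (X i - X k))\<^sup>2"
        using partial_norm_le[of "X i - X k" m] by (simp add: nth_minus)
      also have "\<dots> \<le> e\<^sup>2" using M[OF \<open>i \<ge> M\<close> k] by (intro power_mono) auto
      finally show "(\<Sum>n<m. (cmod (ell2_nth (X i) n - ell2_nth (X k) n))\<^sup>2) \<le> e\<^sup>2" .
    qed
  qed simp
  obtain M1 where M1: "\<And>i j. i \<ge> M1 \<Longrightarrow> j \<ge> M1 \<Longrightarrow> norm (X i - X j) < 1" using X CauchyD[of X 1] by auto
  \<comment> \<open>The limit \<open>l\<close> is not yet known to be square summable, but by
    \<open>tail\<close> its difference from the fixed term \<open>X M1\<close> is; the limit vector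
    is rebuilt as that difference plus \<open>X M1\<close>.\<close>
  define D where "D = Abs_ell2 (\<lambda>n. l n - ell2_nth (X M1) n)"
  have D: "ell2_nth D = (\<lambda>n. l n - ell2_nth (X M1) n)"
    unfolding D_def by (rule ell2_bounded_sumsI[OF tail[OF M1 order_refl]])
  define x where "x = D + X M1"
  have x: "ell2_nth x n = l n" for n by (simp add: x_def nth_add D)
  have "X \<longlonglongrightarrow> x"
  proof (rule LIMSEQ_I)
    fix e :: real assume "e > 0"
    then obtain M where M: "\<And>i j. i \<ge> M \<Longrightarrow> j \<ge> M \<Longrightarrow> norm (X i - X j) < e/2"
      using X CauchyD[of X "e/2"] by auto
    show "\<exists>no. \<forall>n\<ge>no. norm (X n - x) < e"
    proof (intro exI[of _ M] allI impI)
      fix k assume "k \<ge> M"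
      have "(norm (x - X k))\<^sup>2 \<le> (e/2)\<^sup>2"
        by (rule LIMSEQ_le_const2[OF norm_power2_sums[of "x - X k", unfolded sums_def]])
          (use tail[OF M \<open>k \<ge> M\<close>] in \<open>auto simp: nth_minus x\<close>)
      then have "norm (x - X k) \<le> e/2" using \<open>e > 0\<close> by (simp add: power2_le_iff_abs_le)
      then show "norm (X k - x) < e" using \<open>e > 0\<close> by (simp add: norm_minus_commute)
    qed
  qed
  then show "convergent X" by (auto simp: convergent_def)
qed

lemma tendsto_cinner [tendsto_intros]:
  assumes "(f \<longlongrightarrow> a) F" "(g \<longlongrightarrow> b) F"
  shows "((\<lambda>x. cinner (f x) (g x)) \<longlongrightarrow> cinner a b) F"
proof -
  have bb: "bounded_bilinear cinner"
  proof (rule bounded_bilinear.intro)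
    show "\<exists>K. \<forall>a b. norm (cinner a b) \<le> norm a * norm b * K"
      using cmod_cinner_le by (intro exI[of _ 1]) auto
  qed (simp_all add: cinner_simps scaleR_conv_scaleC scaleR_conv_of_real)
  show ?thesis by (rule bounded_bilinear.tendsto[OF bb assms])
qed

definition qform :: "(ell2 \<Rightarrow>\<^sub>L ell2) \<Rightarrow> ell2 \<Rightarrow> real" where
  "qform K x = Re (cinner (blinfun_apply K x) x)"

definition selfadj :: "(ell2 \<Rightarrow>\<^sub>L ell2) \<Rightarrow> bool" where
  "selfadj K \<longleftrightarrow> clinear_op K \<and> (\<forall>x y. cinner (blinfun_apply K x) y = cinner x (blinfun_apply K y))"

text \<open>Subspaces of finite codimension enter everywhere as \<open>perp G\<close> with
  \<open>G\<close> finite: \<open>card G\<close> bounds the codimension, and \<open>G\<close> may be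
  dependent.\<close>

definition perp :: "ell2 set \<Rightarrow> ell2 set" where
  "perp G = {x. \<forall>g\<in>G. cinner x g = 0}"

definition orthonormal :: "ell2 set \<Rightarrow> bool" where
  "orthonormal E \<longleftrightarrow> (\<forall>e\<in>E. \<forall>f\<in>E. cinner e f = (if e = f then 1 else 0))"

lemma clinear_op_scale: "clinear_op A \<Longrightarrow> blinfun_apply A (scaleC c x) = scaleC c (blinfun_apply A x)"
  by (simp add: clinear_op_def Vector_Spaces.linear_def module_hom.scale)

lemma clinear_opI:
  assumes "\<And>c x. blinfun_apply A (scaleC c x) = scaleC c (blinfun_apply A x)"
  shows "clinear_op A"
  unfolding clinear_op_def
  by (rule Vector_Spaces.linear.intro)
    (use assms in \<open>auto intro!: module_hom.intro module_hom_axioms.intro simp: blinfun.add_right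
      ell2.vector_space_axioms ell2.module_axioms\<close>)

lemma perp_add: "x \<in> perp G \<Longrightarrow> y \<in> perp G \<Longrightarrow> x + y \<in> perp G"
  by (simp add: perp_def cinner_simps)

lemma perp_scaleC: "x \<in> perp G \<Longrightarrow> scaleC c x \<in> perp G"
  by (simp add: perp_def cinner_simps)

lemma perp_diff: "x \<in> perp G \<Longrightarrow> y \<in> perp G \<Longrightarrow> x - y \<in> perp G"
  by (simp add: perp_def cinner_simps)

lemma perp_closed:
  assumes "\<And>n. X n \<in> perp G" "X \<longlonglongrightarrow> x"
  shows "x \<in> perp G"
  unfolding perp_def
proof (intro CollectI ballI)
  fix g assume "g \<in> G"
  have "(\<lambda>n. cinner (X n) g) \<longlonglongrightarrow> cinner x g" by (intro tendsto_intros assms)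
  moreover have "cinner (X n) g = 0" for n using assms(1)[of n] \<open>g \<in> G\<close> by (simp add: perp_def)
  ultimately show "cinner x g = 0" by (simp add: LIMSEQ_const_iff)
qed

lemma orthonormal_norm: "orthonormal E \<Longrightarrow> e \<in> E \<Longrightarrow> norm e = 1"
proof -
  assume "orthonormal E" "e \<in> E"
  then have "cinner e e = 1" by (simp add: orthonormal_def)
  then have "complex_of_real ((norm e)\<^sup>2) = of_real 1" unfolding cinner_self by simp
  then have "(norm e)\<^sup>2 = 1" by (simp only: of_real_eq_iff)
  then show "norm e = 1" by (simp add: power2_eq_1_iff) (metis norm_ge_zero not_one_le_zero
      neg_0_le_iff_le zero_le_one)
qed

lemma qform_scaleC: "clinear_op K \<Longrightarrow> qform K (scaleC c x) = (cmod c)\<^sup>2 * qform K x"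
proof -
  assume "clinear_op K"
  then have "cinner (blinfun_apply K (scaleC c x)) (scaleC c x) = of_real ((cmod c)\<^sup>2) * cinner
      (blinfun_apply K x) x"
    by (simp add: clinear_op_scale cinner_simps mult_cnj_norm mult.assoc[symmetric])
  then show ?thesis unfolding qform_def by (simp del: of_real_power)
qed

lemma qform_bound: "\<bar>qform K x\<bar> \<le> norm K * (norm x)\<^sup>2"
proof -
  have "\<bar>qform K x\<bar> \<le> cmod (cinner (blinfun_apply K x) x)" unfolding qform_def by (rule abs_Re_le_cmod)
  also have "\<dots> \<le> norm (blinfun_apply K x) * norm x" by (rule cmod_cinner_le)
  also have "\<dots> \<le> norm K * norm x * norm x" by (intro mult_right_mono norm_blinfun) auto
  finally show ?thesis by (simp add: power2_eq_square mult.assoc)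
qed

section \<open>Orthonormal systems and the spectral theorem above a threshold\<close>

text \<open>Gaussian elimination by induction on the equations: the new equation is solved for one
  unknown \<open>i0\<close> with nonzero coefficient, which is substituted into the others.\<close>

lemma homogeneous_system:
  fixes A :: "'i \<Rightarrow> 'g \<Rightarrow> complex"
  assumes "finite G" "finite I" "card G < card I"
  shows "\<exists>a. (\<exists>i\<in>I. a i \<noteq> 0) \<and> (\<forall>g\<in>G. (\<Sum>i\<in>I. a i * A i g) = 0)"
  using assms
proof (induction G arbitrary: I A rule: finite_induct)
  case empty
  then obtain i where "i \<in> I" by (metis card_gt_0_iff all_not_in_conv card.empty)
  then show ?case by (intro exI[of _ "\<lambda>_. 1"]) auto
next
  case (insert g G)
  show ?case
  proof (cases "\<forall>i\<in>I. A i g = 0")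
    case True
    have "card G < card I" using insert by simp
    from insert.IH[OF insert.prems(1) this] obtain a where "(\<exists>i\<in>I. a i \<noteq> 0)" "\<forall>g\<in>G. (\<Sum>i\<in>I. a i * A i g)
        = 0" by blast
    with True show ?thesis by (intro exI[of _ a]) auto
  next
    case False
    then obtain i0 where i0: "i0 \<in> I" "A i0 g \<noteq> 0" by auto
    let ?J = "I - {i0}"
    have "card G < card ?J" using insert i0 by simp
    from insert.IH[OF _ this, of "\<lambda>i h. A i h - A i g / A i0 g * A i0 h"] insert.prems(1)
    obtain a where a: "\<exists>i\<in>?J. a i \<noteq> 0" "\<And>h. h \<in> G \<Longrightarrow> (\<Sum>i\<in>?J. a i * (A i h - A i g / A i0 g * A i0 h))
        = 0"
      by auto
    \<comment> \<open>The value of the pivot unknown \<open>i0\<close> forced by equation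
      \<open>g\<close>.\<close>
    define c where "c = - (\<Sum>i\<in>?J. a i * A i g) / A i0 g"
    define b where "b = a(i0 := c)"
    have S: "(\<Sum>i\<in>I. b i * A i h) = c * A i0 h + (\<Sum>i\<in>?J. a i * A i h)" for h
      using insert.prems(1) i0 by (subst sum.remove[of _ i0]) (auto simp: b_def intro!: sum.cong)
    show ?thesis
    proof (intro exI[of _ b] conjI ballI)
      show "\<exists>i\<in>I. b i \<noteq> 0" using a(1) by (auto simp: b_def)
      fix h assume "h \<in> insert g G"
      then consider "h = g" | "h \<in> G" by auto
      then show "(\<Sum>i\<in>I. b i * A i h) = 0"
      proof cases
        case 1 then show ?thesis using i0 unfolding S by (simp add: c_def)
      next
        case 2
        have "(\<Sum>i\<in>?J. a i * (A i h - A i g / A i0 g * A i0 h)) = (\<Sum>i\<in>?J. a i * A i h) - (\<Sum>i\<in>?J. a i * A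
            i g) / A i0 g * A i0 h"
          by (simp add: right_diff_distrib sum_subtractf sum_distrib_right sum_distrib_left
              divide_inverse mult_ac)
        then show ?thesis using a(2)[OF 2] unfolding S by (simp add: c_def)
      qed
    qed
  qed
qed

text \<open>The dimension count behind all comparisons of eigenvalue numbers. Only the coefficients
  are claimed to be nonzero: \<open>f\<close> may be dependent, so the vector itself could vanish,
  and the applications argue with the coefficients.\<close>

lemma perp_combination:
  fixes f :: "'i \<Rightarrow> ell2"
  assumes "finite G" "finite I" "card G < card I"
  shows "\<exists>a. (\<exists>i\<in>I. a i \<noteq> 0) \<and> (\<Sum>i\<in>I. scaleC (a i) (f i)) \<in> perp G"
proof -
  obtain a where "\<exists>i\<in>I. a i \<noteq> 0" "\<forall>g\<in>G. (\<Sum>i\<in>I. a i * cinner (f i) g) = 0"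
    using homogeneous_system[OF assms, of "\<lambda>i g. cinner (f i) g"] by blast
  then show ?thesis
    by (intro exI[of _ a]) (auto simp: perp_def cinner_sum_left cinner_scaleC_left)
qed

lemma orthonormal_combination:
  assumes "orthonormal E" "finite E" "e \<in> E"
  shows "cinner (\<Sum>f\<in>E. scaleC (a f) f) e = a e"
proof -
  have "cinner (\<Sum>f\<in>E. scaleC (a f) f) e = (\<Sum>f\<in>E. a f * (if f = e then 1 else 0))"
    using assms by (auto simp: cinner_sum_left cinner_scaleC_left orthonormal_def intro!: sum.cong)
  also have "\<dots> = (\<Sum>f\<in>E. if f = e then a f else 0)" by (intro sum.cong) auto
  finally show ?thesis using assms by simp
qed

lemma orthonormal_proj_perp:
  assumes "orthonormal E" "finite E"
  shows "x - (\<Sum>f\<in>E. scaleC (cinner x f) f) \<in> perp E"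
  by (auto simp: perp_def cinner_diff_left orthonormal_combination[OF assms])

lemma orthonormal_combination_norm:
  assumes "orthonormal E" "finite E"
  shows "(norm (\<Sum>f\<in>E. scaleC (a f) f))\<^sup>2 = (\<Sum>f\<in>E. (cmod (a f))\<^sup>2)"
proof -
  have "cinner (\<Sum>f\<in>E. scaleC (a f) f) (\<Sum>f\<in>E. scaleC (a f) f) = (\<Sum>f\<in>E. cnj (a f) * a f)"
    by (subst cinner_sum_right) (simp add: cinner_scaleC_right orthonormal_combination[OF assms])
  also have "\<dots> = of_real (\<Sum>f\<in>E. (cmod (a f))\<^sup>2)"
    by (simp add: mult_cnj_norm)
  finally have "complex_of_real ((norm (\<Sum>f\<in>E. scaleC (a f) f))\<^sup>2) = of_real (\<Sum>f\<in>E. (cmod (a f))\<^sup>2)"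
    by (simp only: cinner_self)
  then show ?thesis by (simp only: of_real_eq_iff)
qed

lemma bessel:
  assumes "orthonormal E" "finite E"
  shows "(\<Sum>f\<in>E. (cmod (cinner x f))\<^sup>2) \<le> (norm x)\<^sup>2"
proof -
  let ?p = "\<Sum>f\<in>E. scaleC (cinner x f) f"
  have "cinner (x - ?p) ?p = 0"
    using orthonormal_proj_perp[OF assms, of x] by (simp add: perp_def cinner_sum_right
        cinner_scaleC_right)
  then have "inner (x - ?p) ?p = 0" by (simp add: inner_ell2_def)
  then have "(norm x)\<^sup>2 = (norm (x - ?p))\<^sup>2 + (norm ?p)\<^sup>2"
    by (simp add: power2_norm_eq_inner inner_diff_left inner_diff_right inner_commute)
  then show ?thesis unfolding orthonormal_combination_norm[OF assms] by simp
qed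

lemma orthonormal_insert:
  assumes E: "orthonormal E" and x: "x \<in> perp E" "norm x = 1"
  shows "orthonormal (insert x E)" "x \<notin> E"
proof -
  have xx: "cinner x x = 1" by (simp add: cinner_self x)
  show xE: "x \<notin> E" using x xx by (auto simp: perp_def)
  have "cinner x e = 0" "cinner e x = 0" if "e \<in> E" for e
    using x that by (auto simp: perp_def cinner_commute[of e x])
  then show "orthonormal (insert x E)" using E xx xE by (auto simp: orthonormal_def)
qed

text \<open>Components along an orthonormal system can be split off by explicit projection. The
  inclusion of complements expresses that the span of \<open>E\<close> contains
  \<open>G\<close>.\<close>

lemma gram_schmidt:
  assumes "finite G"
  shows "\<exists>E. finite E \<and> orthonormal E \<and> perp E \<subseteq> perp G"
  using assms
proof (induction G rule: finite_induct)
  case empty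
  then show ?case by (intro exI[of _ "{}"]) (auto simp: orthonormal_def perp_def)
next
  case (insert g G)
  then obtain E where E: "finite E" "orthonormal E" "perp E \<subseteq> perp G" by auto
  define r where "r = g - (\<Sum>f\<in>E. scaleC (cinner g f) f)"
  have r: "r \<in> perp E" unfolding r_def by (rule orthonormal_proj_perp[OF E(2,1)])
  show ?case
  proof (cases "r = 0")
    case True
    then have "g = (\<Sum>f\<in>E. scaleC (cinner g f) f)" by (simp add: r_def)
    then have "cinner x g = (\<Sum>f\<in>E. cnj (cinner g f) * cinner x f)" for x
      by (metis (no_types, lifting) cinner_scaleC_right cinner_sum_right sum.cong)
    then have "cinner x g = 0" if "x \<in> perp E" for x
      using that by (simp add: perp_def)
    then show ?thesis using E by (intro exI[of _ E]) (auto simp: perp_def)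
  next
    case False
    define u where "u = scaleC (of_real (inverse (norm r))) r"
    have u: "u \<in> perp E" "norm u = 1" using False r by (auto simp: u_def perp_scaleC norm_scaleC
        norm_inverse)
    have "g = scaleC (of_real (norm r)) u + (\<Sum>f\<in>E. scaleC (cinner g f) f)"
      using False by (simp add: u_def r_def flip: of_real_mult)
    from arg_cong[OF this, of "cinner _"]
    have "cinner x g = of_real (norm r) * cinner x u + (\<Sum>f\<in>E. cnj (cinner g f) * cinner x f)" for x
      unfolding cinner_sum_right cinner_scaleC_right cinner_add_right by simp
    then have "cinner x g = 0" if "x \<in> perp (insert u E)" for x
      using that by (simp add: perp_def)
    moreover have "perp (insert u E) \<subseteq> perp G" using E by (auto simp: perp_def)
    ultimately show ?thesis using E orthonormal_insert[OF E(2) u]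
      by (intro exI[of _ "insert u E"]) (auto simp: perp_def)
  qed
qed

lemma qform_diff_diff:
  assumes "selfadj K"
  shows "qform K (x - y) = qform K x - 2 * Re (cinner (blinfun_apply K x) y) + qform K y"
proof -
  have "cinner (blinfun_apply K y) x = cnj (cinner (blinfun_apply K x) y)"
    using assms by (metis cinner_commute selfadj_def)
  then show ?thesis by (simp add: qform_def blinfun.diff_right cinner_simps)
qed

lemma qform_add_diff:
  assumes "selfadj K"
  shows "qform K (x + y) + qform K (x - y) = 2 * qform K x + 2 * qform K y"
  by (simp add: qform_def blinfun.add_right blinfun.diff_right cinner_simps)

lemma parallelogram: "(norm (x + y))\<^sup>2 + (norm (x - y))\<^sup>2 = 2 * (norm x)\<^sup>2 + 2 * (norm (y::ell2))\<^sup>2"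
  by (simp add: power2_norm_eq_inner inner_simps inner_commute)

lemma norm_normalize: "x \<noteq> 0 \<Longrightarrow> norm (scaleC (of_real (inverse (norm x))) x) = 1"
  by (simp add: norm_scaleC norm_inverse)

lemma qform_normalize:
  "clinear_op K \<Longrightarrow> qform K (scaleC (of_real (inverse (norm x))) x) = qform K x / (norm x)\<^sup>2"
  unfolding qform_scaleC norm_of_real by (simp add: power_inverse divide_inverse mult.commute)

lemma tendsto_qform [tendsto_intros]:
  "(f \<longlongrightarrow> a) F \<Longrightarrow> ((\<lambda>x. qform K (f x)) \<longlongrightarrow> qform K a) F"
  unfolding qform_def by (intro tendsto_intros)

text \<open>The quadratic form exceeds \<open>t\<close> only on a finite-dimensional part of the space, so a
  maximising sequence is Cauchy up to its finitely many components along \<open>G\<close>.\<close>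

lemma exists_eigenvector:
  assumes K: "selfadj K" and G: "finite G" "\<And>x. x \<in> perp G \<Longrightarrow> qform K x \<le> t * (norm x)\<^sup>2"
    and E: "\<And>e. e \<in> E \<Longrightarrow> \<exists>\<mu>. blinfun_apply K e = scaleC (of_real \<mu>) e"
    and x0: "x0 \<in> perp E" "qform K x0 > t * (norm x0)\<^sup>2"
  shows "\<exists>v \<mu>. v \<in> perp E \<and> norm v = 1 \<and> t < \<mu> \<and> blinfun_apply K v = scaleC (of_real \<mu>) v"
proof -
  have cl: "clinear_op K" using K by (simp add: selfadj_def)
  have x0nz: "x0 \<noteq> 0" using x0 by (auto simp: qform_def)
  define S where "S = {qform K x |x. x \<in> perp E \<and> norm x = 1}"
  have bdd: "bdd_above S"
    unfolding S_def by (rule bdd_aboveI[of _ "norm K"]) (use qform_bound[of K] in \<open>auto simp: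
        abs_le_iff\<close>,
      metis abs_le_D1 mult.right_neutral one_power2 qform_bound)
  define u0 where "u0 = scaleC (of_real (inverse (norm x0))) x0"
  have u0: "u0 \<in> perp E" "norm u0 = 1" "qform K u0 > t"
    unfolding u0_def norm_normalize[OF x0nz] qform_normalize[OF cl]
    using x0nz x0 by (auto simp: perp_scaleC field_simps)
  then have u0S: "qform K u0 \<in> S" by (auto simp: S_def)
  define \<mu> where "\<mu> = Sup S"
  have \<mu>t: "\<mu> > t" using u0 cSup_upper[OF u0S bdd] by (simp add: \<mu>_def)
  have le: "qform K x \<le> \<mu> * (norm x)\<^sup>2" if x: "x \<in> perp E" for x
  proof (cases "x = 0")
    case False
    let ?u = "scaleC (of_real (inverse (norm x))) x"
    have "qform K ?u \<in> S" using norm_normalize[OF False] x unfolding S_def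
        by (auto intro!: perp_scaleC simp del: of_real_inverse)
    then have "qform K ?u \<le> \<mu>" unfolding \<mu>_def by (rule cSup_upper[OF _ bdd])
    then show ?thesis using False unfolding qform_normalize[OF cl] by (simp add: field_simps)
  qed (simp add: qform_def)
  \<comment> \<open>A form that is nonnegative on \<open>perp E\<close> and small on nearly
    maximising unit vectors. Its parallelogram law makes it serve as a distance between such
    vectors.\<close>
  define B where "B x = \<mu> * (norm x)\<^sup>2 - qform K x" for x
  have B0: "B x \<ge> 0" if "x \<in> perp E" for x using le[OF that] by (simp add: B_def)
  have Bpar: "B (x + y) + B (x - y) = 2 * B x + 2 * B y" for x y
    using qform_add_diff[OF K, of x y] arg_cong[OF parallelogram[of x y], of "(*) \<mu>"] unfolding B_def
    by (simp add: algebra_simps)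
  have "\<exists>x. x \<in> perp E \<and> norm x = 1 \<and> B x < inverse (real (Suc n))" for n
  proof -
    have "\<mu> - inverse (real (Suc n)) < Sup S" by (simp add: \<mu>_def)
    then obtain s where "s \<in> S" "\<mu> - inverse (real (Suc n)) < s"
      using less_cSup_iff[of S] u0S bdd by blast
    then show ?thesis by (auto simp: S_def B_def)
  qed
  then obtain X where X: "\<And>n. X n \<in> perp E" "\<And>n. norm (X n) = 1" "\<And>n. B (X n) < inverse (real (Suc n))"
    by metis
  obtain H where H: "finite H" "orthonormal H" "perp H \<subseteq> perp G" using gram_schmidt[OF G(1)] by blast
  \<comment> \<open>The components along the finite system \<open>H\<close> are bounded, so
    Bolzano-Weierstrass, one component at a time, gives a common subsequence on which all of them
    converge.\<close>
  have "\<exists>r. strict_mono r \<and> (\<forall>h\<in>H. convergent (\<lambda>n. cinner (X (r n)) h))" 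
    using H(1)
  proof (induction H rule: finite_induct)
    case empty
    then show ?case by (intro exI[of _ id]) (auto simp: strict_mono_def)
  next
    case (insert h H)
    then obtain r :: "nat \<Rightarrow> nat" where r: "strict_mono r" "\<forall>h\<in>H. convergent (\<lambda>n. cinner (X (r n)) h)"
        by auto
    have "bounded (range (\<lambda>n. cinner (X (r n)) h))"
      unfolding bounded_iff
    proof (intro exI[of _ "norm h"] ballI)
      fix y assume "y \<in> range (\<lambda>n. cinner (X (r n)) h)"
      then obtain n where "y = cinner (X (r n)) h" by auto
      then show "norm y \<le> norm h" using cmod_cinner_le[of "X (r n)" h] X(2)[of "r n"] by simp
    qed
    then obtain l r' where r': "strict_mono r'" "((\<lambda>n. cinner (X (r n)) h) \<circ> r') \<longlonglongrightarrow> l"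
      using bounded_imp_convergent_subsequence by blast
    have "convergent (\<lambda>n. cinner (X ((r \<circ> r') n)) k)" if "k \<in> insert h H" for k
    proof (cases "k = h")
      case True then show ?thesis using r'(2) by (auto simp: convergent_def o_def)
    next
      case False
      then have "convergent (\<lambda>n. cinner (X (r n)) k)" using that r by auto
      from convergent_subseq_convergent[OF this r'(1)] show ?thesis by (simp add: o_def)
    qed
    then show ?case using strict_mono_o[OF r(1) r'(1)] by blast
  qed
  then obtain r :: "nat \<Rightarrow> nat" where r: "strict_mono r" "\<And>h. h \<in> H \<Longrightarrow> convergent (\<lambda>n. cinner (X (r n))
      h)" by auto
  define Y where "Y n = X (r n)" for n
  have Y: "Y n \<in> perp E" "norm (Y n) = 1" "B (Y n) < inverse (real (Suc n))" for n
  proof -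
    show "Y n \<in> perp E" "norm (Y n) = 1" using X by (auto simp: Y_def)
    have "inverse (real (Suc (r n))) \<le> inverse (real (Suc n))"
      using seq_suble[OF r(1), of n] by (intro le_imp_inverse_le) auto
    then show "B (Y n) < inverse (real (Suc n))" using X(3)[of "r n"] unfolding Y_def
        by (rule less_le_trans[rotated])
  qed
  have "Cauchy Y"
  proof (rule CauchyI)
    fix e :: real assume e: "e > 0"
    define M where "M = \<bar>\<mu>\<bar> + norm K + 1"
    have M: "M > 0" by (simp add: M_def add_nonneg_pos)
    \<comment> \<open>\<open>\<eta>\<close> bounds the component of a difference along
      \<open>H\<close>. Since \<open>M\<close> controls \<open>B\<close> and its mixed terms, that
      component changes \<open>B\<close> by at most \<open>5 * M * \<eta>\<close>, which has to be a
      fraction of \<open>(\<mu> - t) * (e/2)\<^sup>2\<close>.\<close>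
    define \<eta> where "\<eta> = min (e/2) (min 1 ((\<mu> - t) * (e/2)\<^sup>2 / (16 * M)))"
    have \<eta>: "\<eta> > 0" "\<eta> \<le> e/2" "\<eta> \<le> 1" "\<eta> \<le> (\<mu> - t) * (e/2)\<^sup>2 / (16 * M)" using e M \<mu>t
        by (auto simp: \<eta>_def)
    have "\<exists>N. \<forall>m\<ge>N. \<forall>n\<ge>N. (\<Sum>h\<in>H. (cmod (cinner (Y m - Y n) h))\<^sup>2) < \<eta>\<^sup>2"
    proof -
      obtain c where c: "\<And>h. h \<in> H \<Longrightarrow> (\<lambda>n. cinner (Y n) h) \<longlonglongrightarrow> c h"
        using r(2) unfolding convergent_def Y_def by metis
      have "(\<lambda>n. \<Sum>h\<in>H. (cmod (cinner (Y n) h - c h))\<^sup>2) \<longlonglongrightarrow> (\<Sum>h\<in>H. (cmod (c h - c h))\<^sup>2)"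
        by (intro tendsto_intros c)
      then have "eventually (\<lambda>n. (\<Sum>h\<in>H. (cmod (cinner (Y n) h - c h))\<^sup>2) < \<eta>\<^sup>2 / 4) sequentially"
        using \<eta> by (intro order_tendstoD) auto
      then obtain N where N: "\<And>n. n \<ge> N \<Longrightarrow> (\<Sum>h\<in>H. (cmod (cinner (Y n) h - c h))\<^sup>2) < \<eta>\<^sup>2 / 4"
        by (auto simp: eventually_sequentially)
      have "(\<Sum>h\<in>H. (cmod (cinner (Y m - Y n) h))\<^sup>2) < \<eta>\<^sup>2" if "m \<ge> N" "n \<ge> N" for m n
      proof -
        have "(\<Sum>h\<in>H. (cmod (cinner (Y m - Y n) h))\<^sup>2) \<le>
          (\<Sum>h\<in>H. 2 * (cmod (cinner (Y m) h - c h))\<^sup>2 + 2 * (cmod (cinner (Y n) h - c h))\<^sup>2)"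
        proof (rule sum_mono)
          fix h
          show "(cmod (cinner (Y m - Y n) h))\<^sup>2 \<le> 2 * (cmod (cinner (Y m) h - c h))\<^sup>2 + 2 * (cmod (cinner
              (Y n) h - c h))\<^sup>2"
            using cmod_add_power2_le[of "cinner (Y m) h - c h" "c h - cinner (Y n) h"]
            by (simp add: cinner_diff_left norm_minus_commute)
        qed
        also have "\<dots> < \<eta>\<^sup>2"
          using N[OF that(1)] N[OF that(2)] by (simp add: sum.distrib flip: sum_distrib_left)
        finally show ?thesis .
      qed
      then show ?thesis by blast
    qed
    then obtain N where N: "\<And>m n. m \<ge> N \<Longrightarrow> n \<ge> N \<Longrightarrow> (\<Sum>h\<in>H. (cmod (cinner (Y m - Y n) h))\<^sup>2) < \<eta>\<^sup>2" by blast
    obtain N' where N': "inverse (real (Suc N')) < (\<mu> - t) * (e/2)\<^sup>2 / 16"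
      using reals_Archimedean[of "(\<mu> - t) * (e/2)\<^sup>2 / 16"] e \<mu>t by auto
    show "\<exists>N. \<forall>m\<ge>N. \<forall>n\<ge>N. norm (Y m - Y n) < e"
    proof (intro exI[of _ "max N N'"] allI impI)
      fix m n assume mn: "max N N' \<le> m" "max N N' \<le> n"
      define z where "z = Y m - Y n"
      \<comment> \<open>The part of \<open>z\<close> along \<open>H\<close>. The rest lies in
        \<open>perp G\<close>, where \<open>B\<close> dominates \<open>\<mu> - t\<close> times the
        squared norm, so a small value of \<open>B\<close> there forces a small norm.\<close>
      define w where "w = (\<Sum>f\<in>H. scaleC (cinner z f) f)"
      have nw: "norm w < \<eta>"
      proof -
        have "(norm w)\<^sup>2 < \<eta>\<^sup>2" unfolding w_def orthonormal_combination_norm[OF H(2,1)] z_def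
          using N mn by auto
        then show ?thesis using \<eta> by (simp add: power2_less_imp_less)
      qed
      have zw: "z - w \<in> perp G" using orthonormal_proj_perp[OF H(2,1), of z] H(3) by (auto simp: w_def)
      have nz: "norm z \<le> 2" unfolding z_def using norm_triangle_ineq4[of "Y m" "Y n"] Y(2) by simp
      have "inverse (real (Suc m)) \<le> inverse (real (Suc N'))" "inverse (real (Suc n))
          \<le> inverse (real (Suc N'))"
        using mn by (auto intro!: le_imp_inverse_le)
      \<comment> \<open>Dropping this term from the parallelogram law leaves
        \<open>B z \<le> 2 * B (Y m) + 2 * B (Y n)\<close>, which is small.\<close>
      moreover have "B (Y m + Y n) \<ge> 0" using Y by (intro B0 perp_add)
      ultimately have Bz: "B z < (\<mu> - t) * (e/2)\<^sup>2 / 4"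
        using Bpar[of "Y m" "Y n"] Y(3)[of m] Y(3)[of n] N' unfolding z_def by linarith
      have "B (z - w) = B z - 2 * (\<mu> * inner z w - Re (cinner (blinfun_apply K z) w)) + B w"
        unfolding B_def qform_diff_diff[OF K]
        by (simp add: power2_norm_eq_inner inner_simps inner_commute algebra_simps)
      also have "\<dots> \<le> B z + 2 * (M * 2 * \<eta>) + M * \<eta>"
      proof -
        have a: "\<bar>inner z w\<bar> \<le> 2 * \<eta>"
          using Cauchy_Schwarz_ineq2[of z w] mult_mono[OF nz less_imp_le[OF nw]] by auto
        have "\<bar>Re (cinner (blinfun_apply K z) w)\<bar> \<le> norm (blinfun_apply K z) * norm w"
          using abs_Re_le_cmod cmod_cinner_le order_trans by blast
        also have "\<dots> \<le> (norm K * 2) * \<eta>"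
          using norm_blinfun[of K z] mult_left_mono[OF nz norm_ge_zero[of K]] nw
              by (intro mult_mono) auto
        finally have b: "\<bar>Re (cinner (blinfun_apply K z) w)\<bar> \<le> norm K * 2 * \<eta>" .
        have "\<bar>\<mu> * inner z w\<bar> \<le> \<bar>\<mu>\<bar> * (2 * \<eta>)" unfolding abs_mult using a by (intro mult_left_mono) auto
        with b have c: "- (\<mu> * inner z w - Re (cinner (blinfun_apply K z) w))
            \<le> (\<bar>\<mu>\<bar> + norm K) * (2 * \<eta>)"
          by (simp add: algebra_simps)
        also have "\<dots> \<le> M * (2 * \<eta>)" using \<eta> by (intro mult_right_mono) (auto simp: M_def)
        finally have c: "- (\<mu> * inner z w - Re (cinner (blinfun_apply K z) w)) \<le> M * (2 * \<eta>)" .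
        have "(norm w)\<^sup>2 \<le> \<eta> * 1" unfolding power2_eq_square using nw \<eta> by (intro mult_mono) auto
        then have w2: "(norm w)\<^sup>2 \<le> \<eta>" by simp
        have "B w \<le> \<bar>\<mu>\<bar> * (norm w)\<^sup>2 + norm K * (norm w)\<^sup>2"
          unfolding B_def using qform_bound[of K w] mult_right_mono[OF abs_ge_self zero_le_power2, of \<mu>
              "norm w"] by linarith
        also have "\<dots> \<le> \<bar>\<mu>\<bar> * \<eta> + norm K * \<eta>" using w2 by (intro add_mono mult_left_mono) auto
        also have "\<dots> \<le> M * \<eta>" using \<eta> by (simp add: M_def algebra_simps)
        finally have "B w \<le> M * \<eta>" .
        with c show ?thesis by (simp add: algebra_simps)
      qed
      also have "\<dots> < (\<mu> - t) * (e/2)\<^sup>2"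
      proof -
        have "M * \<eta> \<le> (\<mu> - t) * (e/2)\<^sup>2 / 16" using \<eta>(4) M by (simp add: field_simps)
        moreover have "(\<mu> - t) * (e/2)\<^sup>2 > 0" using e \<mu>t by simp
        ultimately show ?thesis using Bz by linarith
      qed
      finally have "B (z - w) < (\<mu> - t) * (e/2)\<^sup>2" .
      moreover have "(\<mu> - t) * (norm (z - w))\<^sup>2 \<le> B (z - w)" using G(2)[OF zw]
          by (simp add: B_def algebra_simps)
      ultimately have "(\<mu> - t) * (norm (z - w))\<^sup>2 < (\<mu> - t) * (e/2)\<^sup>2" by linarith
      then have "(norm (z - w))\<^sup>2 < (e/2)\<^sup>2" by (rule mult_left_less_imp_less) (use \<mu>t in linarith)
      then have "norm (z - w) < e/2" by (rule power2_less_imp_less) (use e in simp)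
      then show "norm (Y m - Y n) < e"
        using nw \<eta>(2) norm_triangle_ineq[of "z - w" w] unfolding z_def[symmetric] by simp
    qed
  qed
  then obtain x where x: "Y \<longlonglongrightarrow> x" using Cauchy_convergent convergent_def by blast
  have xE: "x \<in> perp E" using perp_closed[OF Y(1) x] .
  have "(\<lambda>n. norm (Y n)) \<longlonglongrightarrow> norm x" by (intro tendsto_intros x)
  then have xn: "norm x = 1" by (simp add: Y LIMSEQ_const_iff)
  have "(\<lambda>n. B (Y n)) \<longlonglongrightarrow> B x" unfolding B_def by (intro tendsto_intros x)
  moreover have "(\<lambda>n. B (Y n)) \<longlonglongrightarrow> 0"
  proof (rule tendsto_sandwich[of "\<lambda>_. 0"])
    show "(\<lambda>n. inverse (real (Suc n))) \<longlonglongrightarrow> 0" by (rule LIMSEQ_inverse_real_of_nat)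
    show "\<forall>\<^sub>F n in sequentially. 0 \<le> B (Y n)" by (intro always_eventually allI B0 Y)
    show "\<forall>\<^sub>F n in sequentially. B (Y n) \<le> inverse (real (Suc n))"
      by (intro always_eventually allI less_imp_le Y)
  qed simp
  ultimately have Bx: "B x = 0" using LIMSEQ_unique by blast
  \<comment> \<open>First variation at the maximiser: along the residual \<open>v\<close> the form
    \<open>B\<close> has slope \<open>2 * (norm v)\<^sup>2\<close>, so unless \<open>v = 0\<close> a
    small negative step makes \<open>B\<close> negative inside \<open>perp E\<close>.\<close>
  define v where "v = blinfun_apply K x - scaleC (of_real \<mu>) x"
  have "blinfun_apply K x \<in> perp E"
    unfolding perp_def
  proof (intro CollectI ballI)
    fix e assume e: "e \<in> E"
    then obtain \<nu> where "blinfun_apply K e = scaleC (of_real \<nu>) e" using E by blast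
    then show "cinner (blinfun_apply K x) e = 0"
      using K xE e by (simp add: selfadj_def cinner_scaleC_right perp_def)
  qed
  then have vE: "v \<in> perp E" unfolding v_def by (intro perp_diff perp_scaleC xE)
  have key: "B (x - s *\<^sub>R v) = 2 * s * (norm v)\<^sup>2 + s\<^sup>2 * B v" for s
  proof -
    have iv: "inner v v = Re (cinner (blinfun_apply K x) v) - \<mu> * inner x v"
      by (subst (1) v_def) (simp add: inner_ell2_def cinner_diff_left cinner_scaleC_left)
    moreover have n: "(norm (x - s *\<^sub>R v))\<^sup>2 = (norm x)\<^sup>2 - 2 * s * inner x v + s\<^sup>2 * (norm v)\<^sup>2"
      unfolding power2_norm_eq_inner inner_diff_left inner_diff_right inner_scaleR_left
          inner_scaleR_right
      by (simp add: inner_commute algebra_simps power2_eq_square)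
    moreover have q: "qform K (x - s *\<^sub>R v) = qform K x - 2 * s * Re (cinner (blinfun_apply K x) v)
        + s\<^sup>2 * qform K v"
      unfolding qform_diff_diff[OF K] scaleR_conv_scaleC cinner_scaleC_right qform_scaleC[OF cl] by simp
    moreover have "B (x - s *\<^sub>R v) = B x - 2 * s * (\<mu> * inner x v - Re (cinner (blinfun_apply K x) v))
        + s\<^sup>2 * B v"
      unfolding B_def n q by (simp add: algebra_simps)
    ultimately have "B (x - s *\<^sub>R v) = B x + 2 * s * inner v v + s\<^sup>2 * B v"
      unfolding iv by (simp only: algebra_simps)
    then show ?thesis using Bx by (simp add: power2_norm_eq_inner)
  qed
  have "v = 0"
  proof (rule ccontr)
    assume "v \<noteq> 0"
    then have vp: "(norm v)\<^sup>2 > 0" by simp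
    \<comment> \<open>Negative, and so small that \<open>s * B v\<close> cannot outweigh the linear
      term.\<close>
    define s where "s = - (norm v)\<^sup>2 / (1 + \<bar>B v\<bar>)"
    have s: "s < 0" using vp by (simp add: s_def divide_neg_pos)
    have "s * B v \<ge> - (norm v)\<^sup>2"
    proof -
      have "\<bar>s * B v\<bar> \<le> (norm v)\<^sup>2" by (simp add: s_def abs_mult field_simps)
      then show ?thesis by linarith
    qed
    then have "2 * (norm v)\<^sup>2 + s * B v > 0" using vp by linarith
    then have "s * (2 * (norm v)\<^sup>2 + s * B v) < 0" using s by (rule mult_neg_pos[rotated])
    then have "B (x - s *\<^sub>R v) < 0" unfolding key by (simp add: algebra_simps power2_eq_square)
    moreover have "x - s *\<^sub>R v \<in> perp E" unfolding scaleR_conv_scaleC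
        by (intro perp_diff perp_scaleC xE vE)
    ultimately show False using B0 by force
  qed
  then have "blinfun_apply K x = scaleC (of_real \<mu>) x" by (simp add: v_def)
  then show ?thesis using xE xn \<mu>t by blast
qed

section \<open>Counting eigenvalues by orthonormal eigenvectors\<close>

definition eigvecs :: "(ell2 \<Rightarrow>\<^sub>L ell2) \<Rightarrow> real \<Rightarrow> ell2 set \<Rightarrow> bool" where
  "eigvecs K t E \<longleftrightarrow> finite E \<and> orthonormal E \<and>
     (\<forall>e\<in>E. \<exists>\<mu>>t. blinfun_apply K e = scaleC (of_real \<mu>) e)"

lemma qform_eigvecs:
  assumes E: "eigvecs K t E" and cl: "clinear_op K"
  shows "qform K (\<Sum>e\<in>E. scaleC (a e) e) \<ge> t * (norm (\<Sum>e\<in>E. scaleC (a e) e))\<^sup>2"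
    and "(\<exists>e\<in>E. a e \<noteq> 0) \<Longrightarrow> qform K (\<Sum>e\<in>E. scaleC (a e) e) > t * (norm (\<Sum>e\<in>E. scaleC (a e) e))\<^sup>2"
proof -
  have fo: "finite E" "orthonormal E" using E by (auto simp: eigvecs_def)
  obtain m where m: "\<And>e. e \<in> E \<Longrightarrow> m e > t" "\<And>e. e \<in> E \<Longrightarrow> blinfun_apply K e = scaleC (of_real (m e)) e"
    using E unfolding eigvecs_def by metis
  let ?x = "\<Sum>e\<in>E. scaleC (a e) e"
  have Kx: "blinfun_apply K ?x = (\<Sum>e\<in>E. scaleC (a e * of_real (m e)) e)"
    by (simp add: blinfun.sum_right clinear_op_scale[OF cl] m cong: sum.cong)
  have "cinner (blinfun_apply K ?x) ?x = (\<Sum>e\<in>E. of_real (m e * (cmod (a e))\<^sup>2))"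
    unfolding Kx
    by (subst cinner_sum_right) (simp add: cinner_scaleC_right orthonormal_combination[OF fo(2,1)]
        mult_cnj_norm mult.assoc[symmetric] mult.commute cong: sum.cong)
  then have q: "qform K ?x = (\<Sum>e\<in>E. m e * (cmod (a e))\<^sup>2)"
    unfolding qform_def by (simp del: of_real_power of_real_mult)
  have n: "t * (norm ?x)\<^sup>2 = (\<Sum>e\<in>E. t * (cmod (a e))\<^sup>2)"
    unfolding orthonormal_combination_norm[OF fo(2,1)] sum_distrib_left ..
  show "qform K ?x \<ge> t * (norm ?x)\<^sup>2"
    unfolding q n using m by (intro sum_mono mult_right_mono) (auto intro: less_imp_le)
  assume "\<exists>e\<in>E. a e \<noteq> 0"
  then obtain e where "e \<in> E" "a e \<noteq> 0" by auto
  then show "qform K ?x > t * (norm ?x)\<^sup>2"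
    unfolding q n using m fo by (intro sum_strict_mono_ex1) (auto intro!: mult_right_mono bexI[of _ e]
        intro: less_imp_le)
qed

text \<open>Otherwise \<open>perp_combination\<close> yields a nontrivial combination of
  eigenvectors in \<open>perp G\<close>, where the form would be both at most and more than
  \<open>t\<close> times the squared norm.\<close>

lemma eigvecs_card_le:
  assumes E: "eigvecs K t E" and cl: "clinear_op K"
    and G: "finite G" "\<And>x. x \<in> perp G \<Longrightarrow> qform K x \<le> t * (norm x)\<^sup>2"
  shows "card E \<le> card G"
proof (rule ccontr)
  assume "\<not> card E \<le> card G"
  then obtain a where a: "\<exists>e\<in>E. a e \<noteq> 0" "(\<Sum>e\<in>E. scaleC (a e) e) \<in> perp G"
    using perp_combination[OF G(1), of E "\<lambda>e. e"] E by (auto simp: eigvecs_def)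
  from qform_eigvecs(2)[OF E cl a(1)] G(2)[OF a(2)] show False by simp
qed

lemma eigenspace_subspace:
  assumes cl: "clinear_op K"
  shows "ell2.subspace (eigenspace K \<mu>)"
  unfolding ell2.subspace_def eigenspace_def
  by (auto simp: blinfun.add_right clinear_op_scale[OF cl] ell2.scale_right_distrib mult.commute)

text \<open>\<open>E\<close> exhausts the spectrum above \<open>t\<close>: an eigenvector for
  \<open>\<mu> > t\<close> minus its projection on \<open>F \<mu>\<close> stays in the eigenspace
  and is orthogonal to \<open>E\<close>, so the bound \<open>le\<close> forces it to vanish. The
  sets \<open>F \<mu>\<close> are therefore bases of the eigenspaces, and they partition
  \<open>E\<close>.\<close>

lemma eigenvalue_count_eq_card:
  assumes K: "selfadj K" and E: "eigvecs K t E"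
    and le: "\<And>x. x \<in> perp E \<Longrightarrow> qform K x \<le> t * (norm x)\<^sup>2"
  shows "eigenvalue_count t K = card E"
proof -
  have cl: "clinear_op K" using K by (simp add: selfadj_def)
  have fo: "finite E" "orthonormal E" using E by (auto simp: eigvecs_def)
  obtain m where m: "\<And>e. e \<in> E \<Longrightarrow> m e > t" "\<And>e. e \<in> E \<Longrightarrow> blinfun_apply K e = scaleC (of_real (m e)) e"
    using E unfolding eigvecs_def by metis
  have nz: "e \<noteq> 0" if "e \<in> E" for e using orthonormal_norm[OF fo(2) that] by auto
  define F where "F \<mu> = {e \<in> E. m e = \<mu>}" for \<mu>
  have orth: "cinner x e = 0" if x: "x \<in> eigenspace K \<mu>" and e: "e \<in> E" "m e \<noteq> \<mu>" for x \<mu> e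
  proof -
    have "of_real \<mu> * cinner x e = cinner (blinfun_apply K x) e"
      using x by (simp add: eigenspace_def cinner_scaleC_left)
    also have "\<dots> = cinner x (blinfun_apply K e)" using K by (simp add: selfadj_def)
    also have "\<dots> = of_real (m e) * cinner x e" using m e by (simp add: cinner_scaleC_right)
    finally show ?thesis using e by simp
  qed
  have span: "x = (\<Sum>e\<in>F \<mu>. scaleC (cinner x e) e)" if x: "x \<in> eigenspace K \<mu>" and \<mu>: "\<mu> > t" for x \<mu>
  proof -
    let ?p = "\<Sum>e\<in>F \<mu>. scaleC (cinner x e) e"
    have "?p = (\<Sum>e\<in>E. scaleC (cinner x e) e)"
      using fo orth[OF x] by (intro sum.mono_neutral_left) (auto simp: F_def)
    then have pe: "x - ?p \<in> perp E" using orthonormal_proj_perp[OF fo(2,1), of x] by simp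
    have "?p \<in> eigenspace K \<mu>"
      by (intro ell2.subspace_sum eigenspace_subspace[OF cl] ell2.subspace_scale)
        (auto simp: F_def eigenspace_def m)
    then have xp: "x - ?p \<in> eigenspace K \<mu>"
      using x by (intro ell2.subspace_diff eigenspace_subspace[OF cl])
    have "qform K (x - ?p) = \<mu> * (norm (x - ?p))\<^sup>2"
    proof -
      have "blinfun_apply K (x - ?p) = scaleC (of_real \<mu>) (x - ?p)" using xp
          by (simp add: eigenspace_def)
      then show ?thesis unfolding qform_def by (simp add: cinner_scaleC_left cinner_self del:
          of_real_power)
    qed
    with le[OF pe] \<mu> have "(norm (x - ?p))\<^sup>2 \<le> 0"
      by (smt (verit) mult_less_cancel_right_pos zero_le_power2 mult_right_less_imp_less)
    then show ?thesis by simp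
  qed
  have dim: "ell2.dim (eigenspace K \<mu>) = card (F \<mu>)" if \<mu>: "\<mu> > t" for \<mu>
  proof (rule ell2.dim_unique[of "F \<mu>"])
    show "F \<mu> \<subseteq> eigenspace K \<mu>" by (auto simp: F_def eigenspace_def m)
    show "eigenspace K \<mu> \<subseteq> ell2.span (F \<mu>)"
    proof
      fix x assume "x \<in> eigenspace K \<mu>"
      then have "x = (\<Sum>e\<in>F \<mu>. scaleC (cinner x e) e)" using \<mu> by (rule span)
      also have "\<dots> \<in> ell2.span (F \<mu>)" by (intro ell2.span_sum ell2.span_scale ell2.span_base)
      finally show "x \<in> ell2.span (F \<mu>)" .
    qed
    have FE: "finite (F \<mu>)" "orthonormal (F \<mu>)" using fo by (auto simp: F_def orthonormal_def)
    show "ell2.independent (F \<mu>)"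
    proof (rule ell2.independent_if_scalars_zero[OF FE(1)])
      fix f x assume s: "(\<Sum>x\<in>F \<mu>. scaleC (f x) x) = 0" and "x \<in> F \<mu>"
      from orthonormal_combination[OF FE(2,1) this(2), of f] show "f x = 0" unfolding s by simp
    qed
  qed simp
  have ev: "{\<mu>. t < \<mu> \<and> eigenspace K \<mu> \<noteq> {0}} = m ` E"
  proof (intro set_eqI iffI)
    fix \<mu> assume "\<mu> \<in> {\<mu>. t < \<mu> \<and> eigenspace K \<mu> \<noteq> {0}}"
    moreover have "0 \<in> eigenspace K \<mu>" by (simp add: eigenspace_def blinfun.zero_right)
    ultimately obtain x where x: "x \<in> eigenspace K \<mu>" "x \<noteq> 0" "t < \<mu>" by auto
    then have "F \<mu> \<noteq> {}" using span[OF x(1,3)] by auto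
    then show "\<mu> \<in> m ` E" by (auto simp: F_def)
  next
    fix \<mu> assume "\<mu> \<in> m ` E"
    then obtain e where "e \<in> E" "\<mu> = m e" by auto
    then have "e \<in> eigenspace K \<mu>" "e \<noteq> 0" "t < \<mu>" using m nz by (auto simp: eigenspace_def)
    then show "\<mu> \<in> {\<mu>. t < \<mu> \<and> eigenspace K \<mu> \<noteq> {0}}" by auto
  qed
  have "eigenvalue_count t K = (\<Sum>\<mu>\<in>m ` E. card (F \<mu>))"
    unfolding eigenvalue_count_def ev using m by (intro sum.cong dim) auto
  also have "\<dots> = card E"
    unfolding F_def using sum.group[OF fo(1) finite_imageI[OF fo(1)], of m m "\<lambda>_. 1::nat"]
        by (simp only: card_eq_sum)
  finally show ?thesis .
qed

text \<open>Glazman's variational principle. A largest system \<open>E\<close> exists because all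
  such systems have at most \<open>card G\<close> members, and \<open>exists_eigenvector\<close>
  would enlarge it if the form exceeded \<open>t\<close> somewhere on \<open>perp E\<close>. The
  bound off the finite set \<open>G\<close> stands in for compactness of \<open>K\<close>.\<close>

theorem eigenvalue_count_spectral:
  assumes K: "selfadj K" and G: "finite G" "\<And>x. x \<in> perp G \<Longrightarrow> qform K x \<le> t * (norm x)\<^sup>2"
  shows "\<exists>E. finite E \<and> card E = eigenvalue_count t K \<and> eigenvalue_count t K \<le> card G \<and>
    (\<forall>x\<in>perp E. qform K x \<le> t * (norm x)\<^sup>2)"
proof -
  have cl: "clinear_op K" using K by (simp add: selfadj_def)
  have "eigvecs K t {}" by (simp add: eigvecs_def orthonormal_def)
  then have "\<exists>E. eigvecs K t E \<and> (\<forall>E'. eigvecs K t E' \<longrightarrow> card E' \<le> card E)"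
    using eigvecs_card_le[OF _ cl G]
    by (intro ex_has_greatest_nat[where P="eigvecs K t" and f=card and b="Suc (card G)"
        and k="{}", rule_format]) (auto simp: less_Suc_eq_le)
  then obtain E where E: "eigvecs K t E" "\<And>E'. eigvecs K t E' \<Longrightarrow> card E' \<le> card E" by blast
  have le: "qform K x \<le> t * (norm x)\<^sup>2" if x: "x \<in> perp E" for x
  proof (rule ccontr)
    assume "\<not> qform K x \<le> t * (norm x)\<^sup>2"
    then have "qform K x > t * (norm x)\<^sup>2" by simp
    moreover have "\<exists>\<mu>. blinfun_apply K e = scaleC (of_real \<mu>) e" if "e \<in> E" for e
      using E(1) that unfolding eigvecs_def by blast
    ultimately obtain v \<mu> where v: "v \<in> perp E" "norm v = 1" "t < \<mu>" "blinfun_apply K v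
        = scaleC (of_real \<mu>) v"
      using exists_eigenvector[OF K G _ x] by blast
    have "orthonormal E" using E by (simp add: eigvecs_def)
    from orthonormal_insert[OF this v(1,2)] have "eigvecs K t (insert v E)" "card (insert v E)
        = Suc (card E)"
      using v E(1) by (auto simp: eigvecs_def)
    with E(2) show False by fastforce
  qed
  then show ?thesis
    using eigenvalue_count_eq_card[OF K E(1) le] eigvecs_card_le[OF E(1) cl G] E(1)
    by (intro exI[of _ E]) (auto simp: eigvecs_def)
qed

section \<open>Counting eigenvalues under perturbation\<close>

text \<open>The squared norms of \<open>A\<close> on an orthonormal system sum to at most
  \<open>S\<close>, so a system on which \<open>A\<close> has norm at least \<open>d\<close> has at
  most \<open>S / d\<^sup>2\<close> members. To a largest such system no vector violating the bound
  can be added. This trades a Hilbert-Schmidt bound for an operator bound off a space of controlled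
  dimension.\<close>

lemma hilbert_schmidt_small:
  assumes cl: "clinear_op A" and S: "\<And>n. (\<Sum>j<n. \<Sum>k<n. (cmod (entry A j k))\<^sup>2) \<le> S" and d: "d > 0"
  shows "\<exists>G. finite G \<and> real (card G) \<le> S / d\<^sup>2 \<and> (\<forall>x\<in>perp G. norm (blinfun_apply A x) \<le> d * norm x)"
proof -
  have S0: "S \<ge> 0" using S[of 0] by simp
  \<comment> \<open>Row \<open>k\<close> of the matrix, conjugated: the vector \<open>r k\<close>
    represents the functional that gives coordinate \<open>k\<close> of \<open>A x\<close>.\<close>
  have rows: "\<exists>r. \<forall>j. ell2_nth r j = cnj (entry A j k)" for k
  proof -
    have "(\<Sum>j<n. (cmod (cnj (entry A j k)))\<^sup>2) \<le> S" for n
    proof -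
      have "(\<Sum>j<n. (cmod (cnj (entry A j k)))\<^sup>2) \<le> (\<Sum>j<max n (Suc k). (cmod (entry A j k))\<^sup>2)"
        by (simp, intro sum_mono2) auto
      also have "\<dots> \<le> (\<Sum>j<max n (Suc k). \<Sum>k<max n (Suc k). (cmod (entry A j k))\<^sup>2)"
        by (intro sum_mono member_le_sum) auto
      also have "\<dots> \<le> S" by (rule S)
      finally show ?thesis .
    qed
    from ell2_bounded_sumsI(1)[of "\<lambda>j. cnj (entry A j k)", OF this] show ?thesis by metis
  qed
  then obtain r where r: "\<And>k j. ell2_nth (r k) j = cnj (entry A j k)" by metis
  have Ax: "ell2_nth (blinfun_apply A x) k = cinner x (r k)" for x k
  proof -
    have "(\<lambda>n. cinner (blinfun_apply A (\<Sum>i<n. scaleC (ell2_nth x i) (basis_vec i))) (basis_vec k))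
        \<longlonglongrightarrow> cinner (blinfun_apply A x) (basis_vec k)"
      by (intro tendsto_intros blinfun.tendsto basis_expansion)
    moreover have "cinner (blinfun_apply A (\<Sum>i<n. scaleC (ell2_nth x i) (basis_vec i))) (basis_vec k)
        = (\<Sum>i<n. ell2_nth x i * cnj (ell2_nth (r k) i))" for n
      by (simp add: blinfun.sum_right clinear_op_scale[OF cl] cinner_sum_left cinner_scaleC_left r
          entry_def)
    ultimately have "(\<lambda>i. ell2_nth x i * cnj (ell2_nth (r k) i)) sums cinner (blinfun_apply A x)
        (basis_vec k)"
      by (simp add: sums_def)
    with cinner_sums[of x "r k"] show ?thesis by (metis sums_unique2 cinner_basis_vec)
  qed
  \<comment> \<open>The Hilbert-Schmidt norm may be computed in any orthonormal system, here as an
    inequality: Bessel is applied to each \<open>r k\<close>, with both index ranges truncated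
    before the limits are taken.\<close>
  have HS: "(\<Sum>g\<in>G. (norm (blinfun_apply A g))\<^sup>2) \<le> S" if G: "finite G" "orthonormal G" for G
  proof (rule LIMSEQ_le_const2)
    show "(\<lambda>n. \<Sum>g\<in>G. \<Sum>k<n. (cmod (ell2_nth (blinfun_apply A g) k))\<^sup>2) \<longlonglongrightarrow> (\<Sum>g\<in>G. (norm (blinfun_apply A
        g))\<^sup>2)"
      using norm_power2_sums by (intro tendsto_sum) (simp add: sums_def)
    have "(\<Sum>g\<in>G. \<Sum>k<n. (cmod (ell2_nth (blinfun_apply A g) k))\<^sup>2) \<le> S" for n
    proof -
      have "(\<Sum>g\<in>G. \<Sum>k<n. (cmod (ell2_nth (blinfun_apply A g) k))\<^sup>2) = (\<Sum>k<n. \<Sum>g\<in>G. (cmod (cinner (r k)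
          g))\<^sup>2)"
        by (subst sum.swap) (simp add: Ax cinner_commute[of _ "r _"])
      also have "\<dots> \<le> (\<Sum>k<n. (norm (r k))\<^sup>2)" by (intro sum_mono bessel G)
      also have "\<dots> \<le> S"
      proof (rule LIMSEQ_le_const2)
        show "(\<lambda>m. \<Sum>k<n. \<Sum>j<m. (cmod (ell2_nth (r k) j))\<^sup>2) \<longlonglongrightarrow> (\<Sum>k<n. (norm (r k))\<^sup>2)"
          using norm_power2_sums by (intro tendsto_sum) (simp add: sums_def)
        have "(\<Sum>k<n. \<Sum>j<m. (cmod (ell2_nth (r k) j))\<^sup>2) \<le> S" if "m \<ge> n" for m
        proof -
          have "(\<Sum>k<n. \<Sum>j<m. (cmod (ell2_nth (r k) j))\<^sup>2) \<le> (\<Sum>k<m. \<Sum>j<m. (cmod (entry A j k))\<^sup>2)"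
            unfolding r complex_mod_cnj using that by (intro sum_mono2) (auto intro: sum_nonneg)
          also have "\<dots> = (\<Sum>j<m. \<Sum>k<m. (cmod (entry A j k))\<^sup>2)" by (rule sum.swap)
          finally show ?thesis using S[of m] by linarith
        qed
        then show "\<exists>N. \<forall>m\<ge>N. (\<Sum>k<n. \<Sum>j<m. (cmod (ell2_nth (r k) j))\<^sup>2) \<le> S" by blast
      qed
      finally show ?thesis .
    qed
    then     show "\<exists>N. \<forall>n\<ge>N. (\<Sum>g\<in>G. \<Sum>k<n. (cmod (ell2_nth (blinfun_apply A g) k))\<^sup>2) \<le> S" by blast
  qed
  define P where "P G \<longleftrightarrow> finite G \<and> orthonormal G \<and> (\<forall>g\<in>G. norm (blinfun_apply A g) \<ge> d)" for G
  have card: "real (card G) \<le> S / d\<^sup>2" if "P G" for G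
  proof -
    have "real (card G) * d\<^sup>2 = (\<Sum>g\<in>G. d\<^sup>2)" by simp
    also have "\<dots> \<le> (\<Sum>g\<in>G. (norm (blinfun_apply A g))\<^sup>2)"
      using that d by (intro sum_mono power_mono) (auto simp: P_def)
    also have "\<dots> \<le> S" using that by (intro HS) (auto simp: P_def)
    finally show ?thesis using d by (simp add: field_simps)
  qed
  have "P {}" by (simp add: P_def orthonormal_def)
  moreover have "card G < Suc (nat \<lceil>S / d\<^sup>2\<rceil>)" if "P G" for G using card[OF that] by linarith
  ultimately have "\<exists>G. P G \<and> (\<forall>G'. P G' \<longrightarrow> card G' \<le> card G)"
    by (intro ex_has_greatest_nat[where P=P and f=card and k="{}", rule_format]) auto
  then obtain G where G: "P G" "\<And>G'. P G' \<Longrightarrow> card G' \<le> card G" by blast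
  have "norm (blinfun_apply A x) \<le> d * norm x" if x: "x \<in> perp G" for x
  proof (rule ccontr)
    assume c: "\<not> norm (blinfun_apply A x) \<le> d * norm x"
    then have nz: "x \<noteq> 0" by (auto simp: blinfun.zero_right)
    let ?u = "scaleC (of_real (inverse (norm x))) x"
    have "norm (blinfun_apply A ?u) = norm (blinfun_apply A x) / norm x"
      unfolding clinear_op_scale[OF cl] norm_scaleC norm_of_real by (simp add: field_simps)
    moreover have "d \<le> norm (blinfun_apply A x) / norm x" using c nz by (simp add: field_simps)
    ultimately have "norm (blinfun_apply A ?u) \<ge> d" by (simp only:)
    moreover have "?u \<in> perp G" using x by (rule perp_scaleC)
    ultimately have "P (insert ?u G)" "?u \<notin> G"
      using G(1) orthonormal_insert[of G ?u] norm_normalize[OF nz] by (auto simp: P_def)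
    then show False using G(2)[of "insert ?u G"] G(1) by (simp add: P_def)
  qed
  then show ?thesis using G(1) card by (intro exI[of _ G]) (auto simp: P_def)
qed

text \<open>The Gram matrix of \<open>y\<close> is within \<open>\<epsilon>\<close> of the identity
  in operator norm. Oscillating block vectors are orthogonal only up to such an error.\<close>

definition near_orthonormal :: "real \<Rightarrow> 'i set \<Rightarrow> ('i \<Rightarrow> ell2) \<Rightarrow> bool" where
  "near_orthonormal \<epsilon> I y \<longleftrightarrow> finite I \<and> 0 \<le> \<epsilon> \<and>
    (\<forall>b. (\<Sum>i\<in>I. (cmod (cinner (\<Sum>k\<in>I. scaleC (b k) (y k)) (y i) - b i))\<^sup>2) \<le> \<epsilon>\<^sup>2 * (\<Sum>i\<in>I. (cmod (b i))\<^sup>2))"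

lemma near_orthonormal_cs:
  assumes "near_orthonormal \<epsilon> I y"
  shows "(\<Sum>i\<in>I. cmod (b i) * cmod (cinner (\<Sum>k\<in>I. scaleC (b k) (y k)) (y i) - b i))
      \<le> \<epsilon> * (\<Sum>i\<in>I. (cmod (b i))\<^sup>2)"
proof -
  let ?D = "\<lambda>i. cmod (cinner (\<Sum>k\<in>I. scaleC (b k) (y k)) (y i) - b i)" and ?N = "\<Sum>i\<in>I. (cmod (b i))\<^sup>2"
  have "(\<Sum>i\<in>I. cmod (b i) * ?D i)\<^sup>2 \<le> ?N * (\<Sum>i\<in>I. (?D i)\<^sup>2)" by (rule Cauchy_Schwarz_ineq_sum)
  also have "\<dots> \<le> ?N * (\<epsilon>\<^sup>2 * ?N)"
    using assms by (intro mult_left_mono sum_nonneg) (auto simp: near_orthonormal_def)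
  also have "\<dots> = (\<epsilon> * ?N)\<^sup>2" by (simp add: power2_eq_square)
  finally show ?thesis
    by (rule power2_le_imp_le) (use assms in \<open>auto simp: near_orthonormal_def intro!: mult_nonneg_nonneg
        sum_nonneg\<close>)
qed

lemma near_orthonormal_norm:
  assumes "near_orthonormal \<epsilon> I y"
  shows "(norm (\<Sum>k\<in>I. scaleC (b k) (y k)))\<^sup>2 \<le> (1 + \<epsilon>) * (\<Sum>i\<in>I. (cmod (b i))\<^sup>2)"
proof -
  let ?x = "\<Sum>k\<in>I. scaleC (b k) (y k)"
  have "complex_of_real ((norm ?x)\<^sup>2) = (\<Sum>i\<in>I. cnj (b i) * cinner ?x (y i))"
    unfolding cinner_self[symmetric] by (subst cinner_sum_right) (simp add: cinner_scaleC_right)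
  then have "(norm ?x)\<^sup>2 = Re (\<Sum>i\<in>I. cnj (b i) * cinner ?x (y i))" by (metis Re_complex_of_real)
  also have "\<dots> = (\<Sum>i\<in>I. Re (cnj (b i) * cinner ?x (y i)))" by simp
  also have "\<dots> \<le> (\<Sum>i\<in>I. (cmod (b i))\<^sup>2 + cmod (b i) * cmod (cinner ?x (y i) - b i))"
  proof (rule sum_mono)
    fix i
    have "cnj (b i) * cinner ?x (y i) = of_real ((cmod (b i))\<^sup>2) + cnj (b i) * (cinner ?x (y i) - b i)"
      by (simp add: right_diff_distrib mult_cnj_norm)
    then have "Re (cnj (b i) * cinner ?x (y i)) = (cmod (b i))\<^sup>2 + Re (cnj (b i) * (cinner ?x (y i)
        - b i))"
      by (simp del: of_real_power)
    then show "Re (cnj (b i) * cinner ?x (y i)) \<le> (cmod (b i))\<^sup>2 + cmod (b i) * cmod (cinner ?x (y i)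
        - b i)"
      using complex_Re_le_cmod[of "cnj (b i) * (cinner ?x (y i) - b i)"] by (simp add: norm_mult)
  qed
  also have "\<dots> \<le> (1 + \<epsilon>) * (\<Sum>i\<in>I. (cmod (b i))\<^sup>2)"
    using near_orthonormal_cs[OF assms, of b] by (simp add: sum.distrib algebra_simps)
  finally show ?thesis .
qed

text \<open>Duality: the map from \<open>x\<close> to its products with \<open>y\<close> is adjoint
  to the synthesis map of \<open>near_orthonormal_norm\<close> and has the same norm;
  \<open>?z\<close> is the synthesis of those products.\<close>

lemma near_orthonormal_bessel:
  assumes "near_orthonormal \<epsilon> I y"
  shows "(\<Sum>i\<in>I. (cmod (cinner x (y i)))\<^sup>2) \<le> (1 + \<epsilon>) * (norm x)\<^sup>2"
proof -
  define S where "S = (\<Sum>i\<in>I. (cmod (cinner x (y i)))\<^sup>2)"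
  have S0: "S \<ge> 0" by (simp add: S_def sum_nonneg)
  have e: "\<epsilon> \<ge> 0" using assms by (simp add: near_orthonormal_def)
  let ?z = "\<Sum>i\<in>I. scaleC (cinner x (y i)) (y i)"
  have "cinner x ?z = of_real S"
    unfolding S_def by (simp add: cinner_sum_right cinner_scaleC_right mult_cnj_norm)
  then have "S = cmod (cinner x ?z)" using S0 by simp
  also have "\<dots> \<le> norm x * norm ?z" by (rule cmod_cinner_le)
  finally have "S\<^sup>2 \<le> (norm x)\<^sup>2 * (norm ?z)\<^sup>2" using S0 by (metis power_mono power_mult_distrib)
  also have "\<dots> \<le> (norm x)\<^sup>2 * ((1 + \<epsilon>) * S)"
    unfolding S_def by (intro mult_left_mono near_orthonormal_norm[OF assms]) auto
  finally have "S * S \<le> ((1 + \<epsilon>) * (norm x)\<^sup>2) * S" by (simp add: power2_eq_square mult_ac)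
  then show ?thesis
    using S0 e unfolding S_def[symmetric] by (cases "S = 0") auto
qed

text \<open>Off \<open>G\<close> and off the vectors \<open>y i\<close> with
  \<open>\<mu> i > s\<close>, the Bessel inequality bounds the form by
  \<open>s * (1 + \<epsilon>) + \<delta>\<close>. The count is at most the number of vectors
  removed.\<close>

theorem eigenvalue_count_upper:
  assumes K: "selfadj K" and y: "near_orthonormal \<epsilon> I y"
    and q: "\<And>x. qform K x = (\<Sum>i\<in>I. \<mu> i * (cmod (cinner x (y i)))\<^sup>2) + R x"
    and G: "finite G" "\<And>x. x \<in> perp G \<Longrightarrow> \<bar>R x\<bar> \<le> \<delta> * (norm x)\<^sup>2"
    and s: "s \<ge> 0" "s * (1 + \<epsilon>) + \<delta> \<le> t"
  shows "eigenvalue_count t K \<le> card {i\<in>I. \<mu> i > s} + card G"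
proof -
  have fI: "finite I" using y by (simp add: near_orthonormal_def)
  let ?P = "{i\<in>I. \<mu> i > s}"
  have "qform K x \<le> t * (norm x)\<^sup>2" if x: "x \<in> perp (y ` ?P \<union> G)" for x
  proof -
    have "(\<Sum>i\<in>I. \<mu> i * (cmod (cinner x (y i)))\<^sup>2) \<le> (\<Sum>i\<in>I. s * (cmod (cinner x (y i)))\<^sup>2)"
    proof (rule sum_mono)
      fix i assume "i \<in> I"
      show "\<mu> i * (cmod (cinner x (y i)))\<^sup>2 \<le> s * (cmod (cinner x (y i)))\<^sup>2"
      proof (cases "\<mu> i > s")
        case True then have "cinner x (y i) = 0" using x \<open>i \<in> I\<close> by (auto simp: perp_def)
        then show ?thesis by simp
      qed (auto intro: mult_right_mono)
    qed
    also have "\<dots> \<le> s * ((1 + \<epsilon>) * (norm x)\<^sup>2)"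
      unfolding sum_distrib_left[symmetric] by (intro mult_left_mono near_orthonormal_bessel[OF y] s)
    finally have "qform K x \<le> s * ((1 + \<epsilon>) * (norm x)\<^sup>2) + \<delta> * (norm x)\<^sup>2"
      unfolding q using G(2)[of x] x by (fastforce simp: perp_def)
    also have "\<dots> = (s * (1 + \<epsilon>) + \<delta>) * (norm x)\<^sup>2" by (simp add: algebra_simps)
    also have "\<dots> \<le> t * (norm x)\<^sup>2" using s by (intro mult_right_mono) auto
    finally show ?thesis .
  qed
  then have "eigenvalue_count t K \<le> card (y ` ?P \<union> G)"
    using eigenvalue_count_spectral[OF K, of "y ` ?P \<union> G" t] fI G by auto
  also have "\<dots> \<le> card (y ` ?P) + card G" by (rule card_Un_le)
  also have "\<dots> \<le> card ?P + card G" using fI by (intro add_mono card_image_le) auto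
  finally show ?thesis .
qed

text \<open>If too many \<open>\<mu> i\<close> exceeded \<open>s\<close>, some combination of their
  vectors would be orthogonal both to the spectral system \<open>E\<close> and to \<open>G\<close>.
  Its form is at most \<open>t\<close> times the squared norm, while near-orthonormality makes it
  larger; the last inequality in \<open>s\<close> is what remains after paying for
  \<open>\<epsilon>\<close> and \<open>\<delta>\<close>.\<close>

theorem eigenvalue_count_lower:
  assumes K: "selfadj K" and y: "near_orthonormal \<epsilon> I y"
    and q: "\<And>x. qform K x = (\<Sum>i\<in>I. \<mu> i * (cmod (cinner x (y i)))\<^sup>2) + R x"
    and G: "finite G" "\<And>x. x \<in> perp G \<Longrightarrow> \<bar>R x\<bar> \<le> \<delta> * (norm x)\<^sup>2"
    and B: "\<And>i. i \<in> I \<Longrightarrow> \<bar>\<mu> i\<bar> \<le> B"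
    and s: "s \<ge> 0" "0 \<le> \<delta>" "\<delta> \<le> t" "t * (1 + \<epsilon>) < s * (1 - 2 * \<epsilon>) - B * \<epsilon>\<^sup>2 - \<delta> * (1 + \<epsilon>)"
  shows "card {i\<in>I. \<mu> i > s} \<le> eigenvalue_count t K + card G"
proof (rule ccontr)
  have fI: "finite I" and e0: "\<epsilon> \<ge> 0" using y by (auto simp: near_orthonormal_def)
  let ?P = "{i\<in>I. \<mu> i > s}"
  assume "\<not> card ?P \<le> eigenvalue_count t K + card G"
  then have big: "eigenvalue_count t K + card G < card ?P" by simp
  \<comment> \<open>Off all the vectors \<open>y\<close> the diagonal part vanishes, so
    \<open>\<delta> \<le> t\<close> already supplies the finite-codimension bound from which
    \<open>E\<close> is obtained.\<close>
  have "qform K x \<le> t * (norm x)\<^sup>2" if x: "x \<in> perp (y ` I \<union> G)" for x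
  proof -
    have "(\<Sum>i\<in>I. \<mu> i * (cmod (cinner x (y i)))\<^sup>2) = 0" using x
        by (intro sum.neutral) (auto simp: perp_def)
    then have "qform K x \<le> \<delta> * (norm x)\<^sup>2" unfolding q using G(2)[of x] x by (fastforce simp: perp_def)
    also have "\<dots> \<le> t * (norm x)\<^sup>2" using s by (intro mult_right_mono) auto
    finally show ?thesis .
  qed
  then obtain E where E: "finite E" "card E = eigenvalue_count t K" "\<And>x. x \<in> perp E \<Longrightarrow> qform K x
      \<le> t * (norm x)\<^sup>2"
    using eigenvalue_count_spectral[OF K, of "y ` I \<union> G" t] fI G by auto
  have "card (E \<union> G) < card ?P" using big E card_Un_le[of E G] by linarith
  then obtain a where a: "\<exists>i\<in>?P. a i \<noteq> 0" "(\<Sum>i\<in>?P. scaleC (a i) (y i)) \<in> perp (E \<union> G)"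
    using perp_combination[of "E \<union> G" ?P y] E(1) G(1) fI by auto
  \<comment> \<open>Extended by zero, since near-orthonormality is a statement about the whole
    family.\<close>
  define b where "b i = (if i \<in> ?P then a i else 0)" for i
  define x where "x = (\<Sum>k\<in>I. scaleC (b k) (y k))"
  have "x = (\<Sum>i\<in>?P. scaleC (a i) (y i))"
    unfolding x_def using fI by (intro sum.mono_neutral_cong_right) (auto simp: b_def)
  then have xp: "x \<in> perp E" "x \<in> perp G" using a by (auto simp: perp_def)
  define N where "N = (\<Sum>i\<in>I. (cmod (b i))\<^sup>2)"
  have N0: "N > 0"
  proof -
    obtain i where "i \<in> ?P" "a i \<noteq> 0" using a by auto
    then have "0 < (cmod (b i))\<^sup>2" "i \<in> I" by (auto simp: b_def)
    then show ?thesis unfolding N_def using fI by (intro sum_pos2[of _ i]) auto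
  qed
  define D where "D i = cinner x (y i) - b i" for i
  have D2: "(\<Sum>i\<in>I. (cmod (D i))\<^sup>2) \<le> \<epsilon>\<^sup>2 * N" using y unfolding D_def x_def N_def near_orthonormal_def
      by blast
  have Dc: "(\<Sum>i\<in>I. cmod (b i) * cmod (D i)) \<le> \<epsilon> * N"
    unfolding D_def x_def N_def by (rule near_orthonormal_cs[OF y])
  have nx: "(norm x)\<^sup>2 \<le> (1 + \<epsilon>) * N" unfolding x_def N_def by (rule near_orthonormal_norm[OF y])
  have B0: "B \<ge> 0" using B a(1) by force
  \<comment> \<open>For a chosen index the true product is \<open>b i + D i\<close>. For the others
    \<open>b i = 0\<close> and the product is pure error, so even a negative \<open>\<mu> i\<close>
    costs at most \<open>B\<close> times its square.\<close>
  have pw: "\<mu> i * (cmod (cinner x (y i)))\<^sup>2 \<ge> s * (cmod (b i))\<^sup>2 - 2 * s * (cmod (b i) * cmod (D i))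
      - B * (cmod (D i))\<^sup>2"
    if i: "i \<in> I" for i
  proof (cases "\<mu> i > s")
    case True
    have "cinner x (y i) = b i + D i" by (simp add: D_def)
    then have "cmod (b i) - cmod (D i) \<le> cmod (cinner x (y i))"
      using norm_triangle_ineq2[of "b i" "- D i"] by simp
    have "(cmod (b i))\<^sup>2 - 2 * (cmod (b i) * cmod (D i)) \<le> (cmod (cinner x (y i)))\<^sup>2"
    proof (cases "cmod (b i) \<ge> cmod (D i)")
      case True
      then have "(cmod (b i) - cmod (D i))\<^sup>2 \<le> (cmod (cinner x (y i)))\<^sup>2"
        using \<open>cmod (b i) - cmod (D i) \<le> _\<close> by (intro power_mono) auto
      moreover have "0 \<le> (cmod (D i))\<^sup>2" by simp
      ultimately show ?thesis unfolding power2_diff mult.assoc by linarith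
    next
      case False
      then have "cmod (b i) * cmod (b i) \<le> cmod (b i) * cmod (D i)" by (intro mult_left_mono) auto
      moreover have "0 \<le> cmod (b i) * cmod (D i)" "0 \<le> (cmod (cinner x (y i)))\<^sup>2" by auto
      ultimately show ?thesis unfolding power2_eq_square[of "cmod (b i)"] by linarith
    qed
    then have "s * ((cmod (b i))\<^sup>2 - 2 * (cmod (b i) * cmod (D i))) \<le> s * (cmod (cinner x (y i)))\<^sup>2"
      using s by (intro mult_left_mono) auto
    also have "\<dots> \<le> \<mu> i * (cmod (cinner x (y i)))\<^sup>2" using True by (intro mult_right_mono) auto
    moreover have "0 \<le> B * (cmod (D i))\<^sup>2" using B0 by simp
    ultimately show ?thesis by (simp add: right_diff_distrib) 
  next
    case False
    then have "b i = 0" by (auto simp: b_def)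
    then have "D i = cinner x (y i)" by (simp add: D_def)
    moreover have "- B * (cmod (D i))\<^sup>2 \<le> \<mu> i * (cmod (D i))\<^sup>2"
      using B[OF i] by (intro mult_right_mono) auto
    ultimately show ?thesis using \<open>b i = 0\<close> by simp
  qed
  have "t * (norm x)\<^sup>2 \<le> t * ((1 + \<epsilon>) * N)" using nx s by (intro mult_left_mono) auto
  also have "\<dots> = (t * (1 + \<epsilon>)) * N" by simp
  also have "\<dots> < (s * (1 - 2 * \<epsilon>) - B * \<epsilon>\<^sup>2 - \<delta> * (1 + \<epsilon>)) * N" using s N0
      by (intro mult_strict_right_mono) auto
  also have "\<dots> = s * N - 2 * s * (\<epsilon> * N) - B * (\<epsilon>\<^sup>2 * N) - \<delta> * ((1 + \<epsilon>) * N)"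
      by (simp add: algebra_simps)
  also have "\<dots> \<le> s * N - 2 * s * (\<Sum>i\<in>I. cmod (b i) * cmod (D i)) - B * (\<Sum>i\<in>I. (cmod (D i))\<^sup>2)
      - \<delta> * (norm x)\<^sup>2"
    using s B0 D2 Dc nx by (intro diff_mono mult_left_mono) auto
  also have "\<dots> = (\<Sum>i\<in>I. s * (cmod (b i))\<^sup>2 - 2 * s * (cmod (b i) * cmod (D i)) - B * (cmod (D i))\<^sup>2)
      - \<delta> * (norm x)\<^sup>2"
    by (simp add: N_def sum_subtractf sum_distrib_left)
  also have "\<dots> \<le> (\<Sum>i\<in>I. \<mu> i * (cmod (cinner x (y i)))\<^sup>2) - \<delta> * (norm x)\<^sup>2"
    using pw by (intro diff_mono sum_mono) auto
  also have "\<dots> \<le> qform K x" unfolding q using G(2)[OF xp(2)] by linarith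
  also have "\<dots> \<le> t * (norm x)\<^sup>2" by (rule E(3)[OF xp(1)])
  finally show False by simp
qed

section \<open>Bounded operators from matrices\<close>

lemma clinear_op_nth:
  assumes "clinear_op A"
  shows "(\<lambda>j. ell2_nth x j * entry A j k) sums ell2_nth (blinfun_apply A x) k"
proof -
  have "(\<lambda>n. cinner (blinfun_apply A (\<Sum>i<n. scaleC (ell2_nth x i) (basis_vec i))) (basis_vec k))
      \<longlonglongrightarrow> cinner (blinfun_apply A x) (basis_vec k)"
    by (intro tendsto_intros blinfun.tendsto basis_expansion)
  then show ?thesis
    by (simp add: sums_def blinfun.sum_right clinear_op_scale[OF assms] cinner_sum_left
        cinner_scaleC_left
        flip: entry_def) (simp add: cinner_basis_vec)
qed

lemma selfadjI_entries:
  assumes cl: "clinear_op A" and h: "\<And>j k. entry A j k = cnj (entry A k j)"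
  shows "selfadj A"
  unfolding selfadj_def
proof (intro conjI cl allI)
  have basis: "cinner (blinfun_apply A (basis_vec j)) y = cinner (basis_vec j) (blinfun_apply A y)"
      for j y
  proof -
    have "(\<lambda>k. entry A j k * cnj (ell2_nth y k)) sums cinner (blinfun_apply A (basis_vec j)) y"
      using cinner_sums[of "blinfun_apply A (basis_vec j)" y] by (simp add: entry_def cinner_basis_vec)
    moreover have "(\<lambda>k. cnj (ell2_nth y k * entry A k j)) sums cnj (ell2_nth (blinfun_apply A y) j)"
      by (subst sums_cnj) (rule clinear_op_nth[OF cl])
    moreover have "(\<lambda>k. cnj (ell2_nth y k * entry A k j)) = (\<lambda>k. entry A j k * cnj (ell2_nth y k))"
      by (rule ext) (subst h[of j], simp add: mult.commute)
    moreover have "cnj (ell2_nth (blinfun_apply A y) j) = cinner (basis_vec j) (blinfun_apply A y)"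
      by (subst cinner_commute) (simp add: cinner_basis_vec)
    ultimately show ?thesis by (metis sums_unique2)
  qed
  fix x y
  let ?s = "\<lambda>n. \<Sum>i<n. scaleC (ell2_nth x i) (basis_vec i)"
  have "(\<lambda>n. cinner (blinfun_apply A (?s n)) y) \<longlonglongrightarrow> cinner (blinfun_apply A x) y"
    by (intro tendsto_intros blinfun.tendsto basis_expansion)
  moreover have "(\<lambda>n. cinner (?s n) (blinfun_apply A y)) \<longlonglongrightarrow> cinner x (blinfun_apply A y)"
    by (intro tendsto_intros basis_expansion)
  moreover have "cinner (blinfun_apply A (?s n)) y = cinner (?s n) (blinfun_apply A y)" for n
    by (simp add: blinfun.sum_right clinear_op_scale[OF cl] cinner_sum_left cinner_scaleC_left basis)
  ultimately show "cinner (blinfun_apply A x) y = cinner x (blinfun_apply A y)"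
    using LIMSEQ_unique by simp
qed

text \<open>A matrix whose finite sections are bounded as bilinear forms defines a bounded operator.
  The bound has additive shape because it will come from the inequality of the means; rescaling the
  arguments recovers the product of norms.\<close>

lemma has_entries_exists:
  assumes B: "B > 0"
    and form: "\<And>n x y. cmod (\<Sum>j<n. \<Sum>k<n. M j k * x j * y k) \<le> B / 2 * ((\<Sum>j<n. (cmod (x j))\<^sup>2)
        + (\<Sum>k<n. (cmod (y k))\<^sup>2))"
  shows "\<exists>A. has_entries A M \<and> norm A \<le> B"
proof -
  \<comment> \<open>The form is tested with the conjugated image of \<open>x\<close> divided by
    \<open>B\<close>, the scaling at which the additive bound is sharp.\<close>
  have op: "(\<Sum>k<n. (cmod (\<Sum>j<n. M j k * x j))\<^sup>2) \<le> B\<^sup>2 * (\<Sum>j<n. (cmod (x j))\<^sup>2)" for n x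
  proof -
    define v where "v k = (\<Sum>j<n. M j k * x j)" for k
    define V where "V = (\<Sum>k<n. (cmod (v k))\<^sup>2)"
    have sw: "(\<Sum>j<n. \<Sum>k<n. M j k * x j * c k) = (\<Sum>k<n. v k * c k)" for c
      unfolding v_def sum_distrib_right by (rule sum.swap)
    have "(\<Sum>j<n. \<Sum>k<n. M j k * x j * (cnj (v k) / of_real B)) = (\<Sum>k<n. v k * cnj (v k)) / of_real B"
      unfolding sw[of "\<lambda>k. cnj (v k) / of_real B"] by (simp add: sum_divide_distrib)
    also have "\<dots> = of_real (V / B)" by (simp add: V_def mult_cnj_norm)
    finally have "cmod (of_real (V / B)) \<le> B / 2 * ((\<Sum>j<n. (cmod (x j))\<^sup>2) + (\<Sum>k<n. (cmod (cnj (v k) /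
        of_real B))\<^sup>2))"
      using form[where n=n and x=x and y="\<lambda>k. cnj (v k) / of_real B"] by simp
    moreover have "(\<Sum>k<n. (cmod (cnj (v k) / of_real B))\<^sup>2) = V / B\<^sup>2"
      using B by (simp add: V_def norm_divide power_divide sum_divide_distrib)
    moreover have "V \<ge> 0" by (simp add: V_def sum_nonneg)
    moreover from this have "cmod (of_real (V / B)) = V / B" using B unfolding norm_of_real by simp
    ultimately have "V / B \<le> B / 2 * ((\<Sum>j<n. (cmod (x j))\<^sup>2) + V / B\<^sup>2)" by (simp only:)
    then have "V \<le> B\<^sup>2 * (\<Sum>j<n. (cmod (x j))\<^sup>2)"
      using B by (simp add: field_simps power2_eq_square)
    then show ?thesis by (simp add: V_def v_def)
  qed
  \<comment> \<open>\<open>op\<close> applied to the conjugated row itself gives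
    \<open>S\<^sup>2 \<le> B\<^sup>2 * S\<close> for its squared length \<open>S\<close>;
    \<open>m\<close> exceeds \<open>k\<close> so that coordinate \<open>k\<close> of the image is
    among those summed.\<close>
  have rows: "(\<Sum>j<n. (cmod (cnj (M j k)))\<^sup>2) \<le> B\<^sup>2" for n k
  proof -
    define m where "m = max n (Suc k)"
    define S where "S = (\<Sum>j<m. (cmod (M j k))\<^sup>2)"
    have "(cmod (\<Sum>j<m. M j k * cnj (M j k)))\<^sup>2 \<le> (\<Sum>k'<m. (cmod (\<Sum>j<m. M j k' * cnj (M j k)))\<^sup>2)"
      by (rule member_le_sum) (auto simp: m_def)
    also have "\<dots> \<le> B\<^sup>2 * S" using op[where n=m and x="\<lambda>j. cnj (M j k)"] by (simp add: S_def)
    also have "(\<Sum>j<m. M j k * cnj (M j k)) = of_real S" by (simp add: S_def mult_cnj_norm)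
    finally have "S\<^sup>2 \<le> B\<^sup>2 * S" by simp
    moreover have "S \<ge> 0" by (simp add: S_def sum_nonneg)
    ultimately have "S \<le> B\<^sup>2" by (cases "S = 0") (auto simp: power2_eq_square)
    moreover have "(\<Sum>j<n. (cmod (cnj (M j k)))\<^sup>2) \<le> S"
      unfolding S_def complex_mod_cnj by (intro sum_mono2) (auto simp: m_def)
    ultimately show ?thesis by simp
  qed
  define r where "r k = Abs_ell2 (\<lambda>j. cnj (M j k))" for k
  have r: "ell2_nth (r k) j = cnj (M j k)" for k j
    unfolding r_def by (simp add: ell2_bounded_sumsI(1)[OF rows])
  have bnd: "(\<Sum>k<m. (cmod (cinner x (r k)))\<^sup>2) \<le> (B * norm x)\<^sup>2" for x m
  proof (rule LIMSEQ_le_const2)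
    show "(\<lambda>n. \<Sum>k<m. (cmod (\<Sum>j<n. ell2_nth x j * cnj (ell2_nth (r k) j)))\<^sup>2) \<longlonglongrightarrow> (\<Sum>k<m. (cmod (cinner x (r
        k)))\<^sup>2)"
      using cinner_sums by (intro tendsto_intros) (simp add: sums_def)
    have "(\<Sum>k<m. (cmod (\<Sum>j<n. ell2_nth x j * cnj (ell2_nth (r k) j)))\<^sup>2) \<le> (B * norm x)\<^sup>2" if "n \<ge> m"
        for n
    proof -
      have "(\<Sum>k<m. (cmod (\<Sum>j<n. ell2_nth x j * cnj (ell2_nth (r k) j)))\<^sup>2)
          \<le> (\<Sum>k<n. (cmod (\<Sum>j<n. M j k * ell2_nth x j))\<^sup>2)"
        using that by (simp add: r mult.commute, intro sum_mono2) auto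
      also have "\<dots> \<le> B\<^sup>2 * (\<Sum>j<n. (cmod (ell2_nth x j))\<^sup>2)" by (rule op)
      also have "\<dots> \<le> B\<^sup>2 * (norm x)\<^sup>2" by (intro mult_left_mono partial_norm_le) auto
      finally show ?thesis by (simp add: power_mult_distrib)
    qed
    then show "\<exists>N. \<forall>n\<ge>N. (\<Sum>k<m. (cmod (\<Sum>j<n. ell2_nth x j * cnj (ell2_nth (r k) j)))\<^sup>2) \<le> (B * norm x)\<^sup>2"
        by blast
  qed
  define F where "F x = Abs_ell2 (\<lambda>k. cinner x (r k))" for x
  have F: "ell2_nth (F x) k = cinner x (r k)" for x k
    unfolding F_def by (simp add: ell2_bounded_sumsI(1)[OF bnd])
  have Fn: "norm (F x) \<le> B * norm x" for x
    unfolding F_def by (rule power2_le_imp_le[OF ell2_bounded_sumsI(2)[OF bnd]]) (use B in auto)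
  have bl: "bounded_linear F"
  proof (rule bounded_linear_intro[of _ B])
    show "F (x + y) = F x + F y" "F (c *\<^sub>R x) = c *\<^sub>R F x" for x y c
      by (rule ell2_eqI; simp add: F nth_add nth_scaleR cinner_add_left scaleR_conv_scaleC
          cinner_scaleC_left nth_scaleC)+
  qed (use Fn in \<open>simp add: mult.commute\<close>)
  define A where "A = Blinfun F"
  have A: "blinfun_apply A = F" unfolding A_def by (rule bounded_linear_Blinfun_apply[OF bl])
  have "clinear_op A"
    by (rule clinear_opI) (simp add: A, rule ell2_eqI, simp add: F nth_scaleC cinner_scaleC_left)
  moreover have "entry A j k = M j k" for j k
    unfolding entry_def cinner_basis_vec A F
    by (subst cinner_commute) (simp add: cinner_basis_vec r)
  moreover have "norm A \<le> B" by (rule norm_blinfun_bound) (use B Fn in \<open>auto simp: A\<close>)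
  ultimately show ?thesis by (auto simp: has_entries_def)
qed

lemma op_of_entries_eq: "has_entries A M \<Longrightarrow> op_of_entries M = A"
  unfolding op_of_entries_def using has_entries_unique by blast

lemma has_entries_scaleR:
  assumes "has_entries A M"
  shows "has_entries (c *\<^sub>R A) (\<lambda>j k. of_real c * M j k)"
  using assms unfolding has_entries_def
  by (auto intro!: clinear_opI simp: clinear_op_scale entry_def scaleR_blinfun.rep_eq scaleR_conv_scaleC
      cinner_scaleC_left ell2.scale_scale mult.commute)

lemma has_entries_diff:
  assumes "has_entries A M" "has_entries A' M'"
  shows "has_entries (A - A') (\<lambda>j k. M j k - M' j k)"
  using assms unfolding has_entries_def
  by (auto intro!: clinear_opI simp: clinear_op_scale entry_def blinfun.diff_left
      cinner_diff_left ell2.scale_right_diff_distrib)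

lemma has_entries_zero: "has_entries 0 (\<lambda>j k. 0)"
  unfolding has_entries_def by (auto intro!: clinear_opI simp: entry_def blinfun.zero_left)

text \<open>\<open>multiplier_norm\<close> is a supremum of infima: finiteness shows that an
  operator with the multiplied entries exists, and uniqueness makes the infimum its norm. The
  supremum runs over \<open>norm A = 1\<close>, hence the rescaling and the separate case
  \<open>A = 0\<close>.\<close>

lemma schur_mult_bound:
  assumes C: "multiplier_norm \<sigma> \<le> ennreal C" "C \<ge> 0" and A: "clinear_op A"
  shows "has_entries (\<sigma> \<star> A) (\<lambda>j k. \<sigma> j k * entry A j k) \<and> norm (\<sigma> \<star> A) \<le> C * norm A"
proof (cases "A = 0")
  case True
  then have "entry A j k = 0" for j k by (simp add: entry_def blinfun.zero_left)
  then have h: "has_entries 0 (\<lambda>j k. \<sigma> j k * entry A j k)" using has_entries_zero by simp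
  then have "\<sigma> \<star> A = 0" unfolding schur_mult_def by (rule op_of_entries_eq)
  then show ?thesis using h C by simp
next
  case False
  define A' where "A' = inverse (norm A) *\<^sub>R A"
  have hA: "has_entries A (entry A)" using A by (simp add: has_entries_def)
  have hA': "has_entries A' (\<lambda>j k. of_real (inverse (norm A)) * entry A j k)"
    unfolding A'_def by (rule has_entries_scaleR[OF hA])
  have "norm A' = 1" using False by (simp add: A'_def)
  then have "entries_norm (\<lambda>j k. \<sigma> j k * entry A' j k) \<le> multiplier_norm \<sigma>"
    unfolding multiplier_norm_def using hA' by (intro SUP_upper) (auto simp: has_entries_def)
  with C have le: "entries_norm (\<lambda>j k. \<sigma> j k * entry A' j k) \<le> ennreal C" by simp
  have "{T. has_entries T (\<lambda>j k. \<sigma> j k * entry A' j k)} \<noteq> {}"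
  proof
    assume "{T. has_entries T (\<lambda>j k. \<sigma> j k * entry A' j k)} = {}"
    then have "entries_norm (\<lambda>j k. \<sigma> j k * entry A' j k) = \<infinity>" by (simp add: entries_norm_def)
    with le show False by (simp add: top_unique)
  qed
  then obtain T where T: "has_entries T (\<lambda>j k. \<sigma> j k * entry A' j k)" by auto
  then have "{T. has_entries T (\<lambda>j k. \<sigma> j k * entry A' j k)} = {T}" using has_entries_unique by blast
  then have "ennreal (norm T) \<le> ennreal C" using le by (simp add: entries_norm_def)
  then have nT: "norm T \<le> C" using C by (simp add: ennreal_le_iff)
  have e: "entry A' j k = of_real (inverse (norm A)) * entry A j k" for j k
    using hA' by (simp add: has_entries_def)
  have "has_entries (norm A *\<^sub>R T) (\<lambda>j k. of_real (norm A) * (\<sigma> j k * entry A' j k))"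
    by (rule has_entries_scaleR[OF T])
  moreover have "of_real (norm A) * (\<sigma> j k * entry A' j k) = \<sigma> j k * entry A j k" for j k
    using False by (simp add: e)
  ultimately have h: "has_entries (norm A *\<^sub>R T) (\<lambda>j k. \<sigma> j k * entry A j k)" by simp
  then have "\<sigma> \<star> A = norm A *\<^sub>R T" unfolding schur_mult_def by (rule op_of_entries_eq)
  then show ?thesis using h nT by (simp add: mult.commute[of C] mult_left_mono)
qed

section \<open>Replacing the multiplier by a sharp cutoff\<close>

text \<open>An antidiagonal \<open>j + k = m\<close> carries at most \<open>m + 1\<close> points,
  which turns double sums of Hankel type into single ones.\<close>

lemma sum_antidiagonal_le:
  fixes w :: "nat \<Rightarrow> real"
  assumes "\<And>m. w m \<ge> 0"
  shows "(\<Sum>j<n. \<Sum>k<n. w (j + k)) \<le> (\<Sum>m<2*n. (real m + 1) * w m)"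
proof -
  have "(\<Sum>j<n. \<Sum>k<n. w (j + k)) \<le> (\<Sum>j<n. \<Sum>m<2*n. if j \<le> m then w m else 0)"
  proof (rule sum_mono)
    fix j assume "j \<in> {..<n}"
    have "(\<Sum>k<n. w (j + k)) = (\<Sum>m\<in>(\<lambda>k. j + k) ` {..<n}. w m)" by (simp add: sum.reindex inj_on_def)
    also have "\<dots> = (\<Sum>m\<in>(\<lambda>k. j + k) ` {..<n}. if j \<le> m then w m else 0)" by (intro sum.cong) auto
    also have "\<dots> \<le> (\<Sum>m<2*n. if j \<le> m then w m else 0)"
      using \<open>j \<in> {..<n}\<close> assms by (intro sum_mono2) auto
    finally show "(\<Sum>k<n. w (j + k)) \<le> (\<Sum>m<2*n. if j \<le> m then w m else 0)" .
  qed
  also have "\<dots> = (\<Sum>m<2*n. \<Sum>j<n. if j \<le> m then w m else 0)" by (rule sum.swap)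
  also have "\<dots> \<le> (\<Sum>m<2*n. (real m + 1) * w m)"
  proof (rule sum_mono)
    fix m
    have "(\<Sum>j<n. if j \<le> m then w m else 0) = (\<Sum>j\<in>{..<n} \<inter> {j. j \<le> m}. w m)"
      by (simp add: sum.If_cases)
    also have "\<dots> = real (card ({..<n} \<inter> {j. j \<le> m})) * w m" by simp
    also have "card ({..<n} \<inter> {j. j \<le> m}) \<le> card {..m}" by (intro card_mono) auto
    then have "real (card ({..<n} \<inter> {j. j \<le> m})) * w m \<le> (real m + 1) * w m"
      using assms by (intro mult_right_mono) auto
    finally show "(\<Sum>j<n. if j \<le> m then w m else 0) \<le> (real m + 1) * w m" .
  qed
  finally show ?thesis .
qed

text \<open>In the integral comparisons below \<open>L\<close> is a logarithm, so that a negative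
  power of it divided by a linear function gets an explicit primitive.\<close>

lemma deriv_powr_primitive:
  fixes b :: real
  assumes "b > 1" "L x > 0" "(L has_real_derivative d) (at x)"
  shows "((\<lambda>x. L x powr (1 - b) / (b - 1)) has_real_derivative - (L x powr (- b)) * d) (at x)"
proof -
  have "((\<lambda>x. L x powr (1 - b)) has_real_derivative (1 - b) * L x powr (1 - b - 1) * d) (at x)"
    by (rule DERIV_chain2[OF has_real_derivative_powr]) (use assms in auto)
  then have "((\<lambda>x. L x powr (1 - b) / (b - 1)) has_real_derivative (1 - b) * L x powr (1 - b
      - 1) * d / (b - 1)) (at x)"
    by (rule DERIV_cdivide)
  moreover have "(1 - b) * L x powr (1 - b - 1) * d / (b - 1) = - (L x powr (- b)) * d"
    using assms by (simp add: field_simps)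
  ultimately show ?thesis by simp
qed

text \<open>Comparison with the integral of \<open>1 / (x * ln (N / x) powr b)\<close>, term by term
  through the mean value theorem. The factor 2 is \<open>z \<le> 2 * m\<close> for \<open>z\<close>
  between \<open>m\<close> and \<open>m + 1\<close>. Staying below \<open>N / 2\<close> avoids the
  singularity at \<open>N\<close> and makes the bound free of \<open>N\<close>.\<close>

lemma sum_inverse_log_inner:
  assumes b: "b > 1" and N: "real K + 1 \<le> real N / 2" and K: "\<And>m. m \<in> A \<Longrightarrow> 1 \<le> m \<and> m \<le> K" 
  shows "(\<Sum>m\<in>A. ln (real N / real m) powr (- b) / real m) \<le> 2 * ln 2 powr (1 - b) / (b - 1)"
proof -
  have N0: "real N > 0" using N by linarith
  define \<phi> where "\<phi> x = ln (real N / x) powr (1 - b) / (b - 1)" for x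
  have step: "ln (real N / real m) powr (- b) / real m \<le> 2 * (\<phi> (real m + 1) - \<phi> (real m))"
      if m: "1 \<le> m" "m \<le> K" for m
  proof -
    have "\<exists>z::real. real m < z \<and> z < real m + 1 \<and> \<phi> (real m + 1) - \<phi> (real m)
        = (real m + 1 - real m) * (ln (real N / z) powr (- b) / z)"
    proof (rule MVT2)
      fix x assume x: "real m \<le> x" "x \<le> real m + 1"
      then have x0: "x > 0" "x < real N" using m N by linarith+
      then have "real N / x > 1" by simp
      then have l: "ln (real N / x) > 0" by simp
      have d: "((\<lambda>x. ln (real N / x)) has_real_derivative - (1 / x)) (at x)"
        using x0 N0 by (auto intro!: derivative_eq_intros simp: power2_eq_square field_simps)
      show "(\<phi> has_real_derivative ln (real N / x) powr (- b) / x) (at x)"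
        unfolding \<phi>_def using deriv_powr_primitive[OF b _ d] l by simp
    qed simp
    then obtain z where z: "real m < z" "z < real m + 1" "\<phi> (real m + 1) - \<phi> (real m)
        = ln (real N / z) powr (- b) / z" by auto
    have zN: "z < real N" using z m N by linarith
    have "real N / z > 1" "real N / z \<le> real N / real m"
      using z zN m N0 by (auto simp: frac_le)
    then have "0 < ln (real N / z)" "ln (real N / z) \<le> ln (real N / real m)" by auto
    then have "ln (real N / real m) powr (- b) \<le> ln (real N / z) powr (- b)"
      using b by (intro powr_mono2') auto
    moreover have "1 / real m \<le> 2 / z" using z m by (simp add: field_simps)
    ultimately have "ln (real N / real m) powr (- b) * (1 / real m) \<le> ln (real N / z) powr (- b) * (2 /
        z)"
      using m by (intro mult_mono) auto
    then show ?thesis unfolding z(3) by (simp add: mult_ac)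
  qed
  have "(\<Sum>m\<in>A. ln (real N / real m) powr (- b) / real m) \<le> (\<Sum>m=1..K. ln (real N / real m) powr (- b) /
      real m)"
    using K by (intro sum_mono2) (auto intro!: divide_nonneg_nonneg)
  also have "\<dots> \<le> (\<Sum>m=1..K. 2 * (\<phi> (real m + 1) - \<phi> (real m)))"
    using step by (intro sum_mono) auto
  also have "\<dots> = 2 * (\<Sum>m=1..K. (\<phi> (real (Suc m)) - \<phi> (real m)))"
    unfolding sum_distrib_left by (simp add: add.commute)
  also have "\<dots> = 2 * (\<phi> (real (Suc K)) - \<phi> 1)"
    by (subst sum_Suc_diff) auto
  also have "\<dots> \<le> 2 * \<phi> (real K + 1)" using b by (simp add: \<phi>_def add.commute)
  also have "\<phi> (real K + 1) \<le> ln 2 powr (1 - b) / (b - 1)"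
  proof -
    have "2 \<le> real N / (real K + 1)" using N by (simp add: field_simps)
    then have "ln 2 \<le> ln (real N / (real K + 1))" by simp
    then show ?thesis unfolding \<phi>_def using b by (intro divide_right_mono powr_mono2') auto
  qed
  finally show ?thesis by simp
qed

text \<open>The same comparison beyond \<open>N\<close>, where the logarithmic factor decreases, so
  each term is compared with the unit interval before \<open>m\<close>. The derivative of
  \<open>ln (z / N + 2)\<close> is \<open>1 / (z + 2 * N)\<close>, and
  \<open>z + 2 * N \<le> 3 * m\<close> gives the factor 3.\<close>

lemma sum_inverse_log_outer:
  assumes b: "b > 1" and N: "N \<ge> 1" and A: "finite A" "\<And>m. m \<in> A \<Longrightarrow> N \<le> m" 
  shows "(\<Sum>m\<in>A. ln (real m / real N + 2) powr (- b) / real m) \<le> 3 * ln 2 powr (1 - b) / (b - 1)"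
proof -
  define \<phi> where "\<phi> x = - (ln (x / real N + 2) powr (1 - b)) / (b - 1)" for x
  have step: "ln (real m / real N + 2) powr (- b) / real m \<le> 3 * (\<phi> (real m) - \<phi> (real m - 1))"
      if m: "N \<le> m" for m
  proof -
    have "\<exists>z::real. real m - 1 < z \<and> z < real m \<and> \<phi> (real m) - \<phi> (real m - 1) = (real m - (real m
        - 1)) * (ln (z / real N + 2) powr (- b) / (z + 2 * real N))"
    proof (rule MVT2)
      fix x assume x: "real m - 1 \<le> x" "x \<le> real m"
      then have x0: "x \<ge> 0" using m N by linarith
      then have p: "x / real N + 2 > 1" by (smt (verit) divide_nonneg_nonneg of_nat_0_le_iff)
      then have l: "ln (x / real N + 2) > 0" by simp
      have "((\<lambda>x. ln (x / real N + 2)) has_real_derivative (1 / (x / real N + 2)) * (1 / real N)) (at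
          x)"
        using p N by (auto intro!: derivative_eq_intros)
      moreover have "(1 / (x / real N + 2)) * (1 / real N) = 1 / (x + 2 * real N)" using N
          by (simp add: field_simps)
      ultimately have d: "((\<lambda>x. ln (x / real N + 2)) has_real_derivative 1 / (x + 2 * real N)) (at x)"
          by simp
      show "(\<phi> has_real_derivative ln (x / real N + 2) powr (- b) / (x + 2 * real N)) (at x)"
        unfolding \<phi>_def minus_divide_left[symmetric]
        using DERIV_minus[OF deriv_powr_primitive[OF b _ d]] l by simp
    qed simp
    then obtain z where z: "real m - 1 < z" "z < real m" "\<phi> (real m) - \<phi> (real m - 1) = ln (z / real N
        + 2) powr (- b) / (z + 2 * real N)" by auto
    have z0: "z \<ge> 0" using z m N by linarith
    have "z / real N \<le> real m / real N" using z by (intro divide_right_mono) auto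
    moreover have "z / real N \<ge> 0" using z0 by simp
    ultimately have "0 < ln (z / real N + 2)" "ln (z / real N + 2) \<le> ln (real m / real N + 2)" by auto
    then have "ln (real m / real N + 2) powr (- b) \<le> ln (z / real N + 2) powr (- b)"
      using b by (intro powr_mono2') auto
    moreover have "z + 2 * real N \<le> 3 * real m" using z m by linarith
    then have "1 / real m \<le> 3 / (z + 2 * real N)" using z0 m N by (simp add: field_simps)
    ultimately have "ln (real m / real N + 2) powr (- b) * (1 / real m) \<le> ln (z / real N + 2) powr (- b)
        * (3 / (z + 2 * real N))"
      by (intro mult_mono) auto
    then show ?thesis unfolding z(3) by (simp add: mult_ac)
  qed
  define K where "K = Max (insert N A)"
  have K: "\<And>m. m \<in> A \<Longrightarrow> m \<le> K" "N \<le> K" using A by (auto simp: K_def)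
  have "(\<Sum>m\<in>A. ln (real m / real N + 2) powr (- b) / real m) \<le> (\<Sum>m=N..K. ln (real m / real N
      + 2) powr (- b) / real m)"
    using K A by (intro sum_mono2) (auto intro!: divide_nonneg_nonneg)
  also have "\<dots> \<le> (\<Sum>m=N..K. 3 * (\<phi> (real m) - \<phi> (real m - 1)))"
    using step by (intro sum_mono) auto
  also have "\<dots> = 3 * (\<Sum>m=N..K. (\<phi> (real (Suc m) - 1) - \<phi> (real m - 1)))"
    unfolding sum_distrib_left by simp
  also have "\<dots> = 3 * (\<phi> (real (Suc K) - 1) - \<phi> (real N - 1))"
    using K by (subst sum_Suc_diff[where f="\<lambda>m. \<phi> (real m - 1)"]) auto
  also have "\<dots> \<le> 3 * (- \<phi> (real N - 1))"
  proof -
    have "\<phi> (real K) \<le> 0" using b by (simp add: \<phi>_def)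
    then show ?thesis by simp
  qed
  also have "- \<phi> (real N - 1) \<le> ln 2 powr (1 - b) / (b - 1)"
  proof -
    have "0 \<le> (real N - 1) / real N" using N by simp
    then have "ln 2 \<le> ln ((real N - 1) / real N + 2)" by simp
    then have "ln ((real N - 1) / real N + 2) powr (1 - b) \<le> ln 2 powr (1 - b)" using b
        by (intro powr_mono2') auto
    then show ?thesis unfolding \<phi>_def using b by (simp add: divide_right_mono)
  qed
  finally show ?thesis by simp
qed

text \<open>Three ranges of \<open>m = j + k\<close>: (B) up to \<open>\<epsilon> * N\<close>, mere
  boundedness from there to \<open>N\<close>, where at most \<open>N\<close> terms
  \<open>1 / m\<close> have order \<open>1 / N\<close> each, and (C) beyond. Squaring turns the
  exponents into \<open>2 * \<beta>\<close> and \<open>2 * \<alpha>\<close>, both above 1.\<close>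

lemma multiplier_cutoff_error:
  assumes B: "cond_B \<tau>" and C: "cond_C \<tau>"
  shows "\<exists>c N0. \<forall>N\<ge>N0. \<forall>n. (\<Sum>j<n. \<Sum>k<n. if j + k = 0 then 0 else
    ((cmod (tau_N \<tau> N j k - (if j + k < N then 1 else 0)) / real (j + k))\<^sup>2)) \<le> c"
proof -
  obtain \<epsilon>0 \<beta> Cb where Bb: "\<epsilon>0 > 0" "\<beta> > 1/2" "Cb > 0"
    "\<And>x y. 0 \<le> x \<Longrightarrow> x \<le> \<epsilon>0 \<Longrightarrow> 0 \<le> y \<Longrightarrow> y \<le> \<epsilon>0 \<Longrightarrow> x + y \<noteq> 1 \<Longrightarrow> cmod (\<tau> x y - 1)
        \<le> Cb * \<bar>ln (x + y)\<bar> powr (- \<beta>)"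
    using B unfolding cond_B_def by blast
  obtain \<alpha> Ca0 where Cc0: "\<alpha> > 1/2" "\<And>x y. 0 \<le> x \<Longrightarrow> 0 \<le> y \<Longrightarrow> cmod (\<tau> x y) \<le> Ca0 * ln (x + y
      + 2) powr (- \<alpha>)"
    using C unfolding cond_C_def by blast
  \<comment> \<open>Condition (C) does not say that its constant is nonnegative.\<close>
  define Ca where "Ca = max Ca0 0"
  have Cc: "cmod (\<tau> x y) \<le> Ca * ln (x + y + 2) powr (- \<alpha>)" if "0 \<le> x" "0 \<le> y" for x y
  proof -
    have "Ca0 * ln (x + y + 2) powr (- \<alpha>) \<le> Ca * ln (x + y + 2) powr (- \<alpha>)"
      by (intro mult_right_mono) (auto simp: Ca_def)
    with Cc0(2)[OF that] show ?thesis by linarith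
  qed
  have Ca0': "Ca \<ge> 0" by (simp add: Ca_def)
  \<comment> \<open>At most 1/4: then \<open>x + y \<le> \<epsilon>\<close> excludes the exceptional
    value 1, makes the logarithm negative and leaves the summation range below
    \<open>N / 2\<close>.\<close>
  define \<epsilon> where "\<epsilon> = min \<epsilon>0 (1/4)"
  have e: "0 < \<epsilon>" "\<epsilon> \<le> \<epsilon>0" "\<epsilon> \<le> 1/4" using Bb by (auto simp: \<epsilon>_def)
  define D where "D = Ca * ln 2 powr (- \<alpha>) + 1"
  have D: "cmod (\<tau> x y - 1) \<le> D" if "0 \<le> x" "0 \<le> y" for x y
  proof -
    have "ln (x + y + 2) powr (- \<alpha>) \<le> ln 2 powr (- \<alpha>)" using that Cc0 by (intro powr_mono2') auto
    then have "Ca * ln (x + y + 2) powr (- \<alpha>) \<le> Ca * ln 2 powr (- \<alpha>)" using Ca0'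
        by (intro mult_left_mono) auto
    then have "cmod (\<tau> x y) \<le> Ca * ln 2 powr (- \<alpha>)" using Cc[OF that] by linarith
    then show ?thesis unfolding D_def using norm_triangle_ineq4[of "\<tau> x y" 1] by simp
  qed
  \<comment> \<open>Ensures \<open>N > 4\<close>, the room for the extra 1 in
    \<open>K + 1 \<le> N / 2\<close> below.\<close>
  obtain N1 :: nat where N1: "real N1 > 4 / \<epsilon>" using reals_Archimedean2 by blast
  define c where "c = 2 * (Cb\<^sup>2 * (2 * ln 2 powr (1 - 2 * \<beta>) / (2 * \<beta> - 1)) + D\<^sup>2 * (1 / \<epsilon>)
      + Ca\<^sup>2 * (3 * ln 2 powr (1 - 2 * \<alpha>) / (2 * \<alpha> - 1)))"
  show ?thesis
  proof (intro exI[of _ c] exI[of _ "max N1 1"] allI impI)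
    fix N n assume N: "max N1 1 \<le> N"
    then have N: "N \<ge> 1" "real N > 4 / \<epsilon>" using N1 by auto
    define w where "w m = (if m = 0 then 0 else if real m \<le> \<epsilon> * real N then (Cb * ln (real N / real m)
        powr (- \<beta>) / real m)\<^sup>2
      else if m < N then (D / real m)\<^sup>2 else (Ca * ln (real m / real N + 2) powr (- \<alpha>) / real m)\<^sup>2)" for m
    have "(\<Sum>j<n. \<Sum>k<n. if j + k = 0 then 0 else
      ((cmod (tau_N \<tau> N j k - (if j + k < N then 1 else 0)) / real (j + k))\<^sup>2)) \<le> (\<Sum>j<n. \<Sum>k<n. w (j
          + k))"
    proof (intro sum_mono)
      fix j k
      define x y where "x = real j / real N" and "y = real k / real N"
      have xy: "x \<ge> 0" "y \<ge> 0" "x + y = real (j + k) / real N"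
          by (auto simp: x_def y_def add_divide_distrib)
      have t: "tau_N \<tau> N j k = \<tau> x y" by (simp add: tau_N_def x_def y_def)
      show "(if j + k = 0 then 0 else ((cmod (tau_N \<tau> N j k - (if j + k < N then 1 else 0)) / real (j
          + k))\<^sup>2)) \<le> w (j + k)"
      proof (cases "j + k = 0")
        case False
        then have jk: "real (j + k) > 0" by (simp only: of_nat_0_less_iff neq0_conv)
        show ?thesis
        proof (cases "real (j + k) \<le> \<epsilon> * real N")
          case True
          then have s: "x + y \<le> \<epsilon>" unfolding xy using N by (simp add: field_simps)
          have "x + y > 0" unfolding xy using jk N by (intro divide_pos_pos) auto
          then have "ln (x + y) < 0" using s e by simp
          then have l: "\<bar>ln (x + y)\<bar> = ln (real N / real (j + k))"
            unfolding xy using jk N by (simp add: ln_div)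
          have "cmod (\<tau> x y - 1) \<le> Cb * \<bar>ln (x + y)\<bar> powr (- \<beta>)"
            using s e xy by (intro Bb) auto
          then have "cmod (\<tau> x y - 1) / real (j + k) \<le> Cb * ln (real N / real (j + k)) powr (- \<beta>) / real
              (j + k)"
            unfolding l by (intro divide_right_mono) auto
          moreover have "real (j + k) < real N"
          proof -
            have "\<epsilon> * real N < 1 * real N" using e N by (intro mult_strict_right_mono) auto
            then show ?thesis using True by linarith
          qed
          ultimately show ?thesis using True False t unfolding w_def
            by (auto intro!: power_mono simp del: of_nat_add)
        next
          case F: False
          show ?thesis
          proof (cases "j + k < N")
            case True
            then show ?thesis using False F t D[OF xy(1,2)] unfolding w_def
              by (auto intro!: power_mono divide_right_mono simp del: of_nat_add)
          next
            case False
            have "cmod (\<tau> x y) \<le> Ca * ln (real (j + k) / real N + 2) powr (- \<alpha>)"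
              using Cc[OF xy(1,2)] unfolding xy .
            then show ?thesis using False F t jk unfolding w_def
              by (auto intro!: power_mono divide_right_mono simp del: of_nat_add)
          qed
        qed
      qed (simp add: w_def)
    qed
    also have "\<dots> \<le> (\<Sum>m<2*n. (real m + 1) * w m)" by (rule sum_antidiagonal_le) (simp add: w_def)
    also have "\<dots> \<le> (\<Sum>m<2*n. 2 * (real m * w m))"
    proof (rule sum_mono)
      fix m
      show "(real m + 1) * w m \<le> 2 * (real m * w m)"
      proof (cases "m = 0")
        case False
        then have "(real m + 1) * w m \<le> (2 * real m) * w m" by (intro mult_right_mono) (auto simp:
            w_def)
        then show ?thesis by simp
      qed (simp add: w_def)
    qed
    also have "\<dots> = 2 * (\<Sum>m<2*n. real m * w m)" by (simp add: sum_distrib_left)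
    also have "(\<Sum>m<2*n. real m * w m) \<le> Cb\<^sup>2 * (2 * ln 2 powr (1 - 2 * \<beta>) / (2 * \<beta> - 1)) + D\<^sup>2 * (1 / \<epsilon>)
        + Ca\<^sup>2 * (3 * ln 2 powr (1 - 2 * \<alpha>) / (2 * \<alpha> - 1))"
    proof -
      define A1 where "A1 = {m. m < 2 * n \<and> m \<noteq> 0 \<and> real m \<le> \<epsilon> * real N}"
      define A2 where "A2 = {m. m < 2 * n \<and> \<not> real m \<le> \<epsilon> * real N \<and> m < N}"
      define A3 where "A3 = {m. m < 2 * n \<and> \<not> real m \<le> \<epsilon> * real N \<and> N \<le> m}"
      have fin: "finite A1" "finite A2" "finite A3" by (auto simp: A1_def A2_def A3_def)
      have "(\<Sum>m<2*n. real m * w m) = (\<Sum>m\<in>A1 \<union> A2 \<union> A3. real m * w m)"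
        by (rule sum.mono_neutral_right) (auto simp: A1_def A2_def A3_def)
      also have "\<dots> = (\<Sum>m\<in>A1. real m * w m) + (\<Sum>m\<in>A2. real m * w m) + (\<Sum>m\<in>A3. real m * w m)"
        using fin by (subst sum.union_disjoint; (subst sum.union_disjoint)?) (auto simp: A1_def A2_def
            A3_def)
      also have "(\<Sum>m\<in>A1. real m * w m) = (\<Sum>m\<in>A1. Cb\<^sup>2 * (ln (real N / real m) powr (- (2 * \<beta>)) / real
          m))"
        by (intro sum.cong) (auto simp: A1_def w_def power_divide power_mult_distrib powr_power
            power2_eq_square simp flip: powr_add)
      also have "\<dots> \<le> Cb\<^sup>2 * (2 * ln 2 powr (1 - 2 * \<beta>) / (2 * \<beta> - 1))"
      proof -
        define K where "K = nat \<lfloor>\<epsilon> * real N\<rfloor>"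
        have "real K \<le> \<epsilon> * real N" using e N by (simp add: K_def)
        also have "\<dots> \<le> 1/4 * real N" using e by (intro mult_right_mono) auto
        finally have "real K \<le> real N / 4" by simp
        moreover have "4 / \<epsilon> \<ge> 4" using e by (simp add: field_simps)
        ultimately have "real K + 1 \<le> real N / 2" using N by linarith
        moreover have "1 \<le> m \<and> m \<le> K" if "m \<in> A1" for m
          using that by (auto simp: A1_def K_def le_nat_floor)
        ultimately show ?thesis
          unfolding sum_distrib_left[symmetric] using Bb
              by (intro mult_left_mono sum_inverse_log_inner[of "2 * \<beta>" K]) auto
      qed
      also have "(\<Sum>m\<in>A2. real m * w m) \<le> (\<Sum>m\<in>A2. D\<^sup>2 * (1 / (\<epsilon> * real N)))"
      proof (rule sum_mono)
        fix m assume m: "m \<in> A2"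
        have "0 < \<epsilon> * real N" using e N by simp
        then have "m \<noteq> 0" using m by (auto simp: A2_def)
        then have "real m * w m = D\<^sup>2 * (1 / real m)" using m by (simp add: w_def A2_def power_divide
            power2_eq_square)
        also have "\<dots> \<le> D\<^sup>2 * (1 / (\<epsilon> * real N))"
          using m e N \<open>m \<noteq> 0\<close> by (intro mult_left_mono divide_left_mono mult_pos_pos) (auto simp:
              A2_def)
        finally show "real m * w m \<le> D\<^sup>2 * (1 / (\<epsilon> * real N))" .
      qed
      also have "\<dots> = real (card A2) * (D\<^sup>2 * (1 / (\<epsilon> * real N)))" by simp
      also have "\<dots> \<le> real N * (D\<^sup>2 * (1 / (\<epsilon> * real N)))"
      proof -
        have "card A2 \<le> card {..<N}" by (intro card_mono) (auto simp: A2_def)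
        then show ?thesis using e by (intro mult_right_mono) auto
      qed
      also have "\<dots> = D\<^sup>2 * (1 / \<epsilon>)" using N by simp
      also have "(\<Sum>m\<in>A3. real m * w m) = (\<Sum>m\<in>A3. Ca\<^sup>2 * (ln (real m / real N + 2) powr (- (2 * \<alpha>)) / real
          m))"
        using N by (intro sum.cong) (auto simp: A3_def w_def power_divide power_mult_distrib
            power2_eq_square simp flip: powr_add)
      also have "\<dots> \<le> Ca\<^sup>2 * (3 * ln 2 powr (1 - 2 * \<alpha>) / (2 * \<alpha> - 1))"
        unfolding sum_distrib_left[symmetric] using Cc0 N fin
            by (intro mult_left_mono sum_inverse_log_outer) (auto simp: A3_def)
      finally show ?thesis by simp
    qed
    finally show "(\<Sum>j<n. \<Sum>k<n. if j + k = 0 then 0 else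
      ((cmod (tau_N \<tau> N j k - (if j + k < N then 1 else 0)) / real (j + k))\<^sup>2)) \<le> c"
      by (simp add: c_def)
  qed
qed

section \<open>The block circulant model of the Carleman matrix\<close>

text \<open>The block \<open>blk h i\<close> consists of the \<open>j\<close> with \<open>h i \<le> ln j < h (i + 1)\<close>; runs of \<open>2 L + 1\<close> consecutive
  blocks are closed up to a cycle. On the product of blocks \<open>i\<close> and \<open>l\<close> the kernel \<open>1/(j + k)\<close> is
  about \<open>sech_coeff h \<bar>i - l\<bar>\<close> divided by the geometric mean of the two block lengths.\<close>

definition blk_idx :: "real \<Rightarrow> nat \<Rightarrow> nat" where
  "blk_idx h j = nat \<lfloor>ln (real j) / h\<rfloor>"

definition blk :: "real \<Rightarrow> nat \<Rightarrow> nat set" where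
  "blk h i = {j. j \<ge> 1 \<and> blk_idx h j = i}"

definition sech_coeff :: "real \<Rightarrow> nat \<Rightarrow> real" where
  "sech_coeff h r = (exp h - 1) / (2 * cosh (h * real r / 2))"

definition circulant :: "real \<Rightarrow> nat \<Rightarrow> nat \<Rightarrow> nat \<Rightarrow> real" where
  "circulant h L i l = (let r = (if i \<le> l then l - i else i - l) in sech_coeff h (if r
      \<le> L then r else 2 * L + 1 - r))"

text \<open>Cycles outside \<open>b0..<b1\<close> are dropped: early blocks are so short that
  rounding spoils their length, and late ones reach the cutoff \<open>j + k < N\<close>.\<close>

definition model :: "real \<Rightarrow> nat \<Rightarrow> nat \<Rightarrow> nat \<Rightarrow> nat \<Rightarrow> nat \<Rightarrow> real" where
  "model h L b0 b1 j k = (let i = blk_idx h j; l = blk_idx h k in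
     if 1 \<le> j \<and> 1 \<le> k \<and> i div (2 * L + 1) = l div (2 * L + 1) \<and> b0 \<le> i div (2 * L + 1)
         \<and> i div (2 * L + 1) < b1
     then circulant h L i l / sqrt (real (card (blk h i)) * real (card (blk h l))) else 0)"

lemma blk_idx_bounds:
  assumes "h > 0" "j \<ge> 1"
  shows "exp (h * real (blk_idx h j)) \<le> real j" "real j < exp (h * (real (blk_idx h j) + 1))"
proof -
  have l: "ln (real j) / h \<ge> 0" using assms by simp
  have f: "real (blk_idx h j) = of_int \<lfloor>ln (real j) / h\<rfloor>"
    unfolding blk_idx_def using l by (simp add: of_nat_nat)
  have "real (blk_idx h j) \<le> ln (real j) / h" "ln (real j) / h < real (blk_idx h j) + 1"
    unfolding f by linarith+
  then have "h * real (blk_idx h j) \<le> ln (real j)" "ln (real j) < h * (real (blk_idx h j) + 1)"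
    using assms by (simp_all add: field_simps)
  then have "exp (h * real (blk_idx h j)) \<le> exp (ln (real j))" "exp (ln (real j))
      < exp (h * (real (blk_idx h j) + 1))"
    by simp_all
  then show "exp (h * real (blk_idx h j)) \<le> real j" "real j < exp (h * (real (blk_idx h j) + 1))"
    using assms by simp_all
qed

lemma blk_idx_ge_iff:
  assumes "h > 0" "j \<ge> 1"
  shows "i \<le> blk_idx h j \<longleftrightarrow> exp (h * real i) \<le> real j"
proof
  assume "i \<le> blk_idx h j"
  then have "exp (h * real i) \<le> exp (h * real (blk_idx h j))" using assms by simp
  then show "exp (h * real i) \<le> real j" using blk_idx_bounds(1)[OF assms] by linarith
next
  assume a: "exp (h * real i) \<le> real j"
  show "i \<le> blk_idx h j"
  proof (rule ccontr)
    assume "\<not> i \<le> blk_idx h j"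
    then have "real (blk_idx h j) + 1 \<le> real i" by linarith
    then have "exp (h * (real (blk_idx h j) + 1)) \<le> exp (h * real i)" using assms by simp
    then show False using a blk_idx_bounds(2)[OF assms] by linarith
  qed
qed

text \<open>Blocks are intervals of integers; sums of oscillating modes are controlled over such
  intervals.\<close>

lemma blk_eq:
  assumes "h > 0"
  shows "blk h i = {nat \<lceil>exp (h * real i)\<rceil>..<nat \<lceil>exp (h * real (Suc i))\<rceil>}"
proof (intro set_eqI)
  fix j
  have "1 \<le> exp (h * real i)" using assms by simp
  then have "(nat \<lceil>exp (h * real i)\<rceil> \<le> j) \<longleftrightarrow> exp (h * real i) \<le> real j" "exp (h * real i) \<le> real j \<Longrightarrow> 1
      \<le> j"
    by (linarith, linarith)
  moreover have "(j < nat \<lceil>exp (h * real (Suc i))\<rceil>) \<longleftrightarrow> \<not> exp (h * real (Suc i)) \<le> real j"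
    by linarith
  ultimately show "j \<in> blk h i \<longleftrightarrow> j \<in> {nat \<lceil>exp (h * real i)\<rceil>..<nat \<lceil>exp (h * real (Suc i))\<rceil>}"
    unfolding blk_def atLeastLessThan_iff mem_Collect_eq
    using blk_idx_ge_iff[OF assms, of j i] blk_idx_ge_iff[OF assms, of j "Suc i"]
        by (auto simp del: of_nat_Suc)
qed

lemma finite_blk: "h > 0 \<Longrightarrow> finite (blk h i)"
  by (simp add: blk_eq)

lemma card_blk:
  assumes "h > 0"
  shows "\<bar>real (card (blk h i)) - (exp h - 1) * exp (h * real i)\<bar> \<le> 1"
proof -
  have "exp (h * real (Suc i)) = exp h * exp (h * real i)" by (simp add: algebra_simps flip: exp_add)
  then have e: "(exp h - 1) * exp (h * real i) = exp (h * real (Suc i)) - exp (h * real i)"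
      by (simp add: algebra_simps)
  have le: "exp (h * real i) \<le> exp (h * real (Suc i))" using assms by simp
  have p: "exp (h * real i) > 0" by simp
  have diff: "real (nat \<lceil>b\<rceil> - nat \<lceil>a\<rceil>) = of_int \<lceil>b\<rceil> - of_int \<lceil>a\<rceil>" if "a \<le> b" "0 < a" for a b :: real
    using ceiling_mono[OF that(1)] that(2) by linarith
  have "real (card (blk h i)) = of_int \<lceil>exp (h * real (Suc i))\<rceil> - of_int \<lceil>exp (h * real i)\<rceil>"
    unfolding blk_eq[OF assms] card_atLeastLessThan by (rule diff[OF le p])
  then show ?thesis unfolding e by linarith
qed

text \<open>The underlying real interval has length at least
  \<open>h * (2 / h\<^sup>2) = 2 / h\<close>, so rounding by 1 is a relative change of order
  \<open>h\<close>.\<close>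

lemma card_blk_ratio:
  assumes h: "0 < h" "h \<le> 1" and i: "2 / h\<^sup>2 \<le> exp (h * real i)"
  shows "card (blk h i) > 0" "1 - h \<le> (exp h - 1) * exp (h * real i) / real (card (blk h i))"
    "(exp h - 1) * exp (h * real i) / real (card (blk h i)) \<le> 1 + h"
proof -
  define \<nu> where "\<nu> = (exp h - 1) * exp (h * real i)"
  have "h \<le> exp h - 1" using exp_ge_add_one_self[of h] by linarith
  then have "h * (2 / h\<^sup>2) \<le> \<nu>" unfolding \<nu>_def
    using h i by (intro mult_mono) auto
  moreover have "h * (2 / h\<^sup>2) = 2 / h" using h by (simp add: power2_eq_square)
  ultimately have v: "2 / h \<le> \<nu>" by simp
  then have v2: "2 \<le> h * \<nu>" using h by (simp add: field_simps)
  have "2 / h \<ge> 2" using h by (simp add: field_simps)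
  then have v3: "\<nu> \<ge> 2" using v by linarith
  define n where "n = real (card (blk h i))"
  have n: "\<nu> - 1 \<le> n" "n \<le> \<nu> + 1" using card_blk[OF h(1), of i] unfolding n_def \<nu>_def by linarith+
  then have n0: "n > 0" using v3 by linarith
  then show "card (blk h i) > 0" by (simp add: n_def)
  have "(1 - h) * n \<le> (1 - h) * (\<nu> + 1)" using n h by (intro mult_left_mono) auto
  also have "\<dots> \<le> \<nu>" using v2 h by (simp add: algebra_simps)
  finally show "1 - h \<le> (exp h - 1) * exp (h * real i) / real (card (blk h i))"
    using n0 unfolding n_def[symmetric] \<nu>_def[symmetric] by (simp add: field_simps)
  have "\<nu> \<le> (1 + h) * (\<nu> - 1)" using v2 h by (simp add: algebra_simps)
  also have "\<dots> \<le> (1 + h) * n" using n h by (intro mult_left_mono) auto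
  finally show "(exp h - 1) * exp (h * real i) / real (card (blk h i)) \<le> 1 + h"
    using n0 unfolding n_def[symmetric] \<nu>_def[symmetric] by (simp add: field_simps)
qed

lemma sech_coeff_le: "sech_coeff h r \<le> (exp h - 1) * exp (- (h * real r / 2))" if "h \<ge> 0"
proof -
  let ?u = "h * real r / 2"
  have "exp ?u \<le> 2 * cosh ?u" by (simp add: cosh_def)
  then have "1 / (2 * cosh ?u) \<le> 1 / exp ?u" by (intro divide_left_mono) auto
  then have "(exp h - 1) * (1 / (2 * cosh ?u)) \<le> (exp h - 1) * (1 / exp ?u)" using that
      by (intro mult_left_mono) auto
  moreover have "1 / exp ?u = exp (- ?u)" by (simp add: exp_minus inverse_eq_divide)
  ultimately show ?thesis by (simp only: sech_coeff_def times_divide_eq_right mult_1_right)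
qed

lemma sech_coeff_nonneg: "h \<ge> 0 \<Longrightarrow> sech_coeff h r \<ge> 0"
  by (auto simp: sech_coeff_def intro!: divide_nonneg_pos)

lemma sech_coeff_antimono: "h \<ge> 0 \<Longrightarrow> r \<le> r' \<Longrightarrow> sech_coeff h r' \<le> sech_coeff h r"
proof -
  assume h: "h \<ge> 0" "r \<le> r'"
  then have "h * real r / 2 \<le> h * real r' / 2" by (intro divide_right_mono mult_left_mono) auto
  then have "cosh (h * real r / 2) \<le> cosh (h * real r' / 2)"
    using h by (subst cosh_real_nonneg_le_iff) auto
  then show ?thesis unfolding sech_coeff_def using h by (intro divide_left_mono) auto
qed

text \<open>\<open>sqrt (a * b) / (a + b)\<close> is
  \<open>1 / (2 * cosh ((ln a - ln b) / 2))\<close>: in logarithmic coordinates the homogeneous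
  kernel becomes convolution with a hyperbolic secant.\<close>

lemma sech_coeff_eq:
  fixes i l :: nat
  defines "r \<equiv> (if i \<le> l then l - i else i - l)"
  assumes that: "h > 0"
  shows "sech_coeff h r = sqrt (((exp h - 1) * exp (h * real i)) * ((exp h - 1) * exp (h * real l))) /
      (exp (h * real i) + exp (h * real l))"
proof -
  let ?a = "exp (h * real i / 2)" and ?b = "exp (h * real l / 2)"
  have e: "exp (h * real i) = ?a * ?a" "exp (h * real l) = ?b * ?b" by (simp_all flip: exp_add)
  have s: "sqrt (((exp h - 1) * exp (h * real i)) * ((exp h - 1) * exp (h * real l)))
      = (exp h - 1) * (?a * ?b)"
    unfolding e using that by (intro real_sqrt_unique) (auto simp: power2_eq_square)
  have c: "2 * cosh (h * real r / 2) = ?a / ?b + ?b / ?a"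
  proof -
    have "2 * cosh (h * (real i - real l) / 2) = ?a / ?b + ?b / ?a"
      by (simp add: cosh_def diff_divide_distrib right_diff_distrib flip: exp_diff)
    moreover have "cosh (h * real r / 2) = cosh (h * (real i - real l) / 2)"
    proof (cases "i \<le> l")
      case True
      then have "h * (real i - real l) / 2 = - (h * real r / 2)"
          by (simp add: r_def of_nat_diff field_simps)
      then show ?thesis by (simp only: cosh_minus)
    qed (simp add: r_def of_nat_diff)
    ultimately show ?thesis by (simp only:)
  qed
  have "?a / ?b + ?b / ?a = (?a * ?a + ?b * ?b) / (?a * ?b)" by (simp add: field_simps)
  then show ?thesis unfolding s unfolding sech_coeff_def c e by simp
qed

section \<open>Elementary sums for the error of the model\<close>

lemma sum_blk_weights_le:
  assumes h: "h > 0" and A: "finite A" "\<And>j. j \<in> A \<Longrightarrow> 1 \<le> j \<and> blk_idx h j \<in> I" and I: "finite I"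
    and f: "\<And>i. f i \<ge> 0"
  shows "(\<Sum>j\<in>A. f (blk_idx h j) / real (card (blk h (blk_idx h j)))) \<le> sum f I"
proof -
  have "(\<Sum>j\<in>A. f (blk_idx h j) / real (card (blk h (blk_idx h j)))) =
      (\<Sum>i\<in>I. \<Sum>j\<in>{j\<in>A. blk_idx h j = i}. f (blk_idx h j) / real (card (blk h (blk_idx h j))))"
    using A I by (intro sum.group[symmetric]) auto
  also have "\<dots> \<le> sum f I"
  proof (rule sum_mono)
    fix i
    let ?S = "{j\<in>A. blk_idx h j = i}"
    have "(\<Sum>j\<in>?S. f (blk_idx h j) / real (card (blk h (blk_idx h j)))) = real (card ?S) * (f i / real
        (card (blk h i)))"
      by simp
    also have "\<dots> \<le> real (card (blk h i)) * (f i / real (card (blk h i)))"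
      using A f finite_blk[OF h] by (intro mult_right_mono divide_nonneg_nonneg) (auto intro!: card_mono
          simp: blk_def)
    also have "\<dots> \<le> f i" using f by (cases "card (blk h i) = 0") auto
    finally show "(\<Sum>j\<in>?S. f (blk_idx h j) / real (card (blk h (blk_idx h j)))) \<le> f i" .
  qed
  finally show ?thesis .
qed

lemma sum_inverse_squares_tail:
  assumes "K \<ge> 1"
  shows "(\<Sum>k=K..n. 1 / (real k)\<^sup>2) \<le> 2 / real K"
proof (cases "K \<le> n")
  case True
  have "(\<Sum>k=K..n. 1 / (real k)\<^sup>2) \<le> 2 / real K - 1 / real n"
    using True
  proof (induction n rule: dec_induct)
    case base
    have "1 / (real K)\<^sup>2 \<le> 1 / real K" using assms by (simp add: power2_eq_square field_simps)
    then show ?case by simp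
  next
    case (step n)
    have n: "real n \<ge> 1" using assms step by simp
    have "1 / (real (Suc n))\<^sup>2 \<le> 1 / real n - 1 / real (Suc n)"
    proof -
      have "1 / (real (Suc n))\<^sup>2 \<le> 1 / (real n * real (Suc n))"
        unfolding power2_eq_square using n by (intro divide_left_mono mult_right_mono mult_pos_pos) auto
      also have "\<dots> = 1 / real n - 1 / real (Suc n)" using n by (simp add: field_simps)
      finally show ?thesis .
    qed
    then show ?case using step by simp
  qed
  moreover have "1 / real n \<ge> 0" by simp
  ultimately show ?thesis by linarith
qed simp

text \<open>The cost of cutting the matrix at one point: each of the \<open>K\<close> rows before it
  has a tail of at most \<open>2 / K\<close>, whatever \<open>X\<close> is.\<close>

lemma sum_separated_le:
  assumes X: "(X::real) > 0"
  shows "(\<Sum>j<n. \<Sum>k<n. if real j < X \<and> X \<le> real k then 1 / (real (j + k))\<^sup>2 else 0) \<le> 2"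
proof -
  define K where "K = nat \<lceil>X\<rceil>"
  have K: "K \<ge> 1" "\<And>j. real j < X \<longleftrightarrow> j < K" "\<And>k. X \<le> real k \<longleftrightarrow> K \<le> k"
    using X by (auto simp: K_def) linarith+
  have "(\<Sum>j<n. \<Sum>k<n. if real j < X \<and> X \<le> real k then 1 / (real (j + k))\<^sup>2 else 0)
      \<le> (\<Sum>j<n. if j < K then 2 / real K else 0)"
  proof (rule sum_mono)
    fix j
    show "(\<Sum>k<n. if real j < X \<and> X \<le> real k then 1 / (real (j + k))\<^sup>2 else 0) \<le> (if j
        < K then 2 / real K else 0)"
    proof (cases "j < K")
      case True
      have "(\<Sum>k<n. if real j < X \<and> X \<le> real k then 1 / (real (j + k))\<^sup>2 else 0) = (\<Sum>k\<in>{..<n} \<inter> {k. K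
          \<le> k}. 1 / (real (j + k))\<^sup>2)"
        using True by (simp add: K sum.If_cases)
      also have "\<dots> \<le> (\<Sum>k\<in>{..<n} \<inter> {k. K \<le> k}. 1 / (real k)\<^sup>2)"
        using K(1) by (intro sum_mono divide_left_mono power_mono) auto
      also have "\<dots> \<le> (\<Sum>k=K..n. 1 / (real k)\<^sup>2)" by (intro sum_mono2) auto
      also have "\<dots> \<le> 2 / real K" by (rule sum_inverse_squares_tail[OF K(1)])
      finally show ?thesis using True by simp
    qed (simp add: K)
  qed
  also have "\<dots> = (\<Sum>j\<in>{..<n} \<inter> {j. j < K}. 2 / real K)" by (simp add: sum.If_cases)
  also have "\<dots> = real (card ({..<n} \<inter> {j. j < K})) * (2 / real K)" by simp
  also have "\<dots> \<le> real K * (2 / real K)"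
  proof -
    have "card ({..<n} \<inter> {j. j < K}) \<le> card {..<K}" by (intro card_mono) auto
    then show ?thesis by (intro mult_right_mono) auto
  qed
  also have "\<dots> = 2" using K by simp
  finally show ?thesis .
qed

lemma harm_le_ln: "n \<ge> 1 \<Longrightarrow> harm n \<le> ln (real n) + 1"
proof (induction n rule: dec_induct)
  case base
  then show ?case by (simp add: harm_def)
next
  case (step n)
  then have n: "real n > 0" by simp
  have "ln (real n / real (Suc n)) \<le> real n / real (Suc n) - 1" using n by (intro ln_le_minus_one) auto
  also have "\<dots> = - (1 / real (Suc n))" by (simp add: field_simps)
  also have "ln (real n / real (Suc n)) = ln (real n) - ln (real (Suc n))" using n
      by (intro ln_divide_pos) auto
  finally show ?case using step by (simp add: harm_Suc inverse_eq_divide)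
qed

text \<open>The squared Hilbert-Schmidt norm of the cut-off Carleman matrix grows only like
  \<open>ln N\<close>, so relative errors of order \<open>h\<close> in its entries cost order
  \<open>h\<^sup>2 * ln N\<close>.\<close>

lemma sum_harmonic_square_le:
  assumes "N \<ge> 1"
  shows "(\<Sum>j<n. \<Sum>k<n. if 0 < j + k \<and> j + k < N then 1 / (real (j + k))\<^sup>2 else 0) \<le> 2 * (1 + ln (real N))"
proof -
  define w where "w m = (if 0 < m \<and> m < N then 1 / (real m)\<^sup>2 else 0)" for m :: nat
  have "(\<Sum>j<n. \<Sum>k<n. if 0 < j + k \<and> j + k < N then 1 / (real (j + k))\<^sup>2 else 0) = (\<Sum>j<n. \<Sum>k<n. w (j
      + k))"
    by (simp add: w_def)
  also have "\<dots> \<le> (\<Sum>m<2*n. (real m + 1) * w m)" by (rule sum_antidiagonal_le) (simp add: w_def)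
  also have "\<dots> \<le> (\<Sum>m<2*n. if 0 < m \<and> m < N then 2 / real m else 0)"
  proof (rule sum_mono)
    fix m
    show "(real m + 1) * w m \<le> (if 0 < m \<and> m < N then 2 / real m else 0)"
    proof (cases "0 < m \<and> m < N")
      case True
      then have "(real m + 1) * (1 / (real m)\<^sup>2) \<le> (2 * real m) * (1 / (real m)\<^sup>2)"
          by (intro mult_right_mono) auto
      then show ?thesis using True by (simp add: w_def power2_eq_square)
    qed (auto simp: w_def)
  qed
  also have "\<dots> = (\<Sum>m\<in>{..<2*n} \<inter> {m. 0 < m \<and> m < N}. 2 / real m)" by (simp add: sum.If_cases)
  also have "\<dots> \<le> (\<Sum>m=1..N. 2 / real m)" by (intro sum_mono2) auto
  also have "\<dots> = 2 * harm N" by (simp add: harm_def sum_distrib_left divide_inverse)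
  also have "harm N \<le> ln (real N) + 1"
    using assms by (rule harm_le_ln)
  finally show ?thesis by simp
qed

lemma exp_sums_le:
  assumes h: "h > 0"
  shows "(\<Sum>m<M. exp (- (h * real m))) \<le> 1 / (1 - exp (- h))"
    "(\<Sum>m<M. exp (- (h * (real M - real m)))) \<le> exp (- h) / (1 - exp (- h))"
proof -
  have q: "0 < exp (- h)" "exp (- h) < 1" using h by auto
  have e: "exp (- (h * real m)) = exp (- h) ^ m" for m by (simp add: exp_of_nat_mult[symmetric]
      mult.commute)
  have "(\<Sum>m<M. exp (- (h * real m))) = (1 - exp (- h) ^ M) / (1 - exp (- h))"
    unfolding e using q by (subst sum_gp_strict) auto
  also have "\<dots> \<le> 1 / (1 - exp (- h))" using q by (intro divide_right_mono) auto
  finally show 1: "(\<Sum>m<M. exp (- (h * real m))) \<le> 1 / (1 - exp (- h))" .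
  have "(\<Sum>m<M. exp (- (h * (real M - real m)))) = (\<Sum>m<M. exp (- h) * exp (- (h * real m)))"
    by (subst sum.nat_diff_reindex[symmetric]) (auto intro!: sum.cong simp: of_nat_diff algebra_simps
        simp flip: exp_add)
  also have "\<dots> \<le> exp (- h) * (1 / (1 - exp (- h)))"
    unfolding sum_distrib_left[symmetric] using 1 by (intro mult_left_mono) auto
  finally show "(\<Sum>m<M. exp (- (h * (real M - real m)))) \<le> exp (- h) / (1 - exp (- h))" by simp
qed

text \<open>With \<open>a\<close> the sum of the left ends of the two blocks,
  \<open>1 / (j + k)\<close> is \<open>1 / a\<close> up to a factor \<open>exp h\<close>, and
  passing from interval lengths to block cardinalities costs the factor \<open>\<rho>\<close>,
  within \<open>h\<close> of 1. The second, cruder bound is for the wrap-around corners.\<close>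

lemma model_near_bound:
  fixes i l :: nat
  assumes h: "0 < h" "h \<le> 1/2" and jk: "j \<ge> 1" "k \<ge> 1"
    and i: "i = blk_idx h j" "2 / h\<^sup>2 \<le> exp (h * real i)" and l: "l = blk_idx h k"
        "2 / h\<^sup>2 \<le> exp (h * real l)"
  defines "r \<equiv> (if i \<le> l then l - i else i - l)"
  shows "\<bar>1 / real (j + k) - sech_coeff h r / sqrt (real (card (blk h i)) * real (card (blk h l)))\<bar>
      \<le> 5 * h / real (j + k)"
    and "1 / real (j + k) \<le> 2 * (sech_coeff h r / sqrt (real (card (blk h i)) * real (card (blk h l))))"
proof -
  define a where "a = exp (h * real i) + exp (h * real l)"
  define \<rho> where "\<rho> = sqrt (((exp h - 1) * exp (h * real i) / real (card (blk h i))) * ((exp h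
      - 1) * exp (h * real l) / real (card (blk h l))))"
  have a0: "a > 0" by (simp add: a_def add_pos_pos)
  have s0: "real (j + k) > 0" using jk by simp
  have r1: "card (blk h i) > 0" "1 - h \<le> (exp h - 1) * exp (h * real i) / real (card (blk h i))"
    "(exp h - 1) * exp (h * real i) / real (card (blk h i)) \<le> 1 + h"
    using card_blk_ratio[of h i] h i by auto
  have r2: "card (blk h l) > 0" "1 - h \<le> (exp h - 1) * exp (h * real l) / real (card (blk h l))"
    "(exp h - 1) * exp (h * real l) / real (card (blk h l)) \<le> 1 + h"
    using card_blk_ratio[of h l] h l by auto
  have "sqrt ((1 - h) * (1 - h)) \<le> \<rho>" unfolding \<rho>_def
    using r1 r2 h by (intro real_sqrt_le_mono mult_mono) auto
  then have rl: "1 - h \<le> \<rho>" using h by simp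
  have "\<rho> \<le> sqrt ((1 + h) * (1 + h))" unfolding \<rho>_def
    using r1 r2 h by (intro real_sqrt_le_mono mult_mono) auto
  then have ru: "\<rho> \<le> 1 + h" using h by simp
  have g: "sech_coeff h r / sqrt (real (card (blk h i)) * real (card (blk h l))) = \<rho> / a"
    unfolding r_def sech_coeff_eq[OF h(1)] a_def[symmetric] \<rho>_def
    by (simp add: real_sqrt_divide real_sqrt_mult)
  have jb: "exp (h * real i) \<le> real j" "real j < exp h * exp (h * real i)"
    using blk_idx_bounds[OF h(1) jk(1)] unfolding i(1)[symmetric]
        by (simp_all add: algebra_simps exp_add)
  have kb: "exp (h * real l) \<le> real k" "real k < exp h * exp (h * real l)"
    using blk_idx_bounds[OF h(1) jk(2)] unfolding l(1)[symmetric]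
        by (simp_all add: algebra_simps exp_add)
  have as: "a \<le> real (j + k)" "real (j + k) \<le> exp h * a"
    using jb kb by (simp_all add: a_def algebra_simps)
  have "exp h \<le> 1 + h + h\<^sup>2" using h by (intro exp_bound) auto
  moreover have "h\<^sup>2 \<le> h * (1/2)" unfolding power2_eq_square using h by (intro mult_left_mono) auto
  ultimately have eh: "exp h - 1 \<le> 2 * h" "exp h \<le> 2" using h by linarith+
  have ia: "1 / a \<le> exp h / real (j + k)" using as a0 s0 by (simp add: field_simps)
  have il: "1 / real (j + k) \<le> 1 / a" using as a0 s0 by (simp add: field_simps)
  have d1: "1 / a - 1 / real (j + k) \<le> 2 * h / real (j + k)"
  proof -
    have "1 / a - 1 / real (j + k) \<le> exp h / real (j + k) - 1 / real (j + k)" using ia by simp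
    also have "\<dots> = (exp h - 1) / real (j + k)" by (simp add: diff_divide_distrib)
    also have "\<dots> \<le> 2 * h / real (j + k)" using eh s0 by (intro divide_right_mono) auto
    finally show ?thesis .
  qed
  have d2: "\<bar>\<rho> - 1\<bar> * (1 / a) \<le> h * (2 / real (j + k))"
  proof (intro mult_mono)
    show "\<bar>\<rho> - 1\<bar> \<le> h" using rl ru by linarith
    have "exp h / real (j + k) \<le> 2 / real (j + k)" using eh s0 by (intro divide_right_mono) auto
    then show "1 / a \<le> 2 / real (j + k)" using ia by linarith
  qed (use h a0 in auto)
  have "1 / real (j + k) - \<rho> / a = - (1 / a - 1 / real (j + k)) - (\<rho> - 1) * (1 / a)"
    by (simp add: diff_divide_distrib left_diff_distrib)
  then have "\<bar>1 / real (j + k) - \<rho> / a\<bar> \<le> \<bar>1 / a - 1 / real (j + k)\<bar> + \<bar>(\<rho> - 1) * (1 / a)\<bar>" by linarith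
  also have "\<dots> = (1 / a - 1 / real (j + k)) + \<bar>\<rho> - 1\<bar> * (1 / a)" using il a0 by (simp add: abs_mult)
  also have "\<dots> \<le> 2 * h / real (j + k) + h * (2 / real (j + k))" using d1 d2 by linarith
  also have "\<dots> = 4 * h / real (j + k)" by simp
  also have "\<dots> \<le> 5 * h / real (j + k)" using h s0 by (intro divide_right_mono) auto
  finally show "\<bar>1 / real (j + k) - sech_coeff h r / sqrt (real (card (blk h i)) * real (card (blk h
      l)))\<bar> \<le> 5 * h / real (j + k)"
    unfolding g .
  have "1 / a \<le> 2 * (\<rho> / a)" using rl h a0 by (simp add: divide_right_mono)
  then show "1 / real (j + k) \<le> 2 * (sech_coeff h r / sqrt (real (card (blk h i)) * real (card (blk h
      l))))"
    unfolding g using il by linarith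
qed

text \<open>Decay away from the start of a cycle; \<open>wgt_down\<close> decays away from its end.
  At a wrap-around corner one index is near each end, and the product of the weights is
  \<open>exp (- (h * (M - r)))\<close> over the block cardinalities, so that the double sum over
  corners factors.\<close>

definition wgt_up :: "real \<Rightarrow> nat \<Rightarrow> nat \<Rightarrow> nat \<Rightarrow> real" where
  "wgt_up h M b j = (if 1 \<le> j \<and> blk_idx h j div M = b then exp (- (h * real (blk_idx h j mod M))) / real
      (card (blk h (blk_idx h j))) else 0)"

definition wgt_down :: "real \<Rightarrow> nat \<Rightarrow> nat \<Rightarrow> nat \<Rightarrow> real" where
  "wgt_down h M b j = (if 1 \<le> j \<and> blk_idx h j div M = b then exp (- (h * (real M - real (blk_idx h j mod
      M)))) / real (card (blk h (blk_idx h j))) else 0)"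

lemma wgt_nonneg: "wgt_up h M b j \<ge> 0" "wgt_down h M b j \<ge> 0"
  by (auto simp: wgt_up_def wgt_down_def)

lemma sum_superblock_le:
  assumes h: "h > 0" and M: "M > 0" and f: "\<And>m. f m \<ge> 0"
  shows "(\<Sum>j<n. if 1 \<le> j \<and> blk_idx h j div M = b then f (blk_idx h j mod M) / real (card (blk h (blk_idx
      h j))) else 0) \<le> (\<Sum>m<M. f m)"
proof -
  let ?A = "{..<n} \<inter> {j. 1 \<le> j \<and> blk_idx h j div M = b}"
  let ?I = "(\<lambda>m. b * M + m) ` {..<M}"
  have "(\<Sum>j<n. if 1 \<le> j \<and> blk_idx h j div M = b then f (blk_idx h j mod M) / real (card (blk h (blk_idx
      h j))) else 0)
      = (\<Sum>j\<in>?A. f (blk_idx h j mod M) / real (card (blk h (blk_idx h j))))" by (simp add: sum.If_cases)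
  also have "\<dots> \<le> (\<Sum>i\<in>?I. f (i mod M))"
  proof (rule sum_blk_weights_le[OF h, where f="\<lambda>i. f (i mod M)"])
    fix j assume j: "j \<in> ?A"
    have "blk_idx h j = b * M + blk_idx h j mod M" using j by (metis (mono_tags, lifting) Int_iff
        div_mult_mod_eq mem_Collect_eq)
    then show "1 \<le> j \<and> blk_idx h j \<in> ?I" using j M by (auto intro!: image_eqI[of _ _
        "blk_idx h j mod M"])
  qed (use f in auto)
  also have "\<dots> = (\<Sum>m<M. f m)" by (subst sum.reindex) (auto simp: inj_on_def)
  finally show ?thesis .
qed

lemma sum_wgt_le:
  assumes "h > 0" "M > 0"
  shows "(\<Sum>j<n. wgt_up h M b j) \<le> 1 / (1 - exp (- h))" "(\<Sum>j<n. wgt_down h M b j) \<le> exp (- h) / (1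
      - exp (- h))"
  unfolding wgt_up_def wgt_down_def
  using order_trans[OF sum_superblock_le[OF assms, where f="\<lambda>m. exp (- (h * real m))"] exp_sums_le(1)[OF
      assms(1)]]
    order_trans[OF sum_superblock_le[OF assms, where f="\<lambda>m. exp (- (h * (real M - real m)))"]
        exp_sums_le(2)[OF assms(1)]]
  by auto

text \<open>Every squared error falls under one of five majorants: \<open>P1\<close> inside a kept
  cycle away from the corners, \<open>P2\<close> at the corners, \<open>P3\<close> for pairs
  separated by a cycle boundary, \<open>P4\<close> below the first kept cycle, and \<open>P5\<close>
  above the last one but before the cutoff.\<close>

lemma model_error:
  fixes h :: real and L b0 b1 N n :: nat
  defines "M \<equiv> 2 * L + 1"
  assumes h: "0 < h" "h \<le> 1/2" and b: "b0 \<ge> 1" "b0 \<le> b1" and b0: "2 / h\<^sup>2 \<le> exp (h * real (M * b0))"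
    and N: "2 * exp (h * real (M * b1)) \<le> real N" "real N < 2 * exp (h * real (M * (b1 + 1)))"
  shows "(\<Sum>j<n. \<Sum>k<n. if j + k = 0 then 0 else
      ((if j + k < N then 1 / real (j + k) else 0) - model h L b0 b1 j k)\<^sup>2)
    \<le> 50 * h\<^sup>2 * (1 + ln (real N)) + 20 * (real b1 + 1) + (exp (h * real (M * b0)) + 1)\<^sup>2 + exp (2 * h *
        real M)"
proof -
  have M: "M > 0" by (simp add: M_def)
  define X where "X b = exp (h * real (M * b))" for b
  have X1: "X b \<ge> 1" for b using h by (simp add: X_def)
  have idx: "b \<le> blk_idx h j div M \<longleftrightarrow> X b \<le> real j" if "j \<ge> 1" for b j
    using blk_idx_ge_iff[OF h(1) that, of "M * b"] M by (simp add: X_def less_eq_div_iff_mult_less_eq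
        mult.commute)
  have Xmono: "X b \<le> X b'" if "b \<le> b'" for b b' using that h by (simp add: X_def mult_left_mono)
  define P1 where "P1 j k = (if 0 < j + k \<and> j + k < N then 25 * h\<^sup>2 * (1 / (real (j + k))\<^sup>2) else 0)"
      for j k :: nat
  define P2 where "P2 j k = (\<Sum>b=b0..<b1. 4 * (exp h - 1)\<^sup>2 * (wgt_up h M b j * wgt_down h M b k
      + wgt_up h M b k * wgt_down h M b j))" for j k
  define S where "S b j k = (if real j < X b \<and> X b \<le> real k then 1 / (real (j + k))\<^sup>2 else 0)" for b j k
  define P3 where "P3 j k = (\<Sum>b=b0..b1. S b j k + S b k j)" for j k
  define P4 where "P4 j k = (if real j < X b0 \<and> real k < X b0 then 1 else 0 :: real)" for j k :: nat
  define P5 where "P5 j k = (if X b1 \<le> real j \<and> X b1 \<le> real k \<and> j + k < N then 1 / (4 * (X b1)\<^sup>2) else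
      0)" for j k :: nat
  have S0: "S b j k \<ge> 0" for b j k by (simp add: S_def)
  have nn: "P1 j k \<ge> 0" "P2 j k \<ge> 0" "P3 j k \<ge> 0" "P4 j k \<ge> 0" "P5 j k \<ge> 0" for j k
    by (auto simp: P1_def P2_def P3_def P4_def P5_def S0 wgt_nonneg intro!: sum_nonneg
        mult_nonneg_nonneg add_nonneg_nonneg)
  have pw: "((if j + k < N then 1 / real (j + k) else 0) - model h L b0 b1 j k)\<^sup>2 \<le> P1 j k + P2 j k
      + P3 j k + P4 j k + P5 j k"
    (is "?e \<le> _") if jk: "j + k \<noteq> 0" for j k
  proof -
    have s0: "real (j + k) \<ge> 1" using jk by linarith
    define i l where "i = blk_idx h j" and "l = blk_idx h k"
    show ?thesis
    proof (cases "1 \<le> j \<and> 1 \<le> k \<and> i div M = l div M \<and> b0 \<le> i div M \<and> i div M < b1")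
      case True
      then have jk1: "j \<ge> 1" "k \<ge> 1" by auto
      have "\<not> X b1 \<le> real j" "\<not> X b1 \<le> real k"
        using True idx[OF jk1(1), of b1] idx[OF jk1(2), of b1] unfolding i_def l_def by auto
      then have "real j + real k < 2 * X b1" by linarith
      then have jkN: "j + k < N" using N unfolding X_def by linarith
      have bi: "M * b0 \<le> i" "M * b0 \<le> l"
        using True less_eq_div_iff_mult_less_eq[OF M, of b0 i] less_eq_div_iff_mult_less_eq[OF M, of b0
            l]
        by (simp_all add: mult.commute)
      have "exp (h * real (M * b0)) \<le> exp (h * real i)" "exp (h * real (M * b0)) \<le> exp (h * real l)"
        using bi h by (auto simp del: of_nat_mult)
      then have big: "2 / h\<^sup>2 \<le> exp (h * real i)" "2 / h\<^sup>2 \<le> exp (h * real l)" using b0 by linarith+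
      define r where "r = (if i \<le> l then l - i else i - l)"
      define n where "n = sqrt (real (card (blk h i)) * real (card (blk h l)))"
      note near = model_near_bound[OF h jk1 i_def big(1) l_def big(2), folded r_def n_def]
      have md: "model h L b0 b1 j k = sech_coeff h (if r \<le> L then r else M - r) / n"
        using True unfolding model_def Let_def M_def[symmetric] i_def[symmetric] l_def[symmetric]
            circulant_def r_def[symmetric] n_def by simp
      show ?thesis
      proof (cases "r \<le> L")
        case True
        have "?e = (1 / real (j + k) - sech_coeff h r / n)\<^sup>2" using jkN md True by simp
        also have "\<dots> \<le> (5 * h / real (j + k))\<^sup>2" using near(1)
            by (metis abs_ge_zero power2_abs power_mono)
        also have "\<dots> = P1 j k" using jkN jk by (simp add: P1_def power_divide power_mult_distrib del:
            of_nat_add)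
        finally show ?thesis using nn[of j k] by linarith
      next
        case False
        have im: "i = M * (i div M) + i mod M" "l = M * (i div M) + l mod M" "i mod M < M" "l mod M < M"
          using True M mult_div_mod_eq[of M i] mult_div_mod_eq[of M l] by auto
        have ds: "l - i < M" "i - l < M" using im by linarith+
        then have rM: "r < M" by (simp add: r_def)
        \<comment> \<open>At a corner \<open>M - r\<close> is smaller than \<open>r\<close>, so the
          wrapped entry \<open>g\<close> dominates the unwrapped one and with it, up to a factor 2,
          the true entry; the whole error is of size \<open>g\<close>.\<close>
        define g where "g = sech_coeff h (M - r) / n"
        have n0: "n \<ge> 0" by (simp add: n_def)
        have g0: "g \<ge> 0" using h n0 by (simp add: g_def sech_coeff_nonneg)
        have "sech_coeff h r \<le> sech_coeff h (M - r)" using False h by (intro sech_coeff_antimono) (auto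
            simp: M_def)
        then have "sech_coeff h r / n \<le> g" unfolding g_def using n0 by (intro divide_right_mono) auto
        then have s2: "1 / real (j + k) \<le> 2 * g" using near(2) by linarith
        have "?e = (1 / real (j + k) - g)\<^sup>2" using jkN md False by (simp add: g_def)
        also have "\<dots> \<le> (2 * g)\<^sup>2"
        proof (rule abs_le_square_iff[THEN iffD1])
          have "1 / real (j + k) \<ge> 0" by simp
          then show "\<bar>1 / real (j + k) - g\<bar> \<le> \<bar>2 * g\<bar>" using s2 g0 by linarith
        qed
        also have "\<dots> = 4 * (sech_coeff h (M - r))\<^sup>2 / (real (card (blk h i)) * real (card (blk h l)))"
          unfolding g_def n_def by (simp add: power_divide power_mult_distrib)
        also have "\<dots> \<le> 4 * ((exp h - 1)\<^sup>2 * exp (- (h * real (M - r)))) / (real (card (blk h i)) * real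
            (card (blk h l)))"
        proof -
          have "(sech_coeff h (M - r))\<^sup>2 \<le> ((exp h - 1) * exp (- (h * real (M - r) / 2)))\<^sup>2"
            using h by (intro power_mono sech_coeff_le sech_coeff_nonneg) auto
          also have "\<dots> = (exp h - 1)\<^sup>2 * exp (- (h * real (M - r)))"
            by (simp add: power_mult_distrib power2_eq_square flip: exp_add)
          finally show ?thesis by (intro divide_right_mono mult_left_mono) auto
        qed
        also have "\<dots> \<le> 4 * (exp h - 1)\<^sup>2 * (wgt_up h M (i div M) j * wgt_down h M (i div M) k
            + wgt_up h M (i div M) k * wgt_down h M (i div M) j)"
        proof -
          define W where "W = real (card (blk h i)) * real (card (blk h l))"
          have e1: "wgt_up h M (i div M) j * wgt_down h M (i div M) k = exp (- (h * (real M
              + real (i mod M) - real (l mod M)))) / W"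
            using True unfolding wgt_up_def wgt_down_def i_def[symmetric] l_def[symmetric] W_def
            by (simp add: algebra_simps flip: exp_add)
          have e2: "wgt_up h M (i div M) k * wgt_down h M (i div M) j = exp (- (h * (real M
              + real (l mod M) - real (i mod M)))) / W"
            using True unfolding wgt_up_def wgt_down_def i_def[symmetric] l_def[symmetric] W_def
            by (simp add: algebra_simps flip: exp_add)
          have p: "exp (- (h * (real M + real (i mod M) - real (l mod M)))) / W \<ge> 0"
              "exp (- (h * (real M + real (l mod M) - real (i mod M)))) / W \<ge> 0"
            by (auto simp: W_def)
          have "exp (- (h * real (M - r))) / W \<le> exp (- (h * (real M + real (i mod M)
              - real (l mod M)))) / W + exp (- (h * (real M + real (l mod M) - real (i mod M)))) / W"
          proof (cases "i \<le> l")
            case le: True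
            then have "real (M - r) = real M + real (i mod M) - real (l mod M)"
              using im ds unfolding r_def if_P[OF le] by linarith
            then show ?thesis using p by simp
          next
            case le: False
            then have "real (M - r) = real M + real (l mod M) - real (i mod M)"
              using im ds le unfolding r_def if_not_P[OF le] by linarith
            then show ?thesis using p by simp
          qed
          then have "4 * (exp h - 1)\<^sup>2 * (exp (- (h * real (M - r))) / W) \<le> 4 * (exp h - 1)\<^sup>2 * (exp (- (h
              * (real M + real (i mod M) - real (l mod M)))) / W + exp (- (h * (real M + real (l mod M)
              - real (i mod M)))) / W)"
            by (intro mult_left_mono) auto
          then show ?thesis unfolding e1 e2 W_def[symmetric] by simp
        qed
        also have "\<dots> \<le> P2 j k"
          unfolding P2_def using True by (intro member_le_sum[where i="i div M"]) (auto simp: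
              wgt_nonneg)
        finally show ?thesis using nn[of j k] by linarith
      qed
    next
      case False
      then have "model h L b0 b1 j k = 0"
        unfolding model_def Let_def M_def[symmetric] i_def[symmetric] l_def[symmetric]
            by (simp only: if_False)
      then have e: "?e \<le> (if j + k < N then 1 / (real (j + k))\<^sup>2 else 0)" by (simp add: power_divide)
      have "(if j + k < N then 1 / (real (j + k))\<^sup>2 else 0) \<le> 1 / (real (j + k))\<^sup>2" by simp
      with e have e': "?e \<le> 1 / (real (j + k))\<^sup>2" by linarith
      have one: "1 / (real (j + k))\<^sup>2 \<le> 1"
        using frac_le[OF _ _ zero_less_one one_le_power[OF s0, of 2], of 1 1] by simp
      \<comment> \<open>Where the pair shares no kept cycle, its indices lie on different sides of
        some boundary \<open>X b\<close>, or both before the first, or both after the last.\<close>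
      consider b where "b \<in> {b0..b1}" "real j < X b" "X b \<le> real k"
        | b where "b \<in> {b0..b1}" "real k < X b" "X b \<le> real j"
        | "real j < X b0" "real k < X b0" | "X b1 \<le> real j" "X b1 \<le> real k"
      proof -
        consider "real j < X b0 \<or> real k < X b0" | "X b1 \<le> real j \<or> X b1 \<le> real k"
          | "X b0 \<le> real j" "X b0 \<le> real k" "real j < X b1" "real k < X b1" by linarith
        then show ?thesis
        proof cases
          case 1 then show ?thesis using that(1)[of b0] that(2)[of b0] that(3) b by force
        next
          case 2 then show ?thesis using that(1)[of b1] that(2)[of b1] that(4) b by force
        next
          case 3
          then have jk1: "j \<ge> 1" "k \<ge> 1" using X1[of b0] by linarith+
          have "b0 \<le> i div M" "b0 \<le> l div M" "i div M < b1" "l div M < b1"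
            using 3 idx[OF jk1(1), of b0] idx[OF jk1(1), of b1] idx[OF jk1(2), of b0] idx[OF jk1(2), of
                b1]
            unfolding i_def l_def by auto
          moreover then have "i div M \<noteq> l div M" using False jk1 by auto
          ultimately show ?thesis
            using that(1)[of "l div M"] that(2)[of "i div M"]
              idx[OF jk1(1), of "l div M"] idx[OF jk1(2), of "i div M"] idx[OF jk1(1), of
                  "i div M"] idx[OF jk1(2), of "l div M"]
            unfolding i_def l_def by (cases "blk_idx h j div M < blk_idx h k div M") force+
        qed
      qed
      then show ?thesis
      proof cases
        case 1
        have "S b j k + S b k j \<le> P3 j k" unfolding P3_def using 1 S0 by (intro member_le_sum) auto
        moreover have "S b j k = 1 / (real (j + k))\<^sup>2" using 1 by (simp add: S_def)
        ultimately have "?e \<le> P3 j k" using e' S0[of b k j] by linarith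
        then show ?thesis using nn[of j k] by linarith
      next
        case 2
        have "S b j k + S b k j \<le> P3 j k" unfolding P3_def using 2 S0 by (intro member_le_sum) auto
        moreover have "S b k j = 1 / (real (j + k))\<^sup>2" using 2 by (simp add: S_def add.commute)
        ultimately have "?e \<le> P3 j k" using e' S0[of b j k] by linarith
        then show ?thesis using nn[of j k] by linarith
      next
        case 3
        then have "P4 j k = 1" by (simp add: P4_def)
        then have "?e \<le> P4 j k" using e' one by linarith
        then show ?thesis using nn[of j k] by linarith
      next
        case 4
        have "(2 * X b1)\<^sup>2 \<le> (real (j + k))\<^sup>2" using 4 X1[of b1] by (intro power_mono) auto
        then have "1 / (real (j + k))\<^sup>2 \<le> 1 / (4 * (X b1)\<^sup>2)" using X1[of b1] s0
          by (intro divide_left_mono mult_pos_pos) (auto simp: power_mult_distrib simp del: of_nat_add)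
        then have "(if j + k < N then 1 / (real (j + k))\<^sup>2 else 0) \<le> P5 j k" using 4
            by (simp add: P5_def)
        then have "?e \<le> P5 j k" using e by linarith
        then show ?thesis using nn[of j k] by linarith
      qed
    qed
  qed
  have N1: "N \<ge> 1" using N(1) X1[of b1] unfolding X_def by linarith
  have "(\<Sum>j<n. \<Sum>k<n. if j + k = 0 then 0 else ((if j + k < N then 1 / real (j + k) else 0)
      - model h L b0 b1 j k)\<^sup>2)
      \<le> (\<Sum>j<n. \<Sum>k<n. P1 j k + P2 j k + P3 j k + P4 j k + P5 j k)"
    using pw nn by (intro sum_mono) (auto intro: add_nonneg_nonneg)
  also have "\<dots> = (\<Sum>j<n. \<Sum>k<n. P1 j k) + (\<Sum>j<n. \<Sum>k<n. P2 j k) + (\<Sum>j<n. \<Sum>k<n. P3 j k) + (\<Sum>j<n. \<Sum>k<n. P4 j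
      k) + (\<Sum>j<n. \<Sum>k<n. P5 j k)"
    by (simp only: sum.distrib)
  also have "\<dots> \<le> 25 * h\<^sup>2 * (2 * (1 + ln (real N))) + 16 * real (b1 - b0) + 4 * real (Suc b1 - b0)
      + (X b0 + 1)\<^sup>2 + exp (2 * h * real M)"
  proof (intro add_mono)
    show "(\<Sum>j<n. \<Sum>k<n. P1 j k) \<le> 25 * h\<^sup>2 * (2 * (1 + ln (real N)))"
    proof -
      have "P1 j k = 25 * h\<^sup>2 * (if 0 < j + k \<and> j + k < N then 1 / (real (j + k))\<^sup>2 else 0)" for j k
          by (simp add: P1_def)
      then show ?thesis using sum_harmonic_square_le[OF N1, of n]
        by (simp only: sum_distrib_left[symmetric]) (intro mult_left_mono, auto)
    qed
    show "(\<Sum>j<n. \<Sum>k<n. P2 j k) \<le> 16 * real (b1 - b0)"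
    proof -
      define U where "U b = (\<Sum>j<n. wgt_up h M b j)" for b
      define V where "V b = (\<Sum>j<n. wgt_down h M b j)" for b
      have UV: "U b * V b \<le> (1 / (1 - exp (- h))) * (exp (- h) / (1 - exp (- h)))" for b
        unfolding U_def V_def using h M by (intro mult_mono sum_wgt_le sum_nonneg wgt_nonneg) auto
      have "(\<Sum>j<n. \<Sum>k<n. P2 j k) = (\<Sum>b=b0..<b1. \<Sum>j<n. \<Sum>k<n. 4 * (exp h - 1)\<^sup>2 * (wgt_up h M b j *
          wgt_down h M b k + wgt_up h M b k * wgt_down h M b j))"
        unfolding P2_def by (subst sum.swap[of _ "{b0..<b1}"], subst sum.swap[of _
            "{b0..<b1}"]) (rule refl)
      also have "\<dots> = (\<Sum>b=b0..<b1. 4 * (exp h - 1)\<^sup>2 * (2 * (U b * V b)))"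
      proof (rule sum.cong[OF refl])
        fix b
        have "(\<Sum>j<n. \<Sum>k<n. wgt_up h M b j * wgt_down h M b k) = U b * V b"
            by (simp add: U_def V_def sum_product)
        moreover have "(\<Sum>j<n. \<Sum>k<n. wgt_up h M b k * wgt_down h M b j) = U b * V b"
          by (subst sum.swap) (simp add: U_def V_def sum_product)
        ultimately show "(\<Sum>j<n. \<Sum>k<n. 4 * (exp h - 1)\<^sup>2 * (wgt_up h M b j * wgt_down h M b k
            + wgt_up h M b k * wgt_down h M b j)) = 4 * (exp h - 1)\<^sup>2 * (2 * (U b * V b))"
          by (simp only: sum_distrib_left[symmetric] sum.distrib) simp
      qed
      also have "\<dots> \<le> (\<Sum>b=b0..<b1. 16)"
      proof (rule sum_mono)
        fix b
        have "4 * (exp h - 1)\<^sup>2 * (2 * (U b * V b)) \<le> 4 * (exp h - 1)\<^sup>2 * (2 * ((1 / (1 - exp (- h))) *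
            (exp (- h) / (1 - exp (- h)))))"
          by (intro mult_left_mono UV) auto
        \<comment> \<open>The two geometric sums multiply to
          \<open>exp h / (exp h - 1)\<^sup>2\<close>, whose denominator cancels the coefficient: a
          cycle pays a constant however small \<open>h\<close> is.\<close>
        also have "\<dots> = 8 * exp h"
        proof -
          have "1 - exp (- h) = (exp h - 1) * exp (- h)" by (simp add: left_diff_distrib flip: exp_add)
          then have "(1 / (1 - exp (- h))) * (exp (- h) / (1 - exp (- h))) = exp (- h) / ((exp h
              - 1)\<^sup>2 * (exp (- h))\<^sup>2)"
            by (simp add: power2_eq_square mult_ac)
          moreover have "exp (- h) / ((exp h - 1)\<^sup>2 * (exp (- h))\<^sup>2) = exp h / (exp h - 1)\<^sup>2"
            by (simp add: power2_eq_square exp_minus field_simps)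
          moreover have "(exp h - 1)\<^sup>2 \<noteq> 0" using h by simp
          ultimately show ?thesis by simp
        qed
        also have "\<dots> \<le> 16"
        proof -
          have "exp h \<le> 1 + h + h\<^sup>2" using h by (intro exp_bound) auto
          moreover have "h\<^sup>2 \<le> h * (1/2)" unfolding power2_eq_square using h
              by (intro mult_left_mono) auto
          ultimately show ?thesis using h by linarith
        qed
        finally show "4 * (exp h - 1)\<^sup>2 * (2 * (U b * V b)) \<le> 16" .
      qed
      finally show ?thesis by simp
    qed
    show "(\<Sum>j<n. \<Sum>k<n. P3 j k) \<le> 4 * real (Suc b1 - b0)"
    proof -
      have "(\<Sum>j<n. \<Sum>k<n. P3 j k) = (\<Sum>b=b0..b1. \<Sum>j<n. \<Sum>k<n. S b j k + S b k j)"
        unfolding P3_def by (subst sum.swap[of _ "{b0..b1}"], subst sum.swap[of _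
            "{b0..b1}"]) (rule refl)
      also have "\<dots> \<le> (\<Sum>b=b0..b1. 4)"
      proof (rule sum_mono)
        fix b
        have "(\<Sum>j<n. \<Sum>k<n. S b j k) \<le> 2" unfolding S_def using X1[of b]
            by (intro sum_separated_le) linarith
        moreover have "(\<Sum>j<n. \<Sum>k<n. S b k j) = (\<Sum>j<n. \<Sum>k<n. S b j k)" by (rule sum.swap)
        ultimately show "(\<Sum>j<n. \<Sum>k<n. S b j k + S b k j) \<le> 4" by (simp only: sum.distrib)
      qed
      finally show ?thesis by simp
    qed
    show "(\<Sum>j<n. \<Sum>k<n. P4 j k) \<le> (X b0 + 1)\<^sup>2"
    proof -
      define v where "v j = (if real j < X b0 then 1 else 0 :: real)" for j :: nat
      have "(\<Sum>j<n. v j) \<le> X b0 + 1"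
      proof -
        have "(\<Sum>j<n. v j) = real (card ({..<n} \<inter> {j. real j < X b0}))" by (simp add: v_def sum.If_cases)
        also have "card ({..<n} \<inter> {j. real j < X b0}) \<le> card {..<nat \<lceil>X b0\<rceil>}"
          by (intro card_mono) (auto, linarith)
        then have "real (card ({..<n} \<inter> {j. real j < X b0})) \<le> real (nat \<lceil>X b0\<rceil>)" by simp
        also have "\<dots> \<le> X b0 + 1" using X1[of b0] by linarith
        finally show ?thesis .
      qed
      moreover have "(\<Sum>j<n. v j) \<ge> 0" by (intro sum_nonneg) (simp add: v_def)
      ultimately have "(\<Sum>j<n. v j) * (\<Sum>k<n. v k) \<le> (X b0 + 1) * (X b0 + 1)" by (intro mult_mono) auto
      moreover have "(\<Sum>j<n. \<Sum>k<n. P4 j k) = (\<Sum>j<n. v j) * (\<Sum>k<n. v k)"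
        unfolding sum_product by (intro sum.cong) (auto simp: P4_def v_def)
      ultimately show ?thesis by (simp add: power2_eq_square)
    qed
    show "(\<Sum>j<n. \<Sum>k<n. P5 j k) \<le> exp (2 * h * real M)"
    proof -
      define v where "v j = (if j < N then 1 else 0 :: real)" for j :: nat
      have v: "(\<Sum>j<n. v j) \<le> real N"
      proof -
        have "(\<Sum>j<n. v j) = real (card ({..<n} \<inter> {j. j < N}))" by (simp add: v_def sum.If_cases)
        also have "card ({..<n} \<inter> {j. j < N}) \<le> card {..<N}" by (intro card_mono) auto
        finally show ?thesis by simp
      qed
      have v0: "(\<Sum>j<n. v j) \<ge> 0" by (intro sum_nonneg) (simp add: v_def)
      have "(\<Sum>j<n. \<Sum>k<n. P5 j k) \<le> (\<Sum>j<n. \<Sum>k<n. v j * v k * (1 / (4 * (X b1)\<^sup>2)))"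
        by (intro sum_mono) (auto simp: P5_def v_def)
      also have "\<dots> = (\<Sum>j<n. v j) * (\<Sum>k<n. v k) * (1 / (4 * (X b1)\<^sup>2))"
        unfolding sum_product unfolding sum_distrib_right ..
      also have "\<dots> \<le> real N * real N * (1 / (4 * (X b1)\<^sup>2))"
        using v v0 by (intro mult_right_mono mult_mono) auto
      \<comment> \<open>\<open>N\<close> lies less than one cycle beyond \<open>2 * X b1\<close>,
        hence the factor \<open>exp (h * M)\<close>.\<close>
      also have "\<dots> \<le> (2 * exp (h * real M) * X b1) * (2 * exp (h * real M) * X b1) * (1 / (4 * (X
          b1)\<^sup>2))"
      proof -
        have "real N \<le> 2 * exp (h * real M) * X b1"
          using N(2) unfolding X_def by (simp add: algebra_simps exp_add)
        then show ?thesis by (intro mult_right_mono mult_mono) (auto simp: X_def)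
      qed
      also have "\<dots> = exp (h * real M) * exp (h * real M)"
        using X1[of b1] by (simp add: power2_eq_square)
      also have "\<dots> = exp (2 * h * real M)" by (simp flip: exp_add)
      finally show ?thesis .
    qed
  qed
  also have "\<dots> \<le> 50 * h\<^sup>2 * (1 + ln (real N)) + 20 * (real b1 + 1) + (X b0 + 1)\<^sup>2 + exp (2 * h * real M)"
  proof -
    define Z where "Z = 50 * h\<^sup>2 * (1 + ln (real N))"
    have Z: "25 * h\<^sup>2 * (2 * (1 + ln (real N))) = Z" by (simp add: Z_def)
    define u v where "u = real (b1 - b0)" and "v = real (Suc b1 - b0)"
    have "u \<le> real b1" "v \<le> real b1 + 1" unfolding u_def v_def by linarith+
    then have "16 * u + 4 * v \<le> 20 * (real b1 + 1)" by simp
    then show ?thesis unfolding Z Z_def[symmetric] u_def[symmetric] v_def[symmetric] by simp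
  qed
  finally show ?thesis by (simp add: X_def)
qed

section \<open>The eigenvalues of the circulant model\<close>

lemma Digamma_reflection_complex:
  fixes z :: complex
  assumes z: "z \<notin> \<int>"
  shows "Digamma (1 - z) - Digamma z = of_real pi * cot (of_real pi * z)"
proof -
  have nz: "z \<notin> \<int>\<^sub>\<le>\<^sub>0" "1 - z \<notin> \<int>\<^sub>\<le>\<^sub>0"
    using z Ints_diff[OF Ints_1, of "1 - z"] by (auto dest!: nonpos_Ints_Int)
  \<comment> \<open>The two sides of the reflection formula for \<open>rGamma\<close> are
    differentiated and the derivatives compared.\<close>
  have d1: "((\<lambda>z. rGamma z * rGamma (1 - z)) has_field_derivative
      (- rGamma z * Digamma z) * rGamma (1 - z) + (rGamma (1 - z) * Digamma (1 - z)) * rGamma z) (at z)"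
    using nz by (auto intro!: derivative_eq_intros)
  have "(\<lambda>z::complex. rGamma z * rGamma (1 - z)) = (\<lambda>z. sin (of_real pi * z) / of_real pi)"
    by (rule ext) (rule rGamma_reflection_complex)
  with d1 have "((\<lambda>z. sin (of_real pi * z) / of_real pi) has_field_derivative
      (- rGamma z * Digamma z) * rGamma (1 - z) + (rGamma (1 - z) * Digamma (1 - z)) * rGamma z) (at z)"
    by simp
  moreover have "((\<lambda>z. sin (of_real pi * z) / of_real pi) has_field_derivative cos (of_real pi * z)) (at
      z)"
    by (auto intro!: derivative_eq_intros)
  ultimately have "cos (of_real pi * z) = (rGamma z * rGamma (1 - z)) * (Digamma (1 - z) - Digamma z)"
    using DERIV_unique by (fastforce simp: algebra_simps)
  also have "rGamma z * rGamma (1 - z) = sin (of_real pi * z) / of_real pi"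
    by (rule rGamma_reflection_complex)
  finally have eq: "cos (of_real pi * z) = sin (of_real pi * z) / of_real pi * (Digamma (1 - z)
      - Digamma z)" .
  have "rGamma z * rGamma (1 - z) \<noteq> 0"
    using nz by (simp add: rGamma_eq_zero_iff)
  then have "sin (of_real pi * z) \<noteq> 0"
    unfolding rGamma_reflection_complex by auto
  with eq show ?thesis by (simp add: cot_def field_simps)
qed

text \<open>Expanding \<open>1 / (2 * cosh (x/2))\<close> into exponentials
  \<open>(-1)^n * exp (- (n + 1/2) * x)\<close> and integrating against
  \<open>exp (\<i> * \<xi> * x)\<close> over the half line gives these terms; twice the real part
  approximates the Fourier transform of this even function. The number of terms is even because
  consecutive terms are paired for absolute convergence.\<close>

definition sech_partial :: "nat \<Rightarrow> real \<Rightarrow> complex" where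
  "sech_partial K \<xi> = (\<Sum>n<2*K. (-1) ^ n / (of_nat n + 1/2 - \<i> * of_real \<xi>))"

lemma sech_partial_pairs:
  "sech_partial K \<xi> = (\<Sum>k<K. 1 / (2 * of_nat k + 1/2 - \<i> * of_real \<xi>) - 1 / (2 * of_nat k + 3/2
      - \<i> * of_real \<xi>))"
  unfolding sech_partial_def by (induction K) (simp_all add: algebra_simps)

lemma cosh_of_real_complex: "cosh (complex_of_real x) = of_real (cosh x)"
  by (simp add: cosh_def exp_of_real scaleR_conv_of_real flip: of_real_minus)

lemma sech_denom_nz: "a > 0 \<Longrightarrow> of_real a - \<i> * of_real \<xi> \<noteq> 0"
  by (auto simp: complex_eq_iff)

text \<open>Adding the conjugate sorts the terms into four progressions of step 2, hence into
  digamma values at \<open>w\<close>, \<open>v\<close> and their reflections. The reflection formula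
  turns these into two cotangents whose arguments add up to \<open>pi/2\<close>.\<close>

lemma sech_partial_Re_limit: "(\<lambda>K. 2 * Re (sech_partial K \<xi>)) \<longlonglongrightarrow> pi / cosh (pi * \<xi>)"
proof -
  define w where "w = Complex (1/4) (\<xi>/2)"
  define v where "v = Complex (1/4) (- \<xi>/2)"
  have notint: "z \<notin> \<int>" if "Re z = 1/4 \<or> Re z = 3/4" for z
  proof
    assume "z \<in> \<int>"
    then obtain n where "z = of_int n" by (auto elim: Ints_cases)
    then have "Re z = of_int n" by simp
    with that have "real_of_int (4 * n) = of_int 1 \<or> real_of_int (4 * n) = of_int 3" by auto
    then have "4 * n = 1 \<or> 4 * n = 3" by linarith
    then show False by presburger
  qed
  have wv: "w \<notin> \<int>" "v \<notin> \<int>" "1 - w \<notin> \<int>" "1 - v \<notin> \<int>"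
    by (auto intro!: notint simp: w_def v_def)
  then have nz: "w \<noteq> 0" "v \<noteq> 0" "1 - w \<noteq> 0" "1 - v \<noteq> 0"
    by auto
  define D where "D z m = of_real (ln (real m)) - (\<Sum>n<m. inverse (z + of_nat n))" for z :: complex and m
  have "(\<lambda>m. 1/2 * (D (1 - w) m - D v m + D (1 - v) m - D w m)) \<longlonglongrightarrow>
      1/2 * (Digamma (1 - w) - Digamma v + Digamma (1 - v) - Digamma w)"
    unfolding D_def by (intro tendsto_intros Digamma_LIMSEQ nz)
  moreover have "1/2 * (D (1 - w) m - D v m + D (1 - v) m - D w m) = of_real (2 * Re (sech_partial m
      \<xi>))" for m
  proof -
    have "sech_partial m \<xi> + cnj (sech_partial m \<xi>) =
      (\<Sum>n<m. 1/2 * (inverse (v + of_nat n) - inverse (1 - w + of_nat n) + inverse (w + of_nat n)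
          - inverse (1 - v + of_nat n)))"
    proof -
      have half: "1 / (2 * z) = 1/2 * inverse z" for z :: complex by (simp add: field_simps)
      have e: "2 * of_nat n + 1/2 - \<i> * of_real \<xi> = 2 * (v + of_nat n)"
        "2 * of_nat n + 3/2 - \<i> * of_real \<xi> = 2 * (1 - w + of_nat n)"
        "2 * of_nat n + 1/2 + \<i> * of_real \<xi> = 2 * (w + of_nat n)"
        "2 * of_nat n + 3/2 + \<i> * of_real \<xi> = 2 * (1 - v + of_nat n)" for n
        by (auto simp: complex_eq_iff v_def w_def)
      have "sech_partial m \<xi> + cnj (sech_partial m \<xi>) = (\<Sum>n<m.
          1 / (2 * of_nat n + 1/2 - \<i> * of_real \<xi>) - 1 / (2 * of_nat n + 3/2 - \<i> * of_real \<xi>) +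
          (1 / (2 * of_nat n + 1/2 + \<i> * of_real \<xi>) - 1 / (2 * of_nat n + 3/2 + \<i> * of_real \<xi>)))"
        unfolding sech_partial_pairs by (simp add: sum.distrib)
      then show ?thesis unfolding e half by (simp only: algebra_simps)
    qed
    also have "\<dots> = 1/2 * (D (1 - w) m - D v m + D (1 - v) m - D w m)"
      unfolding D_def sum_distrib_left[symmetric] sum.distrib sum_subtractf by simp
    finally show ?thesis by (simp add: complex_add_cnj)
  qed
  ultimately have lim: "(\<lambda>m. complex_of_real (2 * Re (sech_partial m \<xi>))) \<longlonglongrightarrow>
      1/2 * (Digamma (1 - w) - Digamma v + Digamma (1 - v) - Digamma w)" by simp
  have "Digamma (1 - w) - Digamma v + Digamma (1 - v) - Digamma w = of_real pi * (cot (of_real pi * w)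
      + cot (of_real pi * v))"
    using Digamma_reflection_complex[OF wv(1)] Digamma_reflection_complex[OF wv(2)]
        by (simp add: algebra_simps)
  also have "cot (of_real pi * w) + cot (of_real pi * v) = 2 / cosh (of_real (pi * \<xi>))"
  proof -
    let ?W = "complex_of_real pi * w" and ?V = "complex_of_real pi * v"
    have s: "?W + ?V = of_real (pi/2)" "?W - ?V = \<i> * of_real (pi * \<xi>)"
      by (auto simp: w_def v_def complex_eq_iff)
    have "2 * (sin ?W * sin ?V) = cos (?W - ?V) - cos (?W + ?V)"
      by (simp add: cos_add cos_diff)
    also have "\<dots> = cosh (of_real (pi * \<xi>))"
      unfolding s cos_of_real by (simp add: cosh_conv_cos)
    finally have m: "2 * (sin ?W * sin ?V) = cosh (of_real (pi * \<xi>))" .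
    have c: "cosh (complex_of_real (pi * \<xi>)) \<noteq> 0"
      by (metis cosh_of_real_complex cosh_real_nonzero of_real_eq_0_iff)
    have "sin ?W \<noteq> 0" "sin ?V \<noteq> 0" using m c by auto
    moreover have "sin ?W * cos ?V + cos ?W * sin ?V = 1"
      using sin_add[of ?W ?V] unfolding s sin_of_real by simp
    ultimately have "cot ?W + cot ?V = 1 / (sin ?W * sin ?V)"
      by (simp add: cot_def field_simps)
    also have "\<dots> = 2 / (2 * (sin ?W * sin ?V))" by simp
    finally show ?thesis unfolding m .
  qed
  finally have "1/2 * (Digamma (1 - w) - Digamma v + Digamma (1 - v) - Digamma w)
      = of_real (pi / cosh (pi * \<xi>))"
    unfolding of_real_divide cosh_of_real_complex[symmetric] by simp
  with lim show ?thesis by (metis tendsto_of_real_iff)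
qed

text \<open>Uniformity matters because the frequencies that occur are \<open>\<theta> / h\<close>
  with \<open>h\<close> small and fill no bounded set. The paired terms have a majorant of order
  \<open>1 / (k + 1)\<^sup>2\<close> free of \<open>\<xi>\<close>, so the Weierstrass test
  applies.\<close>

lemma sech_partial_uniform:
  assumes "e > 0"
  shows "\<exists>K0. \<forall>K\<ge>K0. \<forall>\<xi>. \<bar>2 * Re (sech_partial K \<xi>) - pi / cosh (pi * \<xi>)\<bar> \<le> e"
proof -
  define f where "f k \<xi> = 2 * Re (1 / (2 * of_nat k + 1/2 - \<i> * of_real \<xi>) - 1 / (2 * of_nat k + 3/2
      - \<i> * of_real \<xi>))" for k :: nat and \<xi> :: real
  have bound: "norm (f k \<xi>) \<le> 8 * inverse (of_nat (Suc k) ^ 2)" for k \<xi>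
  proof -
    let ?a = "complex_of_real (2 * of_nat k + 1/2) - \<i> * of_real \<xi>" and ?b =
        "complex_of_real (2 * of_nat k + 3/2) - \<i> * of_real \<xi>"
    have nz: "?a \<noteq> 0" "?b \<noteq> 0" by (rule sech_denom_nz; simp)+
    then have npos: "0 < norm ?a" "0 < norm ?b" by (simp_all only: zero_less_norm_iff not_False_eq_True)
    have "\<bar>Re ?a\<bar> \<le> norm ?a" "\<bar>Re ?b\<bar> \<le> norm ?b" by (rule abs_Re_le_cmod)+
    then have ab: "(real k + 1) / 2 \<le> norm ?a" "(real k + 1) / 2 \<le> norm ?b" by simp_all
    have "((real k + 1) / 2) * ((real k + 1) / 2) \<le> norm ?a * norm ?b"
      by (intro mult_mono ab) auto
    then have "1 / (norm ?a * norm ?b) \<le> 1 / (((real k + 1) / 2) * ((real k + 1) / 2))"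
      using npos by (intro divide_left_mono mult_pos_pos) auto
    moreover have "1 / ?a - 1 / ?b = 1 / (?a * ?b)" using nz by (simp add: field_simps)
    then have "norm (1 / ?a - 1 / ?b) = 1 / (norm ?a * norm ?b)" by (simp add: norm_divide norm_mult)
    ultimately have "norm (1 / ?a - 1 / ?b) \<le> 4 * inverse (of_nat (Suc k) ^ 2)"
      by (simp add: power2_eq_square inverse_eq_divide algebra_simps)
    moreover have "norm (f k \<xi>) = 2 * \<bar>Re (1 / ?a - 1 / ?b)\<bar>" unfolding f_def real_norm_def abs_mult
        by simp
    ultimately show ?thesis using abs_Re_le_cmod[of "1 / ?a - 1 / ?b"] by linarith
  qed
  have "uniform_limit UNIV (\<lambda>n x. \<Sum>i<n. f i x) (\<lambda>x. suminf (\<lambda>i. f i x)) sequentially"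
  proof (rule Weierstrass_m_test)
    show "summable (\<lambda>k. 8 * inverse (real (Suc k) ^ 2))"
      by (intro summable_mult) (use inverse_power_summable[of 2,
          where 'a=real] in \<open>simp only: summable_Suc_iff[of "\<lambda>k. inverse (real k ^ 2)"]\<close>)
  qed (use bound in auto)
  moreover have fs: "(\<Sum>i<n. f i x) = 2 * Re (sech_partial n x)" for n x
    by (simp add: sech_partial_pairs f_def sum_distrib_left)
  moreover have "suminf (\<lambda>i. f i x) = pi / cosh (pi * x)" for x
    using sech_partial_Re_limit[of x] unfolding fs[symmetric] sums_def[symmetric]
        by (simp add: sums_iff)
  ultimately have "uniform_limit UNIV (\<lambda>n x. 2 * Re (sech_partial n x)) (\<lambda>x. pi / cosh (pi * x))
      sequentially"
    by simp
  from uniform_limitD[OF this assms] show ?thesis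
    by (auto simp: eventually_sequentially dist_real_def intro: less_imp_le)
qed

text \<open>The pole of \<open>1 / (exp w - 1)\<close> at 0 is cancelled by \<open>1 / w\<close>,
  and the next ones, at \<open>2 * pi * \<i>\<close> and its conjugate, lie outside the strip:
  Taylor near 0, compactness on the rest of the rectangle.\<close>

lemma exp_m1_inverse_bounded:
  "\<exists>C. \<forall>w::complex. w \<noteq> 0 \<and> \<bar>Im w\<bar> \<le> pi \<and> 0 \<le> Re w \<and> Re w \<le> 1 \<longrightarrow> norm (1 / (exp w - 1) - 1 / w) \<le> C"
proof -
  have small: "norm (1 / (exp w - 1) - 1 / w) \<le> 4" if w: "w \<noteq> 0" "norm w \<le> 1/4" for w :: complex
  proof -
    have "norm (exp w - (\<Sum>k\<le>1. w ^ k / fact k)) \<le> exp (norm w) * (norm w ^ Suc 1) / fact 1"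
      by (rule Taylor_exp_field)
    then have e0: "norm (exp w - 1 - w) \<le> exp (norm w) * (norm w)^2"
      by (simp add: algebra_simps power2_eq_square)
    have "exp (norm w) \<le> 1 + 2 * norm w" using w by (intro real_exp_bound_lemma) auto
    then have "exp (norm w) \<le> 2" using w by linarith
    then have e1: "norm (exp w - 1 - w) \<le> 2 * norm w ^ 2"
      using e0 mult_right_mono[of "exp (norm w)" 2 "norm w ^ 2"] by simp
    have "2 * norm w ^ 2 \<le> norm w / 2"
      using w mult_right_mono[of "norm w" "1/4" "norm w"] by (simp add: power2_eq_square)
    moreover have "norm w - norm (exp w - 1) \<le> norm (exp w - 1 - w)"
      by (metis norm_minus_commute norm_triangle_ineq2)
    ultimately have e2: "norm w / 2 \<le> norm (exp w - 1)" using e1 by linarith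
    then have nz: "exp w - 1 \<noteq> 0" using w by auto
    then have "1 / (exp w - 1) - 1 / w = - (exp w - 1 - w) / (w * (exp w - 1))"
      using w by (simp add: field_simps)
    then have "norm (1 / (exp w - 1) - 1 / w) = norm (exp w - 1 - w) / (norm w * norm (exp w - 1))"
      by (simp add: norm_divide norm_mult norm_minus_commute)
    also have "\<dots> \<le> (2 * norm w ^ 2) / (norm w * (norm w / 2))"
      using e1 e2 w nz by (intro frac_le mult_left_mono) auto
    also have "\<dots> = 4" using w by (simp add: power2_eq_square)
    finally show ?thesis .
  qed
  define S where "S = {w::complex. \<bar>Im w\<bar> \<le> pi \<and> 0 \<le> Re w \<and> Re w \<le> 1 \<and> norm w \<ge> 1/4}"
  have "S = cbox (Complex 0 (-pi)) (Complex 1 pi) - ball 0 (1/4)"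
    by (auto simp: S_def in_cbox_complex_iff)
  then have "compact S" by (simp add: compact_diff)
  have ne: "exp w \<noteq> 1 \<and> w \<noteq> 0" if "w \<in> S" for w
  proof -
    have "exp w \<noteq> 1"
    proof
      assume "exp w = 1"
      then obtain n :: int where n: "Re w = 0" "Im w = of_int (2 * n) * pi" by (auto simp: exp_eq_1)
      then have "\<bar>of_int (2 * n)\<bar> * pi \<le> 1 * pi" using that by (simp add: S_def abs_mult)
      then have "\<bar>real_of_int (2 * n)\<bar> \<le> 1" using pi_gt_zero by (simp only: mult_le_cancel_right_pos)
      then have "n = 0" by linarith
      with n that show False by (auto simp: S_def complex_eq_iff cmod_def)
    qed
    with that show ?thesis by (auto simp: S_def)
  qed
  have "continuous_on S (\<lambda>w. 1 / (exp w - 1) - 1 / w)"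
    using ne by (auto intro!: continuous_intros)
  then have "compact ((\<lambda>w. 1 / (exp w - 1) - 1 / w) ` S)"
    using \<open>compact S\<close> by (rule compact_continuous_image)
  then obtain B where B: "\<And>w. w \<in> S \<Longrightarrow> norm (1 / (exp w - 1) - 1 / w) \<le> B"
    by (fastforce dest!: compact_imp_bounded simp: bounded_iff)
  show ?thesis
  proof (intro exI allI impI)
    fix w :: complex assume w: "w \<noteq> 0 \<and> \<bar>Im w\<bar> \<le> pi \<and> 0 \<le> Re w \<and> Re w \<le> 1"
    show "norm (1 / (exp w - 1) - 1 / w) \<le> max 4 B"
    proof (cases "norm w \<le> 1/4")
      case True then show ?thesis using small[of w] w by auto
    next
      case False then have "w \<in> S" using w by (auto simp: S_def)
      then show ?thesis using B[of w] by auto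
    qed
  qed
qed

section \<open>Discrete Fourier sums of the hyperbolic secant\<close>

lemma sech_alternating:
  fixes u :: real
  assumes "u > 0"
  shows "1 / (2 * cosh (u/2)) = (\<Sum>n<2*K. (-1)^n * exp (- (real n + 1/2) * u)) + exp (- (2 * real K
      + 1/2) * u) / (1 + exp (- u))"
proof (induction K)
  case 0
  have p: "1 + exp (- u) \<noteq> 0" using exp_gt_zero[of "-u"] by linarith
  have "exp (u/2) * exp (-(u/2)) = 1" by (simp flip: exp_add)
  moreover have "exp (-(u/2)) * exp (-(u/2)) = exp (-u)" by (simp flip: exp_add)
  ultimately have "2 * cosh (u/2) * exp (-(u/2)) = 1 + exp (-u)"
    by (simp add: cosh_def algebra_simps)
  then have "1 / (2 * cosh (u/2)) = exp (-(u/2)) / (1 + exp (-u))"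
    using p by (simp add: field_simps)
  then show ?case by simp
next
  case (Suc K)
  have p: "1 + exp (- u) \<noteq> 0" using exp_gt_zero[of "-u"] by linarith
  have e: "exp (- (2 * real K + 1 + 1/2) * u) = exp (- (2 * real K + 1/2) * u) * exp (-u)"
    "exp (- (2 * real (Suc K) + 1/2) * u) = exp (- (2 * real K + 1/2) * u) * exp (-u) * exp (-u)"
    by (simp_all add: algebra_simps flip: exp_add)
  have "exp (- (2 * real K + 1/2) * u) / (1 + exp (- u)) =
    exp (- (2 * real K + 1/2) * u) - exp (- (2 * real K + 1 + 1/2) * u) + exp (- (2 * real (Suc K)
        + 1/2) * u) / (1 + exp (-u))"
    unfolding e using p by (simp add: field_simps)
  moreover have "(\<Sum>n<2*Suc K. (-1)^n * exp (- (real n + 1/2) * u)) =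
     (\<Sum>n<2*K. (-1)^n * exp (- (real n + 1/2) * u)) + exp (- (2 * real K + 1/2) * u) - exp (- (2 * real K
         + 1 + 1/2) * u)"
    by (simp add: algebra_simps)
  ultimately show ?case using Suc by linarith
qed

lemma geometric_exp_sum:
  fixes w :: complex
  assumes "exp w \<noteq> 1"
  shows "(\<Sum>r=1..L. exp (- w * of_nat r)) = (1 - exp (- w * of_nat L)) / (exp w - 1)"
proof (induction L)
  case (Suc L)
  have "exp (- w * of_nat L) = exp w * exp (- w * of_nat (Suc L))"
    by (simp add: algebra_simps flip: exp_add)
  then show ?case using Suc assms by (simp add: field_simps del: of_nat_Suc)
qed simp

lemma geometric_exp_sum_real_le:
  fixes a :: real
  assumes "a > 0"
  shows "(\<Sum>r=1..L. exp (- a * real r)) \<le> 1 / a"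
proof -
  have "(\<Sum>r=1..L. exp (- a * real r)) = (1 - exp (- a * real L)) / (exp a - 1)"
  proof (induction L)
    case (Suc L)
    have "exp (- a * of_nat L) = exp a * exp (- a * of_nat (Suc L))"
      by (simp add: algebra_simps flip: exp_add)
    moreover have "exp a - 1 \<noteq> 0" using assms by simp
    ultimately show ?case using Suc by (simp add: field_simps del: of_nat_Suc)
  qed simp
  also have "\<dots> \<le> 1 / (exp a - 1)" using assms by (intro divide_right_mono) auto
  also have "a \<le> exp a - 1" using exp_ge_add_one_self[of a] by linarith
  then have "1 / (exp a - 1) \<le> 1 / a" using assms by (intro divide_left_mono) auto
  finally show ?thesis .
qed

text \<open>Expanding the secant into \<open>2 * K\<close> exponentials makes the sum over
  \<open>r\<close> geometric. There \<open>1 / (exp w - 1)\<close> is close to \<open>1 / w\<close>,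
  and \<open>h / w n\<close> is, up to sign, a term of \<open>sech_partial\<close>. The three errors
  come from the remainder of the expansion, from this replacement in each of \<open>2 * K\<close>
  terms, and from stopping at \<open>L\<close>.\<close>

lemma sech_sum_estimate:
  fixes h \<theta> :: real
  assumes C: "\<And>w::complex. w \<noteq> 0 \<and> \<bar>Im w\<bar> \<le> pi \<and> 0 \<le> Re w \<and> Re w \<le> 1 \<Longrightarrow> norm (1 / (exp w - 1) - 1 / w)
      \<le> C"
    and h: "h > 0" and K: "K \<ge> 1" "2 * real K * h \<le> 1" and \<theta>: "\<bar>\<theta>\<bar> \<le> pi"
  shows "norm (of_real h * (\<Sum>r=1..L. of_real (1 / (2 * cosh (h * real r / 2))) * cis (real r * \<theta>))
      - sech_partial K (\<theta> / h))
    \<le> 1 / (2 * real K) + 2 * real K * h * C + 4 * real K * exp (- h * real L / 2)"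
proof -
  define w where "w n = of_real (h * (real n + 1/2)) - \<i> * of_real \<theta>" for n :: nat
  define E where "E r = exp (- (2 * real K + 1/2) * (h * real r)) / (1 + exp (- (h * real r)))"
      for r :: nat
  have Rew: "Re (w n) = h * (real n + 1/2)" "Im (w n) = - \<theta>" for n by (simp_all add: w_def)
  have Rpos: "Re (w n) > 0" for n using h by (simp add: Rew)
  have wnz: "w n \<noteq> 0" for n using Rpos[of n] by auto
  \<comment> \<open>The real part of \<open>w n\<close> is at least \<open>h / 2\<close>, which
    keeps the denominators of the truncation terms away from 0.\<close>
  have low: "norm (exp (w n) - 1) \<ge> h / 2" for n
  proof -
    have "h / 2 \<le> h * (real n + 1/2)" using h by (simp add: algebra_simps)
    also have "\<dots> \<le> exp (Re (w n)) - 1" unfolding Rew using exp_ge_add_one_self[of "h * (real n + 1/2)"]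
        by linarith
    also have "\<dots> \<le> norm (exp (w n) - 1)" using norm_triangle_ineq2[of "exp (w n)" 1] by simp
    finally show ?thesis .
  qed
  then have enz: "exp (w n) \<noteq> 1" for n using h by (metis diff_self half_gt_zero_iff norm_zero not_less)
  have ex: "exp (- w n * of_nat r) = of_real (exp (- (real n + 1/2) * (h * real r))) * cis (real r * \<theta>)"
      for n r
    by (simp add: cis_conv_exp exp_of_real[symmetric] w_def algebra_simps flip: exp_add)
  have tm: "of_real (1 / (2 * cosh (h * real r / 2))) * cis (real r * \<theta>) =
      (\<Sum>n<2*K. (-1)^n * exp (- w n * of_nat r)) + of_real (E r) * cis (real r * \<theta>)" if "r \<in> {1..L}"
          for r
  proof -
    have "h * real r > 0" using that h by simp
    from sech_alternating[OF this, of K]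
    have "complex_of_real (1 / (2 * cosh (h * real r / 2))) =
        (\<Sum>n<2*K. (-1)^n * of_real (exp (- (real n + 1/2) * (h * real r)))) + of_real (E r)"
      by (simp add: E_def)
    then show ?thesis by (simp only: ex sum_distrib_right distrib_right mult.assoc)
  qed
  define A where "A n = (1 / (exp (w n) - 1) - 1 / w n) - exp (- w n * of_nat L) / (exp (w n) - 1)"
      for n
  have "(\<Sum>r=1..L. of_real (1 / (2 * cosh (h * real r / 2))) * cis (real r * \<theta>)) =
     (\<Sum>n<2*K. (-1)^n * (\<Sum>r=1..L. exp (- w n * of_nat r))) + (\<Sum>r=1..L. of_real (E r) * cis (real r * \<theta>))"
    unfolding sum_distrib_left
    by (subst sum.swap) (simp only: tm sum.distrib cong: sum.cong)
  also have "(\<Sum>n<2*K. (-1)^n * (\<Sum>r=1..L. exp (- w n * of_nat r))) = (\<Sum>n<2*K. (-1)^n * (1 / w n + A n))"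
    by (simp only: geometric_exp_sum[OF enz] A_def) (simp add: diff_divide_distrib)
  also have "\<dots> = (\<Sum>n<2*K. (-1)^n * (1 / w n)) + (\<Sum>n<2*K. (-1)^n * A n)"
    by (simp add: ring_distribs sum.distrib)
  finally have "of_real h * (\<Sum>r=1..L. of_real (1 / (2 * cosh (h * real r / 2))) * cis (real r * \<theta>)) =
     of_real h * (\<Sum>n<2*K. (-1)^n * (1 / w n)) + (\<Sum>n<2*K. of_real h * ((-1)^n * A n)) + (\<Sum>r=1..L. of_real
         (h * E r) * cis (real r * \<theta>))"
    by (simp add: ring_distribs sum_distrib_left mult.assoc)
  also have "of_real h * (\<Sum>n<2*K. (-1)^n * (1 / w n)) = sech_partial K (\<theta> / h)"
  proof -
    have "w n = of_real h * (of_nat n + 1/2 - \<i> * of_real (\<theta> / h))" for n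
      using h by (simp add: w_def algebra_simps)
    note wn = this
    have aux: "of_real h * (x * (1 / (of_real h * y))) = x / y" for x y :: complex
      using h by simp
    show ?thesis by (simp only: sech_partial_def sum_distrib_left wn aux)
  qed
  finally have dec: "of_real h * (\<Sum>r=1..L. of_real (1 / (2 * cosh (h * real r / 2))) * cis (real r * \<theta>))
      - sech_partial K (\<theta> / h)
      = (\<Sum>n<2*K. of_real h * ((-1)^n * A n)) + (\<Sum>r=1..L. of_real (h * E r) * cis (real r * \<theta>))" by simp
  have main: "norm (of_real h * (\<Sum>r=1..L. of_real (1 / (2 * cosh (h * real r / 2))) * cis (real r * \<theta>))
      - sech_partial K (\<theta> / h))
    \<le> (\<Sum>n<2*K. h * C + 2 * exp (- h * real L / 2)) + (\<Sum>r=1..L. h * exp (- ((2 * real K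
        + 1/2) * h) * real r))"
    unfolding dec
  proof (intro norm_triangle_mono sum_norm_le)
    fix n assume n: "n \<in> {..<2*K}"
    have "h * (real n + 1/2) \<le> h * (2 * real K)" using n h by (intro mult_left_mono) auto
    then have "Re (w n) \<le> 1" using K unfolding Rew by (simp add: algebra_simps)
    then have c: "norm (1 / (exp (w n) - 1) - 1 / w n) \<le> C" using C[of "w n"] wnz[of n] Rpos[of n] \<theta>
        by (auto simp: Rew)
    have "Re (- w n * of_nat L) = - (h * (real n + 1/2) * real L)" by (simp add: Rew)
    moreover have "h * real L / 2 \<le> h * (real n + 1/2) * real L" using h by (simp add: algebra_simps)
    ultimately have "Re (- w n * of_nat L) \<le> - h * real L / 2" by linarith
    then have "norm (exp (- w n * of_nat L)) \<le> exp (- h * real L / 2)"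
      by (simp only: norm_exp_eq_Re exp_le_cancel_iff)
    then have "norm (exp (- w n * of_nat L) / (exp (w n) - 1)) \<le> exp (- h * real L / 2) / (h / 2)"
      unfolding norm_divide using low[of n] h by (intro frac_le) auto
    then have "norm (A n) \<le> C + exp (- h * real L / 2) / (h / 2)"
      unfolding A_def using c by (intro order_trans[OF norm_triangle_ineq4]) linarith
    then have "h * norm (A n) \<le> h * (C + exp (- h * real L / 2) / (h / 2))" using h
        by (intro mult_left_mono) auto
    then show "norm (of_real h * ((-1)^n * A n)) \<le> h * C + 2 * exp (- h * real L / 2)"
      using h by (simp add: norm_mult norm_power ring_distribs)
  next
    fix r assume "r \<in> {1..L}"
    have "E r \<le> exp (- ((2 * real K + 1/2) * (h * real r))) / 1"
      unfolding E_def mult_minus_left by (intro divide_left_mono) (auto intro: add_pos_pos)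
    moreover have "E r \<ge> 0" unfolding E_def by (intro divide_nonneg_pos add_pos_pos) auto
    ultimately show "norm (of_real (h * E r) * cis (real r * \<theta>)) \<le> h * exp (- ((2 * real K
        + 1/2) * h) * real r)"
      using h by (simp add: norm_mult abs_mult mult.assoc)
  qed
  have "(\<Sum>r=1..L. h * exp (- ((2 * real K + 1/2) * h) * real r)) \<le> h * (1 / ((2 * real K + 1/2) * h))"
    unfolding sum_distrib_left[symmetric] using h by (intro mult_left_mono geometric_exp_sum_real_le)
        auto
  also have "h * (1 / ((2 * real K + 1/2) * h)) = 1 / (2 * real K + 1/2)"
    using h by simp
  also have "\<dots> \<le> 1 / (2 * real K)"
    using K by (intro divide_left_mono) auto
  finally show ?thesis using main by (simp add: algebra_simps)
qed

text \<open>The eigenvalues of the circulant with coefficients \<open>sech_coeff h\<close>: the 1/2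
  is the diagonal term \<open>1 / (2 * cosh 0)\<close>, and the factor 2 collects the two directions
  around the cycle.\<close>

definition sech_eig :: "real \<Rightarrow> nat \<Rightarrow> int \<Rightarrow> real" where
  "sech_eig h L p = (exp h - 1) * (1/2 + 2 * (\<Sum>r=1..L. cos (2 * pi * p * real r / (2 * real L
      + 1)) / (2 * cosh (h * real r / 2))))"

text \<open>The accuracy fixes \<open>K\<close>, then \<open>h\<close> must be small against
  \<open>1 / K\<close>, and \<open>L\<close> large for the given \<open>h\<close>; all of this is
  uniform in the frequency \<open>p\<close>.\<close>

lemma sech_eig_limit:
  assumes "e > 0"
  shows "\<exists>h0>0. \<forall>h. 0 < h \<and> h < h0 \<longrightarrow> (\<exists>L0. \<forall>L\<ge>L0. \<forall>p. \<bar>p\<bar> \<le> int L \<longrightarrow>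
    \<bar>sech_eig h L p - pi / cosh (pi * (2 * pi * p / ((2 * real L + 1) * h)))\<bar> \<le> e)"
proof -
  obtain C0 where C0: "\<And>w::complex. w \<noteq> 0 \<and> \<bar>Im w\<bar> \<le> pi \<and> 0 \<le> Re w \<and> Re w \<le> 1 \<Longrightarrow> norm (1 / (exp w - 1)
      - 1 / w) \<le> C0"
    using exp_m1_inverse_bounded by blast
  define C where "C = max C0 1"
  have C: "w \<noteq> 0 \<and> \<bar>Im w\<bar> \<le> pi \<and> 0 \<le> Re w \<and> Re w \<le> 1 \<Longrightarrow> norm (1 / (exp w - 1) - 1 / w) \<le> C"
      for w :: complex
    using C0[of w] by (auto simp: C_def)
  have C1: "C \<ge> 1" by (simp add: C_def)
  \<comment> \<open>The errors below add up to \<open>2 * (8 * d) + 4 * d\<close>.\<close>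
  define d where "d = e / 32"
  have d: "d > 0" using assms by (simp add: d_def)
  obtain K0 where K0: "\<And>K \<xi>. K \<ge> K0 \<Longrightarrow> \<bar>2 * Re (sech_partial K \<xi>) - pi / cosh (pi * \<xi>)\<bar> \<le> d"
    using sech_partial_uniform[OF d] by blast
  obtain K1 :: nat where K1: "real K1 > 1 / d" using reals_Archimedean2 by blast
  define K where "K = max (max K0 K1) 1"
  have K: "K \<ge> 1" "K \<ge> K0" "real K > 1 / d" using K1 by (auto simp: K_def)
  then have Kd: "1 / real K \<le> d" using d by (simp add: field_simps)
  define h0 where "h0 = min (1/2) (min (1 / (2 * real K)) (d / (4 * real K * C)))"
  have h0: "h0 > 0" using K C1 d by (simp add: h0_def)
  show ?thesis
  proof (intro exI[of _ h0] conjI h0 allI impI)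
    fix h assume "0 < h \<and> h < h0"
    then have h: "0 < h" "h < 1/2" "h < 1 / (2 * real K)" "h < d / (4 * real K * C)"
        by (auto simp: h0_def)
    have h2: "2 * real K * h \<le> 1" using h(3) K by (simp add: field_simps)
    have h3: "4 * real K * C * h \<le> d" using h(4) K C1 by (simp add: field_simps)
    have "1 * h \<le> 4 * real K * C * h" using h K C1 by (intro mult_right_mono) (auto intro!:
        mult_ge1_I[of "4 * real K" C])
    then have h4: "h \<le> d" using h3 by linarith
    have "((\<lambda>L. 4 * real K * exp (- h * real L / 2)) \<longlongrightarrow> 4 * real K * 0) sequentially"
      using h by (intro tendsto_intros filterlim_compose[OF exp_at_bot]) real_asymp
    then have "eventually (\<lambda>L. 4 * real K * exp (- h * real L / 2) < d) sequentially"
      using d by (intro order_tendstoD) auto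
    then obtain L0 where L0: "\<And>L. L \<ge> L0 \<Longrightarrow> 4 * real K * exp (- h * real L / 2) < d"
      by (auto simp: eventually_sequentially)
    show "\<exists>L0. \<forall>L\<ge>L0. \<forall>p. \<bar>p\<bar> \<le> int L \<longrightarrow>
      \<bar>sech_eig h L p - pi / cosh (pi * (2 * pi * p / ((2 * real L + 1) * h)))\<bar> \<le> e"
    proof (intro exI[of _ L0] allI impI)
      fix L and p :: int assume L: "L \<ge> L0" and p: "\<bar>p\<bar> \<le> int L"
      define \<theta> where "\<theta> = 2 * pi * p / (2 * real L + 1)"
      have "\<bar>real_of_int p\<bar> \<le> real L" using p by linarith
      then have "2 * \<bar>real_of_int p\<bar> / (2 * real L + 1) \<le> 1" by simp
      then have "pi * (2 * \<bar>real_of_int p\<bar> / (2 * real L + 1)) \<le> pi * 1" by (intro mult_left_mono) auto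
      then have \<theta>: "\<bar>\<theta>\<bar> \<le> pi" by (simp add: \<theta>_def abs_mult mult_ac)
      define F where "F = pi / cosh (pi * (\<theta> / h))"
      have F: "\<bar>F\<bar> \<le> pi" by (simp add: F_def cosh_real_ge_1 divide_le_eq mult_le_cancel_left1)
      define V where "V = (\<Sum>r=1..L. of_real (1 / (2 * cosh (h * real r / 2))) * cis (real r * \<theta>))"
      have "norm (of_real h * V - sech_partial K (\<theta> / h)) \<le> 1 / (2 * real K) + 2 * real K * h * C
          + 4 * real K * exp (- h * real L / 2)"
        unfolding V_def using C h h2 K \<theta> by (intro sech_sum_estimate) auto
      also have "\<dots> \<le> d + d + d"
        using L0[OF L] Kd h3 d by (intro add_mono) (auto simp: field_simps)
      finally have "\<bar>Re (of_real h * V - sech_partial K (\<theta> / h))\<bar> \<le> 3 * d"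
        using abs_Re_le_cmod[of "of_real h * V - sech_partial K (\<theta> / h)"] by linarith
      then have "\<bar>h * Re V - Re (sech_partial K (\<theta> / h))\<bar> \<le> 3 * d" by simp
      moreover have "\<bar>2 * Re (sech_partial K (\<theta> / h)) - F\<bar> \<le> d" unfolding F_def by (rule K0[OF K(2)])
      ultimately have X: "\<bar>(h/2 + 2 * (h * Re V)) - F\<bar> \<le> 8 * d" using h4 h by linarith
      have ReV: "Re V = (\<Sum>r=1..L. cos (2 * pi * p * real r / (2 * real L + 1)) / (2 * cosh (h * real r /
          2)))"
        by (simp add: V_def \<theta>_def field_simps)
      \<comment> \<open>The model carries the prefactor \<open>exp h - 1\<close>, the Riemann sum
        the step \<open>h\<close>; their ratio is within \<open>h\<close> of 1.\<close>
      define k where "k = (exp h - 1) / h"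
      have "exp h \<le> 1 + h + h\<^sup>2" using h by (intro exp_bound) auto
      then have k: "k \<le> 1 + h" "k \<ge> 1" using h exp_ge_add_one_self[of h]
          by (simp_all add: k_def divide_simps algebra_simps power2_eq_square)
      have "sech_eig h L p = k * (h/2 + 2 * (h * Re V))"
        unfolding sech_eig_def ReV[symmetric] k_def using h by (simp add: field_simps)
      then have "sech_eig h L p - F = k * ((h/2 + 2 * (h * Re V)) - F) + (k - 1) * F"
          by (simp add: algebra_simps)
      also have "\<bar>\<dots>\<bar> \<le> k * (8 * d) + h * pi"
        using X F k h by (intro order_trans[OF abs_triangle_ineq] add_mono) (auto simp: abs_mult intro!:
            mult_mono)
      also have "\<dots> \<le> 2 * (8 * d) + d * 4"
        using k h h4 d pi_less_4 by (intro add_mono mult_mono) auto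
      also have "\<dots> \<le> e" using assms by (simp add: d_def)
      finally show "\<bar>sech_eig h L p - pi / cosh (pi * (2 * pi * p / ((2 * real L + 1) * h)))\<bar> \<le> e"
        by (simp add: F_def \<theta>_def)
    qed
  qed
qed

section \<open>Piecewise continuous symbols and step functions\<close>

text \<open>A jump is switched on strictly after its position; estimates avoid the finitely many
  points of \<open>P\<close>, so the convention there is harmless.\<close>

definition step_fun :: "complex \<Rightarrow> real set \<Rightarrow> (real \<Rightarrow> complex) \<Rightarrow> real \<Rightarrow> complex" where
  "step_fun s P d \<theta> = s + (\<Sum>p\<in>P. if p < \<theta> then d p else 0)"

text \<open>One-sided limits give an approximation with at most one jump near each point, and
  approximations on adjacent intervals can be glued; Bolzano's bisection principle passes from local
  to global.\<close>

lemma regulated_step_approx: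
  fixes f :: "real \<Rightarrow> complex"
  assumes lim: "\<And>x. \<exists>l. ((\<lambda>\<epsilon>. f (x + \<epsilon>)) \<longlongrightarrow> l) (at_right 0)" "\<And>x. \<exists>l. ((\<lambda>\<epsilon>. f (x - \<epsilon>)) \<longlongrightarrow> l) (at_right 0)"
    and e: "e > 0" and ab: "a \<le> b"
  shows "\<exists>s P d. finite P \<and> P \<subseteq> {a<..<b} \<and> (\<forall>\<theta>\<in>{a<..<b} - P. cmod (f \<theta> - step_fun s P d \<theta>) \<le> e)"
  using ab
proof (induction a b rule: Bolzano)
  case (trans a b c)
  then obtain s P d s' P' d' where
    1: "finite P" "P \<subseteq> {a<..<b}" "\<And>\<theta>. \<theta> \<in> {a<..<b} - P \<Longrightarrow> cmod (f \<theta> - step_fun s P d \<theta>) \<le> e" and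
    2: "finite P'" "P' \<subseteq> {b<..<c}" "\<And>\<theta>. \<theta> \<in> {b<..<c} - P' \<Longrightarrow> cmod (f \<theta> - step_fun s' P' d' \<theta>) \<le> e"
    by blast
  show ?case
  proof (cases "a = b \<or> b = c")
    case True
    then show ?thesis using trans by auto
  next
    case False
    then have abc: "a < b" "b < c" using trans by auto
    \<comment> \<open>At the seam \<open>b\<close> the jump leads from the final value
      \<open>s + sum d P\<close> of the left function to the initial value \<open>s'\<close> of the
      right one.\<close>
    define D where "D p = (if p < b then d p else if p = b then s' - s - (\<Sum>p\<in>P. d p) else d' p)" for p
    have "p < b" if "p \<in> P" for p using 1(2) that by auto
    moreover have "b < p" if "p \<in> P'" for p using 2(2) that by auto
    ultimately have dis: "P \<inter> insert b P' = {}" "b \<notin> P'" by fastforce+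
    have st: "step_fun s (P \<union> insert b P') D \<theta> = s + (\<Sum>p\<in>P. if p < \<theta> then d p else 0) +
        (if b < \<theta> then s' - s - (\<Sum>p\<in>P. d p) else 0) + (\<Sum>p\<in>P'. if p < \<theta> then d' p else 0)" for \<theta>
    proof -
      have "(\<Sum>p\<in>P. if p < \<theta> then D p else 0) = (\<Sum>p\<in>P. if p < \<theta> then d p else 0)"
        using 1 by (intro sum.cong) (auto simp: D_def)
      moreover have "(\<Sum>p\<in>P'. if p < \<theta> then D p else 0) = (\<Sum>p\<in>P'. if p < \<theta> then d' p else 0)"
        using 2 by (intro sum.cong) (auto simp: D_def)
      ultimately show ?thesis unfolding step_fun_def
        using 1 2 dis by (subst sum.union_disjoint) (auto simp: D_def)
    qed
    show ?thesis
    proof (intro exI[of _ s] exI[of _ "P \<union> insert b P'"] exI[of _ D] conjI ballI)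
      show "finite (P \<union> insert b P')" "P \<union> insert b P' \<subseteq> {a<..<c}" using 1 2 abc by auto
      fix \<theta> assume \<theta>: "\<theta> \<in> {a<..<c} - (P \<union> insert b P')"
      show "cmod (f \<theta> - step_fun s (P \<union> insert b P') D \<theta>) \<le> e"
      proof (cases "\<theta> < b")
        case True
        have "(\<Sum>p\<in>P'. if p < \<theta> then d' p else 0) = 0" using 2 True by (intro sum.neutral) auto
        then have "step_fun s (P \<union> insert b P') D \<theta> = step_fun s P d \<theta>" unfolding st using True
            by (simp add: step_fun_def)
        then show ?thesis using 1(3)[of \<theta>] \<theta> True by auto
      next
        case False
        then have gt: "b < \<theta>" using \<theta> by auto
        have "(\<Sum>p\<in>P. if p < \<theta> then d p else 0) = (\<Sum>p\<in>P. d p)" using 1 gt by (intro sum.cong) auto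
        then have "step_fun s (P \<union> insert b P') D \<theta> = step_fun s' P' d' \<theta>" unfolding st using gt
            by (simp add: step_fun_def)
        then show ?thesis using 2(3)[of \<theta>] \<theta> gt by auto
      qed
    qed
  qed
next
  case (local x)
  obtain l1 l2 where l1: "((\<lambda>\<epsilon>. f (x + \<epsilon>)) \<longlongrightarrow> l1) (at_right 0)" and l2:
      "((\<lambda>\<epsilon>. f (x - \<epsilon>)) \<longlongrightarrow> l2) (at_right 0)"
    using lim by blast
  obtain r1 where r1: "r1 > 0" "\<And>\<epsilon>. 0 < \<epsilon> \<Longrightarrow> \<epsilon> < r1 \<Longrightarrow> cmod (f (x + \<epsilon>) - l1) < e"
    using tendstoD[OF l1 e] unfolding eventually_at_right_field dist_norm by auto
  obtain r2 where r2: "r2 > 0" "\<And>\<epsilon>. 0 < \<epsilon> \<Longrightarrow> \<epsilon> < r2 \<Longrightarrow> cmod (f (x - \<epsilon>) - l2) < e"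
    using tendstoD[OF l2 e] unfolding eventually_at_right_field dist_norm by auto
  have R: "cmod (f \<theta> - l1) \<le> e" if "x < \<theta>" "\<theta> < x + r1" for \<theta>
    using r1(2)[of "\<theta> - x"] that by simp
  have Lf: "cmod (f \<theta> - l2) \<le> e" if "\<theta> < x" "x - r2 < \<theta>" for \<theta>
    using r2(2)[of "x - \<theta>"] that by simp
  show ?case
  proof (intro exI[of _ "min r1 r2"] conjI allI impI)
    show "0 < min r1 r2" using r1 r2 by simp
    fix a b assume ab: "a \<le> x \<and> x \<le> b \<and> b - a < min r1 r2"
    show "\<exists>s P d. finite P \<and> P \<subseteq> {a<..<b} \<and> (\<forall>\<theta>\<in>{a<..<b} - P. cmod (f \<theta> - step_fun s P d \<theta>) \<le> e)"
    proof (cases "a = x \<or> b = x")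
      case True
      then show ?thesis
      proof
        assume "a = x"
        then show ?thesis using R ab
          by (intro exI[of _ l1] exI[of _ "{}"] exI[of _ "\<lambda>_. 0"]) (auto simp: step_fun_def)
      next
        assume "b = x"
        then show ?thesis using Lf ab
          by (intro exI[of _ l2] exI[of _ "{}"] exI[of _ "\<lambda>_. 0"]) (auto simp: step_fun_def)
      qed
    next
      case False
      then show ?thesis using R Lf ab
        by (intro exI[of _ l2] exI[of _ "{x}"] exI[of _ "\<lambda>_. l1 - l2"]) (auto simp: step_fun_def)
    qed
  qed
qed

lemma PC_limits:
  assumes "\<omega> \<in> PC"
  shows "((\<lambda>\<epsilon>. \<omega> (cis (x + \<epsilon>))) \<longlongrightarrow> lim_plus \<omega> (cis x)) (at_right 0)"
    "((\<lambda>\<epsilon>. \<omega> (cis (x - \<epsilon>))) \<longlongrightarrow> lim_minus \<omega> (cis x)) (at_right 0)"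
proof -
  have "cis x \<in> sphere 0 1" by simp
  then obtain l1 l2 where l: "((\<lambda>\<epsilon>. \<omega> (cis x * cis \<epsilon>)) \<longlongrightarrow> l1) (at_right 0)"
      "((\<lambda>\<epsilon>. \<omega> (cis x * cis (- \<epsilon>))) \<longlongrightarrow> l2) (at_right 0)"
    using assms unfolding PC_def by blast
  then have "lim_plus \<omega> (cis x) = l1" "lim_minus \<omega> (cis x) = l2"
    unfolding lim_plus_def lim_minus_def by (auto intro!: tendsto_Lim)
  then show "((\<lambda>\<epsilon>. \<omega> (cis (x + \<epsilon>))) \<longlongrightarrow> lim_plus \<omega> (cis x)) (at_right 0)"
    "((\<lambda>\<epsilon>. \<omega> (cis (x - \<epsilon>))) \<longlongrightarrow> lim_minus \<omega> (cis x)) (at_right 0)"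
    using l by (simp_all add: cis_mult)
qed

lemma borel_measurable_cnj [measurable (raw)]:
  "f \<in> borel_measurable M \<Longrightarrow> (\<lambda>x. cnj (f x)) \<in> borel_measurable M"
proof -
  have "cnj \<in> borel_measurable borel"
    by (intro borel_measurable_continuous_onI continuous_on_cnj continuous_on_id)
  then show "f \<in> borel_measurable M \<Longrightarrow> (\<lambda>x. cnj (f x)) \<in> borel_measurable M"
    by (rule measurable_compose[rotated])
qed

lemma step_fun_measurable [measurable]: "step_fun s P d \<in> borel_measurable borel"
  unfolding step_fun_def[abs_def] by measurable

lemma step_fun_bounded: "cmod (step_fun s P d \<theta>) \<le> cmod s + (\<Sum>p\<in>P. cmod (d p))"
  unfolding step_fun_def
  by (intro order_trans[OF norm_triangle_ineq] add_left_mono order_trans[OF norm_sum] sum_mono) auto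

text \<open>\<open>PC\<close> does not mention measurability. It follows because the symbol is a
  uniform limit of step functions off finite sets.\<close>

lemma PC_measurable:
  assumes "\<omega> \<in> PC"
  shows "(\<lambda>\<theta>. if 0 < \<theta> \<and> \<theta> < 2 * pi then \<omega> (cis \<theta>) else 0) \<in> borel_measurable borel" (is "?F \<in> _")
proof -
  have "\<exists>s P d. finite P \<and> P \<subseteq> {0<..<2*pi} \<and> (\<forall>\<theta>\<in>{0<..<2*pi} - P. cmod (\<omega> (cis \<theta>) - step_fun s P d \<theta>)
      \<le> inverse (real (Suc n)))" for n
    by (rule regulated_step_approx) (use PC_limits[OF assms] in auto)
  then obtain s P d where spd: "\<And>n. finite (P n)" "\<And>n \<theta>. \<theta> \<in> {0<..<2*pi} - P n \<Longrightarrow>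
      cmod (\<omega> (cis \<theta>) - step_fun (s n) (P n) (d n) \<theta>) \<le> inverse (real (Suc n))"
    by metis
  define H where "H n \<theta> = (if 0 < \<theta> \<and> \<theta> < 2 * pi then step_fun (s n) (P n) (d n) \<theta> else 0)" for n \<theta>
  \<comment> \<open>Equal to \<open>?F\<close> on the exceptional set, so that convergence holds at
    every point; a change at finitely many points preserves measurability.\<close>
  define K where "K n \<theta> = (if \<theta> \<in> P n then ?F \<theta> else H n \<theta>)" for n \<theta>
  have [measurable]: "H n \<in> borel_measurable borel" for n unfolding H_def[abs_def] by measurable
  have "K n \<in> borel_measurable borel" for n
    by (rule measurable_discrete_difference[where X="P n" and f="H n"])
      (use spd(1) in \<open>auto simp: K_def intro: countable_finite\<close>)
  moreover have "(\<lambda>n. K n \<theta>) \<longlonglongrightarrow> ?F \<theta>" for \<theta>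
  proof -
    have "dist (K n \<theta>) (?F \<theta>) \<le> inverse (real (Suc n))" for n
      using spd(2)[of \<theta> n] by (auto simp: K_def H_def dist_norm norm_minus_commute)
    then show ?thesis
      by (intro metric_tendsto_imp_tendsto[OF LIMSEQ_inverse_real_of_nat] always_eventually allI) (simp
          add: dist_norm)
  qed
  ultimately show ?thesis by (rule borel_measurable_LIMSEQ_metric)
qed

section \<open>Fourier coefficients and Hankel forms\<close>

definition fcoef :: "(real \<Rightarrow> complex) \<Rightarrow> int \<Rightarrow> complex" where
  "fcoef F n = (LINT \<theta>:{0..2 * pi}|lebesgue. F \<theta> * cis (- (real_of_int n * \<theta>))) / complex_of_real (2 *
      pi)"

lemma bounded_set_integrable:
  fixes F :: "real \<Rightarrow> complex"
  assumes "F \<in> borel_measurable borel" "\<And>\<theta>. cmod (F \<theta>) \<le> B"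
  shows "set_integrable lebesgue {a..b} F"
  unfolding set_integrable_def
proof (rule integrableI_bounded_set_indicator)
  show "F \<in> borel_measurable lebesgue" using assms(1) by (simp add: measurable_completion)
  show "AE x in lebesgue. x \<in> {a..b} \<longrightarrow> cmod (F x) \<le> B" using assms by auto
qed (auto simp: emeasure_completion emeasure_lborel_Icc_eq)

lemma cis_measurable [measurable]: "(\<lambda>\<theta>. cis (c * \<theta>)) \<in> borel_measurable borel"
  by (intro borel_measurable_continuous_onI continuous_intros)

lemma integral_cis:
  assumes "c \<noteq> 0" "a \<le> b"
  shows "(LINT \<theta>:{a..b}|lebesgue. cis (c * \<theta>)) = (cis (c * b) - cis (c * a)) / (\<i> * of_real c)"
proof -
  have si: "set_integrable lebesgue {a..b} (\<lambda>\<theta>. cis (c * \<theta>))" by (rule bounded_set_integrable[of _ 1])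
      auto
  have "((\<lambda>\<theta>. cis (c * \<theta>)) has_integral (cis (c * b) / (\<i> * of_real c) - cis (c * a) / (\<i> * of_real c)))
      {a..b}"
  proof (rule fundamental_theorem_of_calculus[OF assms(2)])
    fix x
    have "((\<lambda>x. exp (\<i> * of_real c * of_real x) / (\<i> * of_real c)) has_vector_derivative exp (\<i> *
        of_real c * of_real x)) (at x within {a..b})"
      using assms by (auto intro!: derivative_eq_intros has_vector_derivative_real_field)
    then show "((\<lambda>x. cis (c * x) / (\<i> * of_real c)) has_vector_derivative cis (c * x)) (at x within
        {a..b})"
      by (simp add: cis_conv_exp mult.assoc)
  qed
  then show ?thesis
    using set_lebesgue_integral_eq_integral(2)[OF si] by (simp add: integral_unique diff_divide_distrib)
qed

lemma integral_cis_period: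
  "(LINT \<theta>:{0..2*pi}|lebesgue. cis (real_of_int m * \<theta>)) = (if m = 0 then of_real (2 * pi) else 0)"
proof (cases "m = 0")
  case True
  then show ?thesis by (simp add: set_lebesgue_integral_def emeasure_completion scaleR_conv_of_real
      measure_completion)
next
  case False
  have "cis (real_of_int m * (2 * pi)) = 1"
    using cis_multiple_2pi[of "real_of_int m"] by (simp add: mult_ac)
  then show ?thesis using False by (subst integral_cis) auto
qed

lemma set_integral_sum:
  fixes f :: "'i \<Rightarrow> real \<Rightarrow> complex"
  assumes "\<And>i. i \<in> I \<Longrightarrow> set_integrable M A (f i)"
  shows "(LINT x:A|M. (\<Sum>i\<in>I. f i x)) = (\<Sum>i\<in>I. LINT x:A|M. f i x)"
  using assms unfolding set_lebesgue_integral_def set_integrable_def by (simp add: scaleR_sum_right)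

lemma set_integral_double_sum:
  fixes f :: "'i \<Rightarrow> 'j \<Rightarrow> real \<Rightarrow> complex"
  assumes "\<And>i j. set_integrable M A (f i j)"
  shows "(LINT x:A|M. (\<Sum>i\<in>I. \<Sum>j\<in>J. f i j x)) = (\<Sum>i\<in>I. \<Sum>j\<in>J. LINT x:A|M. f i j x)"
proof -
  have "set_integrable M A (\<lambda>x. \<Sum>j\<in>J. f i j x)" for i
    using assms unfolding set_integrable_def by (simp add: scaleR_sum_right)
  then show ?thesis using assms by (simp add: set_integral_sum)
qed

lemma trig_parseval:
  "(LINT \<theta>:{0..2*pi}|lebesgue. (\<Sum>j<n. x j * cis (- (real j * \<theta>))) * cnj (\<Sum>j<n. x j * cis (- (real j *
      \<theta>)))) = of_real (2 * pi * (\<Sum>j<n. (cmod (x j))\<^sup>2))"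
proof -
  have e: "(\<Sum>j<n. x j * cis (- (real j * \<theta>))) * cnj (\<Sum>j<n. x j * cis (- (real j * \<theta>))) =
      (\<Sum>j<n. \<Sum>k<n. (x j * cnj (x k)) * cis (real_of_int (int k - int j) * \<theta>))" for \<theta>
    unfolding cnj_sum sum_product
    by (intro sum.cong refl) (simp add: cis_cnj cis_mult algebra_simps)
  have si: "set_integrable lebesgue {0..2*pi} (\<lambda>\<theta>. (x j * cnj (x k)) * cis (real_of_int (int k
      - int j) * \<theta>))" for j k
    by (intro set_integrable_mult_right bounded_set_integrable[of _ 1]) auto
  have "(LINT \<theta>:{0..2*pi}|lebesgue. (\<Sum>j<n. x j * cis (- (real j * \<theta>))) * cnj (\<Sum>j<n. x j * cis (- (real j
      * \<theta>)))) =
      (\<Sum>j<n. \<Sum>k<n. (x j * cnj (x k)) * (if int k - int j = 0 then of_real (2 * pi) else 0))"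
    unfolding e set_integral_double_sum[OF si] set_integral_mult_right integral_cis_period ..
  also have "\<dots> = (\<Sum>j<n. (x j * cnj (x j)) * of_real (2 * pi))"
    by (intro sum.cong refl) (auto simp: sum.delta if_distrib cong: if_cong)
  also have "\<dots> = of_real (2 * pi * (\<Sum>j<n. (cmod (x j))\<^sup>2))"
    by (simp add: complex_norm_square[symmetric] sum_distrib_left mult.commute)
  finally show ?thesis .
qed

text \<open>The easy half of Nehari's theorem. As the matrix depends on \<open>j + k\<close> and
  neither argument is conjugated, the form is the mean of \<open>F * X * Y\<close> with
  trigonometric polynomials \<open>X\<close> and \<open>Y\<close>; the inequality of the means and
  Parseval bound it.\<close>

lemma hankel_form_bound:
  assumes F: "F \<in> borel_measurable borel" "\<And>\<theta>. cmod (F \<theta>) \<le> B"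
  shows "cmod (\<Sum>j<n. \<Sum>k<n. fcoef F (int (j + k)) * x j * y k) \<le> B / 2 * ((\<Sum>j<n. (cmod (x j))\<^sup>2)
      + (\<Sum>k<n. (cmod (y k))\<^sup>2))"
proof -
  define X where "X \<theta> = (\<Sum>j<n. x j * cis (- (real j * \<theta>)))" for \<theta>
  define Y where "Y \<theta> = (\<Sum>j<n. y j * cis (- (real j * \<theta>)))" for \<theta>
  have B0: "B \<ge> 0" using F(2)[of 0] norm_ge_zero order_trans by blast
  have [measurable]: "F \<in> borel_measurable borel" by fact
  have cm: "(\<lambda>\<theta>. cis (- (c * \<theta>))) \<in> borel_measurable borel" for c
    using cis_measurable[of "- c"] by simp
  have [measurable]: "X \<in> borel_measurable borel" "Y \<in> borel_measurable borel"
    unfolding X_def[abs_def] Y_def[abs_def] using cm by measurable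
  have Xb: "cmod (X \<theta>) \<le> (\<Sum>j<n. cmod (x j))" for \<theta>
    unfolding X_def by (intro order_trans[OF norm_sum] sum_mono) (simp add: norm_mult)
  have Yb: "cmod (Y \<theta>) \<le> (\<Sum>j<n. cmod (y j))" for \<theta>
    unfolding Y_def by (intro order_trans[OF norm_sum] sum_mono) (simp add: norm_mult)
  have si: "set_integrable lebesgue {0..2*pi} (\<lambda>\<theta>. F \<theta> * cis (- (real_of_int m * \<theta>)))" for m
    using F cm by (intro bounded_set_integrable[of _ B]) (auto simp: norm_mult)
  have si2: "set_integrable lebesgue {0..2*pi} (\<lambda>\<theta>. F \<theta> * cis (- (real_of_int m * \<theta>)) * u * v)"
      for m u v
    using si by (intro set_integrable_mult_left) auto
  have tm: "fcoef F m * u * v = (LINT \<theta>:{0..2*pi}|lebesgue. F \<theta> * cis (- (real_of_int m * \<theta>)) * u * v) /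
      of_real (2 * pi)" for m u v
    unfolding fcoef_def set_integral_mult_left by simp
  have "(\<Sum>j<n. \<Sum>k<n. fcoef F (int (j + k)) * x j * y k) = (\<Sum>j<n. \<Sum>k<n. LINT \<theta>:{0..2*pi}|lebesgue. F \<theta> *
      cis (- (real_of_int (int (j + k)) * \<theta>)) * x j * y k) / of_real (2 * pi)"
    unfolding tm sum_divide_distrib ..
  also have "(\<Sum>j<n. \<Sum>k<n. LINT \<theta>:{0..2*pi}|lebesgue. F \<theta> * cis (- (real_of_int (int (j + k)) * \<theta>)) * x j
      * y k)
      = (LINT \<theta>:{0..2*pi}|lebesgue. (\<Sum>j<n. \<Sum>k<n. F \<theta> * cis (- (real_of_int (int (j + k)) * \<theta>)) * x j * y
          k))"
    by (rule set_integral_double_sum[OF si2, symmetric])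
  also have "\<dots> = (LINT \<theta>:{0..2*pi}|lebesgue. F \<theta> * (X \<theta> * Y \<theta>))"
  proof -
    have "(\<Sum>j<n. \<Sum>k<n. F \<theta> * cis (- (real_of_int (int (j + k)) * \<theta>)) * x j * y k) = F \<theta> * (X \<theta> * Y \<theta>)"
        for \<theta>
    proof -
      have XY: "X \<theta> * Y \<theta> = (\<Sum>j<n. \<Sum>k<n. x j * cis (- (real j * \<theta>)) * (y k * cis (- (real k * \<theta>))))"
        unfolding X_def Y_def by (rule sum_product)
      show ?thesis unfolding XY sum_distrib_left
        by (intro sum.cong refl) (simp add: cis_mult algebra_simps)
    qed
    then show ?thesis by simp
  qed
  finally have eq: "(\<Sum>j<n. \<Sum>k<n. fcoef F (int (j + k)) * x j * y k) = (LINT \<theta>:{0..2*pi}|lebesgue. F \<theta> *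
      (X \<theta> * Y \<theta>)) / of_real (2 * pi)" .
  \<comment> \<open>The real part of \<open>G\<close> is the pointwise majorant of the integrand,
    and its integral is known from Parseval.\<close>
  define G where "G \<theta> = complex_of_real (B / 2) * (X \<theta> * cnj (X \<theta>) + Y \<theta> * cnj (Y \<theta>))" for \<theta>
  have siX: "set_integrable lebesgue {0..2*pi} (\<lambda>\<theta>. X \<theta> * cnj (X \<theta>))"
    by (rule bounded_set_integrable[of _ "(\<Sum>j<n. cmod (x j)) * (\<Sum>j<n. cmod (x j))"])
      (auto simp: norm_mult intro!: mult_mono Xb sum_nonneg)
  have siY: "set_integrable lebesgue {0..2*pi} (\<lambda>\<theta>. Y \<theta> * cnj (Y \<theta>))"
    by (rule bounded_set_integrable[of _ "(\<Sum>j<n. cmod (y j)) * (\<Sum>j<n. cmod (y j))"])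
      (auto simp: norm_mult intro!: mult_mono Yb sum_nonneg)
  have siG: "set_integrable lebesgue {0..2*pi} G"
    unfolding G_def by (intro set_integrable_mult_right set_integral_add(1) siX siY)
  have IG: "(LINT \<theta>:{0..2*pi}|lebesgue. G \<theta>) = of_real (B / 2 * (2 * pi * (\<Sum>j<n. (cmod (x j))\<^sup>2)
      + 2 * pi * (\<Sum>j<n. (cmod (y j))\<^sup>2)))"
    unfolding G_def set_integral_mult_right set_integral_add(2)[OF siX siY]
    unfolding X_def Y_def trig_parseval by simp
  have "cmod (LINT \<theta>:{0..2*pi}|lebesgue. F \<theta> * (X \<theta> * Y \<theta>)) \<le> (LINT \<theta>:{0..2*pi}|lebesgue. Re (G \<theta>))"
    unfolding set_lebesgue_integral_def
  proof (rule order_trans[OF integral_norm_bound integral_mono])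
    have "set_integrable lebesgue {0..2*pi} (\<lambda>\<theta>. F \<theta> * (X \<theta> * Y \<theta>))"
      using F Xb Yb B0 by (intro bounded_set_integrable[of _ "B * ((\<Sum>j<n. cmod (x j)) * (\<Sum>j<n. cmod (y
          j)))"])
        (auto simp: norm_mult intro!: mult_mono sum_nonneg mult_nonneg_nonneg)
    then show "integrable lebesgue (\<lambda>\<theta>. cmod (indicat_real {0..2*pi} \<theta> *\<^sub>R (F \<theta> * (X \<theta> * Y \<theta>))))"
      unfolding set_integrable_def by (rule integrable_norm)
    have "integrable lebesgue (\<lambda>\<theta>. Re (indicat_real {0..2*pi} \<theta> *\<^sub>R G \<theta>))"
      using siG unfolding set_integrable_def by (rule integrable_Re)
    then show "integrable lebesgue (\<lambda>\<theta>. indicat_real {0..2*pi} \<theta> *\<^sub>R Re (G \<theta>))" by simp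
    fix \<theta>
    have "cmod (F \<theta> * (X \<theta> * Y \<theta>)) \<le> B * (((cmod (X \<theta>))\<^sup>2 + (cmod (Y \<theta>))\<^sup>2) / 2)"
      unfolding norm_mult using F B0 sum_squares_bound[of "cmod (X \<theta>)" "cmod (Y \<theta>)"]
          by (intro mult_mono) auto
    also have "\<dots> = Re (G \<theta>)"
      by (simp add: G_def complex_norm_square[symmetric] del: of_real_power)
    finally show "cmod (indicat_real {0..2*pi} \<theta> *\<^sub>R (F \<theta> * (X \<theta> * Y \<theta>)))
        \<le> indicat_real {0..2*pi} \<theta> *\<^sub>R Re (G \<theta>)"
      by (auto simp: indicator_def)
  qed
  also have "\<dots> = Re (LINT \<theta>:{0..2*pi}|lebesgue. G \<theta>)"
    using siG integral_Re[of lebesgue "\<lambda>\<theta>. indicat_real {0..2*pi} \<theta> *\<^sub>R G \<theta>"]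
    unfolding set_lebesgue_integral_def set_integrable_def by simp
  finally show ?thesis
    unfolding eq IG by (simp add: norm_divide divide_simps) (simp add: algebra_simps)
qed

section \<open>Symmetric step symbols\<close>

text \<open>The symmetry of the symbol relates \<open>\<theta>\<close> to
  \<open>2 * pi - \<theta>\<close>, so only the upper half circle is approximated. Reflecting the
  step function keeps its Fourier coefficients real.\<close>

definition sym_step :: "complex \<Rightarrow> real set \<Rightarrow> (real \<Rightarrow> complex) \<Rightarrow> real \<Rightarrow> complex" where
  "sym_step s P d \<theta> = (if \<theta> \<le> pi then step_fun s P d \<theta> else cnj (step_fun s P d (2 * pi - \<theta>)))"

lemma integral_indicator_cis:
  assumes "0 \<le> a" "a \<le> b" "b \<le> 2 * pi"
  shows "(LINT \<theta>:{0..2*pi}|lebesgue. (if a < \<theta> \<and> \<theta> < b then 1 else 0) * cis (c * \<theta>))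
      = (LINT \<theta>:{a..b}|lebesgue. cis (c * \<theta>))"
  unfolding set_lebesgue_integral_def
  by (rule integral_discrete_difference[of "{a, b}"]) (use assms in \<open>auto simp: indicator_def
      emeasure_completion\<close>)

lemma integral_cis_reflect:
  assumes "0 \<le> p" "p \<le> pi"
  shows "(LINT \<theta>:{pi..2 * pi - p}|lebesgue. cis (- real_of_int n * \<theta>)) = cnj (LINT \<theta>:{p..pi}|lebesgue.
      cis (- real_of_int n * \<theta>))"
proof (cases "n = 0")
  case True
  then show ?thesis using assms
    by (simp add: set_lebesgue_integral_def measure_completion scaleR_conv_of_real)
next
  case False
  have 1: "cis (- real_of_int n * (2 * pi - p)) = cis (real_of_int n * p)"
  proof -
    have "cis (- real_of_int n * (2 * pi - p)) = cis (2 * pi * real_of_int (- n)) * cis (real_of_int n *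
        p)"
      by (simp add: cis_mult algebra_simps)
    then show ?thesis using cis_multiple_2pi[of "real_of_int (- n)"] by simp
  qed
  have 2: "cis (real_of_int n * pi) = cis (- real_of_int n * pi)"
  proof -
    have "cis (real_of_int n * pi) = cis (2 * pi * real_of_int n) * cis (- real_of_int n * pi)"
      by (simp add: cis_mult algebra_simps)
    then show ?thesis using cis_multiple_2pi[of "real_of_int n"] by simp
  qed
  have flip: "(x - y) / z = (y - x) / (- z)" for x y z :: complex
    by (metis minus_diff_eq minus_divide_divide)
  have "(LINT \<theta>:{pi..2 * pi - p}|lebesgue. cis (- real_of_int n * \<theta>)) =
      (cis (real_of_int n * p) - cis (- real_of_int n * pi)) / (\<i> * of_real (- real_of_int n))"
    unfolding 1[symmetric] using False assms by (intro integral_cis) auto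
  also have "\<dots> = (cis (real_of_int n * pi) - cis (real_of_int n * p)) / (- (\<i> * of_real (- real_of_int
      n)))"
    unfolding 2 by (rule flip)
  also have "\<dots> = cnj ((cis (- real_of_int n * pi) - cis (- real_of_int n * p)) / (\<i> * of_real (-
      real_of_int n)))"
    by (simp add: cis_cnj)
  also have "(cis (- real_of_int n * pi) - cis (- real_of_int n * p)) / (\<i> * of_real (- real_of_int n))
      = (LINT \<theta>:{p..pi}|lebesgue. cis (- real_of_int n * \<theta>))"
    using False assms by (intro integral_cis[symmetric]) auto
  finally show ?thesis .
qed

text \<open>A jump and its mirror image contribute complex conjugate integrals, hence the real
  part.\<close>

lemma fcoef_sym_step:
  assumes P: "finite P" "P \<subseteq> {0<..<pi}"
  shows "fcoef (sym_step s P d) n = of_real (Re (s * (LINT \<theta>:{0..pi}|lebesgue. cis (- real_of_int n *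
      \<theta>)) +
    (\<Sum>p\<in>P. d p * (LINT \<theta>:{p..pi}|lebesgue. cis (- real_of_int n * \<theta>)))) / pi)"
proof -
  define c where "c = - real_of_int n"
  define I where "I a b = (LINT \<theta>:{a..b}|lebesgue. cis (c * \<theta>))" for a b
  define J where "J a b \<theta> = (if a < \<theta> \<and> \<theta> < b then 1 else 0) * cis (c * \<theta>)" for a b \<theta>
  \<comment> \<open>The finitely many angles at which the representation by indicators may fail; the
    integral does not see them.\<close>
  define E where "E = P \<union> {0, pi, 2 * pi} \<union> (\<lambda>p. 2 * pi - p) ` P"
  have siJ: "set_integrable lebesgue {0..2*pi} (J a b)" for a b
    by (rule bounded_set_integrable[of _ 1]) (auto simp: J_def[abs_def])
  have siJu: "set_integrable lebesgue {0..2*pi} (\<lambda>\<theta>. u * J a b \<theta>)" for a b u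
    using siJ by (intro set_integrable_mult_right) auto
  have IJ: "set_lebesgue_integral lebesgue {0..2*pi} (J a b) = I a b" if "0 \<le> a" "a \<le> b" "b \<le> 2 * pi"
      for a b
    unfolding J_def[abs_def] I_def integral_indicator_cis[OF that] ..
  have off: "sym_step s P d \<theta> * cis (c * \<theta>) = s * J 0 pi \<theta> + cnj s * J pi (2*pi) \<theta> +
      (\<Sum>p\<in>P. d p * J p pi \<theta> + cnj (d p) * J pi (2*pi - p) \<theta>)" if "\<theta> \<in> {0..2*pi}" "\<theta> \<notin> E" for \<theta>
  proof (cases "\<theta> < pi")
    case True
    have "(\<Sum>p\<in>P. d p * J p pi \<theta> + cnj (d p) * J pi (2*pi - p) \<theta>) = (\<Sum>p\<in>P. (if p
        < \<theta> then d p else 0) * cis (c * \<theta>))"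
      using True by (intro sum.cong) (auto simp: J_def)
    then show ?thesis using True that
      by (auto simp: sym_step_def step_fun_def J_def E_def ring_distribs sum_distrib_right)
  next
    case False
    then have gt: "pi < \<theta>" "\<theta> < 2 * pi" using that by (auto simp: E_def)
    have "(\<Sum>p\<in>P. d p * J p pi \<theta> + cnj (d p) * J pi (2*pi - p) \<theta>) = (\<Sum>p\<in>P. cnj (if p
        < 2 * pi - \<theta> then d p else 0) * cis (c * \<theta>))"
      using gt by (intro sum.cong) (auto simp: J_def)
    then show ?thesis using gt
      by (simp add: sym_step_def step_fun_def J_def ring_distribs sum_distrib_right)
  qed
  have "(LINT \<theta>:{0..2*pi}|lebesgue. sym_step s P d \<theta> * cis (c * \<theta>)) =
      (LINT \<theta>:{0..2*pi}|lebesgue. (s * J 0 pi \<theta> + cnj s * J pi (2*pi) \<theta>) + (\<Sum>p\<in>P. d p * J p pi \<theta>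
          + cnj (d p) * J pi (2*pi - p) \<theta>))"
    unfolding set_lebesgue_integral_def
    by (rule integral_discrete_difference[of E])
      (use P off in \<open>auto simp: E_def indicator_def emeasure_completion intro: countable_finite\<close>)
  also have "\<dots> = (s * I 0 pi + cnj s * I pi (2*pi)) + (\<Sum>p\<in>P. d p * I p pi + cnj (d p) * I pi (2*pi
      - p))"
  proof -
    have sis: "set_integrable lebesgue {0..2*pi} (\<lambda>\<theta>. d p * J p pi \<theta> + cnj (d p) * J pi (2*pi - p) \<theta>)"
        for p
      by (intro set_integral_add(1) siJu)
    have sis2: "set_integrable lebesgue {0..2*pi} (\<lambda>\<theta>. \<Sum>p\<in>P. d p * J p pi \<theta> + cnj (d p) * J pi (2*pi
        - p) \<theta>)"
      using sis unfolding set_integrable_def by (simp add: scaleR_sum_right)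
    have "(LINT \<theta>:{0..2*pi}|lebesgue. (\<Sum>p\<in>P. d p * J p pi \<theta> + cnj (d p) * J pi (2*pi - p) \<theta>))
        = (\<Sum>p\<in>P. d p * I p pi + cnj (d p) * I pi (2*pi - p))"
      unfolding set_integral_sum[OF sis]
    proof (rule sum.cong[OF refl])
      fix p assume "p \<in> P"
      then have "0 \<le> p" "p \<le> pi" "pi \<le> 2 * pi" "pi \<le> 2 * pi - p" "2 * pi - p \<le> 2 * pi" "0 \<le> pi" using P
          by auto
      then show "(LINT \<theta>:{0..2*pi}|lebesgue. d p * J p pi \<theta> + cnj (d p) * J pi (2*pi - p) \<theta>)
          = d p * I p pi + cnj (d p) * I pi (2*pi - p)"
        by (subst set_integral_add(2)[OF siJu siJu]) (simp add: IJ)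
    qed
    then show ?thesis
      by (subst set_integral_add(2)[OF set_integral_add(1)[OF siJu siJu] sis2], subst
          set_integral_add(2)[OF siJu siJu]) (simp add: IJ)
  qed
  also have "\<dots> = (s * I 0 pi + cnj (s * I 0 pi)) + (\<Sum>p\<in>P. d p * I p pi + cnj (d p * I p pi))"
  proof -
    have "I pi (2*pi - p) = cnj (I p pi)" if "0 \<le> p" "p \<le> pi" for p
      unfolding I_def c_def by (rule integral_cis_reflect[OF that])
    from this[of 0] this show ?thesis using P by (auto intro!: sum.cong simp: subset_iff less_imp_le)
  qed
  also have "\<dots> = of_real (2 * Re (s * I 0 pi + (\<Sum>p\<in>P. d p * I p pi)))"
    unfolding complex_add_cnj by (simp add: sum_distrib_left)
  finally have e: "(LINT \<theta>:{0..2*pi}|lebesgue. sym_step s P d \<theta> * cis (c * \<theta>))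
      = of_real (2 * Re (s * I 0 pi + (\<Sum>p\<in>P. d p * I p pi)))" .
  define R where "R = Re (s * I 0 pi + (\<Sum>p\<in>P. d p * I p pi))"
  have "fcoef (sym_step s P d) n = of_real (2 * R) / of_real (2 * pi)"
    unfolding R_def e[symmetric] by (simp only: fcoef_def c_def mult_minus_left)
  also have "\<dots> = of_real (R / pi)" by simp
  finally show ?thesis by (simp only: R_def I_def c_def)
qed

text \<open>Integration over \<open>{p..pi}\<close> leaves boundary terms at \<open>p\<close> and at
  \<open>pi\<close>. The latter give \<open>(-1) ^ n\<close>, the oscillation belonging to the point
  -1, while the term without oscillation belongs to the point 1.\<close>

lemma fcoef_sym_step_pos:
  assumes P: "finite P" "P \<subseteq> {0<..<pi}" and n: "n \<ge> 1"
  shows "fcoef (sym_step s P d) (int n) = of_real ((Im s + (\<Sum>p\<in>P. Im (d p * cis (- (real n * p))))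
      - (-1) ^ n * Im (s + (\<Sum>p\<in>P. d p))) / (pi * real n))"
proof -
  have I: "(LINT \<theta>:{p..pi}|lebesgue. cis (- real_of_int (int n) * \<theta>)) = (cis (- (real n * p))
      - (-1) ^ n) / (\<i> * of_nat n)" if "p \<le> pi" for p
  proof -
    have "cis (- (real n * pi)) = (-1) ^ n"
    proof -
      have "cis (- pi) = -1" by (simp add: complex_eq_iff)
      moreover have "cis (- (real n * pi)) = cis (- pi) ^ n" by (subst Complex.DeMoivre) simp
      ultimately show ?thesis by (simp only:)
    qed
    then show ?thesis using n that by (subst integral_cis) (auto simp: divide_simps algebra_simps)
  qed
  have R: "Re (w / (\<i> * of_nat n)) = Im w / real n" for w
    using n by (simp add: Re_divide power2_eq_square)
  have pw: "Im (z * (-1) ^ n) = (-1) ^ n * Im z" for z :: complex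
    by (cases "even n") auto
  have m1: "((-1) ^ n :: complex) = of_real ((-1) ^ n)" by simp
  have "Re (s * (LINT \<theta>:{0..pi}|lebesgue. cis (- real_of_int (int n) * \<theta>)) + (\<Sum>p\<in>P. d p * (LINT
      \<theta>:{p..pi}|lebesgue. cis (- real_of_int (int n) * \<theta>))))
     = Re (s * (1 - (-1) ^ n) / (\<i> * of_nat n)) + (\<Sum>p\<in>P. Re (d p * (cis (- (real n * p))
         - (-1) ^ n) / (\<i> * of_nat n)))"
  proof -
    have "(\<Sum>p\<in>P. d p * (LINT \<theta>:{p..pi}|lebesgue. cis (- real_of_int (int n) * \<theta>)))
        = (\<Sum>p\<in>P. d p * (cis (- (real n * p)) - (-1) ^ n) / (\<i> * of_nat n))"
      using P I by (intro sum.cong) (auto simp: subset_iff less_imp_le)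
    then show ?thesis using I[of 0] by simp
  qed
  also have "\<dots> = (Im s - (-1) ^ n * Im s) / real n + (\<Sum>p\<in>P. (Im (d p * cis (- (real n * p)))
      - (-1) ^ n * Im (d p)) / real n)"
    unfolding R right_diff_distrib by (simp only: minus_complex.sel pw mult_1_right)
  also have "\<dots> = (Im s + (\<Sum>p\<in>P. Im (d p * cis (- (real n * p)))) - (-1) ^ n * Im (s + (\<Sum>p\<in>P. d p))) /
      real n"
  proof -
    have "(\<Sum>p\<in>P. (Im (d p * cis (- (real n * p))) - (-1) ^ n * Im (d p)) / real n) =
        ((\<Sum>p\<in>P. Im (d p * cis (- (real n * p)))) - (-1) ^ n * (\<Sum>p\<in>P. Im (d p))) / real n"
      by (simp only: sum_divide_distrib[symmetric] sum_subtractf sum_distrib_left[symmetric])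
    then show ?thesis by (simp only: add_divide_distrib diff_divide_distrib plus_complex.sel Im_sum
        distrib_left)
  qed
  finally show ?thesis unfolding fcoef_sym_step[OF P] by (simp add: mult.commute)
qed

lemma sym_step_measurable: "sym_step s P d \<in> borel_measurable borel"
proof -
  have "step_fun s P d \<circ> (\<lambda>\<theta>. 2 * pi - \<theta>) \<in> borel_measurable borel"
    by (rule measurable_comp[OF _ step_fun_measurable]) simp
  then have [measurable]: "(\<lambda>\<theta>. step_fun s P d (2 * pi - \<theta>)) \<in> borel_measurable borel"
      by (simp add: o_def)
  show ?thesis unfolding sym_step_def[abs_def] by measurable
qed

lemma sym_step_bounded: "cmod (sym_step s P d \<theta>) \<le> cmod s + (\<Sum>p\<in>P. cmod (d p))"
  using step_fun_bounded[of s P d] by (simp add: sym_step_def)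

text \<open>Splits off a remainder \<open>\<rho>\<close> whose Hankel operator has norm at most
  \<open>e\<close> by \<open>hankel_form_bound\<close>, leaving explicit coefficients.
  \<open>\<rho>\<close> is 0 at the exceptional angles so that its bound holds everywhere.\<close>

lemma symbol_step_approx:
  assumes pc: "\<omega> \<in> PC" and sym: "\<And>v. v \<in> sphere 0 1 \<Longrightarrow> \<omega> v = cnj (\<omega> (cnj v))" and e: "e > 0"
  obtains s P d \<rho> where "finite P" "P \<subseteq> {0<..<pi}" "\<rho> \<in> borel_measurable borel" "\<And>\<theta>. cmod (\<rho> \<theta>) \<le> e"
    "\<And>n. fourier_coeff \<omega> n = fcoef \<rho> n + fcoef (sym_step s P d) n"
    "\<And>\<theta>. \<theta> \<in> {0<..<pi} - P \<Longrightarrow> cmod (\<omega> (cis \<theta>) - step_fun s P d \<theta>) \<le> e"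
proof -
  have "\<exists>s P d. finite P \<and> P \<subseteq> {0<..<pi} \<and> (\<forall>\<theta>\<in>{0<..<pi} - P. cmod (\<omega> (cis \<theta>) - step_fun s P d \<theta>) \<le> e)"
    by (rule regulated_step_approx) (use PC_limits[OF pc] e in auto)
  then obtain s P d where P: "finite P" "P \<subseteq> {0<..<pi}" and st: "\<And>\<theta>. \<theta> \<in> {0<..<pi} - P \<Longrightarrow>
      cmod (\<omega> (cis \<theta>) - step_fun s P d \<theta>) \<le> e"
    by blast
  define E where "E = P \<union> {pi} \<union> (\<lambda>p. 2 * pi - p) ` P"
  have fE: "finite E" using P by (simp add: E_def)
  define \<rho> where "\<rho> \<theta> = (if 0 < \<theta> \<and> \<theta> < 2 * pi \<and> \<theta> \<notin> E then \<omega> (cis \<theta>) - sym_step s P d \<theta> else 0)" for \<theta>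
  have mr: "\<rho> \<in> borel_measurable borel"
  proof (rule measurable_discrete_difference[where X=E and f="\<lambda>\<theta>. (if 0 < \<theta> \<and> \<theta>
      < 2 * pi then \<omega> (cis \<theta>) else 0) - (if 0 < \<theta> \<and> \<theta> < 2 * pi then sym_step s P d \<theta> else 0)"])
    have [measurable]: "sym_step s P d \<in> borel_measurable borel" by (rule sym_step_measurable)
    show "(\<lambda>\<theta>. (if 0 < \<theta> \<and> \<theta> < 2 * pi then \<omega> (cis \<theta>) else 0) - (if 0 < \<theta> \<and> \<theta>
        < 2 * pi then sym_step s P d \<theta> else 0)) \<in> borel_measurable borel"
      by (intro borel_measurable_diff PC_measurable[OF pc]) measurable
  qed (use fE in \<open>auto simp: \<rho>_def intro: countable_finite\<close>)
  have br: "cmod (\<rho> \<theta>) \<le> e" for \<theta>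
  proof (cases "0 < \<theta> \<and> \<theta> < 2 * pi \<and> \<theta> \<notin> E")
    case True
    show ?thesis
    proof (cases "\<theta> \<le> pi")
      case le: True
      then have "\<theta> \<in> {0<..<pi} - P" using True by (auto simp: E_def)
      then show ?thesis using st True le by (simp add: \<rho>_def sym_step_def)
    next
      case False
      then have "2 * pi - \<theta> \<in> {0<..<pi} - P" using True by (auto simp: E_def image_iff)
      moreover have "\<omega> (cis \<theta>) = cnj (\<omega> (cis (2 * pi - \<theta>)))"
        using sym[of "cis \<theta>"] by (simp add: cis_cnj) (metis cis_2pi cis_mult diff_conv_add_uminus
            mult_1)
      ultimately show ?thesis using st[of "2 * pi - \<theta>"] True False
        by (simp add: \<rho>_def sym_step_def flip: complex_cnj_diff)
    qed
  next
    case False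
    then show ?thesis using e by (auto simp: \<rho>_def)
  qed
  have f: "fourier_coeff \<omega> n = fcoef \<rho> n + fcoef (sym_step s P d) n" for n
  proof -
    have cm: "(\<lambda>\<theta>. cis (- (real_of_int n * \<theta>))) \<in> borel_measurable borel"
      using cis_measurable[of "- real_of_int n"] by simp
    have s1: "set_integrable lebesgue {0..2*pi} (\<lambda>\<theta>. \<rho> \<theta> * cis (- (real_of_int n * \<theta>)))"
      using mr br cm by (intro bounded_set_integrable[of _ e]) (auto simp: norm_mult)
    have s2: "set_integrable lebesgue {0..2*pi} (\<lambda>\<theta>. sym_step s P d \<theta> * cis (- (real_of_int n * \<theta>)))"
      using sym_step_measurable cm sym_step_bounded by (intro bounded_set_integrable) (auto simp:
          norm_mult)
    have "(LINT \<theta>:{0..2*pi}|lebesgue. \<omega> (cis \<theta>) * cis (- (real_of_int n * \<theta>))) =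
      (LINT \<theta>:{0..2*pi}|lebesgue. \<rho> \<theta> * cis (- (real_of_int n * \<theta>)) + sym_step s P d \<theta> * cis (-
          (real_of_int n * \<theta>)))"
      unfolding set_lebesgue_integral_def
    proof (rule integral_discrete_difference[of "E \<union> {0, 2*pi}"])
      show "countable (E \<union> {0, 2*pi})" using fE by (intro countable_finite) auto
    qed (auto simp: indicator_def \<rho>_def emeasure_completion algebra_simps)
    then show ?thesis unfolding fourier_coeff_def fcoef_def set_integral_add(2)[OF s1 s2]
        by (simp add: add_divide_distrib)
  qed
  show ?thesis by (rule that[OF P mr br f st])
qed

section \<open>Jumps of the symbol against jumps of the step function\<close>

lemma step_fun_right_const:
  assumes "finite P"
  shows "\<forall>\<^sub>F \<epsilon> in at_right 0. step_fun s P d (x + \<epsilon>) = s + (\<Sum>p\<in>P. if p \<le> x then d p else 0)"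
proof -
  have "\<forall>\<^sub>F \<epsilon> in at_right 0. \<forall>p\<in>P. (p < x + \<epsilon>) = (p \<le> x)"
    unfolding eventually_ball_finite_distrib[OF assms]
  proof
    fix p
    show "\<forall>\<^sub>F \<epsilon> in at_right 0. (p < x + \<epsilon>) = (p \<le> x)"
    proof (cases "p \<le> x")
      case True
      then show ?thesis by (auto simp: eventually_at_right_field intro!: exI[of _ 1])
    next
      case False
      then show ?thesis by (auto simp: eventually_at_right_field intro!: exI[of _ "p - x"])
    qed
  qed
  then show ?thesis by eventually_elim (auto simp: step_fun_def intro!: sum.cong)
qed

lemma step_fun_left_const:
  assumes "finite P"
  shows "\<forall>\<^sub>F \<epsilon> in at_right 0. step_fun s P d (x - \<epsilon>) = s + (\<Sum>p\<in>P. if p < x then d p else 0)"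
proof -
  have "\<forall>\<^sub>F \<epsilon> in at_right 0. \<forall>p\<in>P. (p < x - \<epsilon>) = (p < x)"
    unfolding eventually_ball_finite_distrib[OF assms]
  proof
    fix p
    show "\<forall>\<^sub>F \<epsilon> in at_right 0. (p < x - \<epsilon>) = (p < x)"
    proof (cases "p < x")
      case False
      then show ?thesis by (auto simp: eventually_at_right_field intro!: exI[of _ 1])
    next
      case True
      then show ?thesis by (auto simp: eventually_at_right_field intro!: exI[of _ "x - p"])
    qed
  qed
  then show ?thesis by eventually_elim (auto simp: step_fun_def intro!: sum.cong)
qed

lemma eventually_avoid_finite:
  fixes P :: "real set"
  assumes "finite P"
  shows "\<forall>\<^sub>F \<epsilon> in at_right 0. x + \<epsilon> \<notin> P" "\<forall>\<^sub>F \<epsilon> in at_right 0. x - \<epsilon> \<notin> P"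
proof -
  have "\<forall>\<^sub>F \<epsilon> in at_right 0. \<forall>p\<in>P. x + \<epsilon> \<noteq> p"
    unfolding eventually_ball_finite_distrib[OF assms]
  proof
    fix p show "\<forall>\<^sub>F \<epsilon> in at_right 0. x + \<epsilon> \<noteq> p"
      by (cases "p \<le> x") (auto simp: eventually_at_right_field intro!: exI[of _
          "if p \<le> x then 1 else p - x"])
  qed
  then show "\<forall>\<^sub>F \<epsilon> in at_right 0. x + \<epsilon> \<notin> P" by eventually_elim auto
  have "\<forall>\<^sub>F \<epsilon> in at_right 0. \<forall>p\<in>P. x - \<epsilon> \<noteq> p"
    unfolding eventually_ball_finite_distrib[OF assms]
  proof
    fix p show "\<forall>\<^sub>F \<epsilon> in at_right 0. x - \<epsilon> \<noteq> p"
      by (cases "x \<le> p") (auto simp: eventually_at_right_field intro!: exI[of _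
          "if x \<le> p then 1 else x - p"])
  qed
  then show "\<forall>\<^sub>F \<epsilon> in at_right 0. x - \<epsilon> \<notin> P" by eventually_elim auto
qed

lemma step_limits_close:
  assumes pc: "\<omega> \<in> PC" and P: "finite P"
    and st: "\<And>\<theta>. \<theta> \<in> {0<..<pi} - P \<Longrightarrow> cmod (\<omega> (cis \<theta>) - step_fun s P d \<theta>) \<le> e"
  shows "0 \<le> x \<Longrightarrow> x < pi \<Longrightarrow> cmod (lim_plus \<omega> (cis x) - (s + (\<Sum>p\<in>P. if p \<le> x then d p else 0))) \<le> e"
    and "0 < x \<Longrightarrow> x \<le> pi \<Longrightarrow> cmod (lim_minus \<omega> (cis x) - (s + (\<Sum>p\<in>P. if p < x then d p else 0))) \<le> e"
proof -
  assume x: "0 \<le> x" "x < pi"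
  have "((\<lambda>\<epsilon>. cmod (\<omega> (cis (x + \<epsilon>)) - (s + (\<Sum>p\<in>P. if p \<le> x then d p else 0)))) \<longlongrightarrow>
    cmod (lim_plus \<omega> (cis x) - (s + (\<Sum>p\<in>P. if p \<le> x then d p else 0)))) (at_right 0)"
    by (intro tendsto_intros PC_limits[OF pc])
  moreover have "\<forall>\<^sub>F \<epsilon> in at_right 0. cmod (\<omega> (cis (x + \<epsilon>)) - (s + (\<Sum>p\<in>P. if p \<le> x then d p else 0)))
      \<le> e"
  proof -
    have "\<forall>\<^sub>F \<epsilon> in at_right 0. 0 < \<epsilon> \<and> \<epsilon> < pi - x" using x by (auto simp: eventually_at_right_field
        intro!: exI[of _ "pi - x"])
    with step_fun_right_const[OF P, of s d x] eventually_avoid_finite(1)[OF P, of x] show ?thesis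
    proof eventually_elim
      case (elim \<epsilon>)
      then show ?case using st[of "x + \<epsilon>"] x by auto
    qed
  qed
  ultimately show "cmod (lim_plus \<omega> (cis x) - (s + (\<Sum>p\<in>P. if p \<le> x then d p else 0))) \<le> e"
    by (rule tendsto_upperbound) simp
next
  assume x: "0 < x" "x \<le> pi"
  have "((\<lambda>\<epsilon>. cmod (\<omega> (cis (x - \<epsilon>)) - (s + (\<Sum>p\<in>P. if p < x then d p else 0)))) \<longlongrightarrow>
    cmod (lim_minus \<omega> (cis x) - (s + (\<Sum>p\<in>P. if p < x then d p else 0)))) (at_right 0)"
    by (intro tendsto_intros PC_limits[OF pc])
  moreover have "\<forall>\<^sub>F \<epsilon> in at_right 0. cmod (\<omega> (cis (x - \<epsilon>)) - (s + (\<Sum>p\<in>P. if p < x then d p else 0)))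
      \<le> e"
  proof -
    have "\<forall>\<^sub>F \<epsilon> in at_right 0. 0 < \<epsilon> \<and> \<epsilon> < x" using x by (auto simp: eventually_at_right_field intro!:
        exI[of _ x])
    with step_fun_left_const[OF P, of s d x] eventually_avoid_finite(2)[OF P, of x] show ?thesis
    proof eventually_elim
      case (elim \<epsilon>)
      then show ?case using st[of "x - \<epsilon>"] x by auto
    qed
  qed
  ultimately show "cmod (lim_minus \<omega> (cis x) - (s + (\<Sum>p\<in>P. if p < x then d p else 0))) \<le> e"
    by (rule tendsto_upperbound) simp
qed

text \<open>Each one-sided limit is within \<open>e\<close> of the corresponding step value, and the
  division by 2 in \<open>half_jump\<close> averages the two errors.\<close>

lemma half_jump_interior_close:
  assumes pc: "\<omega> \<in> PC" and P: "finite P"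
    and st: "\<And>\<theta>. \<theta> \<in> {0<..<pi} - P \<Longrightarrow> cmod (\<omega> (cis \<theta>) - step_fun s P d \<theta>) \<le> e"
    and x: "0 < x" "x < pi"
  shows "cmod (half_jump \<omega> (cis x) - (if x \<in> P then d x else 0) / 2) \<le> e"
proof -
  define A B where A: "A = s + (\<Sum>p\<in>P. if p \<le> x then d p else 0)" and B: "B = s + (\<Sum>p\<in>P. if p
      < x then d p else 0)"
  have "A - B = (\<Sum>p\<in>P. (if p \<le> x then d p else 0) - (if p < x then d p else 0))"
      by (simp add: sum_subtractf A B)
  also have "\<dots> = (\<Sum>p\<in>P. if p = x then d p else 0)" by (intro sum.cong) auto
  also have "\<dots> = (if x \<in> P then d x else 0)" using P by simp
  finally have AB: "(if x \<in> P then d x else 0) = A - B" ..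
  have "half_jump \<omega> (cis x) - (A - B) / 2 = ((lim_plus \<omega> (cis x) - A) - (lim_minus \<omega> (cis x) - B)) / 2"
    by (simp add: half_jump_def field_simps)
  then have "cmod (half_jump \<omega> (cis x) - (A - B) / 2) = cmod ((lim_plus \<omega> (cis x) - A) - (lim_minus \<omega>
      (cis x) - B)) / 2"
    by (simp only: norm_divide norm_numeral)
  also have "\<dots> \<le> (e + e) / 2"
  proof -
    have "cmod (lim_plus \<omega> (cis x) - A) \<le> e" "cmod (lim_minus \<omega> (cis x) - B) \<le> e"
      unfolding A B using x by (auto intro!: step_limits_close[OF pc P st])
    then show ?thesis
      by (intro divide_right_mono order_trans[OF norm_triangle_ineq4[of "_ - A"
          "_ - B"] add_mono]) simp_all
  qed
  finally show ?thesis unfolding AB by simp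
qed

text \<open>At 1 and -1 conjugation exchanges the two sides, so the limit along the upper half
  circle determines the whole jump, and approximation between 0 and \<open>pi\<close> suffices there
  too.\<close>

lemma half_jump_real_points:
  assumes pc: "\<omega> \<in> PC" and sym: "\<And>v. v \<in> sphere 0 1 \<Longrightarrow> \<omega> v = cnj (\<omega> (cnj v))"
  shows "half_jump \<omega> 1 = \<i> * of_real (Im (lim_plus \<omega> (cis 0)))"
    "half_jump \<omega> (- 1) = \<i> * of_real (- Im (lim_minus \<omega> (cis pi)))"
proof -
  have c: "cnj (cis \<theta>) = cis (- \<theta>)" for \<theta> by (simp add: cis_cnj)
  have sy: "\<omega> (cis \<theta>) = cnj (\<omega> (cis (- \<theta>)))" for \<theta> using sym[of "cis \<theta>"] by (simp add: c)
  have "((\<lambda>\<epsilon>. cnj (\<omega> (cis (0 + \<epsilon>)))) \<longlongrightarrow> cnj (lim_plus \<omega> (cis 0))) (at_right 0)"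
    by (intro tendsto_intros PC_limits[OF pc])
  moreover have "cnj (\<omega> (cis (0 + \<epsilon>))) = \<omega> (cis (0 - \<epsilon>))" for \<epsilon> using sy[of "- \<epsilon>"] by simp
  ultimately have "((\<lambda>\<epsilon>. \<omega> (cis (0 - \<epsilon>))) \<longlongrightarrow> cnj (lim_plus \<omega> (cis 0))) (at_right 0)" by simp
  with PC_limits(2)[OF pc, of 0] have "lim_minus \<omega> (cis 0) = cnj (lim_plus \<omega> (cis 0))"
    using tendsto_unique[OF trivial_limit_at_right_real] by blast
  then show "half_jump \<omega> 1 = \<i> * of_real (Im (lim_plus \<omega> (cis 0)))"
    by (simp add: half_jump_def complex_eq_iff)
  have "((\<lambda>\<epsilon>. cnj (\<omega> (cis (pi - \<epsilon>)))) \<longlongrightarrow> cnj (lim_minus \<omega> (cis pi))) (at_right 0)"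
    by (intro tendsto_intros PC_limits[OF pc])
  moreover have "cnj (\<omega> (cis (pi - \<epsilon>))) = \<omega> (cis (pi + \<epsilon>))" for \<epsilon>
  proof -
    have "cis (- (pi + \<epsilon>)) = cis (pi - \<epsilon>)" by (simp add: cis.ctr complex_eq_iff cos_diff sin_diff
        cos_add sin_add)
    then show ?thesis using sy[of "pi + \<epsilon>"] by simp
  qed
  ultimately have "((\<lambda>\<epsilon>. \<omega> (cis (pi + \<epsilon>))) \<longlongrightarrow> cnj (lim_minus \<omega> (cis pi))) (at_right 0)" by simp
  with PC_limits(1)[OF pc, of pi] have "lim_plus \<omega> (cis pi) = cnj (lim_minus \<omega> (cis pi))"
    using tendsto_unique[OF trivial_limit_at_right_real] by blast
  then show "half_jump \<omega> (- 1) = \<i> * of_real (- Im (lim_minus \<omega> (cis pi)))"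
    by (simp add: half_jump_def complex_eq_iff)
qed

section \<open>Spectrum of the block model\<close>

lemma finite_rank_op:
  fixes \<mu> :: "'i \<Rightarrow> real" and y :: "'i \<Rightarrow> ell2"
  assumes "finite I"
  obtains W where "has_entries W (\<lambda>j k. \<Sum>i\<in>I. of_real (\<mu> i) * cnj (ell2_nth (y i) j) * ell2_nth (y i)
      k)"
    "\<And>x. qform W x = (\<Sum>i\<in>I. \<mu> i * (cmod (cinner x (y i)))\<^sup>2)"
proof -
  define F where "F x = (\<Sum>i\<in>I. scaleC (of_real (\<mu> i) * cinner x (y i)) (y i))" for x
  have bl: "bounded_linear F"
  proof (rule bounded_linear_intro[of _ "\<Sum>i\<in>I. \<bar>\<mu> i\<bar> * norm (y i) * norm (y i)"])
    show "F (x + z) = F x + F z" for x z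
      unfolding F_def by (simp add: cinner_add_left distrib_left ell2.scale_left_distrib sum.distrib)
    show "F (r *\<^sub>R x) = r *\<^sub>R F x" for r x
      unfolding F_def scaleR_conv_scaleC by (simp add: cinner_scaleC_left ell2.scale_sum_right mult_ac)
    show "norm (F x) \<le> norm x * (\<Sum>i\<in>I. \<bar>\<mu> i\<bar> * norm (y i) * norm (y i))" for x
      unfolding F_def sum_distrib_left
    proof (intro order_trans[OF norm_sum] sum_mono)
      fix i
      have "\<bar>\<mu> i\<bar> * norm (y i) * cmod (cinner x (y i)) \<le> \<bar>\<mu> i\<bar> * norm (y i) * (norm x * norm (y i))"
        by (intro mult_left_mono cmod_cinner_le) auto
      then show "norm (scaleC (of_real (\<mu> i) * cinner x (y i)) (y i)) \<le> norm x * (\<bar>\<mu> i\<bar> * norm (y i) *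
          norm (y i))"
        by (simp add: norm_scaleC norm_mult mult_ac)
    qed
  qed
  define W where "W = Blinfun F"
  have W: "blinfun_apply W = F" unfolding W_def by (rule bounded_linear_Blinfun_apply[OF bl])
  have "clinear_op W"
    by (rule clinear_opI) (simp add: W F_def cinner_scaleC_left ell2.scale_sum_right mult_ac)
  moreover have "entry W j k = (\<Sum>i\<in>I. of_real (\<mu> i) * cnj (ell2_nth (y i) j) * ell2_nth (y i) k)"
      for j k
  proof -
    have "cinner (basis_vec j) (y i) = cnj (ell2_nth (y i) j)" for i
      by (subst cinner_commute) (simp add: cinner_basis_vec)
    then show ?thesis unfolding entry_def W F_def by (simp add: cinner_basis_vec nth_sum nth_scaleC)
  qed
  moreover have "qform W x = (\<Sum>i\<in>I. \<mu> i * (cmod (cinner x (y i)))\<^sup>2)" for x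
  proof -
    have "cinner (y i) x = cnj (cinner x (y i))" for i by (rule cinner_commute)
    then have "cinner (F x) x = (\<Sum>i\<in>I. of_real (\<mu> i * (cmod (cinner x (y i)))\<^sup>2))"
      unfolding F_def by (simp add: cinner_sum_left cinner_scaleC_left mult_cnj_norm mult.assoc)
    then show ?thesis unfolding qform_def W by (simp del: of_real_power of_real_mult)
  qed
  ultimately show ?thesis using that by (auto simp: has_entries_def)
qed

text \<open>The Gram error is block diagonal with blocks of size at most \<open>D\<close> and
  entries at most \<open>\<eta>\<close>; by Cauchy-Schwarz its norm is at most
  \<open>D * \<eta>\<close>, however many blocks there are.\<close>

lemma near_orthonormal_of_gram:
  fixes y :: "'i \<Rightarrow> ell2" and blkf :: "'i \<Rightarrow> 'b"
  assumes I: "finite I" and \<eta>: "\<eta> \<ge> 0"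
    and G: "\<And>i k. i \<in> I \<Longrightarrow> k \<in> I \<Longrightarrow> cmod (cinner (y k) (y i) - (if k = i then 1 else 0)) \<le> (if blkf k
        = blkf i then \<eta> else 0)"
    and D: "\<And>b. card {i\<in>I. blkf i = b} \<le> D"
  shows "near_orthonormal (real D * \<eta>) I y"
  unfolding near_orthonormal_def
proof (intro conjI I allI)
  show "0 \<le> real D * \<eta>" using \<eta> by simp
  fix b
  define E where "E k i = cinner (y k) (y i) - (if k = i then 1 else 0)" for k i
  have e: "cinner (\<Sum>k\<in>I. scaleC (b k) (y k)) (y i) - b i = (\<Sum>k\<in>{k\<in>I. blkf k = blkf i}. b k * E k i)"
      if i: "i \<in> I" for i
  proof -
    have "(\<Sum>k\<in>I. b k * (if k = i then 1 else 0)) = b i" using i I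
        by (simp add: if_distrib cong: if_cong)
    then have "cinner (\<Sum>k\<in>I. scaleC (b k) (y k)) (y i) - b i = (\<Sum>k\<in>I. b k * E k i)"
      by (simp add: cinner_sum_left cinner_scaleC_left E_def right_diff_distrib sum_subtractf)
    also have "\<dots> = (\<Sum>k\<in>{k\<in>I. blkf k = blkf i}. b k * E k i)"
    proof (rule sum.mono_neutral_right[OF I])
      show "\<forall>k\<in>I - {k \<in> I. blkf k = blkf i}. b k * E k i = 0"
      proof
        fix k assume "k \<in> I - {k \<in> I. blkf k = blkf i}"
        then have "cmod (E k i) \<le> 0" using G[OF i, of k] by (simp add: E_def)
        then show "b k * E k i = 0" by simp
      qed
    qed auto
    finally show ?thesis .
  qed
  have le: "(cmod (cinner (\<Sum>k\<in>I. scaleC (b k) (y k)) (y i) - b i))\<^sup>2 \<le> real D * \<eta>\<^sup>2 * (\<Sum>k\<in>{k\<in>I. blkf k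
      = blkf i}. (cmod (b k))\<^sup>2)"
    if i: "i \<in> I" for i
  proof -
    let ?J = "{k\<in>I. blkf k = blkf i}"
    have "cmod (\<Sum>k\<in>?J. b k * E k i) \<le> (\<Sum>k\<in>?J. cmod (b k) * \<eta>)"
    proof (intro order_trans[OF norm_sum] sum_mono)
      fix k assume "k \<in> ?J"
      then have "cmod (E k i) \<le> \<eta>" using G[OF i, of k] by (auto simp: E_def)
      then show "cmod (b k * E k i) \<le> cmod (b k) * \<eta>" unfolding norm_mult by (intro mult_left_mono) auto
    qed
    then have "(cmod (\<Sum>k\<in>?J. b k * E k i))\<^sup>2 \<le> (\<Sum>k\<in>?J. cmod (b k) * \<eta>)\<^sup>2" by (intro power_mono) auto
    also have "\<dots> \<le> (\<Sum>k\<in>?J. (cmod (b k))\<^sup>2) * (\<Sum>k\<in>?J. \<eta>\<^sup>2)" by (rule Cauchy_Schwarz_ineq_sum)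
    also have "(\<Sum>k\<in>?J. \<eta>\<^sup>2) \<le> real D * \<eta>\<^sup>2" using D[of "blkf i"] by (simp add: mult_right_mono)
    then have "(\<Sum>k\<in>?J. (cmod (b k))\<^sup>2) * (\<Sum>k\<in>?J. \<eta>\<^sup>2) \<le> (\<Sum>k\<in>?J. (cmod (b k))\<^sup>2) * (real D * \<eta>\<^sup>2)"
      by (intro mult_left_mono sum_nonneg) auto
    finally show ?thesis unfolding e[OF i] by (simp add: mult_ac)
  qed
  have "(\<Sum>i\<in>I. \<Sum>k\<in>{k\<in>I. blkf k = blkf i}. (cmod (b k))\<^sup>2) = (\<Sum>i\<in>I. \<Sum>k\<in>I. if blkf k
      = blkf i then (cmod (b k))\<^sup>2 else 0)"
    by (simp add: sum.inter_filter[OF I])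
  also have "\<dots> = (\<Sum>k\<in>I. \<Sum>i\<in>I. if blkf k = blkf i then (cmod (b k))\<^sup>2 else 0)" by (rule sum.swap)
  also have "\<dots> \<le> (\<Sum>k\<in>I. real D * (cmod (b k))\<^sup>2)"
  proof (rule sum_mono)
    fix k
    have "(\<Sum>i\<in>I. if blkf k = blkf i then (cmod (b k))\<^sup>2 else 0) = (\<Sum>i\<in>{i\<in>I. blkf k
        = blkf i}. (cmod (b k))\<^sup>2)"
      using I by (intro sum.inter_filter[symmetric])
    also have "\<dots> = real (card {i\<in>I. blkf i = blkf k}) * (cmod (b k))\<^sup>2" by (simp add: eq_commute)
    also have "\<dots> \<le> real D * (cmod (b k))\<^sup>2" using D by (intro mult_right_mono) auto
    finally show "(\<Sum>i\<in>I. if blkf k = blkf i then (cmod (b k))\<^sup>2 else 0) \<le> real D * (cmod (b k))\<^sup>2" .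
  qed
  also have "\<dots> = real D * (\<Sum>k\<in>I. (cmod (b k))\<^sup>2)" by (simp add: sum_distrib_left)
  finally have dbl: "(\<Sum>i\<in>I. \<Sum>k\<in>{k\<in>I. blkf k = blkf i}. (cmod (b k))\<^sup>2) \<le> real D * (\<Sum>k\<in>I. (cmod (b k))\<^sup>2)"
      .
  have "(\<Sum>i\<in>I. (cmod (cinner (\<Sum>k\<in>I. scaleC (b k) (y k)) (y i) - b i))\<^sup>2) \<le>
      (\<Sum>i\<in>I. real D * \<eta>\<^sup>2 * (\<Sum>k\<in>{k\<in>I. blkf k = blkf i}. (cmod (b k))\<^sup>2))"
    by (intro sum_mono le)
  also have "\<dots> = real D * \<eta>\<^sup>2 * (\<Sum>i\<in>I. \<Sum>k\<in>{k\<in>I. blkf k = blkf i}. (cmod (b k))\<^sup>2)"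
    by (simp add: sum_distrib_left)
  also have "\<dots> \<le> real D * \<eta>\<^sup>2 * (real D * (\<Sum>k\<in>I. (cmod (b k))\<^sup>2))"
    by (intro mult_left_mono dbl) auto
  finally show "(\<Sum>i\<in>I. (cmod (cinner (\<Sum>k\<in>I. scaleC (b k) (y k)) (y i) - b i))\<^sup>2)
      \<le> (real D * \<eta>)\<^sup>2 * (\<Sum>i\<in>I. (cmod (b i))\<^sup>2)"
    by (simp add: power_mult_distrib power2_eq_square mult_ac)
qed

section \<open>Diagonalising the cycles of blocks\<close>

lemma roots_of_unity_sum:
  fixes M :: nat and u :: int
  assumes M: "M > 0"
  shows "(\<Sum>m<M. cis (2 * pi * real_of_int u * real m / real M)) = (if int M dvd u then of_nat M else 0)"
proof -
  define z where "z = cis (2 * pi * real_of_int u / real M)"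
  have p: "cis (2 * pi * real_of_int u * real m / real M) = z ^ m" for m
    unfolding z_def Complex.DeMoivre by (simp add: field_simps)
  show ?thesis
  proof (cases "int M dvd u")
    case True
    then obtain k where "u = int M * k" by (auto simp: dvd_def)
    then have "2 * pi * real_of_int u / real M = 2 * pi * real_of_int k" using M by simp
    then have "z = 1" unfolding z_def using cis_multiple_2pi[of "real_of_int k"] by simp
    then show ?thesis using True unfolding p by simp
  next
    case False
    have "z \<noteq> 1"
    proof
      assume "z = 1"
      then have "cos (2 * pi * real_of_int u / real M) = 1" by (simp add: z_def complex_eq_iff)
      then obtain k :: int where "2 * pi * real_of_int u / real M = real_of_int k * 2 * pi"
          by (auto simp: cos_one_2pi_int)
      then have "real_of_int u = real_of_int (k * int M)" using M by (simp add: field_simps)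
      then have "u = k * int M" by (simp only: of_int_eq_iff)
      then show False using False by simp
    qed
    moreover have "z ^ M = 1"
      unfolding p[symmetric] using M cis_multiple_2pi[of "real_of_int u"] by simp
    ultimately show ?thesis using False unfolding p by (simp add: geometric_sum)
  qed
qed

lemma roots_of_unity_sum_centered:
  fixes L :: nat and u :: int
  shows "(\<Sum>p\<in>{- int L..int L}. cis (2 * pi * real_of_int p * real_of_int u / real (2 * L + 1)))
      = (if int (2 * L + 1) dvd u then of_nat (2 * L + 1) else 0)"
proof -
  let ?M = "2 * L + 1"
  have "(\<Sum>p\<in>{- int L..int L}. cis (2 * pi * real_of_int p * real_of_int u / real ?M)) =
      (\<Sum>m<?M. cis (2 * pi * real_of_int (int m - int L) * real_of_int u / real ?M))"
    by (rule sum.reindex_bij_witness[of _ "\<lambda>m. int m - int L" "\<lambda>p. nat (p + int L)"]) auto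
  also have "\<dots> = (\<Sum>m<?M. cis (- (2 * pi * real L * real_of_int u / real ?M)) * cis (2 * pi * real_of_int
      u * real m / real ?M))"
    by (intro sum.cong refl) (simp add: cis_mult diff_divide_distrib add_divide_distrib algebra_simps)
  also have "\<dots> = cis (- (2 * pi * real L * real_of_int u / real ?M)) * (if int ?M dvd u then of_nat ?M
      else 0)"
    unfolding sum_distrib_left[symmetric] by (subst roots_of_unity_sum) auto
  also have "\<dots> = (if int ?M dvd u then of_nat ?M else 0)"
  proof (cases "int ?M dvd u")
    case True
    then obtain k where "u = int ?M * k" by (auto simp: dvd_def)
    then have "- (2 * pi * real L * real_of_int u / real ?M) = 2 * pi * real_of_int (- int L * k)"
        by simp
    then have "cis (- (2 * pi * real L * real_of_int u / real ?M)) = 1" using cis_multiple_2pi[of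
        "real_of_int (- int L * k)"] by simp
    then show ?thesis by simp
  qed simp
  finally show ?thesis .
qed

text \<open>Discrete Fourier inversion. By orthogonality of the roots of unity only the distances
  \<open>d\<close> and \<open>M - d\<close> survive for \<open>d > 0\<close>, and exactly one of
  them is at most \<open>L\<close>.\<close>

lemma sech_eig_circulant_nonneg:
  fixes d :: int
  assumes d: "0 \<le> d" "d < int (2 * L + 1)"
  shows "(\<Sum>p\<in>{- int L..int L}. of_real (sech_eig h L p) * cis (2 * pi * real_of_int p * real_of_int d /
      real (2 * L + 1))) / of_nat (2 * L + 1)
    = of_real (sech_coeff h (if nat d \<le> L then nat d else 2 * L + 1 - nat d))"
proof -
  define M where "M = 2 * L + 1"
  define del where "del u = (if int M dvd u then 1 else 0 :: complex)" for u
  have M0: "M > 0" by (simp add: M_def)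
  have se: "sech_eig h L p = sech_coeff h 0 + (\<Sum>r=1..L. 2 * sech_coeff h r * cos (2 * pi * real_of_int p
      * real r / real M))" for p
  proof -
    have e: "x * (2 * (c / (2 * k))) = 2 * (x / (2 * k)) * c" for x c k :: real by simp
    have Mr: "real M = 2 * real L + 1" by (simp add: M_def)
    show ?thesis unfolding sech_eig_def distrib_left sum_distrib_left sech_coeff_def e Mr by simp
  qed
  have cs: "complex_of_real (2 * cos x) * cis v = cis (v + x) + cis (v - x)" for x v
    by (simp add: complex_eq_iff cos_add sin_add cos_diff sin_diff)
  have tm: "of_real (sech_eig h L p) * cis (2 * pi * real_of_int p * real_of_int d / real M) =
      of_real (sech_coeff h 0) * cis (2 * pi * real_of_int p * real_of_int d / real M) +
      (\<Sum>r=1..L. of_real (sech_coeff h r) * (cis (2 * pi * real_of_int p * real_of_int (d + int r) / real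
          M) + cis (2 * pi * real_of_int p * real_of_int (d - int r) / real M)))" for p
  proof -
    have "of_real (2 * sech_coeff h r * cos (2 * pi * real_of_int p * real r / real M)) * cis (2 * pi *
        real_of_int p * real_of_int d / real M)
      = of_real (sech_coeff h r) * (cis (2 * pi * real_of_int p * real_of_int (d + int r) / real M)
          + cis (2 * pi * real_of_int p * real_of_int (d - int r) / real M))" for r
    proof -
      have "of_real (2 * sech_coeff h r * cos (2 * pi * real_of_int p * real r / real M)) * cis (2 * pi
          * real_of_int p * real_of_int d / real M)
        = of_real (sech_coeff h r) * (of_real (2 * cos (2 * pi * real_of_int p * real r / real M)) * cis
            (2 * pi * real_of_int p * real_of_int d / real M))" by simp
      then show ?thesis unfolding cs by (simp add: algebra_simps add_divide_distrib diff_divide_distrib)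
    qed
    then show ?thesis unfolding se by (simp only: of_real_add of_real_sum distrib_right
        sum_distrib_right)
  qed
  have r: "(\<Sum>p\<in>{- int L..int L}. cis (2 * pi * real_of_int p * real_of_int u / real M))
      = of_nat M * del u" for u
    using roots_of_unity_sum_centered[where L=L and u=u] by (simp add: M_def del_def)
  have "(\<Sum>p\<in>{- int L..int L}. of_real (sech_eig h L p) * cis (2 * pi * real_of_int p * real_of_int d /
      real M)) =
     of_real (sech_coeff h 0) * (of_nat M * del d) + (\<Sum>r=1..L. of_real (sech_coeff h r) * (of_nat M *
         del (d + int r) + of_nat M * del (d - int r)))"
    unfolding tm sum.distrib sum_distrib_left[symmetric] r
    by (subst sum.swap) (simp only: sum_distrib_left[symmetric] sum.distrib r)
  also have "\<dots> = of_nat M * (of_real (sech_coeff h 0) * del d + (\<Sum>r=1..L. of_real (sech_coeff h r) *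
      (del (d + int r) + del (d - int r))))"
    by (simp add: distrib_left sum_distrib_left mult_ac)
  also have "of_real (sech_coeff h 0) * del d + (\<Sum>r=1..L. of_real (sech_coeff h r) * (del (d + int r)
      + del (d - int r))) =
      complex_of_real (sech_coeff h (if nat d \<le> L then nat d else M - nat d))"
  proof -
    have dvd0: "int M dvd u \<longleftrightarrow> u = 0" if "- int M < u" "u < int M" for u
      using that by (metis abs_less_iff dvd_0_right zdvd_not_zless dvd_minus_iff
          linorder_neqE_linordered_idom minus_less_iff neg_0_less_iff_less)
    have d1: "del (d - int r) = (if int r = d then 1 else 0)" if "r \<in> {1..L}" for r
      unfolding del_def using dvd0[of "d - int r"] that d by (auto simp: M_def)
    have d2: "del (d + int r) = (if int r = int M - d then 1 else 0)" if "r \<in> {1..L}" for r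
    proof -
      have "int M dvd d + int r \<longleftrightarrow> int M dvd d + int r - int M" by (simp add: dvd_diff_left_iff)
      also have "\<dots> \<longleftrightarrow> d + int r - int M = 0" using that d by (intro dvd0) (auto simp: M_def)
      finally show ?thesis unfolding del_def by auto
    qed
    have d0: "del d = (if d = 0 then 1 else 0)" unfolding del_def using dvd0[of d] d
        by (auto simp: M_def)
    have "(\<Sum>r=1..L. of_real (sech_coeff h r) * (del (d + int r) + del (d - int r))) =
       (\<Sum>r=1..L. if r = M - nat d then complex_of_real (sech_coeff h r) else 0) + (\<Sum>r=1..L. if r
           = nat d then complex_of_real (sech_coeff h r) else 0)"
      unfolding sum.distrib[symmetric]
    proof (rule sum.cong[OF refl])
      fix r assume rr: "r \<in> {1..L}"
      have "int r = int M - d \<longleftrightarrow> r = M - nat d" "int r = d \<longleftrightarrow> r = nat d" using d rr by (auto simp: M_def)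
      then show "of_real (sech_coeff h r) * (del (d + int r) + del (d - int r)) = (if r
          = M - nat d then complex_of_real (sech_coeff h r) else 0) + (if r
          = nat d then complex_of_real (sech_coeff h r) else 0)"
        unfolding d1[OF rr] d2[OF rr] by auto
    qed
    also have "\<dots> = (if M - nat d \<in> {1..L} then complex_of_real (sech_coeff h (M - nat d)) else 0)
        + (if nat d \<in> {1..L} then complex_of_real (sech_coeff h (nat d)) else 0)"
      by simp
    finally show ?thesis unfolding d0 using d by (auto simp: M_def)
  qed
  finally show ?thesis unfolding M_def[symmetric] using M0 by simp
qed

text \<open>Negative differences reduce to positive ones because \<open>sech_eig\<close> is even in
  \<open>p\<close>.\<close>

lemma sech_eig_circulant:
  assumes "i < 2 * L + 1" "l < 2 * L + 1"
  shows "(\<Sum>p\<in>{- int L..int L}. of_real (sech_eig h L p) * cis (2 * pi * real_of_int p * (real l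
      - real i) / real (2 * L + 1))) / of_nat (2 * L + 1)
    = of_real (circulant h L i l)"
proof (cases "i \<le> l")
  case True
  then have "real l - real i = real_of_int (int l - int i)" "nat (int l - int i) = l - i"
      "0 \<le> int l - int i" "int l - int i < int (2 * L + 1)" using assms by auto
  then show ?thesis using sech_eig_circulant_nonneg[where d="int l - int i" and L=L and h=h] True assms
      by (simp only: circulant_def Let_def if_True)
next
  case False
  have neg: "sech_eig h L (- p) = sech_eig h L p" for p by (simp add: sech_eig_def)
  have "(\<Sum>p\<in>{- int L..int L}. of_real (sech_eig h L p) * cis (2 * pi * real_of_int p * (real l
      - real i) / real (2 * L + 1)))
     = (\<Sum>p\<in>{- int L..int L}. of_real (sech_eig h L p) * cis (2 * pi * real_of_int p * (real i
         - real l) / real (2 * L + 1)))"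
    by (rule sum.reindex_bij_witness[of _ uminus uminus]) (auto simp: neg algebra_simps)
  moreover have "real i - real l = real_of_int (int i - int l)" "nat (int i - int l) = i - l"
      "0 \<le> int i - int l" "int i - int l < int (2 * L + 1)" using False assms by auto
  ultimately show ?thesis using sech_eig_circulant_nonneg[where d="int i - int l" and L=L
      and h=h] False assms by (simp only: circulant_def Let_def if_False)
qed

text \<open>The discrete Fourier modes of the cycle of blocks number \<open>b\<close>, modulated by the oscillation \<open>z\<close>.\<close>

definition blk_vec :: "real \<Rightarrow> nat \<Rightarrow> (nat \<Rightarrow> real) \<Rightarrow> nat \<Rightarrow> int \<Rightarrow> ell2" where
  "blk_vec h M z b p = Abs_ell2 (\<lambda>j. if 1 \<le> j \<and> blk_idx h j div M = b
     then of_real (z j / sqrt (real M * real (card (blk h (blk_idx h j))))) * cis (2 * pi * real_of_int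
         p * real (blk_idx h j mod M) / real M)
     else 0)"

definition superblk :: "real \<Rightarrow> nat \<Rightarrow> nat \<Rightarrow> nat set" where
  "superblk h M b = {j. 1 \<le> j \<and> blk_idx h j div M = b}"

lemma superblk_eq:
  assumes "M > 0"
  shows "superblk h M b = (\<Union>m<M. blk h (b * M + m))"
proof (intro set_eqI iffI)
  fix j assume "j \<in> superblk h M b"
  then have j: "1 \<le> j" "blk_idx h j div M = b" by (auto simp: superblk_def)
  have "blk_idx h j = b * M + blk_idx h j mod M" using j(2) div_mult_mod_eq[of "blk_idx h j" M] by simp
  moreover have "blk_idx h j mod M < M" using assms by simp
  ultimately show "j \<in> (\<Union>m<M. blk h (b * M + m))" using j by (auto simp: blk_def)
qed (use assms in \<open>auto simp: superblk_def blk_def\<close>)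

lemma nth_blk_vec:
  assumes "h > 0" "M > 0"
  shows "ell2_nth (blk_vec h M z b p) j = (if 1 \<le> j \<and> blk_idx h j div M = b
     then of_real (z j / sqrt (real M * real (card (blk h (blk_idx h j))))) * cis (2 * pi * real_of_int
         p * real (blk_idx h j mod M) / real M)
     else 0)"
proof -
  let ?f = "\<lambda>j. if 1 \<le> j \<and> blk_idx h j div M = b
     then of_real (z j / sqrt (real M * real (card (blk h (blk_idx h j))))) * cis (2 * pi * real_of_int
         p * real (blk_idx h j mod M) / real M)
     else 0"
  have "finite (superblk h M b)" unfolding superblk_eq[OF assms(2)] using finite_blk[OF assms(1)]
      by auto
  then have "summable (\<lambda>n. (cmod (?f n))\<^sup>2)"
    by (rule summable_finite) (auto simp: superblk_def)
  then have "ell2_nth (Abs_ell2 ?f) = ?f" by (subst Abs_ell2_inverse) auto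
  then show ?thesis unfolding blk_vec_def by (rule fun_cong)
qed

text \<open>Within a block the Fourier factor is constant, so only the sum of \<open>z * z'\<close>
  over the block enters, which is \<open>dl\<close> times the cardinality up to \<open>C\<close>.
  The main terms form a full sum of roots of unity and vanish for \<open>p \<noteq> p'\<close>; the
  errors average to at most \<open>C / \<nu>\<close>.\<close>

lemma blk_vec_gram:
  assumes h: "h > 0" and M: "M = 2 * L + 1"
    and z: "\<And>m. m < M \<Longrightarrow> \<bar>(\<Sum>j\<in>blk h (b * M + m). z j * z' j) - dl * real (card (blk h (b * M + m)))\<bar> \<le> C"
    and \<nu>: "\<nu> > 0" "\<And>m. m < M \<Longrightarrow> \<nu> \<le> real (card (blk h (b * M + m)))"
    and p: "p \<in> {- int L..int L}" "p' \<in> {- int L..int L}"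
  shows "cmod (cinner (blk_vec h M z b p) (blk_vec h M z' b p') - (if p = p' then of_real dl else 0))
      \<le> C / \<nu>"
proof -
  have M0: "M > 0" by (simp add: M)
  define n where "n m = real (card (blk h (b * M + m)))" for m
  define c where "c m = cis (2 * pi * real_of_int (p - p') * real m / real M)" for m
  let ?y = "blk_vec h M z b p" and ?y' = "blk_vec h M z' b p'"
  have n0: "n m > 0" if "m < M" for m using \<nu> that by (force simp: n_def)
  have fin: "finite (superblk h M b)" unfolding superblk_eq[OF M0] using finite_blk[OF h] by auto
  have "(\<lambda>j. ell2_nth ?y j * cnj (ell2_nth ?y' j)) sums (\<Sum>j\<in>superblk h M b. ell2_nth ?y j * cnj
      (ell2_nth ?y' j))"
    by (rule sums_finite[OF fin]) (auto simp: nth_blk_vec[OF h M0] superblk_def)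
  then have "cinner ?y ?y' = (\<Sum>j\<in>superblk h M b. ell2_nth ?y j * cnj (ell2_nth ?y' j))"
    using cinner_sums[of ?y ?y'] by (metis sums_unique2)
  also have "\<dots> = (\<Sum>m<M. \<Sum>j\<in>blk h (b * M + m). ell2_nth ?y j * cnj (ell2_nth ?y' j))"
    unfolding superblk_eq[OF M0] using finite_blk[OF h]
    by (intro sum.UNION_disjoint) (auto simp: blk_def)
  also have "\<dots> = (\<Sum>m<M. c m * of_real ((\<Sum>j\<in>blk h (b * M + m). z j * z' j) / (real M * n m)))"
  proof (rule sum.cong[OF refl])
    fix m assume m: "m \<in> {..<M}"
    have "ell2_nth ?y j * cnj (ell2_nth ?y' j) = c m * of_real (z j * z' j / (real M * n m))"
        if j: "j \<in> blk h (b * M + m)" for j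
    proof -
      have i: "1 \<le> j" "blk_idx h j = b * M + m" "blk_idx h j div M = b" "blk_idx h j mod M = m"
          using j m by (auto simp: blk_def)
      have "complex_of_real (z j / sqrt (real M * n m)) * complex_of_real (z' j / sqrt (real M * n m))
          = of_real (z j * z' j / (real M * n m))"
        using M0 n0[of m] m unfolding of_real_mult[symmetric] by (simp add: field_simps)
      moreover have "cis (2 * pi * real_of_int p * real m / real M) * cnj (cis (2 * pi * real_of_int p'
          * real m / real M)) = c m"
        unfolding c_def cis_cnj cis_mult by (simp add: diff_divide_distrib algebra_simps)
      moreover have "ell2_nth ?y j * cnj (ell2_nth ?y' j) =
          (cis (2 * pi * real_of_int p * real m / real M) * cnj (cis (2 * pi * real_of_int p' * real m /
              real M))) *
          (complex_of_real (z j / sqrt (real M * n m)) * complex_of_real (z' j / sqrt (real M * n m)))"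
        unfolding nth_blk_vec[OF h M0] i(4) using i by (simp add: n_def)
      ultimately show ?thesis by simp
    qed
    then show "(\<Sum>j\<in>blk h (b * M + m). ell2_nth ?y j * cnj (ell2_nth ?y' j))
        = c m * of_real ((\<Sum>j\<in>blk h (b * M + m). z j * z' j) / (real M * n m))"
      by (simp add: sum_distrib_left sum_divide_distrib)
  qed
  finally have G: "cinner ?y ?y' = (\<Sum>m<M. c m * of_real ((\<Sum>j\<in>blk h (b * M + m). z j * z' j) / (real M *
      n m)))" .
  \<comment> \<open>The frequencies lie in a window of \<open>M\<close> consecutive integers, so
    agreement modulo \<open>M\<close> is equality.\<close>
  have dvd: "int M dvd p - p' \<longleftrightarrow> p = p'"
  proof
    assume "int M dvd p - p'"
    moreover have "\<bar>p - p'\<bar> < int M" using p by (auto simp: M)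
    ultimately show "p = p'" using dvd_imp_le_int[of "p - p'" "int M"] by auto
  qed simp
  have D: "(if p = p' then of_real dl else 0) = (\<Sum>m<M. c m * of_real (dl * n m / (real M * n m)))"
  proof -
    have "(\<Sum>m<M. c m * of_real (dl * n m / (real M * n m))) = (\<Sum>m<M. c m) * of_real (dl / real M)"
      unfolding sum_distrib_right using n0 by (intro sum.cong) force+
    also have "(\<Sum>m<M. c m) = (if p = p' then of_nat M else 0)"
      unfolding c_def using roots_of_unity_sum[OF M0, of "p - p'"] dvd by simp
    finally show ?thesis using M0 by simp
  qed
  have "cinner ?y ?y' - (if p = p' then of_real dl else 0) =
    (\<Sum>m<M. c m * of_real (((\<Sum>j\<in>blk h (b * M + m). z j * z' j) - dl * n m) / (real M * n m)))"
    unfolding G D by (simp add: sum_subtractf[symmetric] diff_divide_distrib right_diff_distrib)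
  also have "cmod \<dots> \<le> (\<Sum>m<M. C / (real M * \<nu>))"
  proof (intro order_trans[OF norm_sum] sum_mono)
    fix m assume m: "m \<in> {..<M}"
    have "\<bar>(\<Sum>j\<in>blk h (b * M + m). z j * z' j) - dl * n m\<bar> \<le> C" using z m by (simp add: n_def)
    moreover have "real M * \<nu> \<le> real M * n m" using \<nu> m by (intro mult_left_mono) (auto simp: n_def)
    ultimately have "\<bar>(\<Sum>j\<in>blk h (b * M + m). z j * z' j) - dl * n m\<bar> / (real M * n m)
        \<le> C / (real M * \<nu>)"
      using M0 \<nu> by (intro frac_le) auto
    moreover have "\<bar>real M * n m\<bar> = real M * n m" by (simp add: n_def)
    ultimately show "cmod (c m * of_real (((\<Sum>j\<in>blk h (b * M + m). z j * z' j) - dl * n m) / (real M * n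
        m))) \<le> C / (real M * \<nu>)"
      by (simp only: norm_mult norm_of_real c_def norm_cis mult_1_left abs_divide)
  qed
  also have "\<dots> = C / \<nu>" using M0 by simp
  finally show ?thesis .
qed

lemma circulant_mod:
  assumes "i div (2 * L + 1) = l div (2 * L + 1)"
  shows "circulant h L i l = circulant h L (i mod (2 * L + 1)) (l mod (2 * L + 1))"
proof -
  define c a b where "c = (2 * L + 1) * (i div (2 * L + 1))" and "a = i mod (2 * L + 1)" and
      "b = l mod (2 * L + 1)"
  have "i = c + a" unfolding c_def a_def by (rule mult_div_mod_eq[symmetric])
  moreover have "l = c + b" unfolding c_def b_def assms by (rule mult_div_mod_eq[symmetric])
  ultimately show ?thesis unfolding a_def[symmetric] b_def[symmetric] by (simp add: circulant_def)
qed

text \<open>The oscillating model is exactly a sum of rank-one matrices: a mode multiplies the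
  Fourier vectors entrywise and leaves the weights \<open>sech_eig\<close> alone. What is
  approximate is the orthonormality of the resulting vectors.\<close>

lemma blk_vec_entries:
  fixes A :: "'a set" and z :: "'a \<Rightarrow> nat \<Rightarrow> real" and L :: nat
  assumes h: "h > 0" and A: "finite A"
  defines "M \<equiv> 2 * L + 1"
  shows "(\<Sum>i\<in>{b0..<b1} \<times> ({- int L..int L} \<times> A). of_real (\<gamma> (snd (snd i)) * sech_eig h L (fst (snd i)))
      *
      cnj (ell2_nth (blk_vec h M (z (snd (snd i))) (fst i) (fst (snd i))) j) * ell2_nth (blk_vec h M (z
          (snd (snd i))) (fst i) (fst (snd i))) k)
    = of_real ((\<Sum>a\<in>A. \<gamma> a * z a j * z a k) * model h L b0 b1 j k)"
proof -
  have M0: "M > 0" by (simp add: M_def)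
  define B where "B = blk_idx h j div M"
  define f where "f b p a = of_real (\<gamma> a * sech_eig h L p) * cnj (ell2_nth (blk_vec h M (z a) b p) j) *
      ell2_nth (blk_vec h M (z a) b p) k" for b p a
  have "(\<Sum>i\<in>{b0..<b1} \<times> ({- int L..int L} \<times> A). f (fst i) (fst (snd i)) (snd (snd i)))
      = (\<Sum>b=b0..<b1. \<Sum>p\<in>{- int L..int L}. \<Sum>a\<in>A. f b p a)"
    by (simp add: sum.cartesian_product case_prod_unfold)
  also have "\<dots> = of_real ((\<Sum>a\<in>A. \<gamma> a * z a j * z a k) * model h L b0 b1 j k)"
  proof (cases "1 \<le> j \<and> 1 \<le> k \<and> B = blk_idx h k div M \<and> b0 \<le> B \<and> B < b1")
    case False
    then have m: "model h L b0 b1 j k = 0" unfolding model_def Let_def M_def[symmetric] B_def[symmetric]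
        by auto
    have "f b p a = 0" if "b \<in> {b0..<b1}" for b p a
      using False that unfolding f_def nth_blk_vec[OF h M0] B_def by auto
    then show ?thesis unfolding m by simp
  next
    case True
    define m l where "m = blk_idx h j mod M" and "l = blk_idx h k mod M"
    define nn where "nn = real (card (blk h (blk_idx h j))) * real (card (blk h (blk_idx h k)))"
    have model: "model h L b0 b1 j k = circulant h L m l / sqrt nn"
      using True circulant_mod[of "blk_idx h j" L "blk_idx h k" h]
      unfolding model_def Let_def M_def[symmetric] B_def[symmetric] m_def l_def nn_def by auto
    have ml: "m < M" "l < M" using M0 by (auto simp: m_def l_def)
    have "(\<Sum>b=b0..<b1. \<Sum>p\<in>{- int L..int L}. \<Sum>a\<in>A. f b p a) = (\<Sum>b=b0..<b1. if b
        = B then \<Sum>p\<in>{- int L..int L}. \<Sum>a\<in>A. f B p a else 0)"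
    proof (rule sum.cong[OF refl])
      fix b
      have "f b p a = 0" if "b \<noteq> B" for p a using that unfolding f_def nth_blk_vec[OF h M0] B_def
          by auto
      then show "(\<Sum>p\<in>{- int L..int L}. \<Sum>a\<in>A. f b p a) = (if b = B then \<Sum>p\<in>{- int L..int L}. \<Sum>a\<in>A. f B p
          a else 0)" by auto
    qed
    also have "\<dots> = (\<Sum>p\<in>{- int L..int L}. \<Sum>a\<in>A. f B p a)" using True by simp
    also have "\<dots> = (\<Sum>p\<in>{- int L..int L}. \<Sum>a\<in>A. of_real (sech_eig h L p) * cis (2 * pi * real_of_int p *
        (real l - real m) / real M) / of_nat M * of_real (\<gamma> a * z a j * z a k / sqrt nn))"
    proof (intro sum.cong refl)
      fix p a
      have s: "sqrt (real M * real (card (blk h (blk_idx h j)))) * sqrt (real M * real (card (blk h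
          (blk_idx h k)))) = real M * sqrt nn"
        unfolding real_sqrt_mult nn_def by simp
      have "f B p a = of_real (sech_eig h L p) * (cnj (cis (2 * pi * real_of_int p * real m / real M)) *
          cis (2 * pi * real_of_int p * real l / real M)) *
          of_real (\<gamma> a * z a j * z a k / (sqrt (real M * real (card (blk h (blk_idx h j)))) * sqrt (real
              M * real (card (blk h (blk_idx h k))))))"
        using True unfolding f_def nth_blk_vec[OF h M0] m_def[symmetric] l_def[symmetric]
            B_def[symmetric]
        by (simp add: field_simps)
      also have "cnj (cis (2 * pi * real_of_int p * real m / real M)) * cis (2 * pi * real_of_int p *
          real l / real M) = cis (2 * pi * real_of_int p * (real l - real m) / real M)"
        unfolding cis_cnj cis_mult by (simp add: diff_divide_distrib algebra_simps)
      finally show "f B p a = of_real (sech_eig h L p) * cis (2 * pi * real_of_int p * (real l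
          - real m) / real M) / of_nat M * of_real (\<gamma> a * z a j * z a k / sqrt nn)"
        unfolding s by (simp add: field_simps)
    qed
    also have "\<dots> = (\<Sum>p\<in>{- int L..int L}. of_real (sech_eig h L p) * cis (2 * pi * real_of_int p * (real
        l - real m) / real M)) / of_nat M * of_real ((\<Sum>a\<in>A. \<gamma> a * z a j * z a k) / sqrt nn)"
      unfolding sum_distrib_left[symmetric] sum_distrib_right[symmetric] sum_divide_distrib[symmetric]
          of_real_sum[symmetric] ..
    also have "\<dots> = of_real ((\<Sum>a\<in>A. \<gamma> a * z a j * z a k) * model h L b0 b1 j k)"
      using sech_eig_circulant[of m L l h] ml unfolding M_def[symmetric] model by simp
    finally show ?thesis .
  qed
  finally show ?thesis unfolding f_def .
qed

text \<open>The frequencies \<open>\<xi>\<close> with \<open>g \<pi> / cosh (\<pi>\<xi>) > s\<close> fill an interval of length \<open>2 \<pi> jump_density (\<pi> g / s)\<close>;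
  \<open>jump_density (k / t)\<close> is the function \<open>c_fun (t / k)\<close> of the theorem.\<close>

definition jump_density :: "real \<Rightarrow> real" where
  "jump_density y = arcosh (max 1 y) / pi\<^sup>2"

lemma jump_density_nonneg: "jump_density y \<ge> 0" by (simp add: jump_density_def)

lemma jump_density_mono: "x \<le> y \<Longrightarrow> jump_density x \<le> jump_density y"
proof -
  assume "x \<le> y"
  then have "max 1 x \<le> max 1 y" by simp
  then have "arcosh (max 1 x) \<le> arcosh (max 1 y)"
    using arcosh_less_iff_real[of "max 1 y" "max 1 x"] by (simp add: not_less[symmetric] del: not_less)
  then show ?thesis unfolding jump_density_def by (intro divide_right_mono) auto
qed

lemma jump_density_le_1: "y \<le> 1 \<Longrightarrow> jump_density y = 0" by (simp add: jump_density_def max_def)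

lemma cosh_jump_density: "y \<ge> 1 \<Longrightarrow> cosh (pi\<^sup>2 * jump_density y) = y"
  by (simp add: jump_density_def max_def)

lemma sech_gt_iff:
  assumes g: "g > 0" and s: "s > 0"
  shows "g * (pi / cosh (pi * \<xi>)) > s \<longleftrightarrow> \<bar>\<xi>\<bar> < pi * jump_density (pi * g / s)"
proof (cases "pi * g / s \<le> 1")
  case True
  have "g * (pi / cosh (pi * \<xi>)) \<le> g * (pi / 1)" using g by (intro mult_left_mono divide_left_mono)
      (auto simp: cosh_real_ge_1)
  also have "\<dots> \<le> s" using True s by (simp add: field_simps)
  finally show ?thesis using True by (simp add: jump_density_le_1)
next
  case False
  have "g * (pi / cosh (pi * \<xi>)) > s \<longleftrightarrow> cosh (pi * \<xi>) < pi * g / s"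
    using s by (simp add: field_simps)
  also have "\<dots> \<longleftrightarrow> cosh \<bar>pi * \<xi>\<bar> < cosh (pi\<^sup>2 * jump_density (pi * g / s))"
    using False by (simp add: cosh_jump_density)
  also have "\<dots> \<longleftrightarrow> \<bar>pi * \<xi>\<bar> < pi\<^sup>2 * jump_density (pi * g / s)"
    by (rule cosh_real_nonneg_less_iff) (auto simp: jump_density_nonneg)
  also have "\<dots> \<longleftrightarrow> \<bar>\<xi>\<bar> < pi * jump_density (pi * g / s)" by (simp add: abs_mult power2_eq_square)
  finally show ?thesis .
qed

lemma card_int_abs_less:
  assumes "X \<ge> 0"
  shows "{p::int. \<bar>real_of_int p\<bar> < X} = {- (\<lceil>X\<rceil> - 1)..\<lceil>X\<rceil> - 1}"
    "real (card {p::int. \<bar>real_of_int p\<bar> < X}) \<le> 2 * X + 1" "2 * X - 1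
        \<le> real (card {p::int. \<bar>real_of_int p\<bar> < X})"
proof -
  show e: "{p::int. \<bar>real_of_int p\<bar> < X} = {- (\<lceil>X\<rceil> - 1)..\<lceil>X\<rceil> - 1}"
  proof (intro set_eqI)
    fix p :: int
    have "\<bar>real_of_int p\<bar> < X \<longleftrightarrow> \<bar>p\<bar> < \<lceil>X\<rceil>" by (metis less_ceiling_iff of_int_abs)
    then show "p \<in> {p::int. \<bar>real_of_int p\<bar> < X} \<longleftrightarrow> p \<in> {- (\<lceil>X\<rceil> - 1)..\<lceil>X\<rceil> - 1}" by auto
  qed
  have g: "real (card {- (c - 1)..c - 1}) = (if c = 0 then 0 else 2 * real_of_int c - 1)" if "c \<ge> 0"
      for c :: int
  proof (cases "c = 0")
    case False
    then have "nat (c - 1 - - (c - 1) + 1) = nat (2 * c - 1)" "2 * c - 1 \<ge> 0" using that by auto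
    then show ?thesis using False by (simp add: of_nat_nat)
  qed simp
  have "\<lceil>X\<rceil> \<ge> 0" using assms by linarith
  then have "real (card {p::int. \<bar>real_of_int p\<bar> < X}) = (if \<lceil>X\<rceil> = 0 then 0 else 2 * real_of_int \<lceil>X\<rceil>
      - 1)"
    unfolding e by (rule g)
  then show "real (card {p::int. \<bar>real_of_int p\<bar> < X}) \<le> 2 * X + 1" "2 * X - 1
      \<le> real (card {p::int. \<bar>real_of_int p\<bar> < X})"
    using assms by (auto split: if_splits) linarith+
qed

text \<open>Counts the integers in a symmetric interval of length
  \<open>M * h * jump_density\<close>, up to 1; the eigenvalue error \<open>el\<close> moves the
  threshold \<open>s\<close>. For \<open>g \<le> 0\<close> the set is empty in the upper bound and
  the density vanishes in the lower one.\<close>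

lemma sech_eig_count:
  fixes L :: nat
  defines "M \<equiv> 2 * L + 1"
  assumes h: "h > 0" and L: "L \<ge> 1"
    and ap: "\<And>p. \<bar>p\<bar> \<le> int L \<Longrightarrow> \<bar>sech_eig h L p - pi / cosh (pi * (2 * pi * p / ((2 * real L + 1) * h)))\<bar>
        \<le> el"
  shows "0 < s - \<bar>g\<bar> * el \<Longrightarrow> real (card {p\<in>{- int L..int L}. g * sech_eig h L p > s})
      \<le> real M * h * jump_density (pi * g / (s - \<bar>g\<bar> * el)) + 1"
    and "0 < s + \<bar>g\<bar> * el \<Longrightarrow> h * jump_density (pi * g / (s + \<bar>g\<bar> * el)) \<le> 1/2 \<Longrightarrow>
      real M * h * jump_density (pi * g / (s + \<bar>g\<bar> * el)) - 1 \<le> real (card {p\<in>{- int L..int L}. g *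
          sech_eig h L p > s})"
proof -
  define F where "F p = pi / cosh (pi * (2 * pi * real_of_int p / (real M * h)))" for p :: int
  have M0: "real M * h > 0" using h by (simp add: M_def)
  have F0: "F p > 0" for p by (simp add: F_def)
  have apF: "\<bar>g * sech_eig h L p - g * F p\<bar> \<le> \<bar>g\<bar> * el" if "\<bar>p\<bar> \<le> int L" for p
  proof -
    have "\<bar>g\<bar> * \<bar>sech_eig h L p - F p\<bar> \<le> \<bar>g\<bar> * el" using ap[OF that]
        by (intro mult_left_mono) (auto simp: F_def M_def add.commute)
    then show ?thesis by (simp add: abs_mult[symmetric] right_diff_distrib)
  qed
  have Fiff: "g * F p > s' \<longleftrightarrow> \<bar>real_of_int p\<bar> < real M * h * jump_density (pi * g / s') / 2"
      if "g > 0" "s' > 0" for p s'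
  proof -
    have "g * F p > s' \<longleftrightarrow> \<bar>2 * pi * real_of_int p / (real M * h)\<bar> < pi * jump_density (pi * g / s')"
      unfolding F_def by (rule sech_gt_iff[OF that])
    also have "\<dots> \<longleftrightarrow> \<bar>real_of_int p\<bar> < real M * h * jump_density (pi * g / s') / 2"
      using M0 h by (simp add: abs_mult field_simps)
    finally show ?thesis .
  qed
  have X0: "real M * h * jump_density y / 2 \<ge> 0" for y using h jump_density_nonneg[of y] by simp
  show "real (card {p\<in>{- int L..int L}. g * sech_eig h L p > s}) \<le> real M * h * jump_density (pi * g /
      (s - \<bar>g\<bar> * el)) + 1" if s: "0 < s - \<bar>g\<bar> * el"
  proof (cases "g > 0")
    case True
    let ?X = "real M * h * jump_density (pi * g / (s - \<bar>g\<bar> * el)) / 2"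
    have "{p\<in>{- int L..int L}. g * sech_eig h L p > s} \<subseteq> {p. \<bar>real_of_int p\<bar> < ?X}"
    proof
      fix p assume p: "p \<in> {p\<in>{- int L..int L}. g * sech_eig h L p > s}"
      then have "g * F p > s - \<bar>g\<bar> * el" using apF[of p] by (auto simp: abs_le_iff)
      then show "p \<in> {p. \<bar>real_of_int p\<bar> < ?X}" using Fiff[OF True s] by simp
    qed
    moreover have "finite {p::int. \<bar>real_of_int p\<bar> < ?X}" unfolding card_int_abs_less(1)[OF X0] by simp
    ultimately have "card {p\<in>{- int L..int L}. g * sech_eig h L p > s} \<le> card {p::int. \<bar>real_of_int p\<bar>
        < ?X}" by (intro card_mono)
    then show ?thesis using card_int_abs_less(2)[OF X0[of "pi * g / (s - \<bar>g\<bar> * el)"]] by simp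
  next
    case False
    have "\<not> g * sech_eig h L p > s" if "p \<in> {- int L..int L}" for p
    proof -
      have "g * F p \<le> 0" using False F0[of p] by (simp add: mult_nonpos_nonneg)
      then show ?thesis using apF[of p] that s by (auto simp: abs_le_iff)
    qed
    then have e: "{p\<in>{- int L..int L}. g * sech_eig h L p > s} = {}" by blast
    show ?thesis unfolding e using X0[of "pi * g / (s - \<bar>g\<bar> * el)"] by simp
  qed
  show "real M * h * jump_density (pi * g / (s + \<bar>g\<bar> * el)) - 1 \<le> real (card {p\<in>{- int L..int L}. g *
      sech_eig h L p > s})"
    if s: "0 < s + \<bar>g\<bar> * el" and hc: "h * jump_density (pi * g / (s + \<bar>g\<bar> * el)) \<le> 1/2"
  proof (cases "g > 0")
    case True
    let ?X = "real M * h * jump_density (pi * g / (s + \<bar>g\<bar> * el)) / 2"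
    \<comment> \<open>The interval of frequencies must fit into \<open>{- L..L}\<close>, which is
      the purpose of the bound 1/2 and of \<open>L \<ge> 1\<close>.\<close>
    have "real M * (h * jump_density (pi * g / (s + \<bar>g\<bar> * el))) \<le> real M * (1/2)" using hc
        by (intro mult_left_mono) auto
    then have "?X \<le> real M / 4" by (simp add: mult_ac)
    moreover have "real M = 2 * real L + 1" "real L \<ge> 1" using L by (simp_all add: M_def)
    ultimately have XL: "?X \<le> real L" by linarith
    have "{p. \<bar>real_of_int p\<bar> < ?X} \<subseteq> {p\<in>{- int L..int L}. g * sech_eig h L p > s}"
    proof
      fix p assume p: "p \<in> {p. \<bar>real_of_int p\<bar> < ?X}"
      then have "\<bar>real_of_int p\<bar> < real L" using XL by simp
      then have pL: "\<bar>p\<bar> \<le> int L" by linarith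
      have "g * F p > s + \<bar>g\<bar> * el" using p Fiff[OF True s] by simp
      then have "g * sech_eig h L p > s" using apF[OF pL] by (auto simp: abs_le_iff)
      then show "p \<in> {p\<in>{- int L..int L}. g * sech_eig h L p > s}" using pL by auto
    qed
    moreover have "finite {p\<in>{- int L..int L}. g * sech_eig h L p > s}"
      by (rule finite_subset[of _ "{- int L..int L}"]) auto
    ultimately have "card {p::int. \<bar>real_of_int p\<bar> < ?X} \<le> card {p\<in>{- int L..int L}. g * sech_eig h L p
        > s}"
      by (intro card_mono)
    then show ?thesis using card_int_abs_less(3)[OF X0[of "pi * g / (s + \<bar>g\<bar> * el)"]] by simp
  next
    case False
    then have "pi * g / (s + \<bar>g\<bar> * el) \<le> 1" using s by (simp add: field_simps mult_nonneg_nonpos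
        add.commute)
      (smt (verit) mult_nonneg_nonpos pi_ge_zero)
    then show ?thesis by (simp add: jump_density_le_1)
  qed
qed

lemma near_orthonormal_mono:
  assumes "near_orthonormal \<epsilon> I y" "\<epsilon> \<le> \<epsilon>'"
  shows "near_orthonormal \<epsilon>' I y"
  unfolding near_orthonormal_def
proof (intro conjI allI)
  show "finite I" "0 \<le> \<epsilon>'" using assms by (auto simp: near_orthonormal_def)
  fix b
  have "\<epsilon>\<^sup>2 * (\<Sum>i\<in>I. (cmod (b i))\<^sup>2) \<le> \<epsilon>'\<^sup>2 * (\<Sum>i\<in>I. (cmod (b i))\<^sup>2)"
    using assms by (intro mult_right_mono power_mono sum_nonneg) (auto simp: near_orthonormal_def)
  then show "(\<Sum>i\<in>I. (cmod (cinner (\<Sum>k\<in>I. scaleC (b k) (y k)) (y i) - b i))\<^sup>2)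
      \<le> \<epsilon>'\<^sup>2 * (\<Sum>i\<in>I. (cmod (b i))\<^sup>2)"
    using assms(1) unfolding near_orthonormal_def by (meson order_trans)
qed

lemma blk_vec_orthogonal:
  assumes "h > 0" "M > 0" "b \<noteq> b'"
  shows "cinner (blk_vec h M z b p) (blk_vec h M z' b' p') = 0"
proof -
  have "ell2_nth (blk_vec h M z b p) j * cnj (ell2_nth (blk_vec h M z' b' p') j) = 0" for j
    using assms(3) by (simp add: nth_blk_vec[OF assms(1,2)])
  then show ?thesis unfolding cinner_def by (simp only: suminf_zero)
qed

text \<open>Vectors of different cycles have disjoint supports, so the Gram error splits into one
  block of size \<open>M * card A\<close> per cycle; long blocks of indices make its entries
  small.\<close>

lemma blk_vec_near_orthonormal:
  fixes A :: "'a set" and z :: "'a \<Rightarrow> nat \<Rightarrow> real" and L :: nat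
  defines "M \<equiv> 2 * L + 1"
  assumes h: "h > 0" and A: "finite A" and C: "C \<ge> 0" and \<nu>: "\<nu> > 0" "\<And>i. i \<ge> b0 * M \<Longrightarrow> \<nu>
      \<le> real (card (blk h i))"
    and z: "\<And>a a' x y. a \<in> A \<Longrightarrow> a' \<in> A \<Longrightarrow> x \<le> y \<Longrightarrow> \<bar>(\<Sum>j=x..<y. z a j * z a' j) - (if a = a' then real (y
        - x) else 0)\<bar> \<le> C"
  shows "near_orthonormal (real (M * card A) * (C / \<nu>)) ({b0..<b1} \<times> ({- int L..int L} \<times> A))
    (\<lambda>i. blk_vec h M (z (snd (snd i))) (fst i) (fst (snd i)))"
proof (rule near_orthonormal_of_gram[where blkf=fst])
  have M0: "M > 0" by (simp add: M_def)
  let ?I = "{b0..<b1} \<times> ({- int L..int L} \<times> A)"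
  show "finite ?I" using A by simp
  show "C / \<nu> \<ge> 0" using C \<nu> by simp
  show "card {i \<in> ?I. fst i = b} \<le> M * card A" for b
  proof -
    have "card {i \<in> ?I. fst i = b} \<le> card ({b} \<times> ({- int L..int L} \<times> A))"
      using A by (intro card_mono) auto
    also have "\<dots> = M * card A" by (simp add: card_cartesian_product M_def nat_add_distrib
        nat_mult_distrib)
    finally show ?thesis .
  qed
  fix i k assume i: "i \<in> ?I" and k: "k \<in> ?I"
  obtain b p a where i': "i = (b, p, a)" by (cases i)
  obtain b' p' a' where k': "k = (b', p', a')" by (cases k)
  show "cmod (cinner (blk_vec h M (z (snd (snd k))) (fst k) (fst (snd k))) (blk_vec h M (z (snd (snd
      i))) (fst i) (fst (snd i))) - (if k = i then 1 else 0))
      \<le> (if fst k = fst i then C / \<nu> else 0)"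
  proof (cases "b' = b")
    case False
    then show ?thesis unfolding i' k' using blk_vec_orthogonal[OF h M0 False] by simp
  next
    case True
    define dl where "dl = (if a' = a then 1 else 0 :: real)"
    have "cmod (cinner (blk_vec h M (z a') b p') (blk_vec h M (z a) b p) - (if p'
        = p then of_real dl else 0)) \<le> C / \<nu>"
    proof (rule blk_vec_gram[OF h M_def[THEN meta_eq_to_obj_eq]])
      fix m assume "m < M"
      have ble: "b0 * M \<le> b * M + m" using i unfolding i' by (auto intro: trans_le_add1)
      then show "\<nu> \<le> real (card (blk h (b * M + m)))" by (rule \<nu>)
      let ?x = "nat \<lceil>exp (h * real (b * M + m))\<rceil>" and ?y = "nat \<lceil>exp (h * real (Suc (b * M + m)))\<rceil>"
      have xy: "?x \<le> ?y" using h by (intro nat_mono ceiling_mono) simp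
      have "\<bar>(\<Sum>j=?x..<?y. z a' j * z a j) - (if a' = a then real (?y - ?x) else 0)\<bar> \<le> C"
        by (rule z[OF _ _ xy]) (use i k in \<open>auto simp: i' k'\<close>)
      then show "\<bar>(\<Sum>j\<in>blk h (b * M + m). z a' j * z a j) - dl * real (card (blk h (b * M + m)))\<bar> \<le> C"
        unfolding blk_eq[OF h] dl_def card_atLeastLessThan
        by (cases "a' = a") (simp_all only: if_True if_False mult_1_left mult_zero_left simp_thms)
    qed (use i k \<nu> in \<open>auto simp: i' k'\<close>)
    moreover have "(if p' = p then of_real dl else 0) = (if k = i then 1 else 0 :: complex)"
      using True by (auto simp: i' k' dl_def)
    ultimately show ?thesis using True by (simp add: i' k')
  qed
qed

lemma card_product_filter:
  assumes "finite B" "finite P" "finite A"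
  shows "card {i \<in> B \<times> (P \<times> A). Q (fst (snd i)) (snd (snd i))} = card B * (\<Sum>a\<in>A. card {p\<in>P. Q p a})"
proof -
  have "card {i \<in> B \<times> (P \<times> A). Q (fst (snd i)) (snd (snd i))} = card (B \<times> (\<lambda>(a, p). (p, a)) ` (SIGMA
      a:A. {p\<in>P. Q p a}))"
    by (rule arg_cong[where f=card]) force
  also have "\<dots> = card B * card ((\<lambda>(a, p). (p, a)) ` (SIGMA a:A. {p\<in>P. Q p a}))"
      by (rule card_cartesian_product)
  also have "card ((\<lambda>(a, p). (p, a)) ` (SIGMA a:A. {p\<in>P. Q p a})) = card (SIGMA a:A. {p\<in>P. Q p a})"
    by (rule card_image) (auto simp: inj_on_def)
  also have "\<dots> = (\<Sum>a\<in>A. card {p\<in>P. Q p a})" using assms by (intro card_SigmaI) auto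
  finally show ?thesis .
qed

text \<open>Off the origin the residual is \<open>S (j + k)\<close> times the sum of the multiplier
  error and the model error. The entry at (0,0), where \<open>1 / (j + k)\<close> has no meaning,
  gets its own bound \<open>c0\<close>.\<close>

lemma model_residual_bound:
  assumes "c1 \<ge> 0" and E1: "(\<Sum>j<n. \<Sum>k<n. if j + k = 0 then 0 else ((cmod (T j k - (if j + k
      < N then 1 else 0)) / real (j + k))\<^sup>2)) \<le> c1"
    and E2: "(\<Sum>j<n. \<Sum>k<n. if j + k = 0 then 0 else ((if j + k < N then 1 / real (j + k) else 0)
        - m j k)\<^sup>2) \<le> c2"
    and S: "\<And>n. \<bar>S n\<bar> \<le> CS"
    and e: "\<And>j k. j + k \<noteq> 0 \<Longrightarrow> E j k = T j k * of_real (S (j + k) / real (j + k)) - of_real (S (j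
        + k) * m j k)"
    and e0: "cmod (E 0 0) \<le> c0"
  shows "(\<Sum>j<n. \<Sum>k<n. (cmod (E j k))\<^sup>2) \<le> c0\<^sup>2 + 2 * CS\<^sup>2 * (c1 + c2)"
proof -
  define u where "u j k = (if j + k = 0 then 0 else ((cmod (T j k - (if j + k
      < N then 1 else 0)) / real (j + k))\<^sup>2))" for j k :: nat
  define v where "v j k = (if j + k = 0 then 0 else ((if j + k < N then 1 / real (j + k) else 0)
      - m j k)\<^sup>2)" for j k :: nat
  define w where "w j k = (if j = 0 \<and> k = 0 then c0\<^sup>2 else 0)" for j k :: nat
  have "(cmod (E j k))\<^sup>2 \<le> w j k + 2 * CS\<^sup>2 * (u j k + v j k)" for j k
  proof (cases "j + k = 0")
    case True
    then have "(cmod (E j k))\<^sup>2 \<le> c0\<^sup>2" using e0 by (auto intro: power_mono)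
    then show ?thesis using True by (simp add: w_def u_def v_def)
  next
    case False
    define ch where "ch = (if j + k < N then 1 else 0 :: real)"
    have eq: "E j k = of_real (S (j + k)) * ((T j k - of_real ch) / of_real (real (j + k))
        + of_real (ch / real (j + k) - m j k))"
      unfolding e[OF False] by (simp add: diff_divide_distrib algebra_simps)
    have "(cmod (E j k))\<^sup>2 = (S (j + k))\<^sup>2 * (cmod ((T j k - of_real ch) / of_real (real (j + k))
        + of_real (ch / real (j + k) - m j k)))\<^sup>2"
      unfolding eq norm_mult power_mult_distrib by simp
    also have "\<dots> \<le> CS\<^sup>2 * (2 * (cmod ((T j k - of_real ch) / of_real (real (j + k))))\<^sup>2
        + 2 * (cmod (complex_of_real (ch / real (j + k) - m j k)))\<^sup>2)"
    proof (intro mult_mono cmod_add_power2_le)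
      have "\<bar>S (j + k)\<bar>\<^sup>2 \<le> CS\<^sup>2" using S[of "j + k"] by (intro power_mono) auto
      then show "(S (j + k))\<^sup>2 \<le> CS\<^sup>2" by simp
    qed auto
    also have "cmod ((T j k - of_real ch) / of_real (real (j + k))) = cmod (T j k - (if j + k
        < N then 1 else 0)) / real (j + k)"
      unfolding norm_divide norm_of_real ch_def by (auto simp del: of_nat_add)
    also have "(cmod (complex_of_real (ch / real (j + k) - m j k)))\<^sup>2 = v j k"
      using False unfolding norm_of_real v_def ch_def by (auto simp del: of_nat_add)
    finally have "(cmod (E j k))\<^sup>2 \<le> CS\<^sup>2 * (2 * (cmod (T j k - (if j + k < N then 1 else 0)) / real (j
        + k))\<^sup>2 + 2 * v j k)" .
    moreover have "u j k = (cmod (T j k - (if j + k < N then 1 else 0)) / real (j + k))\<^sup>2" using False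
        by (simp add: u_def)
    moreover have "w j k = 0" using False by (auto simp: w_def)
    ultimately show ?thesis by (simp only: distrib_left mult_ac add_0_left)
  qed
  then have "(\<Sum>j<n. \<Sum>k<n. (cmod (E j k))\<^sup>2) \<le> (\<Sum>j<n. \<Sum>k<n. w j k + 2 * CS\<^sup>2 * (u j k + v j k))"
    by (intro sum_mono)
  also have "\<dots> = (\<Sum>j<n. \<Sum>k<n. w j k) + 2 * CS\<^sup>2 * ((\<Sum>j<n. \<Sum>k<n. u j k) + (\<Sum>j<n. \<Sum>k<n. v j k))"
    by (simp only: sum.distrib sum_distrib_left[symmetric])
  also have "\<dots> \<le> c0\<^sup>2 + 2 * CS\<^sup>2 * (c1 + c2)"
  proof (intro add_mono mult_left_mono)
    have "(\<Sum>j<n. \<Sum>k<n. w j k) = (\<Sum>j<n. if j = 0 then (\<Sum>k<n. if k = 0 then c0\<^sup>2 else 0) else 0)"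
      by (intro sum.cong refl) (auto simp: w_def)
    also have "\<dots> \<le> c0\<^sup>2" by (cases "n = 0") auto
    finally show "(\<Sum>j<n. \<Sum>k<n. w j k) \<le> c0\<^sup>2" .
  qed (use E1 E2 in \<open>auto simp: u_def v_def\<close>)
  finally show ?thesis .
qed

text \<open>Each cycle has logarithmic length \<open>H\<close>, so the main terms add up to the
  density times \<open>lN\<close>. The error 1 per cycle and mode amounts to
  \<open>card A / H\<close> relative to \<open>lN\<close>, and \<open>c\<close> is the logarithmic
  length left uncovered.\<close>

lemma block_count_bounds:
  fixes A :: "'a set" and L b0 b1 :: nat and \<gamma> :: "'a \<Rightarrow> real" and h :: real
  defines "H \<equiv> h * real (2 * L + 1)" and "\<Gamma> \<equiv> (\<Sum>a\<in>A. \<bar>\<gamma> a\<bar>) + 1"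
  assumes h: "h > 0" and L: "L \<ge> 1" and A: "finite A"
    and ap: "\<And>p. \<bar>p\<bar> \<le> int L \<Longrightarrow> \<bar>sech_eig h L p - pi / cosh (pi * (2 * pi * p / ((2 * real L + 1) * h)))\<bar>
        \<le> el"
    and el: "el > 0" "\<Gamma> * el < t" and ts: "0 < t" "t \<le> s"
    and cm: "h * jump_density (pi * \<Gamma> / t) \<le> 1/2"
    and b: "b0 \<le> b1" "H * real b1 \<le> lN" "lN - c \<le> H * real (b1 - b0)" "0 \<le> c" and lN: "0 \<le> lN"
    and e: "real (card A) / H \<le> e / 2" "c * (real (card A) * jump_density (pi * \<Gamma> / t)) \<le> e / 2 * lN"
  shows "real (card {i \<in> {b0..<b1} \<times> ({- int L..int L} \<times> A). \<gamma> (snd (snd i)) * sech_eig h L (fst (snd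
      i)) > s})
      \<le> ((\<Sum>a\<in>A. jump_density (pi * \<gamma> a / (s - \<Gamma> * el))) + e) * lN"
    "((\<Sum>a\<in>A. jump_density (pi * \<gamma> a / (s + \<Gamma> * el))) - e) * lN
      \<le> real (card {i \<in> {b0..<b1} \<times> ({- int L..int L} \<times> A). \<gamma> (snd (snd i)) * sech_eig h L (fst (snd i))
          > s})"
proof -
  have H0: "H > 0" using h by (simp add: H_def add_pos_nonneg)
  have g\<Gamma>: "\<bar>\<gamma> a\<bar> \<le> \<Gamma>" if "a \<in> A" for a
    using member_le_sum[OF that _ A, of "\<lambda>a. \<bar>\<gamma> a\<bar>"] by (simp add: \<Gamma>_def)
  have \<Gamma>1: "\<Gamma> \<ge> 1" by (simp add: \<Gamma>_def sum_nonneg)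
  define n where "n a = real (card {p\<in>{- int L..int L}. \<gamma> a * sech_eig h L p > s})" for a
  have card: "real (card {i \<in> {b0..<b1} \<times> ({- int L..int L} \<times> A). \<gamma> (snd (snd i)) * sech_eig h L (fst
      (snd i)) > s})
      = real (b1 - b0) * (\<Sum>a\<in>A. n a)"
    unfolding n_def using card_product_filter[of "{b0..<b1}" "{- int L..int L}" A
        "\<lambda>p a. \<gamma> a * sech_eig h L p > s"] A by simp
  have sp: "s - \<Gamma> * el > 0" using el ts by linarith
  have up: "n a \<le> H * jump_density (pi * \<gamma> a / (s - \<Gamma> * el)) + 1" if a: "a \<in> A" for a
  proof -
    have ge: "\<bar>\<gamma> a\<bar> * el \<le> \<Gamma> * el" using g\<Gamma>[OF a] el by (intro mult_right_mono) auto
    then have sp': "0 < s - \<bar>\<gamma> a\<bar> * el" using sp by linarith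
    have "n a \<le> real (2 * L + 1) * h * jump_density (pi * \<gamma> a / (s - \<bar>\<gamma> a\<bar> * el)) + 1"
      unfolding n_def by (rule sech_eig_count(1)[OF h L ap sp'])
    also have "jump_density (pi * \<gamma> a / (s - \<bar>\<gamma> a\<bar> * el)) \<le> jump_density (pi * \<gamma> a / (s - \<Gamma> * el))"
    proof (cases "\<gamma> a > 0")
      case True
      then show ?thesis using ge sp by (intro jump_density_mono divide_left_mono) auto
    next
      case False
      then have "pi * \<gamma> a / (s - \<bar>\<gamma> a\<bar> * el) \<le> 0" using sp'
          by (intro divide_nonpos_pos mult_nonneg_nonpos) auto
      then show ?thesis by (simp add: jump_density_le_1 jump_density_nonneg)
    qed
    then have "real (2 * L + 1) * h * jump_density (pi * \<gamma> a / (s - \<bar>\<gamma> a\<bar> * el))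
        \<le> H * jump_density (pi * \<gamma> a / (s - \<Gamma> * el))"
      unfolding H_def mult.commute[of h] using h by (intro mult_left_mono) auto
    finally show ?thesis by simp
  qed
  have low: "H * jump_density (pi * \<gamma> a / (s + \<Gamma> * el)) - 1 \<le> n a" and cfle:
      "jump_density (pi * \<gamma> a / (s + \<Gamma> * el)) \<le> jump_density (pi * \<Gamma> / t)" if a: "a \<in> A" for a
  proof -
    have ge: "\<bar>\<gamma> a\<bar> * el \<le> \<Gamma> * el" using g\<Gamma>[OF a] el by (intro mult_right_mono) auto
    have ge0: "0 \<le> \<bar>\<gamma> a\<bar> * el" using el by simp
    then have sp': "0 < s + \<bar>\<gamma> a\<bar> * el" using ts by linarith
    have c1: "pi * \<gamma> a / (s + x) \<le> pi * \<Gamma> / t" if "x \<ge> 0" for x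
    proof -
      have "pi * \<gamma> a / (s + x) \<le> pi * \<Gamma> / (s + x)" using g\<Gamma>[OF a] ts that
          by (intro divide_right_mono mult_left_mono) auto
      also have "\<dots> \<le> pi * \<Gamma> / t" using ts that \<Gamma>1 by (intro divide_left_mono) auto
      finally show ?thesis .
    qed
    show "jump_density (pi * \<gamma> a / (s + \<Gamma> * el)) \<le> jump_density (pi * \<Gamma> / t)" using el \<Gamma>1
        by (intro jump_density_mono c1) auto
    have "h * jump_density (pi * \<gamma> a / (s + \<bar>\<gamma> a\<bar> * el)) \<le> h * jump_density (pi * \<Gamma> / t)" using h ge0
        by (intro mult_left_mono jump_density_mono c1) auto
    then have hc: "h * jump_density (pi * \<gamma> a / (s + \<bar>\<gamma> a\<bar> * el)) \<le> 1/2" using cm by linarith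
    have "real (2 * L + 1) * h * jump_density (pi * \<gamma> a / (s + \<bar>\<gamma> a\<bar> * el)) - 1 \<le> n a"
      unfolding n_def by (rule sech_eig_count(2)[OF h L ap sp' hc])
    moreover have "jump_density (pi * \<gamma> a / (s + \<Gamma> * el)) \<le> jump_density (pi * \<gamma> a / (s + \<bar>\<gamma> a\<bar> * el))"
    proof (cases "\<gamma> a > 0")
      case True
      then show ?thesis using ge sp' by (intro jump_density_mono divide_left_mono) auto
    next
      case False
      then have "pi * \<gamma> a / (s + \<Gamma> * el) \<le> 0" using ge sp'
          by (intro divide_nonpos_pos mult_nonneg_nonpos) auto
      then show ?thesis by (simp add: jump_density_le_1 jump_density_nonneg)
    qed
    then have "H * jump_density (pi * \<gamma> a / (s + \<Gamma> * el)) \<le> real (2 * L + 1) * h * jump_density (pi * \<gamma>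
        a / (s + \<bar>\<gamma> a\<bar> * el))"
      unfolding H_def mult.commute[of h] using h by (intro mult_left_mono) auto
    ultimately show "H * jump_density (pi * \<gamma> a / (s + \<Gamma> * el)) - 1 \<le> n a" by linarith
  qed
  have bH: "real (b1 - b0) * H \<le> lN"
  proof -
    have "real (b1 - b0) * H \<le> real b1 * H" using H0 by (intro mult_right_mono) auto
    then show ?thesis using b(2) by (simp add: mult.commute)
  qed
  have bA: "real (b1 - b0) * real (card A) \<le> e / 2 * lN"
  proof -
    have "real (b1 - b0) \<le> lN / H" using bH H0 by (simp add: field_simps)
    then have "real (b1 - b0) * real (card A) \<le> lN / H * real (card A)" by (intro mult_right_mono) auto
    also have "\<dots> = real (card A) / H * lN" by simp
    also have "\<dots> \<le> e / 2 * lN" using e lN by (intro mult_right_mono) auto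
    finally show ?thesis .
  qed
  have e0: "e \<ge> 0" using e(1) H0 by (smt (verit) divide_nonneg_pos of_nat_0_le_iff half_gt_zero_iff
      zero_less_divide_iff divide_minus_left)
  define F where "F = (\<Sum>a\<in>A. jump_density (pi * \<gamma> a / (s - \<Gamma> * el)))"
  have F0: "F \<ge> 0" by (simp add: F_def sum_nonneg jump_density_nonneg)
  have "real (b1 - b0) * (\<Sum>a\<in>A. n a) \<le> real (b1 - b0) * (\<Sum>a\<in>A. H * jump_density (pi * \<gamma> a / (s
      - \<Gamma> * el)) + 1)"
    by (intro mult_left_mono sum_mono up) auto
  also have "\<dots> = (real (b1 - b0) * H) * F + real (b1 - b0) * real (card A)"
    by (simp add: sum.distrib F_def sum_distrib_left algebra_simps)
  also have "\<dots> \<le> lN * F + e / 2 * lN" using bH bA F0 by (intro add_mono mult_right_mono) auto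
  also have "\<dots> \<le> (F + e) * lN" using e0 lN by (simp add: algebra_simps)
  finally show "real (card {i \<in> {b0..<b1} \<times> ({- int L..int L} \<times> A). \<gamma> (snd (snd i)) * sech_eig h L (fst
      (snd i)) > s}) \<le> ((\<Sum>a\<in>A. jump_density (pi * \<gamma> a / (s - \<Gamma> * el))) + e) * lN"
    unfolding card F_def .
  define f where "f = (\<Sum>a\<in>A. jump_density (pi * \<gamma> a / (s + \<Gamma> * el)))"
  have f0: "f \<ge> 0" by (simp add: f_def sum_nonneg jump_density_nonneg)
  have f1: "f \<le> real (card A) * jump_density (pi * \<Gamma> / t)"
    unfolding f_def using cfle by (intro sum_bounded_above) auto
  have "(f - e) * lN \<le> lN * f - e / 2 * lN - e / 2 * lN" by (simp add: algebra_simps)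
  also have "\<dots> \<le> lN * f - c * f - real (b1 - b0) * real (card A)"
  proof -
    have "c * f \<le> e / 2 * lN" using mult_left_mono[OF f1 b(4)] e(2) by linarith
    then show ?thesis using bA by linarith
  qed
  also have "\<dots> = (lN - c) * f - real (b1 - b0) * real (card A)" by (simp add: algebra_simps)
  also have "\<dots> \<le> (H * real (b1 - b0)) * f - real (b1 - b0) * real (card A)"
    using b(3) f0 by (intro diff_mono mult_right_mono) auto
  also have "\<dots> = real (b1 - b0) * (\<Sum>a\<in>A. H * jump_density (pi * \<gamma> a / (s + \<Gamma> * el)) - 1)"
    by (simp add: sum_subtractf f_def sum_distrib_left algebra_simps)
  also have "\<dots> \<le> real (b1 - b0) * (\<Sum>a\<in>A. n a)" by (intro mult_left_mono sum_mono low) auto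
  finally show "((\<Sum>a\<in>A. jump_density (pi * \<gamma> a / (s + \<Gamma> * el))) - e) * lN
      \<le> real (card {i \<in> {b0..<b1} \<times> ({- int L..int L} \<times> A). \<gamma> (snd (snd i)) * sech_eig h L (fst (snd i))
          > s})"
    unfolding card f_def .
qed

section \<open>Eigenvalue asymptotics for sums of oscillating Carleman matrices\<close>

text \<open>Bundles what the two comparison theorems need at one \<open>N\<close>: \<open>u\<close>
  is the shift of the threshold caused by approximate eigenvalues, and \<open>l\<close> stands for
  \<open>ln N\<close>. The 5 comes from \<open>pi + el \<le> 5\<close>.\<close>

definition approx_model :: "'a set \<Rightarrow> ('a \<Rightarrow> real) \<Rightarrow> real \<Rightarrow> real \<Rightarrow> real \<Rightarrow> real \<Rightarrow> real \<Rightarrow> real \<Rightarrow> (ell2 \<Rightarrow>\<^sub>L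
    ell2) \<Rightarrow> bool" where
  "approx_model A \<gamma> \<delta> \<epsilon> e u t l K \<longleftrightarrow> (\<exists>(I :: (nat \<times> int \<times> 'a) set) \<mu> y G R.
    near_orthonormal \<epsilon> I y \<and> (\<forall>i\<in>I. \<bar>\<mu> i\<bar> \<le> 5 * ((\<Sum>a\<in>A. \<bar>\<gamma> a\<bar>) + 1)) \<and>
    (\<forall>x. qform K x = (\<Sum>i\<in>I. \<mu> i * (cmod (cinner x (y i)))\<^sup>2) + R x) \<and>
    finite G \<and> real (card G) \<le> e * l \<and> (\<forall>x\<in>perp G. \<bar>R x\<bar> \<le> \<delta> * (norm x)\<^sup>2) \<and>
    (\<forall>s\<ge>t. real (card {i\<in>I. \<mu> i > s}) \<le> ((\<Sum>a\<in>A. jump_density (pi * \<gamma> a / (s - u))) + e) * l \<and>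
      ((\<Sum>a\<in>A. jump_density (pi * \<gamma> a / (s + u))) - e) * l \<le> real (card {i\<in>I. \<mu> i > s})))"

text \<open>All parameters are chosen here. \<open>R2\<close> is the small-norm part left by the
  approximation of the symbol; after subtracting it and the diagonalised model, the residual has a
  squared Hilbert-Schmidt norm that is a small multiple of \<open>ln N\<close>.\<close>

lemma spectral_decomposition:
  fixes A :: "'a set" and z :: "'a \<Rightarrow> nat \<Rightarrow> real" and \<gamma> :: "'a \<Rightarrow> real" and S :: "nat \<Rightarrow> real"
    and K R2 :: "nat \<Rightarrow> ell2 \<Rightarrow>\<^sub>L ell2"
  defines "\<Gamma> \<equiv> (\<Sum>a\<in>A. \<bar>\<gamma> a\<bar>) + 1"
  assumes A: "finite A" and C0: "C \<ge> 0"
    and zo: "\<And>a a' x y. a \<in> A \<Longrightarrow> a' \<in> A \<Longrightarrow> x \<le> y \<Longrightarrow> \<bar>(\<Sum>j=x..<y. z a j * z a' j) - (if a = a' then real (y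
        - x) else 0)\<bar> \<le> C"
    and S: "\<And>j k. S (j + k) = (\<Sum>a\<in>A. \<gamma> a * z a j * z a k)" "\<And>n. \<bar>S n\<bar> \<le> CS"
    and B: "cond_B \<tau>" and Cc: "cond_C \<tau>"
    and K: "\<And>N. N \<ge> 1 \<Longrightarrow> clinear_op (K N)"
    and R2: "\<And>N. N \<ge> 1 \<Longrightarrow> clinear_op (R2 N) \<and> norm (R2 N) \<le> \<delta>"
    and ent: "\<And>N j k. N \<ge> 1 \<Longrightarrow> j + k \<noteq> 0 \<Longrightarrow> entry (K N) j k - entry (R2 N) j k
        = tau_N \<tau> N j k * of_real (S (j + k) / real (j + k))"
    and ent0: "\<And>N. N \<ge> 1 \<Longrightarrow> cmod (entry (K N) 0 0 - entry (R2 N) 0 0) \<le> c0"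
    and par: "t > 0" "\<epsilon> > 0" "\<delta>1 > 0" "e > 0" "el > 0" "el \<le> 1" "\<Gamma> * el < t"
  shows "\<exists>N0. \<forall>N\<ge>N0. approx_model A \<gamma> (\<delta> + \<delta>1) \<epsilon> e (\<Gamma> * el) t (ln (real N)) (K N)"
proof -
  have \<Gamma>1: "\<Gamma> \<ge> 1" by (simp add: \<Gamma>_def sum_nonneg)
  have g\<Gamma>: "\<bar>\<gamma> a\<bar> \<le> \<Gamma>" if "a \<in> A" for a
    using member_le_sum[OF that _ A, of "\<lambda>a. \<bar>\<gamma> a\<bar>"] by (simp add: \<Gamma>_def)
  \<comment> \<open>The factor from a squared model error to the dimension of the exceptional space:
    \<open>2 * CS\<^sup>2\<close> from \<open>model_residual_bound\<close>, the division from
    \<open>hilbert_schmidt_small\<close>.\<close>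
  define Q where "Q = 2 * CS\<^sup>2 / \<delta>1\<^sup>2"
  have Q0: "Q \<ge> 0" by (simp add: Q_def)
  define cm where "cm = jump_density (pi * \<Gamma> / t)"
  have cm0: "cm \<ge> 0" by (simp add: cm_def jump_density_nonneg)
  obtain c1' N1 where c1': "\<And>N n. N \<ge> N1 \<Longrightarrow> (\<Sum>j<n. \<Sum>k<n. if j + k = 0 then 0 else
    ((cmod (tau_N \<tau> N j k - (if j + k < N then 1 else 0)) / real (j + k))\<^sup>2)) \<le> c1'"
    using multiplier_cutoff_error[OF B Cc] by blast
  define c1 where "c1 = max c1' 0"
  have c1: "\<And>N n. N \<ge> N1 \<Longrightarrow> (\<Sum>j<n. \<Sum>k<n. if j + k = 0 then 0 else
    ((cmod (tau_N \<tau> N j k - (if j + k < N then 1 else 0)) / real (j + k))\<^sup>2)) \<le> c1" "c1 \<ge> 0"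
    by (rule order_trans[OF c1'], assumption, simp add: c1_def) (simp add: c1_def)
  obtain h0 where h0: "h0 > 0" "\<And>h. 0 < h \<Longrightarrow> h < h0 \<Longrightarrow> \<exists>L0. \<forall>L\<ge>L0. \<forall>p. \<bar>p\<bar> \<le> int L \<longrightarrow>
    \<bar>sech_eig h L p - pi / cosh (pi * (2 * pi * p / ((2 * real L + 1) * h)))\<bar> \<le> el"
    using sech_eig_limit[OF par(5)] by blast
  \<comment> \<open>In order: validity of the eigenvalue limit, of the block estimates, of the lower
    frequency count, and smallness of the \<open>h\<^sup>2 * ln N\<close> term.\<close>
  define h where "h = min (h0/2) (min (1/2) (min (1 / (2 * (cm + 1))) (e / (800 * (Q + 1)))))"
  have h: "0 < h" "h < h0" "h \<le> 1/2" "h \<le> 1 / (2 * (cm + 1))" "h \<le> e / (800 * (Q + 1))"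
  proof -
    have "0 < 1 / (2 * (cm + 1))" "0 < e / (800 * (Q + 1))" using cm0 Q0 par
        by (auto intro!: divide_pos_pos)
    then show "0 < h" "h < h0" "h \<le> 1/2" "h \<le> 1 / (2 * (cm + 1))" "h \<le> e / (800 * (Q + 1))"
      unfolding h_def using h0(1) by linarith+
  qed
  have hcm: "h * cm \<le> 1/2"
  proof -
    have "h * (cm + 1) \<le> 1/2" using h(4) cm0 by (simp add: field_simps)
    then show ?thesis using h(1) by (simp add: algebra_simps)
  qed
  have hQ: "Q * (100 * h\<^sup>2) \<le> e / 8"
  proof -
    have "h * (800 * (Q + 1)) \<le> e" using h(5) Q0 by (simp add: pos_le_divide_eq)
    moreover have "h\<^sup>2 \<le> h" using h by (simp add: power2_eq_square mult_le_cancel_left1)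
    then have "Q * (100 * h\<^sup>2) \<le> Q * (100 * h)" using Q0 by (intro mult_left_mono) auto
    moreover have "Q * (100 * h) \<le> (Q + 1) * (100 * h)" using h by (intro mult_right_mono) auto
    ultimately show ?thesis by (simp add: algebra_simps)
  qed
  obtain L1 where L1: "\<And>L p. L \<ge> L1 \<Longrightarrow> \<bar>p\<bar> \<le> int L \<Longrightarrow>
    \<bar>sech_eig h L p - pi / cosh (pi * (2 * pi * p / ((2 * real L + 1) * h)))\<bar> \<le> el"
    using h0(2)[OF h(1,2)] by blast
  \<comment> \<open>A lower bound for the logarithmic length \<open>H\<close> of a cycle, making the
    costs per cycle small against it: boundaries and corners in the error, rounding in the
    count.\<close>
  define Y where "Y = max (160 * Q / e) (4 * real (card A) / e) + 1"
  have Y: "Y \<ge> 1" "160 * Q / e \<le> Y" "4 * real (card A) / e \<le> Y" using Q0 par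
      by (auto simp: Y_def le_max_iff_disj)
  obtain L2 :: nat where L2: "real L2 > Y / h" using reals_Archimedean2 by blast
  define L where "L = max (max L1 1) L2"
  define M where "M = 2 * L + 1"
  define H where "H = h * real M"
  have L: "L \<ge> L1" "L \<ge> 1" "real L > Y / h" using L2 by (auto simp: L_def)
  have "Y \<le> h * real L" using L(3) h by (simp add: field_simps)
  also have "\<dots> \<le> H" unfolding H_def M_def using h by (intro mult_left_mono) auto
  finally have HY: "Y \<le> H" .
  have H1: "H \<ge> 1" using HY Y by linarith
  have HQ: "Q * 20 / H \<le> e / 8"
  proof -
    have "160 * Q / e \<le> H" using HY Y by linarith
    then show ?thesis using H1 par by (simp add: field_simps)
  qed
  have HA: "real (card A) / H \<le> e / 4"
  proof -
    have "4 * real (card A) / e \<le> H" using HY Y by linarith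
    then show ?thesis using H1 par by (simp add: field_simps)
  qed
  define D where "D = real (M * card A)"
  \<comment> \<open>The block cardinality at which the Gram error \<open>D * (C / \<nu>)\<close> is
    at most \<open>\<epsilon>\<close>; the \<open>+ 1\<close> keeps it positive.\<close>
  define \<nu> where "\<nu> = D * C / \<epsilon> + 1"
  have \<nu>0: "\<nu> > 0" using C0 par by (simp add: \<nu>_def D_def add_nonneg_pos)
  have D\<nu>: "D * (C / \<nu>) \<le> \<epsilon>"
  proof -
    have "D * C \<le> \<epsilon> * \<nu>" using par by (simp add: \<nu>_def algebra_simps)
    then show ?thesis using \<nu>0 by (simp add: field_simps)
  qed
  \<comment> \<open>A size of \<open>exp (h * M * b0)\<close> beyond which the block estimates hold
    and all blocks have at least \<open>\<nu>\<close> elements.\<close>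
  define W where "W = max (2 / h\<^sup>2) ((\<nu> + 1) / h)"
  obtain b0' :: nat where b0': "real b0' > W" using reals_Archimedean2 by blast
  define b0 where "b0 = max b0' 1"
  have b0: "b0 \<ge> 1" "W \<le> real b0" using b0' by (auto simp: b0_def)
  have expb0: "W \<le> exp (h * real (M * b0))"
  proof -
    have "W \<le> 1 * real b0" using b0 by simp
    also have "\<dots> \<le> H * real b0" using H1 by (intro mult_right_mono) auto
    also have "\<dots> = h * real (M * b0)" by (simp add: H_def)
    also have "\<dots> \<le> exp (h * real (M * b0))" using exp_ge_add_one_self[of "h * real (M * b0)"]
        by linarith
    finally show ?thesis .
  qed
  have cardb: "\<nu> \<le> real (card (blk h i))" if "b0 * M \<le> i" for i
  proof -
    have "(\<nu> + 1) / h \<le> exp (h * real (M * b0))" using expb0 by (simp add: W_def)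
    then have "\<nu> + 1 \<le> h * exp (h * real (M * b0))" using h by (simp add: field_simps)
    also have "\<dots> \<le> (exp h - 1) * exp (h * real i)"
    proof (intro mult_mono)
      show "h \<le> exp h - 1" using exp_ge_add_one_self[of h] by linarith
      have "real (M * b0) \<le> real i" using that by (simp only: of_nat_le_iff mult.commute)
      then show "exp (h * real (M * b0)) \<le> exp (h * real i)" using h
          by (simp only: exp_le_cancel_iff mult_le_cancel_left_pos)
    qed (use h in auto)
    also have "\<dots> \<le> real (card (blk h i)) + 1" using card_blk[OF h(1), of i] by linarith
    finally show ?thesis by simp
  qed
  define Z where "Z = (exp (h * real (M * b0)) + 1)\<^sup>2 + exp (2 * h * real M)"
  define con1 where "con1 = (c0\<^sup>2 + 2 * CS\<^sup>2 * (c1 + 20 + Z)) / \<delta>1\<^sup>2"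
  \<comment> \<open>The uncovered logarithmic length: \<open>b0\<close> cycles at the start, at most
    one at the end, and \<open>ln 2\<close> from \<open>2 * exp (H * b1) \<le> N\<close>.\<close>
  define c where "c = ln 2 + (real b0 + 1) * H"
  have c0': "c \<ge> 0" using H1 by (simp add: c_def)
  have lnlim: "filterlim (\<lambda>N. ln (real N)) at_top sequentially" by real_asymp
  have "\<forall>\<^sub>F N in sequentially. N1 \<le> N \<and> 2 \<le> N \<and> max 1 (max (H * real b0 + ln 2) (max (con1 * (4 / e)) (c
      * (real (card A) * cm) * (2 / e)))) \<le> ln (real N)"
    using lnlim[unfolded filterlim_at_top] by (intro eventually_conj eventually_ge_at_top) (rule spec)
  then obtain N0 where N0: "\<And>N. N \<ge> N0 \<Longrightarrow> N1 \<le> N \<and> 2 \<le> N \<and> max 1 (max (H * real b0 + ln 2) (max (con1 *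
      (4 / e)) (c * (real (card A) * cm) * (2 / e)))) \<le> ln (real N)"
    by (auto simp: eventually_sequentially)
  show ?thesis
  proof (intro exI[of _ N0] allI impI)
    fix N assume "N0 \<le> N"
    from N0[OF this] have N: "N1 \<le> N" "2 \<le> N" and lN: "1 \<le> ln (real N)" "H * real b0 + ln 2
        \<le> ln (real N)"
      "con1 * (4 / e) \<le> ln (real N)" "c * (real (card A) * cm) * (2 / e) \<le> ln (real N)" by auto
    define lNN where "lNN = ln (real N)"
    have con1: "con1 \<le> e / 4 * lNN" using lN(3) par by (simp add: lNN_def field_simps)
    have con2: "c * (real (card A) * cm) \<le> e / 2 * lNN" using lN(4) par
        by (simp add: lNN_def field_simps)
    \<comment> \<open>The last boundary with \<open>2 * exp (H * b1) \<le> N\<close>, so that all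
      pairs in kept cycles satisfy \<open>j + k < N\<close>.\<close>
    define b1 where "b1 = nat \<lfloor>(lNN - ln 2) / H\<rfloor>"
    have q0: "(lNN - ln 2) / H \<ge> real b0" using lN(2) H1 by (simp add: lNN_def field_simps)
    have b1r: "real b1 = of_int \<lfloor>(lNN - ln 2) / H\<rfloor>" unfolding b1_def using q0 by (simp add: of_nat_nat)
    have b1: "real b1 \<le> (lNN - ln 2) / H" "(lNN - ln 2) / H < real b1 + 1" unfolding b1r by linarith+
    then have b1H: "H * real b1 \<le> lNN - ln 2" "lNN - ln 2 < H * (real b1 + 1)" using H1
        by (simp_all add: field_simps)
    have "real b0 < real b1 + 1" using q0 b1 by linarith
    then have b01: "b0 \<le> b1" by linarith
    have hM: "h * real (M * b) = H * real b" for b by (simp add: H_def)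
    have exN: "2 * exp (lNN - ln 2) = real N" using N by (simp add: lNN_def exp_diff)
    have N_a: "2 * exp (h * real (M * b1)) \<le> real N" unfolding hM exN[symmetric] using b1H by simp
    have N_b: "real N < 2 * exp (h * real (M * (b1 + 1)))" unfolding hM exN[symmetric] using b1H
        by (simp add: add.commute)
    define I where "I = {b0..<b1} \<times> ({- int L..int L} \<times> A)"
    define \<mu> where "\<mu> i = \<gamma> (snd (snd i)) * sech_eig h L (fst (snd i))" for i :: "nat \<times> int \<times> 'a"
    define y where "y i = blk_vec h M (z (snd (snd i))) (fst i) (fst (snd i))" for i :: "nat \<times> int \<times> 'a"
    have fI: "finite I" using A by (simp add: I_def)
    have no: "near_orthonormal \<epsilon> I y"
    proof (rule near_orthonormal_mono)
      show "near_orthonormal (real (M * card A) * (C / \<nu>)) I y"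
        unfolding I_def y_def[abs_def] M_def by (rule blk_vec_near_orthonormal[OF h(1) A C0 \<nu>0]) (use
            cardb zo in \<open>auto simp: M_def\<close>)
      show "real (M * card A) * (C / \<nu>) \<le> \<epsilon>" using D\<nu> by (simp only: D_def)
    qed
    have \<mu>b: "\<bar>\<mu> i\<bar> \<le> 5 * \<Gamma>" if i: "i \<in> I" for i
    proof -
      have p: "\<bar>fst (snd i)\<bar> \<le> int L" "snd (snd i) \<in> A" using i by (auto simp: I_def)
      let ?F = "pi / cosh (pi * (2 * pi * fst (snd i) / ((2 * real L + 1) * h)))"
      have "?F \<le> pi / 1" by (intro divide_left_mono) (auto simp: cosh_real_ge_1)
      moreover have "?F \<ge> 0" by simp
      ultimately have "\<bar>sech_eig h L (fst (snd i))\<bar> \<le> 5" using L1[OF L(1) p(1)] pi_less_4 par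
          by linarith
      then have "\<bar>\<mu> i\<bar> \<le> \<Gamma> * 5" unfolding \<mu>_def abs_mult using g\<Gamma>[OF p(2)] \<Gamma>1 by (intro mult_mono) auto
      then show ?thesis by simp
    qed
    obtain Wo where Wo: "has_entries Wo (\<lambda>j k. \<Sum>i\<in>I. of_real (\<mu> i) * cnj (ell2_nth (y i) j) * ell2_nth
        (y i) k)"
      "\<And>x. qform Wo x = (\<Sum>i\<in>I. \<mu> i * (cmod (cinner x (y i)))\<^sup>2)"
      using finite_rank_op[OF fI] by blast
    have Went: "entry Wo j k = of_real (S (j + k) * model h L b0 b1 j k)" for j k
      using Wo(1) blk_vec_entries[OF h(1) A, where ?b0.0=b0 and ?b1.0=b1 and L=L and \<gamma>=\<gamma> and z=z and j=j
          and k=k]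
      unfolding has_entries_def I_def \<mu>_def y_def M_def S(1) by simp
    have N1': "N \<ge> 1" using N by simp
    define T where "T = K N - R2 N - Wo"
    have hK: "has_entries (K N) (entry (K N))" "has_entries (R2 N) (entry (R2 N))"
        "has_entries Wo (entry Wo)"
      using K[OF N1'] R2[OF N1'] Wo(1) by (auto simp: has_entries_def)
    have hT: "has_entries T (\<lambda>j k. entry (K N) j k - entry (R2 N) j k - entry Wo j k)"
      unfolding T_def by (intro has_entries_diff hK)
    then have clT: "clinear_op T" and Te: "\<And>j k. entry T j k = entry (K N) j k - entry (R2 N) j k
        - entry Wo j k"
      by (auto simp: has_entries_def)
    define E2 where "E2 = 50 * h\<^sup>2 * (1 + lNN) + 20 * (real b1 + 1) + (exp (h * real (M * b0)) + 1)\<^sup>2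
        + exp (2 * h * real M)"
    define ST where "ST = c0\<^sup>2 + 2 * CS\<^sup>2 * (c1 + E2)"
    have HS: "(\<Sum>j<n. \<Sum>k<n. (cmod (entry T j k))\<^sup>2) \<le> ST" for n
      unfolding ST_def
    proof (rule model_residual_bound[OF c1(2) c1(1)[OF N(1)], where m="model h L b0 b1"])
      have "2 / h\<^sup>2 \<le> exp (h * real (M * b0))" using expb0 by (simp add: W_def)
      from model_error[OF h(1,3) b0(1) b01 this[unfolded M_def] N_a[unfolded M_def] N_b[unfolded M_def]]
      show "(\<Sum>j<n. \<Sum>k<n. if j + k = 0 then 0 else ((if j + k < N then 1 / real (j + k) else 0)
          - model h L b0 b1 j k)\<^sup>2) \<le> E2"
        unfolding E2_def M_def lNN_def .
      show "\<bar>S n\<bar> \<le> CS" for n by (rule S(2))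
      show "entry T j k = tau_N \<tau> N j k * of_real (S (j + k) / real (j + k)) - of_real (S (j
          + k) * model h L b0 b1 j k)" if "j + k \<noteq> 0" for j k
        unfolding Te Went ent[OF N1' that] ..
      have "model h L b0 b1 0 0 = 0" by (simp add: model_def)
      then show "cmod (entry T 0 0) \<le> c0" unfolding Te Went using ent0[OF N1'] by simp
    qed
    obtain G where G: "finite G" "real (card G) \<le> ST / \<delta>1\<^sup>2" "\<And>x. x \<in> perp G \<Longrightarrow> norm (blinfun_apply T x)
        \<le> \<delta>1 * norm x"
      using hilbert_schmidt_small[OF clT HS par(3)] by blast
    have cG: "real (card G) \<le> e * lNN"
    proof -
      have "ST / \<delta>1\<^sup>2 = con1 + Q * (50 * h\<^sup>2 * (1 + lNN)) + Q * (20 * real b1)"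
        unfolding ST_def con1_def Q_def E2_def Z_def by (simp add: add_divide_distrib algebra_simps)
      also have "\<dots> \<le> e / 4 * lNN + e / 8 * lNN + e / 8 * lNN"
      proof (intro add_mono con1)
        have "Q * (50 * h\<^sup>2 * (1 + lNN)) \<le> Q * (50 * h\<^sup>2 * (2 * lNN))"
          using Q0 lN(1) by (intro mult_left_mono) (auto simp: lNN_def)
        also have "\<dots> = Q * (100 * h\<^sup>2) * lNN" by simp
        also have "\<dots> \<le> e / 8 * lNN" using hQ lN(1) by (intro mult_right_mono) (auto simp: lNN_def)
        finally show "Q * (50 * h\<^sup>2 * (1 + lNN)) \<le> e / 8 * lNN" .
        have "(lNN - ln 2) / H \<le> lNN / H" using H1 by (intro divide_right_mono) auto
        then have "real b1 \<le> lNN / H" using b1(1) by linarith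
        then have "Q * (20 * real b1) \<le> Q * (20 * (lNN / H))" using Q0 by (intro mult_left_mono) auto
        also have "\<dots> = Q * 20 / H * lNN" by simp
        also have "\<dots> \<le> e / 8 * lNN" using HQ lN(1) by (intro mult_right_mono) (auto simp: lNN_def)
        finally show "Q * (20 * real b1) \<le> e / 8 * lNN" .
      qed
      also have "\<dots> \<le> e * lNN" using par lN(1) by (simp add: lNN_def)
      finally show ?thesis using G(2) by linarith
    qed
    define R where "R x = qform (R2 N) x + qform T x" for x
    have qf: "qform (K N) x = (\<Sum>i\<in>I. \<mu> i * (cmod (cinner x (y i)))\<^sup>2) + R x" for x
    proof -
      have "qform T x = qform (K N) x - qform (R2 N) x - qform Wo x"
        by (simp add: T_def qform_def blinfun.diff_left cinner_diff_left)
      then show ?thesis using Wo(2)[of x] by (simp add: R_def)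
    qed
    have Rb: "\<bar>R x\<bar> \<le> (\<delta> + \<delta>1) * (norm x)\<^sup>2" if x: "x \<in> perp G" for x
    proof -
      have "\<bar>qform T x\<bar> \<le> cmod (cinner (blinfun_apply T x) x)" unfolding qform_def
          by (rule abs_Re_le_cmod)
      also have "\<dots> \<le> norm (blinfun_apply T x) * norm x" by (rule cmod_cinner_le)
      also have "\<dots> \<le> (\<delta>1 * norm x) * norm x" by (intro mult_right_mono G(3)[OF x]) auto
      finally have 1: "\<bar>qform T x\<bar> \<le> \<delta>1 * (norm x)\<^sup>2" by (simp add: power2_eq_square mult.assoc)
      have "\<bar>qform (R2 N) x\<bar> \<le> norm (R2 N) * (norm x)\<^sup>2" by (rule qform_bound)
      also have "\<dots> \<le> \<delta> * (norm x)\<^sup>2" using R2[OF N1'] by (intro mult_right_mono) auto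
      finally show ?thesis using 1 by (simp add: R_def distrib_right)
    qed
    have cnt: "real (card {i\<in>I. \<mu> i > s}) \<le> ((\<Sum>a\<in>A. jump_density (pi * \<gamma> a / (s - \<Gamma> * el))) + e) * lNN \<and>
      ((\<Sum>a\<in>A. jump_density (pi * \<gamma> a / (s + \<Gamma> * el))) - e) * lNN \<le> real (card {i\<in>I. \<mu> i > s})"
          if s: "s \<ge> t" for s
    proof -
      have HH: "h * real (2 * L + 1) = H" by (simp add: H_def M_def)
      have "lNN - c \<le> H * real (b1 - b0)"
        using b1H b01 by (simp add: c_def of_nat_diff algebra_simps)
      moreover have "H * real b1 \<le> lNN" using b1H by (smt (verit) ln_ge_zero)
      moreover have "real (card A) / H \<le> e / 2" using HA par by linarith
      moreover have "0 \<le> lNN" using lN(1) by (simp add: lNN_def)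
      ultimately show ?thesis
        using block_count_bounds[where A=A and L=L and ?b0.0=b0 and ?b1.0=b1 and \<gamma>=\<gamma> and h=h and el=el
            and t=t and s=s and lN=lNN and c=c and e=e,
            OF h(1) L(2) A L1[OF L(1)] par(5) par(7)[unfolded \<Gamma>_def] par(1) s hcm[unfolded cm_def \<Gamma>_def]
                b01]
          con2 c0'
        unfolding I_def \<mu>_def \<Gamma>_def[symmetric] HH cm_def by blast
    qed
    show "approx_model A \<gamma> (\<delta> + \<delta>1) \<epsilon> e (\<Gamma> * el) t (ln (real N)) (K N)"
      unfolding lNN_def[symmetric] approx_model_def \<Gamma>_def[symmetric]
      by (rule exI[of _ I], rule exI[of _ \<mu>], rule exI[of _ y], rule exI[of _ G], rule exI[of _ R])
        (use no \<mu>b qf G(1) cG Rb cnt in blast)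
  qed
qed

text \<open>The approximation of the symbol moves the threshold by \<open>\<delta>\<close>,
  everything else by an arbitrarily small amount; hence the strict inequalities between
  \<open>s\<close> and \<open>t\<close>.\<close>

theorem eigenvalue_count_asymptotics:
  fixes A :: "'a set" and z :: "'a \<Rightarrow> nat \<Rightarrow> real" and \<gamma> :: "'a \<Rightarrow> real" and S :: "nat \<Rightarrow> real"
    and K R2 :: "nat \<Rightarrow> ell2 \<Rightarrow>\<^sub>L ell2"
  assumes A: "finite A" and C0: "C \<ge> 0"
    and zo: "\<And>a a' x y. a \<in> A \<Longrightarrow> a' \<in> A \<Longrightarrow> x \<le> y \<Longrightarrow> \<bar>(\<Sum>j=x..<y. z a j * z a' j) - (if a = a' then real (y
        - x) else 0)\<bar> \<le> C"
    and S: "\<And>j k. S (j + k) = (\<Sum>a\<in>A. \<gamma> a * z a j * z a k)" "\<And>n. \<bar>S n\<bar> \<le> CS"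
    and B: "cond_B \<tau>" and Cc: "cond_C \<tau>"
    and K: "\<And>N. N \<ge> 1 \<Longrightarrow> selfadj (K N)"
    and R2: "\<And>N. N \<ge> 1 \<Longrightarrow> clinear_op (R2 N) \<and> norm (R2 N) \<le> \<delta>"
    and ent: "\<And>N j k. N \<ge> 1 \<Longrightarrow> j + k \<noteq> 0 \<Longrightarrow> entry (K N) j k - entry (R2 N) j k
        = tau_N \<tau> N j k * of_real (S (j + k) / real (j + k))"
    and ent0: "\<And>N. N \<ge> 1 \<Longrightarrow> cmod (entry (K N) 0 0 - entry (R2 N) 0 0) \<le> c0"
    and par: "t > 0" "e > 0" "\<delta> \<ge> 0"
  shows "0 < s \<Longrightarrow> s < t - \<delta> \<Longrightarrow> \<forall>\<^sub>F N in sequentially. real (eigenvalue_count t (K N))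
      \<le> ((\<Sum>a\<in>A. jump_density (pi * \<gamma> a / s)) + e) * ln (real N)"
    and "\<delta> < t \<Longrightarrow> t + \<delta> < s \<Longrightarrow> \<forall>\<^sub>F N in sequentially. ((\<Sum>a\<in>A. jump_density (pi * \<gamma> a / s)) - e) * ln (real
        N) \<le> real (eigenvalue_count t (K N))"
proof -
  define \<Gamma> where "\<Gamma> = (\<Sum>a\<in>A. \<bar>\<gamma> a\<bar>) + 1"
  have \<Gamma>1: "\<Gamma> \<ge> 1" by (simp add: \<Gamma>_def sum_nonneg)
  have clK: "clinear_op (K N)" if "N \<ge> 1" for N using K[OF that] by (simp add: selfadj_def)
  have dec: "\<And>t \<epsilon> \<delta>1 e el. t > 0 \<Longrightarrow> \<epsilon> > 0 \<Longrightarrow> \<delta>1 > 0 \<Longrightarrow> e > 0 \<Longrightarrow> el > 0 \<Longrightarrow> el \<le> 1 \<Longrightarrow> \<Gamma> * el < t \<Longrightarrow>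
    \<exists>N0. \<forall>N\<ge>N0. approx_model A \<gamma> (\<delta> + \<delta>1) \<epsilon> e (\<Gamma> * el) t (ln (real N)) (K N)"
    by (rule spectral_decomposition[OF A C0 zo S B Cc clK R2 ent ent0, folded \<Gamma>_def]) assumption+
  have cfm: "(\<Sum>a\<in>A. jump_density (pi * \<gamma> a / u)) \<le> (\<Sum>a\<in>A. jump_density (pi * \<gamma> a / v))"
      if "0 < v" "v \<le> u" for u v
  proof (rule sum_mono)
    fix a
    show "jump_density (pi * \<gamma> a / u) \<le> jump_density (pi * \<gamma> a / v)"
    proof (cases "\<gamma> a > 0")
      case True then show ?thesis using that by (intro jump_density_mono divide_left_mono) auto
    next
      case False
      then have "pi * \<gamma> a / u \<le> 0" using that by (intro divide_nonpos_pos mult_nonneg_nonpos) auto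
      then show ?thesis by (simp add: jump_density_le_1 jump_density_nonneg)
    qed
  qed
  have ln0: "\<forall>\<^sub>F N in sequentially. 1 \<le> N \<and> 0 \<le> ln (real N)"
    by (rule eventually_sequentiallyI[of 1]) auto
  show "\<forall>\<^sub>F N in sequentially. real (eigenvalue_count t (K N)) \<le> ((\<Sum>a\<in>A. jump_density (pi * \<gamma> a / s))
      + e) * ln (real N)"
    if s: "0 < s" "s < t - \<delta>"
  proof -
    \<comment> \<open>A third of the gap each for the eigenvalue shift, for the defect of
      orthonormality and for the residual.\<close>
    define q where "q = (t - \<delta> - s) / 3"
    have q: "q > 0" "s + 3 * q = t - \<delta>" using s by (simp_all add: q_def field_simps)
    define s' where "s' = s + q"
    define el where "el = min 1 (min (q / \<Gamma>) (s' / (2 * \<Gamma>)))"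
    have "el > 0" "el \<le> 1" "el \<le> q / \<Gamma>" "el \<le> s' / (2 * \<Gamma>)" using q s \<Gamma>1 by (auto simp: el_def s'_def)
    then have el: "el > 0" "el \<le> 1" "\<Gamma> * el \<le> q" "\<Gamma> * el < s'" using \<Gamma>1 q s
        by (auto simp: field_simps s'_def)
    have s'0: "s' > 0" using q s by (simp add: s'_def)
    define \<epsilon> where "\<epsilon> = q / s'"
    have \<epsilon>: "\<epsilon> > 0" using q s'0 by (simp add: \<epsilon>_def)
    have e2: "e / 2 > 0" using par by simp
    from dec[OF s'0 \<epsilon> q(1) e2 el(1,2,4)] obtain N0 where N0: "\<And>N. N \<ge> N0 \<Longrightarrow> approx_model A \<gamma> (\<delta>
        + q) \<epsilon> (e / 2) (\<Gamma> * el) s' (ln (real N)) (K N)"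
      by blast
    have "\<forall>\<^sub>F N in sequentially. N0 \<le> N" by (rule eventually_ge_at_top)
    with ln0 show ?thesis
    proof eventually_elim
      case (elim N)
      obtain I :: "(nat \<times> int \<times> 'a) set" and \<mu> y G R where w: "near_orthonormal \<epsilon> I y"
        "\<And>x. qform (K N) x = (\<Sum>i\<in>I. \<mu> i * (cmod (cinner x (y i)))\<^sup>2) + R x"
        "finite G" "real (card G) \<le> e / 2 * ln (real N)" "\<And>x. x \<in> perp G \<Longrightarrow> \<bar>R x\<bar> \<le> (\<delta> + q) * (norm x)\<^sup>2"
        "real (card {i\<in>I. \<mu> i > s'}) \<le> ((\<Sum>a\<in>A. jump_density (pi * \<gamma> a / (s' - \<Gamma> * el)))
            + e / 2) * ln (real N)"
        using N0[OF elim(2)] unfolding approx_model_def by blast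
      have "s' * (1 + \<epsilon>) + (\<delta> + q) \<le> t" using s'0 q by (simp add: \<epsilon>_def s'_def distrib_left)
      from eigenvalue_count_upper[OF K w(1,2,3,5) _ this] s'0 elim(1)
      have "eigenvalue_count t (K N) \<le> card {i\<in>I. \<mu> i > s'} + card G" by auto
      then have "real (eigenvalue_count t (K N)) \<le> real (card {i\<in>I. \<mu> i > s'}) + real (card G)"
          by linarith
      also have "\<dots> \<le> ((\<Sum>a\<in>A. jump_density (pi * \<gamma> a / (s' - \<Gamma> * el))) + e) * ln (real N)"
        using w(4,6) by (simp add: algebra_simps)
      also have "\<dots> \<le> ((\<Sum>a\<in>A. jump_density (pi * \<gamma> a / s)) + e) * ln (real N)"
        using elim(1) el(3) s by (intro mult_right_mono add_right_mono cfm) (auto simp: s'_def)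
      finally show ?case .
    qed
  qed
  show "\<forall>\<^sub>F N in sequentially. ((\<Sum>a\<in>A. jump_density (pi * \<gamma> a / s)) - e) * ln (real N)
      \<le> real (eigenvalue_count t (K N))"
    if s: "\<delta> < t" "t + \<delta> < s"
  proof -
    \<comment> \<open>Also at most \<open>t - \<delta>\<close>, since the lower comparison wants the
      total residual \<open>\<delta> + q\<close> to be at most \<open>t\<close>.\<close>
    define q where "q = min ((s - t - \<delta>) / 3) (t - \<delta>)"
    have "q \<le> (s - t - \<delta>) / 3" "q \<le> t - \<delta>" unfolding q_def by (rule min.cobounded1, rule min.cobounded2)
    moreover have "q > 0" using s by (simp add: q_def)
    ultimately have q: "q > 0" "3 * q \<le> s - t - \<delta>" "\<delta> + q \<le> t" by (simp_all add: field_simps)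
    define s' where "s' = s - q"
    have s't: "s' \<ge> t" "s' > 0" using q par by (auto simp: s'_def)
    define el where "el = min 1 (min (q / \<Gamma>) (t / (2 * \<Gamma>)))"
    have "el > 0" "el \<le> 1" "el \<le> q / \<Gamma>" "el \<le> t / (2 * \<Gamma>)" using q s \<Gamma>1 par by (auto simp: el_def)
    then have el: "el > 0" "el \<le> 1" "\<Gamma> * el \<le> q" "\<Gamma> * el < t" using \<Gamma>1 q s par
        by (auto simp: field_simps)
    \<comment> \<open>Collects the coefficients of \<open>\<epsilon>\<close> in the last condition
      of \<open>eigenvalue_count_lower\<close>, after
      \<open>\<epsilon>\<^sup>2 \<le> \<epsilon>\<close>.\<close>
    define c where "c = t + 2 * s' + 5 * \<Gamma> + \<delta> + q + 1"
    have c: "c > 0" using par s't q \<Gamma>1 by (simp add: c_def)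
    define \<epsilon> where "\<epsilon> = min 1 (q / (2 * c))"
    have \<epsilon>: "\<epsilon> > 0" "\<epsilon> \<le> 1" "\<epsilon> * c < q"
    proof -
      show "\<epsilon> > 0" "\<epsilon> \<le> 1" using q c by (auto simp: \<epsilon>_def)
      have "\<epsilon> \<le> q / (2 * c)" by (simp add: \<epsilon>_def)
      then have "\<epsilon> * c \<le> q / 2" using c by (simp add: field_simps)
      then show "\<epsilon> * c < q" using q by linarith
    qed
    have e2: "e / 2 > 0" using par by simp
    from dec[OF par(1) \<epsilon>(1) q(1) e2 el(1,2,4)] obtain N0 where N0: "\<And>N. N \<ge> N0 \<Longrightarrow> approx_model A \<gamma> (\<delta>
        + q) \<epsilon> (e / 2) (\<Gamma> * el) t (ln (real N)) (K N)"
      by blast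
    have "\<forall>\<^sub>F N in sequentially. N0 \<le> N" by (rule eventually_ge_at_top)
    with ln0 show ?thesis
    proof eventually_elim
      case (elim N)
      obtain I :: "(nat \<times> int \<times> 'a) set" and \<mu> y G R where w: "near_orthonormal \<epsilon> I y"
        "\<And>i. i \<in> I \<Longrightarrow> \<bar>\<mu> i\<bar> \<le> 5 * \<Gamma>"
        "\<And>x. qform (K N) x = (\<Sum>i\<in>I. \<mu> i * (cmod (cinner x (y i)))\<^sup>2) + R x"
        "finite G" "real (card G) \<le> e / 2 * ln (real N)" "\<And>x. x \<in> perp G \<Longrightarrow> \<bar>R x\<bar> \<le> (\<delta> + q) * (norm x)\<^sup>2"
        "((\<Sum>a\<in>A. jump_density (pi * \<gamma> a / (s' + \<Gamma> * el))) - e / 2) * ln (real N)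
            \<le> real (card {i\<in>I. \<mu> i > s'})"
        using N0[OF elim(2)] s't(1) unfolding approx_model_def \<Gamma>_def[symmetric] by blast
      have "t * (1 + \<epsilon>) < s' * (1 - 2 * \<epsilon>) - 5 * \<Gamma> * \<epsilon>\<^sup>2 - (\<delta> + q) * (1 + \<epsilon>)"
      proof -
        have "\<epsilon>\<^sup>2 \<le> \<epsilon> * 1" unfolding power2_eq_square using \<epsilon> by (intro mult_left_mono) auto
        then have "5 * \<Gamma> * \<epsilon>\<^sup>2 \<le> 5 * \<Gamma> * \<epsilon>" using \<Gamma>1 by (intro mult_left_mono) auto
        moreover have "\<epsilon> * c = t * \<epsilon> + 2 * s' * \<epsilon> + 5 * \<Gamma> * \<epsilon> + (\<delta> + q) * \<epsilon> + \<epsilon>"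
            by (simp add: c_def algebra_simps)
        moreover have "t + (\<delta> + q) + q \<le> s'" using q by (simp add: s'_def)
        ultimately show ?thesis using \<epsilon> by (simp add: algebra_simps)
      qed
      from eigenvalue_count_lower[OF K w(1,3,4,6,2) _ _ q(3) this] s't(2) elim(1) par(3) q(1)
      have "card {i\<in>I. \<mu> i > s'} \<le> eigenvalue_count t (K N) + card G" by auto
      then have le: "real (card {i\<in>I. \<mu> i > s'}) \<le> real (eigenvalue_count t (K N)) + real (card G)"
          by linarith
      have "((\<Sum>a\<in>A. jump_density (pi * \<gamma> a / s)) - e) * ln (real N) \<le> ((\<Sum>a\<in>A. jump_density (pi * \<gamma> a /
          (s' + \<Gamma> * el))) - e) * ln (real N)"
        using elim(1) el s't \<Gamma>1 by (intro mult_right_mono diff_right_mono cfm) (auto simp: s'_def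
            intro!: add_pos_nonneg)
      also have "\<dots> \<le> real (eigenvalue_count t (K N))" using w(5,7) le by (simp add: algebra_simps)
      finally show ?case .
    qed
  qed
qed

section \<open>The oscillating modes of a step symbol\<close>

lemma cis_eq_1_small: "\<bar>x\<bar> < 2 * pi \<Longrightarrow> cis x = 1 \<longleftrightarrow> x = 0"
proof
  assume x: "\<bar>x\<bar> < 2 * pi" and "cis x = 1"
  then have "cos x = 1" by (simp add: complex_eq_iff)
  then obtain k :: int where k: "x = real_of_int k * 2 * pi" by (auto simp: cos_one_2pi_int)
  then have "\<bar>real_of_int k\<bar> * (2 * pi) < 1 * (2 * pi)" using x by (simp add: abs_mult mult_ac)
  then have "\<bar>real_of_int k\<bar> < 1" using pi_gt_zero by (subst (asm) mult_less_cancel_right_pos) auto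
  then have "k = 0" by linarith
  then show "x = 0" using k by simp
qed simp

text \<open>A geometric sum: bounded unless the frequency is a multiple of \<open>2 * pi\<close>, in
  which case the terms are constant.\<close>

lemma trig_sum_bounded:
  "\<exists>C\<ge>0. \<forall>x y::nat. x \<le> y \<longrightarrow> \<bar>(\<Sum>j=x..<y. Re (w * cis (- (q * real j)))) - (if cis q
      = 1 then Re w else 0) * real (y - x)\<bar> \<le> C"
proof (cases "cis q = 1")
  case True
  have "cis (- (q * real j)) = 1" for j
  proof -
    have "cis (- (q * real j)) = cnj (cis q ^ j)" by (simp add: Complex.DeMoivre cis_cnj mult.commute)
    then show ?thesis using True by simp
  qed
  then show ?thesis using True by (intro exI[of _ 0]) simp
next
  case False
  define u where "u = cis (- q)"
  have u: "cmod u = 1" "cis (- (q * real j)) = u ^ j" for j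
    by (simp_all add: u_def Complex.DeMoivre mult.commute)
  have "u \<noteq> 1"
  proof
    assume "u = 1"
    then have "cnj u = 1" by simp
    then show False using False by (simp add: u_def cis_cnj)
  qed
  have "\<bar>\<Sum>j=x..<y. Re (w * u ^ j)\<bar> \<le> cmod w * (2 / cmod (1 - u))" if "x \<le> y" for x y
  proof -
    have "(\<Sum>j=x..<y. u ^ j) = (u ^ x - u ^ y) / (1 - u)"
    proof -
      have "(1 - u) * (\<Sum>j=x..<y. u ^ j) = u ^ x - u ^ y"
        using that
      proof (induction y rule: dec_induct)
        case (step n)
        have "(1 - u) * (\<Sum>j=x..<Suc n. u ^ j) = (1 - u) * (\<Sum>j=x..<n. u ^ j) + (1 - u) * u ^ n"
          using step(1) by (simp add: distrib_left)
        then show ?case unfolding step.IH by (simp add: algebra_simps)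
      qed simp
      then show ?thesis using \<open>u \<noteq> 1\<close> by (simp add: field_simps)
    qed
    then have "cmod (\<Sum>j=x..<y. u ^ j) = cmod (u ^ x - u ^ y) / cmod (1 - u)" by (simp add: norm_divide)
    also have "\<dots> \<le> 2 / cmod (1 - u)"
      using norm_triangle_ineq4[of "u ^ x" "u ^ y"] u(1) by (intro divide_right_mono) (auto simp:
          norm_power)
    finally have s: "cmod (\<Sum>j=x..<y. u ^ j) \<le> 2 / cmod (1 - u)" .
    have "(\<Sum>j=x..<y. Re (w * u ^ j)) = Re (w * (\<Sum>j=x..<y. u ^ j))"
        by (simp only: sum_distrib_left Re_sum)
    also have "\<bar>\<dots>\<bar> \<le> cmod (w * (\<Sum>j=x..<y. u ^ j))" by (rule abs_Re_le_cmod)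
    also have "\<dots> \<le> cmod w * (2 / cmod (1 - u))" unfolding norm_mult using s
        by (intro mult_left_mono) auto
    finally show ?thesis .
  qed
  then show ?thesis using False unfolding u(2)
    by (intro exI[of _ "cmod w * (2 / cmod (1 - u))"]) auto
qed

definition osc :: "complex \<Rightarrow> real \<Rightarrow> nat \<Rightarrow> real" where
  "osc w q j = Re (w * cis (- (q * real j)))"

lemma osc_product: "osc w q j * osc w' q' j = (Re (w * w' * cis (- ((q + q') * real j)))
    + Re (w * cnj w' * cis (- ((q - q') * real j)))) / 2"
proof -
  have c1: "cis (- ((q + q') * real j)) = cis (- (q * real j)) * cis (- (q' * real j))"
    by (simp add: cis_mult algebra_simps)
  have c2: "cis (- ((q - q') * real j)) = cis (- (q * real j)) * cnj (cis (- (q' * real j)))"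
    by (simp add: cis_mult cis_cnj algebra_simps)
  have r: "Re a * Re b = (Re (a * b) + Re (a * cnj b)) / 2" for a b by simp
  have e1: "(w * x) * (w' * y) = w * w' * (x * y)" "(w * x) * cnj (w' * y) = w * cnj w' * (x * cnj y)"
      for x y
    by (simp_all add: mult_ac)
  show ?thesis unfolding osc_def c1 c2 r e1 ..
qed

lemma osc_product_sum_bounded:
  "\<exists>C\<ge>0. \<forall>x y::nat. x \<le> y \<longrightarrow> \<bar>(\<Sum>j=x..<y. osc w q j * osc w' q' j) -
    ((if cis (q + q') = 1 then Re (w * w') else 0) + (if cis (q - q') = 1 then Re (w * cnj w') else 0))
        / 2 * real (y - x)\<bar> \<le> C"
proof -
  obtain C1 where C1: "C1 \<ge> 0" "\<And>x y::nat. x \<le> y \<Longrightarrow> \<bar>(\<Sum>j=x..<y. Re (w * w' * cis (- ((q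
      + q') * real j)))) - (if cis (q + q') = 1 then Re (w * w') else 0) * real (y - x)\<bar> \<le> C1"
    using trig_sum_bounded[of "w * w'" "q + q'"] by blast
  obtain C2 where C2: "C2 \<ge> 0" "\<And>x y::nat. x \<le> y \<Longrightarrow> \<bar>(\<Sum>j=x..<y. Re (w * cnj w' * cis (- ((q
      - q') * real j)))) - (if cis (q - q') = 1 then Re (w * cnj w') else 0) * real (y - x)\<bar> \<le> C2"
    using trig_sum_bounded[of "w * cnj w'" "q - q'"] by blast
  have avg: "\<bar>(a + b) / 2 - (c + d) / 2 * n\<bar> \<le> C1 + C2" if "\<bar>a - c * n\<bar> \<le> C1" "\<bar>b - d * n\<bar> \<le> C2"
      for a b c d n :: real
  proof -
    define X Y where "X = a - c * n" and "Y = b - d * n"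
    have "(a + b) / 2 - (c + d) / 2 * n = (X + Y) / 2" by (simp add: X_def Y_def field_simps)
    moreover have "\<bar>(X + Y) / 2\<bar> \<le> C1 + C2"
    proof -
      have "\<bar>X\<bar> \<le> C1" "\<bar>Y\<bar> \<le> C2" using that by (simp_all add: X_def Y_def)
      then have "\<bar>X + Y\<bar> \<le> C1 + C2" by linarith
      moreover have "\<bar>(X + Y) / 2\<bar> = \<bar>X + Y\<bar> / 2" by simp
      moreover have "Z / 2 \<le> W" if "Z \<le> W" "0 \<le> Z" for Z W :: real using that by simp
      ultimately show ?thesis by (simp only: abs_ge_zero)
    qed
    ultimately show ?thesis by (simp only:)
  qed
  show ?thesis
  proof (intro exI[of _ "C1 + C2"] conjI allI impI)
    show "0 \<le> C1 + C2" using C1 C2 by simp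
    fix x y :: nat assume xy: "x \<le> y"
    have eq: "(\<Sum>j=x..<y. osc w q j * osc w' q' j) =
      ((\<Sum>j=x..<y. Re (w * w' * cis (- ((q + q') * real j)))) + (\<Sum>j=x..<y. Re (w * cnj w' * cis (- ((q
          - q') * real j))))) / 2"
      unfolding osc_product by (simp only: sum_divide_distrib[symmetric] sum.distrib)
    show "\<bar>(\<Sum>j=x..<y. osc w q j * osc w' q' j) -
    ((if cis (q + q') = 1 then Re (w * w') else 0) + (if cis (q - q') = 1 then Re (w * cnj w') else 0))
        / 2 * real (y - x)\<bar> \<le> C1 + C2"
      unfolding eq by (rule avg[OF C1(2)[OF xy] C2(2)[OF xy]])
  qed
qed

text \<open>The jump \<open>d\<close> of a step symbol at \<open>p\<close> contributes \<open>Im (d e\<^sup>-\<^sup>i\<^sup>n\<^sup>p)\<close> to \<open>\<pi> S(n)\<close>. With \<open>r = jump_root d\<close> and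
  \<open>W\<^sub>j = r e\<^sup>-\<^sup>i\<^sup>j\<^sup>p\<close>, this is \<open>\<bar>d\<bar>/2\<close> times \<open>Re W\<^sub>j Re W\<^sub>k - Im W\<^sub>j Im W\<^sub>k\<close> for \<open>n = j + k\<close>: the modes
  \<open>(p, 0)\<close> and \<open>(p, 1)\<close>, with opposite weights. The modes \<open>(0, 0)\<close> and \<open>(0, 1)\<close> belong to the points
  \<open>1\<close> and \<open>-1\<close>.\<close>

definition jump_root :: "complex \<Rightarrow> complex" where
  "jump_root c = (if c = 0 then of_real (sqrt 2) else csqrt (- 2 * \<i> * c / of_real (cmod c)))"

text \<open>The value \<open>sqrt 2\<close> at 0 makes the first claim hold for a vanishing jump
  too, so every interior mode is normalised.\<close>

lemma jump_root: "(cmod (jump_root c))\<^sup>2 = 2" "of_real (cmod c) * (jump_root c)\<^sup>2 = - 2 * \<i> * c"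
proof -
  show "(cmod (jump_root c))\<^sup>2 = 2"
  proof (cases "c = 0")
    case False
    then have "(cmod (jump_root c))\<^sup>2 = cmod ((csqrt (- 2 * \<i> * c / of_real (cmod c)))\<^sup>2)"
        by (simp add: jump_root_def norm_power)
    also have "\<dots> = 2" using False by (simp add: norm_mult norm_divide)
    finally show ?thesis .
  qed (simp add: jump_root_def)
  show "of_real (cmod c) * (jump_root c)\<^sup>2 = - 2 * \<i> * c" by (simp add: jump_root_def)
qed

definition mode_amp :: "(real \<Rightarrow> complex) \<Rightarrow> real \<times> nat \<Rightarrow> complex" where
  "mode_amp d a = (if fst a = 0 then 1 else if snd a = 0 then jump_root (d (fst a)) else - \<i> * jump_root
      (d (fst a)))"

definition mode_freq :: "real \<times> nat \<Rightarrow> real" where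
  "mode_freq a = (if fst a = 0 then (if snd a = 0 then 0 else pi) else fst a)"

definition modes :: "real set \<Rightarrow> (real \<times> nat) set" where
  "modes P = insert (0, 0) (insert (0, 1) (P \<times> {0, 1}))"

lemma finite_modes: "finite P \<Longrightarrow> finite (modes P)"
  by (simp add: modes_def)

text \<open>All frequencies lie between 0 and \<open>pi\<close>, so two of them add up to a multiple
  of \<open>2 * pi\<close> only for the mode of 1 or of -1 paired with itself. An interior mode
  resonates only through the difference and therefore needs squared amplitude 2. The factor
  \<open>- \<i>\<close> makes the two modes of one point orthogonal.\<close>

lemma mode_orthogonality:
  assumes P: "P \<subseteq> {0<..<pi}" and a: "a \<in> modes P" "b \<in> modes P"
  shows "((if cis (mode_freq a + mode_freq b) = 1 then Re (mode_amp d a * mode_amp d b) else 0) +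
    (if cis (mode_freq a - mode_freq b) = 1 then Re (mode_amp d a * cnj (mode_amp d b)) else 0)) / 2
        = (if a = b then 1 else 0)"
proof -
  have fr: "0 \<le> mode_freq c" "mode_freq c \<le> pi" if "c \<in> modes P" for c
    using that P by (auto simp: modes_def mode_freq_def)
  have P0: "0 \<notin> P" "pi \<notin> P" using P by auto
  have diff: "cis (mode_freq a - mode_freq b) = 1 \<longleftrightarrow> mode_freq a = mode_freq b"
    using cis_eq_1_small[of "mode_freq a - mode_freq b"] fr[OF a(1)] fr[OF a(2)] pi_gt_zero
        by (auto simp: abs_less_iff)
  have sum: "cis (mode_freq a + mode_freq b) = 1 \<longleftrightarrow> fst a = 0 \<and> a = b"
  proof (cases "mode_freq a + mode_freq b = 2 * pi")
    case True
    then have "mode_freq a = pi" "mode_freq b = pi" using fr[OF a(1)] fr[OF a(2)] by linarith+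
    then have "a = (0, 1)" "b = (0, 1)" using a P0 by (auto simp: modes_def mode_freq_def split:
        if_splits)
    then show ?thesis using True by simp
  next
    case False
    then have "cis (mode_freq a + mode_freq b) = 1 \<longleftrightarrow> mode_freq a + mode_freq b = 0"
      using cis_eq_1_small[of "mode_freq a + mode_freq b"] fr[OF a(1)] fr[OF a(2)]
          by (auto simp: abs_less_iff)
    also have "\<dots> \<longleftrightarrow> mode_freq a = 0 \<and> mode_freq b = 0" using fr[OF a(1)] fr[OF a(2)] by linarith
    also have "\<dots> \<longleftrightarrow> fst a = 0 \<and> a = b"
      using a P0 False by (auto simp: modes_def mode_freq_def split: if_splits)
    finally show ?thesis .
  qed
  have jr: "jump_root c * cnj (jump_root c) = 2" for c
    unfolding mult_cnj_norm using jump_root(1)[of c] by (metis of_real_numeral of_real_power)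
  show ?thesis
  proof (cases "fst a = 0")
    case True
    then show ?thesis unfolding sum diff using a P0
      by (auto simp: modes_def mode_freq_def mode_amp_def split: if_splits)
  next
    case fa: False
    show ?thesis
    proof (cases "fst a = fst b")
      case True
      obtain p k k' where ab: "a = (p, k)" "b = (p, k')" using True by (metis prod.collapse)
      have p0: "p \<noteq> 0" using fa ab by simp
      have k: "k = 0 \<or> k = 1" "k' = 0 \<or> k' = 1" using a ab p0 by (auto simp: modes_def)
      have 1: "\<i> * jump_root (d p) * cnj (jump_root (d p)) = 2 * \<i>" using jr[of "d p"]
          by (simp add: mult.assoc)
      have f: "mode_freq a = mode_freq b" using ab p0 by (simp add: mode_freq_def)
      have amp: "mode_amp d (p, 0) = jump_root (d p)" "mode_amp d (p, 1) = - \<i> * jump_root (d p)"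
          using p0 by (simp_all add: mode_amp_def)
      have e: "jump_root (d p) * cnj (jump_root (d p)) = 2" "jump_root (d p) * cnj (- \<i> * jump_root (d
          p)) = 2 * \<i>"
        "(- \<i> * jump_root (d p)) * cnj (jump_root (d p)) = - 2 * \<i>"
            "(- \<i> * jump_root (d p)) * cnj (- \<i> * jump_root (d p)) = 2"
        using jr[of "d p"] by (simp_all add: algebra_simps)
      have val: "Re (mode_amp d a * cnj (mode_amp d b)) = (if k = k' then 2 else 0)"
        using k unfolding ab by (elim disjE) (simp_all only: amp e, simp_all)
      show ?thesis unfolding sum diff val using f fa ab by simp
    next
      case False
      have "mode_freq a \<noteq> mode_freq b" using False fa a P0 by (auto simp: modes_def mode_freq_def)
      moreover have "a \<noteq> b" using False by auto
      ultimately show ?thesis unfolding sum diff using fa by simp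
    qed
  qed
qed

lemma modes_near_orthogonal:
  assumes P: "finite P" "P \<subseteq> {0<..<pi}"
  shows "\<exists>C\<ge>0. \<forall>a\<in>modes P. \<forall>b\<in>modes P. \<forall>x y::nat. x \<le> y \<longrightarrow>
    \<bar>(\<Sum>j=x..<y. osc (mode_amp d a) (mode_freq a) j * osc (mode_amp d b) (mode_freq b) j) - (if a
        = b then real (y - x) else 0)\<bar> \<le> C"
proof -
  have "\<exists>C\<ge>0. \<forall>x y::nat. x \<le> y \<longrightarrow>
    \<bar>(\<Sum>j=x..<y. osc (mode_amp d a) (mode_freq a) j * osc (mode_amp d b) (mode_freq b) j) - (if a
        = b then real (y - x) else 0)\<bar> \<le> C"
    if "a \<in> modes P" "b \<in> modes P" for a b
    using osc_product_sum_bounded[of "mode_amp d a" "mode_freq a" "mode_amp d b" "mode_freq b"]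
    unfolding mode_orthogonality[OF P(2) that] by (simp add: if_distrib[of "\<lambda>t. t * _"] cong: if_cong)
  then obtain C where C: "\<And>a b. a \<in> modes P \<Longrightarrow> b \<in> modes P \<Longrightarrow> C a b \<ge> 0" "\<And>a b x y. a \<in> modes P \<Longrightarrow>
      b \<in> modes P \<Longrightarrow> x \<le> y \<Longrightarrow>
    \<bar>(\<Sum>j=x..<y. osc (mode_amp d a) (mode_freq a) j * osc (mode_amp d b) (mode_freq b) j) - (if a
        = b then real (y - x) else 0)\<bar> \<le> C a b"
    by metis
  have fin: "finite (modes P)" by (rule finite_modes[OF P(1)])
  have le: "C a b \<le> (\<Sum>a\<in>modes P. \<Sum>b\<in>modes P. C a b)" if "a \<in> modes P" "b \<in> modes P" for a b
  proof -
    have "C a b \<le> (\<Sum>b\<in>modes P. C a b)" using that C(1) fin by (intro member_le_sum) auto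
    also have "\<dots> \<le> (\<Sum>a\<in>modes P. \<Sum>b\<in>modes P. C a b)"
      using that C(1) fin by (intro member_le_sum[where f="\<lambda>a. \<Sum>b\<in>modes P. C a b"] sum_nonneg) auto
    finally show ?thesis .
  qed
  show ?thesis
  proof (intro exI[of _ "\<Sum>a\<in>modes P. \<Sum>b\<in>modes P. C a b"] conjI ballI allI impI)
    show "0 \<le> (\<Sum>a\<in>modes P. \<Sum>b\<in>modes P. C a b)" using C(1) by (intro sum_nonneg) auto
  qed (use C(2) le order_trans in blast)
qed

text \<open>Normalised so that \<open>pi\<close> times the coefficient is, up to sign, the modulus
  of the half jump of the step symbol at that point.\<close>

definition mode_coeff :: "complex \<Rightarrow> real set \<Rightarrow> (real \<Rightarrow> complex) \<Rightarrow> real \<times> nat \<Rightarrow> real" where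
  "mode_coeff s P d a = (if fst a = 0 then (if snd a = 0 then Im s / pi else - Im (s + (\<Sum>p\<in>P. d p)) /
      pi)
     else (if snd a = 0 then 1 else - 1) * cmod (d (fst a)) / (2 * pi))"

lemma sum_modes:
  assumes "finite P" "0 \<notin> P"
  shows "(\<Sum>a\<in>modes P. f a) = f (0, 0) + f (0, 1) + (\<Sum>p\<in>P. f (p, 0) + f (p, 1))"
proof -
  have "(\<Sum>a\<in>modes P. f a) = f (0, 0) + (f (0, 1) + (\<Sum>a\<in>P \<times> {0, 1}. f a))"
    unfolding modes_def using assms by (subst sum.insert; (subst sum.insert)?) auto
  also have "(\<Sum>a\<in>P \<times> {0, 1}. f a) = (\<Sum>p\<in>P. \<Sum>k\<in>{0, 1}. f (p, k))"
    unfolding sum.cartesian_product by (simp add: case_prod_unfold)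
  finally show ?thesis by (simp add: add.assoc)
qed

lemma mode_expansion:
  assumes P: "finite P" "P \<subseteq> {0<..<pi}"
  shows "(Im s + (\<Sum>p\<in>P. Im (d p * cis (- (real (j + k) * p)))) - (-1) ^ (j + k) * Im (s + (\<Sum>p\<in>P. d p)))
      / pi
    = (\<Sum>a\<in>modes P. mode_coeff s P d a * osc (mode_amp d a) (mode_freq a) j * osc (mode_amp d a)
        (mode_freq a) k)"
proof -
  have P0: "0 \<notin> P" using P by auto
  have o0: "osc (mode_amp d (0, 0)) (mode_freq (0, 0)) i = 1" for i
      by (simp add: osc_def mode_amp_def mode_freq_def)
  have o1: "osc (mode_amp d (0, 1)) (mode_freq (0, 1)) i = (-1) ^ i" for i
  proof -
    have "cis (- (pi * real i)) = cis (- pi) ^ i" by (subst Complex.DeMoivre) (simp add: mult.commute)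
    also have "cis (- pi) = -1" by (simp add: complex_eq_iff)
    finally have "cis (- (pi * real i)) = of_real ((-1) ^ i)" by simp
    then show ?thesis by (simp add: osc_def mode_amp_def mode_freq_def del: of_real_power)
  qed
  have pr: "mode_coeff s P d (p, 0) * osc (mode_amp d (p, 0)) (mode_freq (p, 0)) j * osc (mode_amp d (p,
      0)) (mode_freq (p, 0)) k +
      mode_coeff s P d (p, 1) * osc (mode_amp d (p, 1)) (mode_freq (p, 1)) j * osc (mode_amp d (p, 1))
          (mode_freq (p, 1)) k
      = Im (d p * cis (- (real (j + k) * p))) / pi" if p: "p \<in> P" for p
  proof -
    have p0: "p \<noteq> 0" using p P0 by auto
    define W where "W i = jump_root (d p) * cis (- (p * real i))" for i
    have os: "osc (mode_amp d (p, 0)) (mode_freq (p, 0)) i = Re (W i)"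
        "osc (mode_amp d (p, 1)) (mode_freq (p, 1)) i = Im (W i)" for i
      using p0 by (simp_all add: osc_def mode_amp_def mode_freq_def W_def)
    have wt: "mode_coeff s P d (p, 0) = cmod (d p) / (2 * pi)" "mode_coeff s P d (p, 1)
        = - (cmod (d p) / (2 * pi))"
      using p0 by (simp_all add: mode_coeff_def)
    have "of_real (cmod (d p)) * (W j * W k) = (of_real (cmod (d p)) * (jump_root (d p))\<^sup>2) * cis (-
        (real (j + k) * p))"
      by (simp add: W_def power2_eq_square cis_mult algebra_simps)
    also have "\<dots> = - 2 * \<i> * (d p * cis (- (real (j + k) * p)))" unfolding jump_root(2) by simp
    finally have r: "of_real (cmod (d p)) * (W j * W k) = - 2 * \<i> * (d p * cis (- (real (j + k) * p)))"
        .
    define V where "V = Im (d p * cis (- (real (j + k) * p)))"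
    have "Re (of_real (cmod (d p)) * (W j * W k)) = 2 * V" unfolding r V_def by simp
    then have "cmod (d p) * (Re (W j) * Re (W k) - Im (W j) * Im (W k)) = 2 * V" by simp
    then have "cmod (d p) * (Re (W j) * Re (W k) - Im (W j) * Im (W k)) / (2 * pi)
        = Im (d p * cis (- (real (j + k) * p))) / pi"
      unfolding V_def[symmetric] by simp
    then show ?thesis unfolding os wt by (simp add: diff_divide_distrib algebra_simps)
  qed
  have hs: "(\<Sum>p\<in>P. mode_coeff s P d (p, 0) * osc (mode_amp d (p, 0)) (mode_freq (p, 0)) j * osc
      (mode_amp d (p, 0)) (mode_freq (p, 0)) k +
      mode_coeff s P d (p, 1) * osc (mode_amp d (p, 1)) (mode_freq (p, 1)) j * osc (mode_amp d (p, 1))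
          (mode_freq (p, 1)) k)
      = (\<Sum>p\<in>P. Im (d p * cis (- (real (j + k) * p))) / pi)"
    by (intro sum.cong refl pr)
  have w: "mode_coeff s P d (0, 0) = Im s / pi" "mode_coeff s P d (0, 1) = - Im (s + (\<Sum>p\<in>P. d p)) / pi"
    by (simp_all add: mode_coeff_def del: plus_complex.sel Im_sum)
  define X where "X = Im (s + (\<Sum>p\<in>P. d p))"
  define Y where "Y = (\<Sum>p\<in>P. Im (d p * cis (- (real (j + k) * p))))"
  have "(Im s + Y - (-1) ^ (j + k) * X) / pi = Im s / pi * 1 * 1 + - X / pi * (-1) ^ j * (-1) ^ k
      + Y / pi"
    by (simp add: power_add field_simps)
  then show ?thesis
    unfolding sum_modes[OF P(1) P0] o0 o1 hs w X_def Y_def sum_divide_distrib[symmetric] by (simp only:)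
qed

text \<open>Of the two modes of an interior point one has the weight of either sign, and
  \<open>jump_density\<close> vanishes at nonpositive arguments. So an interior jump counts once for
  each sign, and the points 1 and -1 only for the matching one.\<close>

lemma sum_modes_density:
  assumes P: "finite P" "P \<subseteq> {0<..<pi}" and u: "u > 0" and \<sigma>: "\<sigma> = 1 \<or> \<sigma> = - 1"
  shows "(\<Sum>a\<in>modes P. jump_density (pi * (\<sigma> * mode_coeff s P d a) / u)) =
    jump_density (\<sigma> * Im s / u) + jump_density (- \<sigma> * Im (s + (\<Sum>p\<in>P. d p)) / u) + (\<Sum>p\<in>P. jump_density
        (cmod (d p) / 2 / u))"
proof -
  have P0: "0 \<notin> P" using P by auto
  have c0: "jump_density (- x / u) = 0" if "x \<ge> 0" for x
  proof -
    have "- x / u \<le> 0" using that u by (intro divide_nonpos_pos) auto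
    then show ?thesis by (intro jump_density_le_1) linarith
  qed
  have pr: "jump_density (pi * (\<sigma> * mode_coeff s P d (p, 0)) / u) + jump_density (pi * (\<sigma> * mode_coeff s
      P d (p, 1)) / u) = jump_density (cmod (d p) / 2 / u)" if p: "p \<in> P" for p
  proof -
    have "p \<noteq> 0" using p P0 by auto
    then have "pi * (\<sigma> * mode_coeff s P d (p, 0)) / u = \<sigma> * (cmod (d p) / 2) / u"
        "pi * (\<sigma> * mode_coeff s P d (p, 1)) / u = - \<sigma> * (cmod (d p) / 2) / u"
      by (simp_all add: mode_coeff_def)
    then show ?thesis using \<sigma> c0[of "cmod (d p) / 2"] by auto
  qed
  moreover have h: "pi * (\<sigma> * mode_coeff s P d (0, 0)) / u = \<sigma> * Im s / u"
    "pi * (\<sigma> * mode_coeff s P d (0, 1)) / u = - \<sigma> * Im (s + (\<Sum>p\<in>P. d p)) / u"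
    by (simp_all add: mode_coeff_def del: plus_complex.sel Im_sum)
  moreover have "(\<Sum>p\<in>P. jump_density (pi * (\<sigma> * mode_coeff s P d (p, 0)) / u) + jump_density (pi * (\<sigma> *
      mode_coeff s P d (p, 1)) / u)) = (\<Sum>p\<in>P. jump_density (cmod (d p) / 2 / u))"
    by (intro sum.cong refl pr)
  ultimately show ?thesis unfolding sum_modes[OF P(1) P0] by (simp only:)
qed

section \<open>The theorem\<close>

definition pm_sign :: "pm \<Rightarrow> real" where
  "pm_sign s = (case s of Plus \<Rightarrow> 1 | Minus \<Rightarrow> - 1)"

lemma pm_sign_cases: "pm_sign s = 1 \<or> pm_sign s = - 1"
  by (cases s) (simp_all add: pm_sign_def)

lemma n_pm_eq: "n_pm s t K = eigenvalue_count t (pm_sign s *\<^sub>R K)"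
  by (cases s) (simp_all add: pm_sign_def)

lemma cond_A_bound:
  assumes "cond_A \<tau>"
  obtains C where "C \<ge> 0" "\<And>N. N \<ge> 1 \<Longrightarrow> multiplier_norm (tau_N \<tau> N) \<le> ennreal C"
proof -
  define S where "S = (SUP N\<in>{1..}. multiplier_norm (tau_N \<tau> N))"
  have "S < \<infinity>" using assms by (simp add: cond_A_def S_def)
  then obtain C where C: "C \<ge> 0" "S = ennreal C" by (cases S) auto
  have "multiplier_norm (tau_N \<tau> N) \<le> ennreal C" if "N \<ge> 1" for N
    unfolding C(2)[symmetric] S_def by (rule SUP_upper) (use that in simp)
  with C(1) show thesis by (rule that)
qed

lemma cmod_entry_le: "cmod (entry A j k) \<le> norm A"
proof -
  have "norm (basis_vec j) = 1"
  proof -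
    have "(\<lambda>n. (cmod (ell2_nth (basis_vec j) n))\<^sup>2) sums (\<Sum>n\<in>{j}. (cmod (ell2_nth (basis_vec j) n))\<^sup>2)"
      by (rule sums_finite) (auto simp: nth_basis_vec)
    then show ?thesis by (simp add: norm_ell2_def nth_basis_vec sums_iff)
  qed
  then have "norm (blinfun_apply A (basis_vec j)) \<le> norm A" using norm_blinfun[of A "basis_vec j"]
      by simp
  then show ?thesis unfolding entry_def cinner_basis_vec using ell2_nth_le_norm order_trans by blast
qed

text \<open>Symmetric step symbols have real coefficients by \<open>fcoef_sym_step\<close>, and the
  error of the approximation is an entry of an operator of norm at most \<open>e\<close>.\<close>

lemma fourier_coeff_real:
  assumes pc: "\<omega> \<in> PC" and sym: "\<And>v. v \<in> sphere 0 1 \<Longrightarrow> \<omega> v = cnj (\<omega> (cnj v))"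
  shows "cnj (fourier_coeff \<omega> (int n)) = fourier_coeff \<omega> (int n)"
proof -
  have "\<bar>Im (fourier_coeff \<omega> (int n))\<bar> \<le> 0 + e" if e: "e > 0" for e
  proof -
    obtain s P d \<rho> where a: "finite P" "P \<subseteq> {0<..<pi}" "\<rho> \<in> borel_measurable borel" "\<And>\<theta>. cmod (\<rho> \<theta>) \<le> e"
      "\<And>n. fourier_coeff \<omega> n = fcoef \<rho> n + fcoef (sym_step s P d) n"
      by (rule symbol_step_approx[OF pc sym e]) blast+
    obtain A where A: "has_entries A (\<lambda>j k. fcoef \<rho> (int (j + k)))" "norm A \<le> e"
      using has_entries_exists[OF e hankel_form_bound[OF a(3,4)]] by blast
    have "entry A n 0 = fcoef \<rho> (int n)" using A(1) by (simp add: has_entries_def)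
    then have "cmod (fcoef \<rho> (int n)) \<le> e" using cmod_entry_le[of A n 0] A(2) by simp
    then have "\<bar>Im (fcoef \<rho> (int n))\<bar> \<le> e" using abs_Im_le_cmod order_trans by blast
    then show ?thesis unfolding a(5) fcoef_sym_step[OF a(1,2)] by simp
  qed
  then have "Im (fourier_coeff \<omega> (int n)) = 0" using field_le_epsilon[of
      "\<bar>Im (fourier_coeff \<omega> (int n))\<bar>" 0] by simp
  then show ?thesis by (simp add: complex_eq_iff)
qed

text \<open>The asymptotics at a fixed accuracy \<open>\<eta>\<close>: the approximate jumps
  \<open>a\<close>, \<open>b\<close> and \<open>D\<close> are within \<open>\<eta>\<close> of the
  true ones, and the threshold moves by \<open>C * \<eta>\<close>, which bounds the norm of the
  multiplied remainder.\<close>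

lemma log_dens_step_bounds:
  fixes \<tau> :: "real \<Rightarrow> real \<Rightarrow> complex" and \<omega> :: "complex \<Rightarrow> complex"
  defines "k \<equiv> \<lambda>x. cmod (half_jump \<omega> (cis x))"
  assumes tb: "\<And>x y. x \<ge> 0 \<Longrightarrow> y \<ge> 0 \<Longrightarrow> cmod (\<tau> x y) \<le> Mt"
    and ts: "\<And>x y. 0 \<le> x \<Longrightarrow> 0 \<le> y \<Longrightarrow> \<tau> x y = cnj (\<tau> y x)"
    and cA: "C \<ge> 0" "\<And>N. N \<ge> 1 \<Longrightarrow> multiplier_norm (tau_N \<tau> N) \<le> ennreal C"
    and cB: "cond_B \<tau>" and cC: "cond_C \<tau>"
    and pc: "\<omega> \<in> PC" and sym: "\<And>v. v \<in> sphere 0 1 \<Longrightarrow> \<omega> v = cnj (\<omega> (cnj v))"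
    and par: "t > 0" "\<eta> > 0" "e > 0"
    and \<kappa>: "half_jump \<omega> 1 = \<i> * of_real k1" "half_jump \<omega> (- 1) = \<i> * of_real km"
  obtains P D a b where "finite P" "P \<subseteq> {0<..<pi}" "\<bar>a - k1\<bar> \<le> \<eta>" "\<bar>b - km\<bar> \<le> \<eta>"
    "\<forall>x\<in>{0<..<pi}. \<bar>(if x \<in> P then D x else 0) - k x\<bar> \<le> \<eta>"
    "\<forall>u. 0 < u \<longrightarrow> u < t - C * \<eta> \<longrightarrow> (\<forall>\<^sub>F N in sequentially.
      log_dens_seq \<tau> s t (hankel (fourier_coeff \<omega>)) N \<le> jump_density (pm_sign s * a / u) + jump_density
          (pm_sign s * b / u) + (\<Sum>x\<in>P. jump_density (D x / u)) + e)"
    "\<forall>u. C * \<eta> < t \<longrightarrow> t + C * \<eta> < u \<longrightarrow> (\<forall>\<^sub>F N in sequentially.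
      jump_density (pm_sign s * a / u) + jump_density (pm_sign s * b / u) + (\<Sum>x\<in>P. jump_density (D x /
          u)) - e \<le> log_dens_seq \<tau> s t (hankel (fourier_coeff \<omega>)) N)"
proof -
  obtain c P d \<rho> where P: "finite P" "P \<subseteq> {0<..<pi}" and \<rho>: "\<rho> \<in> borel_measurable borel" "\<And>\<theta>. cmod (\<rho> \<theta>)
      \<le> \<eta>"
    and fc: "\<And>n. fourier_coeff \<omega> n = fcoef \<rho> n + fcoef (sym_step c P d) n"
    and st: "\<And>\<theta>. \<theta> \<in> {0<..<pi} - P \<Longrightarrow> cmod (\<omega> (cis \<theta>) - step_fun c P d \<theta>) \<le> \<eta>"
    by (rule symbol_step_approx[OF pc sym par(2)]) blast+
  define \<sigma> where "\<sigma> = pm_sign s"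
  have \<sigma>: "\<sigma> = 1 \<or> \<sigma> = - 1" unfolding \<sigma>_def by (rule pm_sign_cases)
  obtain G\<rho> where G\<rho>: "has_entries G\<rho> (\<lambda>j k. fcoef \<rho> (int (j + k)))" "norm G\<rho> \<le> \<eta>"
    using has_entries_exists[OF par(2) hankel_form_bound[OF \<rho>]] by blast
  define B where "B = cmod c + (\<Sum>p\<in>P. cmod (d p)) + 1"
  have B: "B > 0" "\<And>\<theta>. cmod (sym_step c P d \<theta>) \<le> B"
  proof -
    have "(\<Sum>p\<in>P. cmod (d p)) \<ge> 0" by (simp add: sum_nonneg)
    then show "B > 0" unfolding B_def using norm_ge_zero[of c] by linarith
    show "cmod (sym_step c P d \<theta>) \<le> B" for \<theta> using sym_step_bounded[of c P d \<theta>] unfolding B_def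
        by linarith
  qed
  obtain Gs where Gs: "has_entries Gs (\<lambda>j k. fcoef (sym_step c P d) (int (j + k)))"
    using has_entries_exists[OF B(1) hankel_form_bound[OF sym_step_measurable B(2)]] by blast
  define G where "G = hankel (fourier_coeff \<omega>)"
  have hG: "has_entries G (\<lambda>j k. fourier_coeff \<omega> (int (j + k)))"
  proof -
    have "has_entries (G\<rho> - (-1) *\<^sub>R Gs) (\<lambda>j k. fcoef \<rho> (int (j + k)) - of_real (-1) * fcoef (sym_step c
        P d) (int (j + k)))"
      by (intro has_entries_diff has_entries_scaleR G\<rho> Gs)
    then have h: "has_entries (G\<rho> - (-1) *\<^sub>R Gs) (\<lambda>j k. fourier_coeff \<omega> (int (j + k)))" by (simp add: fc)
    show ?thesis unfolding G_def hankel_def op_of_entries_eq[OF h] by (rule h)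
  qed
  have eG: "entry G j k = fourier_coeff \<omega> (int (j + k))" "clinear_op G" for j k using hG
      by (simp_all add: has_entries_def)
  have eR: "entry G\<rho> j k = fcoef \<rho> (int (j + k))" "clinear_op G\<rho>" for j k using G\<rho>(1)
      by (simp_all add: has_entries_def)
  \<comment> \<open>The sign is moved into the operator, so that both counts become counts of
    eigenvalues above \<open>t\<close>.\<close>
  define K where "K N = \<sigma> *\<^sub>R (tau_N \<tau> N \<star> G)" for N
  define R2 where "R2 N = \<sigma> *\<^sub>R (tau_N \<tau> N \<star> G\<rho>)" for N
  have hK: "has_entries (K N) (\<lambda>j k. of_real \<sigma> * (tau_N \<tau> N j k * fourier_coeff \<omega> (int (j + k))))"
      if "N \<ge> 1" for N
    unfolding K_def using schur_mult_bound[OF cA(2)[OF that] cA(1) eG(2)] unfolding eG(1)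
        by (intro has_entries_scaleR) blast
  have hR: "has_entries (R2 N) (\<lambda>j k. of_real \<sigma> * (tau_N \<tau> N j k * fcoef \<rho> (int (j + k))))" if "N \<ge> 1"
      for N
    unfolding R2_def using schur_mult_bound[OF cA(2)[OF that] cA(1) eR(2)] unfolding eR(1)
        by (intro has_entries_scaleR) blast
  have nR: "norm (R2 N) \<le> C * \<eta>" if "N \<ge> 1" for N
  proof -
    have "norm (R2 N) = norm (tau_N \<tau> N \<star> G\<rho>)" using \<sigma> by (auto simp: R2_def)
    also have "\<dots> \<le> C * norm G\<rho>" using schur_mult_bound[OF cA(2)[OF that] cA(1) eR(2)] by blast
    also have "\<dots> \<le> C * \<eta>" using G\<rho>(2) cA(1) by (intro mult_left_mono)
    finally show ?thesis .
  qed
  have eK: "entry (K N) j k = of_real \<sigma> * (tau_N \<tau> N j k * fourier_coeff \<omega> (int (j + k)))"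
    and eR2: "entry (R2 N) j k = of_real \<sigma> * (tau_N \<tau> N j k * fcoef \<rho> (int (j + k)))" if "N \<ge> 1"
        for N j k
    using hK[OF that] hR[OF that] by (simp_all add: has_entries_def)
  have sK: "selfadj (K N)" if N: "N \<ge> 1" for N
  proof (rule selfadjI_entries)
    show "clinear_op (K N)" using hK[OF N] by (simp add: has_entries_def)
    fix j k
    have t: "tau_N \<tau> N j k = cnj (tau_N \<tau> N k j)" unfolding tau_N_def by (rule ts) auto
    show "entry (K N) j k = cnj (entry (K N) k j)"
      unfolding eK[OF N] complex_cnj_mult complex_cnj_complex_of_real t[symmetric] add.commute[of k j]
      by (simp only: fourier_coeff_real[OF pc sym])
  qed
  define S0 where "S0 n = (Im c + (\<Sum>p\<in>P. Im (d p * cis (- (real n * p)))) - (-1) ^ n * Im (c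
      + (\<Sum>p\<in>P. d p))) / pi" for n :: nat
  define S where "S n = \<sigma> * S0 n" for n
  define CS where "CS = (\<bar>Im c\<bar> + (\<Sum>p\<in>P. cmod (d p)) + \<bar>Im (c + (\<Sum>p\<in>P. d p))\<bar>) / pi"
  have SB: "\<bar>S n\<bar> \<le> CS" for n
  proof -
    define X where "X = Im (c + (\<Sum>p\<in>P. d p))"
    define Y where "Y = (\<Sum>p\<in>P. Im (d p * cis (- (real n * p))))"
    have Y: "\<bar>Y\<bar> \<le> (\<Sum>p\<in>P. cmod (d p))"
      unfolding Y_def
    proof (rule order_trans[OF sum_abs], rule sum_mono)
      fix p show "\<bar>Im (d p * cis (- (real n * p)))\<bar> \<le> cmod (d p)" using abs_Im_le_cmod[of
          "d p * cis (- (real n * p))"] by (simp add: norm_mult)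
    qed
    have "\<bar>Im c + Y - (-1) ^ n * X\<bar> \<le> \<bar>Im c + Y\<bar> + \<bar>(-1) ^ n * X\<bar>" by (rule abs_triangle_ineq4)
    also have "\<dots> \<le> \<bar>Im c\<bar> + (\<Sum>p\<in>P. cmod (d p)) + \<bar>X\<bar>" using Y abs_triangle_ineq[of "Im c" Y]
        by (simp add: abs_mult power_abs)
    finally have "\<bar>Im c + Y - (-1) ^ n * X\<bar> / pi \<le> CS" unfolding CS_def X_def
        by (intro divide_right_mono) auto
    moreover have "\<bar>S n\<bar> = \<bar>S0 n\<bar>" using \<sigma> by (auto simp: S_def)
    moreover have "\<bar>S0 n\<bar> = \<bar>Im c + Y - (-1) ^ n * X\<bar> / pi" unfolding S0_def X_def Y_def
        by (simp only: abs_divide) simp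
    ultimately show ?thesis by simp
  qed
  have Sexp: "S (j + k) = (\<Sum>a\<in>modes P. \<sigma> * mode_coeff c P d a * osc (mode_amp d a) (mode_freq a) j * osc
      (mode_amp d a) (mode_freq a) k)" for j k
    unfolding S_def S0_def mode_expansion[OF P] sum_distrib_left by (simp only: mult.assoc)
  obtain Co where Co: "Co \<ge> 0" "\<And>a b (x::nat) y. a \<in> modes P \<Longrightarrow> b \<in> modes P \<Longrightarrow> x \<le> y \<Longrightarrow>
    \<bar>(\<Sum>j=x..<y. osc (mode_amp d a) (mode_freq a) j * osc (mode_amp d b) (mode_freq b) j) - (if a
        = b then real (y - x) else 0)\<bar> \<le> Co"
    using modes_near_orthogonal[OF P, of d] by blast
  have ent: "entry (K N) j k - entry (R2 N) j k = tau_N \<tau> N j k * of_real (S (j + k) / real (j + k))"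
      if N: "N \<ge> 1" and jk: "j + k \<noteq> 0" for N j k
  proof -
    have n1: "j + k \<ge> 1" using jk by linarith
    have e: "fcoef (sym_step c P d) (int (j + k)) = of_real (S0 (j + k) / real (j + k))"
      unfolding fcoef_sym_step_pos[OF P n1] S0_def by (simp only: divide_divide_eq_left)
    show ?thesis unfolding eK[OF N] eR2[OF N] fc e S_def by (simp add: algebra_simps del: of_nat_add)
  qed
  \<comment> \<open>The entry (0,0) is not of the form \<open>S (j + k) / (j + k)\<close>;
    boundedness of \<open>\<tau>\<close> controls it uniformly in \<open>N\<close>.\<close>
  define c0 where "c0 = Mt * cmod (fcoef (sym_step c P d) 0)"
  have ent0: "cmod (entry (K N) 0 0 - entry (R2 N) 0 0) \<le> c0" if N: "N \<ge> 1" for N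
  proof -
    have "entry (K N) 0 0 - entry (R2 N) 0 0 = of_real \<sigma> * (\<tau> 0 0 * fcoef (sym_step c P d) 0)"
      unfolding eK[OF N] eR2[OF N] fc by (simp add: algebra_simps tau_N_def)
    moreover have "cmod (of_real \<sigma> * (\<tau> 0 0 * fcoef (sym_step c P d) 0))
        = cmod (\<tau> 0 0) * cmod (fcoef (sym_step c P d) 0)"
      using \<sigma> by (auto simp: norm_mult)
    moreover have "\<dots> \<le> c0" unfolding c0_def by (intro mult_right_mono tb) auto
    ultimately show ?thesis by simp
  qed
  have R2': "clinear_op (R2 N) \<and> norm (R2 N) \<le> C * \<eta>" if "N \<ge> 1" for N using nR[OF that] hR[OF that]
      by (simp add: has_entries_def)
  have C\<eta>: "C * \<eta> \<ge> 0" using cA(1) par by simp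
  note asy = eigenvalue_count_asymptotics[where A = "modes P" and z =
      "\<lambda>a. osc (mode_amp d a) (mode_freq a)"
      and \<gamma> = "\<lambda>a. \<sigma> * mode_coeff c P d a" and S = S and K = K and ?R2.0 = R2 and \<delta> = "C * \<eta>" and C = Co
          and CS = CS and e = e and t = t,
      OF finite_modes[OF P(1)] Co Sexp SB cB cC sK R2' ent ent0 par(1,3) C\<eta>]
  have asy_upper: "0 < u \<Longrightarrow> u < t - C * \<eta> \<Longrightarrow> \<forall>\<^sub>F N in sequentially.
      real (eigenvalue_count t (K N)) \<le> ((\<Sum>a\<in>modes P. jump_density (pi * (\<sigma> * mode_coeff c P d a) / u))
          + e) * ln (real N)" for u
    by (rule asy(1))
  have asy_lower: "C * \<eta> < t \<Longrightarrow> t + C * \<eta> < u \<Longrightarrow> \<forall>\<^sub>F N in sequentially.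
      ((\<Sum>a\<in>modes P. jump_density (pi * (\<sigma> * mode_coeff c P d a) / u)) - e) * ln (real N)
          \<le> real (eigenvalue_count t (K N))" for u
    by (rule asy(2))
  define b where "b = - Im (c + (\<Sum>p\<in>P. d p))"
  define V where "V u = jump_density (\<sigma> * Im c / u) + jump_density (\<sigma> * b / u) + (\<Sum>x\<in>P. jump_density
      (cmod (d x) / 2 / u))" for u
  have V: "(\<Sum>a\<in>modes P. jump_density (pi * (\<sigma> * mode_coeff c P d a) / u)) = V u" if "u > 0" for u
    unfolding V_def sum_modes_density[OF P that \<sigma>] b_def
        by (simp only: mult_minus_left mult_minus_right)
  have ld: "log_dens_seq \<tau> s t (hankel (fourier_coeff \<omega>)) N = real (eigenvalue_count t (K N)) / ln (real
      N)" for N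
    by (simp add: log_dens_seq_def n_pm_eq K_def G_def \<sigma>_def)
  show thesis
  proof (rule that[where P = P and a = "Im c" and b = b and D = "\<lambda>x. cmod (d x) / 2"])
    show "finite P" "P \<subseteq> {0<..<pi}" by fact+
    show "\<bar>Im c - k1\<bar> \<le> \<eta>"
    proof -
      have "k1 = Im (lim_plus \<omega> (cis 0))" using half_jump_real_points(1)[OF pc sym] \<kappa>(1)
          by (simp only: mult_cancel_left of_real_eq_iff) simp
      moreover have "(\<Sum>p\<in>P. if p \<le> 0 then d p else 0) = 0" using P(2) by (intro sum.neutral) auto
      moreover have "cmod (lim_plus \<omega> (cis 0) - (c + (\<Sum>p\<in>P. if p \<le> 0 then d p else 0))) \<le> \<eta>"
        by (rule step_limits_close(1)[OF pc P(1) st]) auto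
      ultimately show ?thesis using abs_Im_le_cmod[of "lim_plus \<omega> (cis 0) - c"]
          by (simp add: abs_minus_commute)
    qed
    show "\<bar>b - km\<bar> \<le> \<eta>"
    proof -
      have "km = - Im (lim_minus \<omega> (cis pi))" using half_jump_real_points(2)[OF pc sym] \<kappa>(2)
          by (simp only: mult_cancel_left of_real_eq_iff) simp
      moreover have "(\<Sum>p\<in>P. if p < pi then d p else 0) = sum d P" using P(2) by (intro sum.cong) auto
      moreover have "cmod (lim_minus \<omega> (cis pi) - (c + (\<Sum>p\<in>P. if p < pi then d p else 0))) \<le> \<eta>"
        by (rule step_limits_close(2)[OF pc P(1) st]) auto
      ultimately have "\<bar>Im (lim_minus \<omega> (cis pi) - (c + sum d P))\<bar> \<le> \<eta>"
          "km = - Im (lim_minus \<omega> (cis pi))"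
        using abs_Im_le_cmod[of "lim_minus \<omega> (cis pi) - (c + sum d P)"] by (simp_all only:)
      then show ?thesis unfolding b_def minus_complex.sel by linarith
    qed
    show "\<forall>x\<in>{0<..<pi}. \<bar>(if x \<in> P then cmod (d x) / 2 else 0) - k x\<bar> \<le> \<eta>"
    proof
      fix x assume x: "x \<in> {0<..<pi}"
      have "cmod (half_jump \<omega> (cis x) - (if x \<in> P then d x else 0) / 2) \<le> \<eta>"
        by (rule half_jump_interior_close[OF pc P(1) st]) (use x in auto)
      moreover have "(if x \<in> P then cmod (d x) / 2 else 0) = cmod ((if x \<in> P then d x else 0) / 2)"
          by (simp add: norm_divide)
      ultimately show "\<bar>(if x \<in> P then cmod (d x) / 2 else 0) - k x\<bar> \<le> \<eta>" unfolding k_def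
          using norm_triangle_ineq3[of "half_jump \<omega> (cis x)" "(if x \<in> P then d x else 0) / 2"]
          by linarith
    qed
    show "\<forall>u. 0 < u \<longrightarrow> u < t - C * \<eta> \<longrightarrow> (\<forall>\<^sub>F N in sequentially. log_dens_seq \<tau> s t (hankel (fourier_coeff
        \<omega>)) N \<le>
        jump_density (pm_sign s * Im c / u) + jump_density (pm_sign s * b / u) + (\<Sum>x\<in>P. jump_density
            (cmod (d x) / 2 / u)) + e)"
    proof (intro allI impI)
      fix u assume u: "0 < u" "u < t - C * \<eta>"
      show "\<forall>\<^sub>F N in sequentially. log_dens_seq \<tau> s t (hankel (fourier_coeff \<omega>)) N \<le>
        jump_density (pm_sign s * Im c / u) + jump_density (pm_sign s * b / u) + (\<Sum>x\<in>P. jump_density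
            (cmod (d x) / 2 / u)) + e"
        using asy_upper[OF u] eventually_gt_at_top[of 1] unfolding V[OF u(1)]
      proof eventually_elim
        case (elim N)
        have "ln (real N) > 0" using elim(2) by simp
        then show ?case using elim(1) unfolding ld V_def[unfolded \<sigma>_def, symmetric]
            by (simp add: pos_divide_le_eq)
      qed
    qed
    show "\<forall>u. C * \<eta> < t \<longrightarrow> t + C * \<eta> < u \<longrightarrow> (\<forall>\<^sub>F N in sequentially.
        jump_density (pm_sign s * Im c / u) + jump_density (pm_sign s * b / u) + (\<Sum>x\<in>P. jump_density
            (cmod (d x) / 2 / u)) - e
        \<le> log_dens_seq \<tau> s t (hankel (fourier_coeff \<omega>)) N)"
    proof (intro allI impI)
      fix u assume u: "C * \<eta> < t" "t + C * \<eta> < u"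
      have u0: "u > 0" using u C\<eta> par by linarith
      show "\<forall>\<^sub>F N in sequentially. jump_density (pm_sign s * Im c / u) + jump_density (pm_sign s * b / u)
          + (\<Sum>x\<in>P. jump_density (cmod (d x) / 2 / u)) - e
        \<le> log_dens_seq \<tau> s t (hankel (fourier_coeff \<omega>)) N"
        using asy_lower[OF u] eventually_gt_at_top[of 1] unfolding V[OF u0]
      proof eventually_elim
        case (elim N)
        have "ln (real N) > 0" using elim(2) by simp
        then show ?case using elim(1) unfolding ld V_def[unfolded \<sigma>_def, symmetric]
            by (simp add: pos_le_divide_eq)
      qed
    qed
  qed
qed

section \<open>Letting the step approximation improve\<close>

lemma isCont_jump_density: "isCont jump_density y"
proof -
  have "continuous_on UNIV jump_density" unfolding jump_density_def
    by (intro continuous_intros continuous_on_arcosh') auto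
  then show ?thesis by (simp add: continuous_on_eq_continuous_at)
qed

text \<open>The logarithmic formula for \<open>arcosh\<close> at \<open>k / t\<close>. For
  \<open>k = 0\<close> the quotient \<open>t / k\<close> is 0 and both sides vanish.\<close>

lemma c_fun_eq_density:
  assumes "k \<ge> 0" "t > 0"
  shows "c_fun (t / k) = jump_density (k / t)"
proof (cases "k \<ge> t")
  case True
  define r where "r = t / k"
  have r: "0 < r" "r \<le> 1" "k / t = 1 / r" using True assms by (auto simp: r_def field_simps)
  have "sqrt ((1 / r)\<^sup>2 - 1) = sqrt ((1 - r\<^sup>2) / r\<^sup>2)" using r
      by (simp add: power_divide diff_divide_distrib)
  also have "\<dots> = sqrt (1 - r\<^sup>2) / r" using r by (simp add: real_sqrt_divide)
  finally have sq: "sqrt ((1 / r)\<^sup>2 - 1) = sqrt (1 - r\<^sup>2) / r" .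
  have r1: "1 / r \<ge> 1" using r by simp
  have "arcosh (1 / r) = ln (1 / r + sqrt ((1 / r)\<^sup>2 - 1))" by (rule arcosh_real_def[OF r1])
  also have "\<dots> = ln ((1 + sqrt (1 - r\<^sup>2)) / r)" unfolding sq by (simp add: add_divide_distrib)
  finally have "arcosh (1 / r) = ln ((1 + sqrt (1 - r\<^sup>2)) / r)" .
  then show ?thesis using r r1 unfolding r(3) r_def[symmetric] by (simp add: c_fun_def jump_density_def
      max_def)
next
  case False
  then have "\<not> (0 < t / k \<and> t / k \<le> 1)" using assms by (cases "k = 0") (auto simp: field_simps)
  moreover have "jump_density (k / t) = 0" using False assms by (intro jump_density_le_1) simp
  ultimately show ?thesis by (simp only: c_fun_def if_False)
qed

text \<open>The indicator of the sign is absorbed: \<open>jump_density\<close> is 0 at nonpositive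
  arguments, so the signed jump can be inserted directly.\<close>

lemma c_fun_real_jump:
  assumes "t > 0"
  shows "c_fun (t / cmod (\<i> * of_real k)) * ind_pm s (Re (- \<i> * (\<i> * of_real k)))
      = jump_density (pm_sign s * k / t)"
proof -
  have 1: "cmod (\<i> * of_real k) = \<bar>k\<bar>" by (simp add: norm_mult)
  have 2: "Re (- \<i> * (\<i> * of_real k)) = k" by simp
  have neg: "jump_density (x / t) = 0" if "x \<le> 0" for x
  proof -
    have "x / t \<le> 0" using that assms by (intro divide_nonpos_pos)
    then show ?thesis by (intro jump_density_le_1) simp
  qed
  have "c_fun (t / \<bar>k\<bar>) = jump_density (\<bar>k\<bar> / t)" by (rule c_fun_eq_density) (use assms in auto)
  then show ?thesis unfolding 1 2 using neg[of k] neg[of "- k"]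
    by (cases s) (auto simp: pm_sign_def indicator_def abs_if)
qed

lemma cis_Arg_upper:
  assumes "z \<in> sphere 0 1" "Im z > 0"
  shows "Arg z \<in> {0<..<pi}" "cis (Arg z) = z"
proof -
  have "cmod z = 1" using assms(1) by simp
  moreover have "z \<noteq> 0" using assms(2) by auto
  ultimately show "cis (Arg z) = z" by (simp add: cis_Arg sgn_div_norm)
  show "Arg z \<in> {0<..<pi}" using assms(2) Arg_lt_pi[of z] by simp
qed

lemma inj_on_cis_upper: "inj_on cis {0<..<pi}"
proof (rule inj_onI)
  fix x y assume xy: "x \<in> {0<..<pi}" "y \<in> {0<..<pi}" "cis x = cis y"
  have x: "0 \<le> x" "x \<le> pi" "0 \<le> y" "y \<le> pi" using xy(1,2) by auto
  have "cos x = cos y" using arg_cong[OF xy(3), of Re] by (simp only: cis.sel)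
  with x show "x = y" by (rule cos_inj_pi)
qed

text \<open>Only jumps of modulus above \<open>t\<close> contribute. \<open>Z\<close> goes down to
  \<open>t / 2\<close>, a margin that will also cover thresholds slightly below
  \<open>t\<close>.\<close>

lemma infsum_upper_jumps:
  assumes t: "t > 0" and Z: "Z = {x\<in>{0<..<pi}. t / 2 \<le> cmod (half_jump \<omega> (cis x))}" "finite Z"
  shows "(\<Sum>\<^sub>\<infinity>z\<in>jumps_upper \<omega>. c_fun (t / cmod (half_jump \<omega> z))) = (\<Sum>x\<in>Z. jump_density (cmod (half_jump \<omega>
      (cis x)) / t))"
proof -
  have c: "c_fun (t / cmod (half_jump \<omega> z)) = jump_density (cmod (half_jump \<omega> z) / t)" for z
      by (rule c_fun_eq_density) (use t in auto)
  have "(\<Sum>\<^sub>\<infinity>z\<in>jumps_upper \<omega>. c_fun (t / cmod (half_jump \<omega> z))) = (\<Sum>\<^sub>\<infinity>z\<in>cis ` Z. jump_density (cmod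
      (half_jump \<omega> z) / t))"
    unfolding c
  proof (rule infsum_cong_neutral)
    fix z assume z: "z \<in> cis ` Z - jumps_upper \<omega>"
    then obtain x where x: "x \<in> Z" "z = cis x" by blast
    have "0 < x" "x < pi" "0 < cmod (half_jump \<omega> z)" using x t unfolding Z(1) by auto
    then have "half_jump \<omega> z \<noteq> 0" "Im z > 0" "cmod z = 1" unfolding x(2) by (simp_all add: sin_gt_zero)
    then show "jump_density (cmod (half_jump \<omega> z) / t) = 0" using z
        by (simp add: jumps_upper_def jumps_def)
  next
    fix z assume z: "z \<in> jumps_upper \<omega> - cis ` Z"
    then have "z \<in> sphere 0 1" "Im z > 0" by (auto simp: jumps_upper_def jumps_def)
    note a = cis_Arg_upper[OF this]
    have "Arg z \<notin> Z" using z a(2) imageI[of "Arg z" Z cis] by auto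
    then have "cmod (half_jump \<omega> z) < t / 2" using a unfolding Z(1) by auto
    then show "jump_density (cmod (half_jump \<omega> z) / t) = 0" using t by (intro jump_density_le_1) simp
  qed simp
  also have "\<dots> = (\<Sum>z\<in>cis ` Z. jump_density (cmod (half_jump \<omega> z) / t))" using Z(2) by simp
  also have "\<dots> = (\<Sum>x\<in>Z. jump_density (cmod (half_jump \<omega> (cis x)) / t))"
    by (rule sum.reindex_cong[OF inj_on_subset[OF inj_on_cis_upper]]) (auto simp: Z(1))
  finally show ?thesis .
qed

theorem theorem1p2:
  fixes \<tau> :: "real \<Rightarrow> real \<Rightarrow> complex" and \<omega> :: "complex \<Rightarrow> complex"
    and t :: real and s :: pm
  assumes tau_bounded: "\<exists>M. \<forall>x\<ge>0. \<forall>y\<ge>0. cmod (\<tau> x y) \<le> M"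
    and tau_symmetric: "\<And>x y. 0 \<le> x \<Longrightarrow> 0 \<le> y \<Longrightarrow> \<tau> x y = cnj (\<tau> y x)"
    and "cond_A \<tau>" and "cond_B \<tau>" and "cond_C \<tau>"
    and "\<omega> \<in> PC"
    and omega_symmetric: "\<And>v. v \<in> sphere 0 1 \<Longrightarrow> \<omega> v = cnj (\<omega> (cnj v))"
    and "0 < t"
  shows
    "convergent (log_dens_seq \<tau> s t (hankel (fourier_coeff \<omega>))) \<and>
    LogDens \<tau> s t (hankel (fourier_coeff \<omega>)) =
      (\<Sum>\<^sub>\<infinity>z\<in>jumps_upper \<omega>. c_fun (t / cmod (half_jump \<omega> z)))
      + c_fun (t / cmod (half_jump \<omega> 1)) * ind_pm s (Re (- \<i> * half_jump \<omega> 1))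
      + c_fun (t / cmod (half_jump \<omega> (- 1))) * ind_pm s (Re (- \<i> * half_jump \<omega> (- 1)))"
proof -
  note pc = \<open>\<omega> \<in> PC\<close> and sym = omega_symmetric and t = \<open>0 < t\<close>
  define f where "f = log_dens_seq \<tau> s t (hankel (fourier_coeff \<omega>))"
  define \<sigma> where "\<sigma> = pm_sign s"
  have \<sigma>: "\<sigma> = 1 \<or> \<sigma> = - 1" unfolding \<sigma>_def by (rule pm_sign_cases)
  obtain Mt where Mt: "\<And>x y. x \<ge> 0 \<Longrightarrow> y \<ge> 0 \<Longrightarrow> cmod (\<tau> x y) \<le> Mt" using tau_bounded by blast
  obtain C where C: "C \<ge> 0" "\<And>N. N \<ge> 1 \<Longrightarrow> multiplier_norm (tau_N \<tau> N) \<le> ennreal C"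
    using cond_A_bound[OF \<open>cond_A \<tau>\<close>] by blast
  define k1 where "k1 = Im (lim_plus \<omega> (cis 0))"
  define km where "km = - Im (lim_minus \<omega> (cis pi))"
  have \<kappa>: "half_jump \<omega> 1 = \<i> * of_real k1" "half_jump \<omega> (- 1) = \<i> * of_real km"
    unfolding k1_def km_def by (rule half_jump_real_points[OF pc sym]; assumption)+
  define k where "k x = cmod (half_jump \<omega> (cis x))" for x
  define Z where "Z = {x\<in>{0<..<pi}. t / 2 \<le> k x}"
  note bounds = log_dens_step_bounds[where s = s, OF Mt tau_symmetric C \<open>cond_B \<tau>\<close> \<open>cond_C \<tau>\<close> pc sym t _
      _ \<kappa>, folded f_def \<sigma>_def k_def]
  \<comment> \<open>At a point outside \<open>P\<close> the approximate jump is 0, so the true one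
    is at most \<open>\<eta> < t / 2\<close>.\<close>
  have subZ: "Z \<subseteq> P" if P: "\<forall>x\<in>{0<..<pi}. \<bar>(if x \<in> P then D x else 0) - k x\<bar> \<le> \<eta>" and \<eta>: "\<eta> < t / 2"
      for P D \<eta>
  proof
    fix x assume x: "x \<in> Z"
    show "x \<in> P"
    proof (rule ccontr)
      assume "x \<notin> P"
      then have "k x \<le> \<eta>" using bspec[OF P, of x] x by (simp add: Z_def)
      then show False using x \<eta> by (simp add: Z_def)
    qed
  qed
  \<comment> \<open>One approximation of accuracy \<open>t / 4\<close> already has all of
    \<open>Z\<close> among its finitely many points.\<close>
  have finZ: "finite Z"
  proof -
    have t4: "t / 4 > 0" "(1::real) > 0" "t / 4 < t / 2" using t by simp_all
    show ?thesis 
    proof (rule bounds[OF _ _ _ _ _ _ t4(1,2)])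
      fix P :: "real set" and D :: "real \<Rightarrow> real"
      assume "finite P" "\<forall>x\<in>{0<..<pi}. \<bar>(if x \<in> P then D x else 0) - k x\<bar> \<le> t / 4"
      then show "finite Z" using subZ[OF _ t4(3), of P D] finite_subset by blast
    qed assumption+
  qed
  \<comment> \<open>Used with \<open>h = 1\<close> above and \<open>h = -1\<close> below: all jumps
    are enlarged or reduced by \<open>\<eta>\<close>, and the threshold \<open>u\<close> is moved
    correspondingly.\<close>
  define V where "V h \<eta> u = jump_density ((\<sigma> * k1 + h * \<eta>) / u) + jump_density ((\<sigma> * km + h * \<eta>) / u)
      + (\<Sum>x\<in>Z. jump_density ((k x + h * \<eta>) / u))" for h \<eta> u
  define L where "L = (\<Sum>x\<in>Z. jump_density (k x / t)) + jump_density (\<sigma> * k1 / t) + jump_density (\<sigma> * km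
      / t)"
  have lim_V: "((\<lambda>\<eta>. V h \<eta> (t - h * ((C + 1) * \<eta>)) + h * \<eta>) \<longlongrightarrow> L) (at_right 0)" for h
  proof -
    have lim: "((\<lambda>\<eta>. jump_density ((c + h * \<eta>) / (t - h * ((C + 1) * \<eta>)))) \<longlongrightarrow> jump_density (c / t))
        (at_right 0)" for c
    proof (rule isCont_tendsto_compose[OF isCont_jump_density])
      have "((\<lambda>\<eta>. (c + h * \<eta>) / (t - h * ((C + 1) * \<eta>))) \<longlongrightarrow> (c + h * 0) / (t - h * ((C
          + 1) * 0))) (at_right 0)"
        using t by (intro tendsto_intros) auto
      then show "((\<lambda>\<eta>. (c + h * \<eta>) / (t - h * ((C + 1) * \<eta>))) \<longlongrightarrow> c / t) (at_right 0)" by simp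
    qed
    have "((\<lambda>\<eta>. V h \<eta> (t - h * ((C + 1) * \<eta>)) + h * \<eta>) \<longlongrightarrow> jump_density (\<sigma> * k1 / t) + jump_density (\<sigma> *
        km / t) + (\<Sum>x\<in>Z. jump_density (k x / t)) + h * 0) (at_right 0)"
      unfolding V_def by (intro tendsto_intros lim)
    then show ?thesis by (simp add: L_def add_ac)
  qed
  have close: "\<sigma> * x - \<eta> \<le> \<sigma> * y" "\<sigma> * y \<le> \<sigma> * x + \<eta>" if "\<bar>y - x\<bar> \<le> \<eta>" for x y \<eta> :: real
    using \<sigma> that by auto
  have "f \<longlonglongrightarrow> L"
  proof (rule LIMSEQ_I)
    fix r :: real assume r: "r > 0"
    have c: "((\<lambda>\<eta>. (C + 2) * \<eta>) \<longlongrightarrow> (C + 2) * 0) (at_right 0)" by (intro tendsto_intros)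
    have c': "((\<lambda>\<eta>. (C + 2) * \<eta>) \<longlongrightarrow> 0) (at_right 0)" using c by simp
    \<comment> \<open>The last condition keeps the lowered threshold at least
      \<open>t / 2 + \<eta>\<close>, so that points outside \<open>Z\<close> cannot
      contribute.\<close>
    have "\<forall>\<^sub>F \<eta> in at_right 0. \<eta> > 0 \<and> V 1 \<eta> (t - 1 * ((C + 1) * \<eta>)) + 1 * \<eta> < L + r \<and>
        L - r < V (- 1) \<eta> (t - (- 1) * ((C + 1) * \<eta>)) + (- 1) * \<eta> \<and> (C + 2) * \<eta> < t / 2"
      using r t by (intro eventually_conj eventually_at_right_less order_tendstoD[OF lim_V]
          order_tendstoD(2)[OF c']) auto
    then obtain \<eta> where \<eta>: "\<eta> > 0" and U: "V 1 \<eta> (t - (C + 1) * \<eta>) + \<eta> < L + r"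
      and W: "L - r < V (- 1) \<eta> (t + (C + 1) * \<eta>) - \<eta>" and C\<eta>: "(C + 2) * \<eta> < t / 2"
      using eventually_happens[of _ "at_right (0::real)"] by auto
    have C\<eta>0: "0 \<le> C * \<eta>" using C \<eta> by simp
    have exp: "(C + 2) * \<eta> = C * \<eta> + 2 * \<eta>" "(C + 1) * \<eta> = C * \<eta> + \<eta>" by (simp_all add: algebra_simps)
    define u v where "u = t - (C + 1) * \<eta>" and "v = t + (C + 1) * \<eta>"
    have u: "0 < u" "u < t - C * \<eta>" "t / 2 + \<eta> \<le> u" "C * \<eta> < t" "t + C * \<eta> < v" "0 < v" "\<eta> < t / 2"
      using C\<eta> C\<eta>0 \<eta> t unfolding u_def v_def exp by linarith+
    obtain P D a b where P: "finite P" "P \<subseteq> {0<..<pi}" and ab: "\<bar>a - k1\<bar> \<le> \<eta>" "\<bar>b - km\<bar> \<le> \<eta>"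
      and D: "\<forall>x\<in>{0<..<pi}. \<bar>(if x \<in> P then D x else 0) - k x\<bar> \<le> \<eta>"
      and up: "\<forall>u. 0 < u \<longrightarrow> u < t - C * \<eta> \<longrightarrow> (\<forall>\<^sub>F N in sequentially. f N \<le> jump_density (\<sigma> * a / u)
          + jump_density (\<sigma> * b / u) + (\<Sum>x\<in>P. jump_density (D x / u)) + \<eta>)"
      and low: "\<forall>u. C * \<eta> < t \<longrightarrow> t + C * \<eta> < u \<longrightarrow> (\<forall>\<^sub>F N in sequentially. jump_density (\<sigma> * a / u)
          + jump_density (\<sigma> * b / u) + (\<Sum>x\<in>P. jump_density (D x / u)) - \<eta> \<le> f N)"
      apply (rule bounds[OF _ _ _ _ _ _ \<eta> \<eta>])
      apply assumption
      apply assumption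
      apply assumption
      apply assumption
      apply assumption
      apply assumption
      apply (rule that)
      apply assumption+
      done
    have ZP: "Z \<subseteq> P" by (rule subZ[OF D u(7)])
    have DP: "k x - \<eta> \<le> D x" "D x \<le> k x + \<eta>" if "x \<in> P" for x using bspec[OF D, of x] that P(2) by auto
    have mono: "jump_density (x / w) \<le> jump_density (y / w)" if "x \<le> y" "w > 0" for x y w using that
        by (intro jump_density_mono divide_right_mono) auto
    \<comment> \<open>The step function may have many spurious small jumps, depending on
      \<open>\<eta>\<close>; outside \<open>Z\<close> they stay below
      \<open>t / 2 + \<eta> \<le> u\<close> and have density 0.\<close>
    have D0: "jump_density (D x / u) = 0" if "x \<in> P - Z" for x
    proof (rule jump_density_le_1)
      have "k x < t / 2" using that P(2) by (auto simp: Z_def)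
      then have "D x \<le> u" using DP(2)[of x] that u(3) by auto
      then show "D x / u \<le> 1" using u(1) by simp
    qed
    have "(\<Sum>x\<in>P. jump_density (D x / u)) = (\<Sum>x\<in>Z. jump_density (D x / u))"
        by (rule sum.mono_neutral_right) (use P ZP D0 in auto)
    also have "\<dots> \<le> (\<Sum>x\<in>Z. jump_density ((k x + \<eta>) / u))" using DP ZP u(1) by (intro sum_mono mono) auto
    finally have "jump_density (\<sigma> * a / u) + jump_density (\<sigma> * b / u) + (\<Sum>x\<in>P. jump_density (D x / u))
        \<le> V 1 \<eta> u"
      using mono[OF close(2)[OF ab(1)] u(1)] mono[OF close(2)[OF ab(2)] u(1)] by (simp add: V_def)
    then have ub: "jump_density (\<sigma> * a / u) + jump_density (\<sigma> * b / u) + (\<Sum>x\<in>P. jump_density (D x / u))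
        + \<eta> < L + r" using U u_def by simp
    have "(\<Sum>x\<in>Z. jump_density ((k x - \<eta>) / v)) \<le> (\<Sum>x\<in>Z. jump_density (D x / v))" using DP ZP u(6)
        by (intro sum_mono mono) auto
    also have "\<dots> \<le> (\<Sum>x\<in>P. jump_density (D x / v))" by (intro sum_mono2 P(1) ZP jump_density_nonneg)
    finally have "V (- 1) \<eta> v \<le> jump_density (\<sigma> * a / v) + jump_density (\<sigma> * b / v)
        + (\<Sum>x\<in>P. jump_density (D x / v))"
      using mono[OF close(1)[OF ab(1)] u(6)] mono[OF close(1)[OF ab(2)] u(6)] by (simp add: V_def)
    then have lb: "L - r < jump_density (\<sigma> * a / v) + jump_density (\<sigma> * b / v) + (\<Sum>x\<in>P. jump_density (D
        x / v)) - \<eta>" using W v_def by simp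
    have "\<forall>\<^sub>F N in sequentially. norm (f N - L) < r"
      using up[rule_format, OF u(1,2)] low[rule_format, OF u(4,5)]
    proof eventually_elim
      case (elim N)
      then have "f N < L + r" "L - r < f N" using ub lb by linarith+
      then show ?case by (simp add: abs_less_iff)
    qed
    then show "\<exists>no. \<forall>n\<ge>no. norm (f n - L) < r" by (simp add: eventually_sequentially)
  qed
  moreover have "L = (\<Sum>\<^sub>\<infinity>z\<in>jumps_upper \<omega>. c_fun (t / cmod (half_jump \<omega> z)))
      + c_fun (t / cmod (half_jump \<omega> 1)) * ind_pm s (Re (- \<i> * half_jump \<omega> 1))
      + c_fun (t / cmod (half_jump \<omega> (- 1))) * ind_pm s (Re (- \<i> * half_jump \<omega> (- 1)))"
    unfolding \<kappa> c_fun_real_jump[OF t] infsum_upper_jumps[OF t Z_def[unfolded k_def] finZ] L_def \<sigma>_def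
        k_def ..
  ultimately show ?thesis unfolding LogDens_def f_def by (metis convergentI limI)
qed

end
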